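(* Let $k$ be a field, $m\ge1$, and let $K$ be a simplicial complex on the vertex set $[m]$ that is properly contained in $K_m=\{\sigma\subseteq[m] : \#\sigma\le m-2\}$. Then the category $\mathcal{L}(K)$ contains the category $k[s,t]\text{-mod}$ of finitely generated $\mathbb{N}^2$-graded $k[s,t]$-modules as an exact retract (up to equivalence); that is, there are exact functors $k[s,t]\text{-mod}\to\mathcal{L}(K)\to k[s,t]\text{-mod}$ whose composite is naturally isomorphic to the identity. In particular, $\mathcal{L}(K)$ has wild representation type.
   Context: $k[s,t]$ is graded with $|s|=(1,0)$, $|t|=(0,1)$. $R=k[t_1,\dots,t_m]$ is $\mathbb{N}^m$-graded ($0\in\mathbb{N}$) with $|t_i|=\vec e_i$. All modules are multigraded and morphisms preserve multidegree. For $\sigma\subseteq[m]=\{1,\dots,m\}$, let $\sigma^{-1}\mathbb{N}^m=\{\vec d\in\mathbb{Z}^m : d_i\ge 0 \text{ for } i\notin\sigma\}$ and $R_\sigma=R[t_i^{-1}\mid i\in\sigma]$; $R_\sigma$-modules are $\sigma^{-1}\mathbb{N}^m$-graded (extended by zero to larger grading sets when necessary). A simplicial complex on $[m]$ is a downward closed collection $K$ of subsets of $[m]$ (possibly empty; not every $\{i\}$ need belong to $K$). A missing face is a subset $\sigma\subseteq[m]$ with $\sigma\notin K$. An object $M$ of $\mathcal{L}(K)$ consists of: for each missing face $\sigma$ a finitely generated $R_\sigma$-module $M_\sigma$; for all missing faces $\sigma\subseteq\tau$ a map of $R_\sigma$-modules $\varphi_{\sigma,\tau}\colon M_\sigma\to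 M_\tau$ inducing an isomorphism $R_\tau\otimes_{R_\sigma}M_\sigma\cong M_\tau$, with $\varphi_{\sigma,\sigma}=\mathrm{id}$ and $\varphi_{\tau,\upsilon}\circ\varphi_{\sigma,\tau}=\varphi_{\sigma,\upsilon}$. Morphisms are families of module maps commuting with the transition maps; $\mathcal{L}(K)$ is abelian with kernels and cokernels computed pointwise. A functor $T\colon\mathcal{A}\to\mathcal{B}$ between $k$-linear abelian categories is a representation embedding if it is $k$-linear, exact, injective on isomorphism classes, and sends indecomposables to indecomposables. $\mathcal{A}$ has wild representation type if there is a representation embedding into $\mathcal{A}$ from the category of (ungraded) modules over the free associative algebra $k\langle x_1,x_2\rangle$ that are finite-dimensional over $k$. The field $k$ is not assumed algebraically closed. *)

theory Defs
  imports "HOL-Algebra.Module" "HOL-Algebra.Free_Abelian_Groups" "HOL-Library.Function_Algebras"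
begin

section \<open>Linear categories with short exact sequences\<close>

text \<open>
  Arrows do not determine their source and target, so the operations take the objects involved as
  arguments: \<open>Comp C X Y Z g f\<close> is the composite of \<open>f : X \<rightarrow> Y\<close> and \<open>g : Y \<rightarrow> Z\<close>, and
  \<open>Ses C X Y Z f g\<close> says that \<open>0 \<rightarrow> X \<rightarrow> Y \<rightarrow> Z \<rightarrow> 0\<close> is a short exact sequence.
\<close>

record ('k, 'o, 'm) lincat =
  Ob :: "'o set"
  Hom :: "'o \<Rightarrow> 'o \<Rightarrow> 'm set"
  Id :: "'o \<Rightarrow> 'm"
  Comp :: "'o \<Rightarrow> 'o \<Rightarrow> 'o \<Rightarrow> 'm \<Rightarrow> 'm \<Rightarrow> 'm"
  Zero :: "'o \<Rightarrow> 'o \<Rightarrow> 'm"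
  Add :: "'o \<Rightarrow> 'o \<Rightarrow> 'm \<Rightarrow> 'm \<Rightarrow> 'm"
  Scale :: "'o \<Rightarrow> 'o \<Rightarrow> 'k \<Rightarrow> 'm \<Rightarrow> 'm"
  Ses :: "'o \<Rightarrow> 'o \<Rightarrow> 'o \<Rightarrow> 'm \<Rightarrow> 'm \<Rightarrow> bool"

definition iso_arrow :: "('k, 'o, 'm) lincat \<Rightarrow> 'o \<Rightarrow> 'o \<Rightarrow> 'm \<Rightarrow> bool" where
  "iso_arrow C X Y f \<longleftrightarrow> f \<in> Hom C X Y \<and>
     (\<exists>g \<in> Hom C Y X. Comp C X Y X g f = Id C X \<and> Comp C Y X Y f g = Id C Y)"

definition isomorphic :: "('k, 'o, 'm) lincat \<Rightarrow> 'o \<Rightarrow> 'o \<Rightarrow> bool" where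
  "isomorphic C X Y \<longleftrightarrow> (\<exists>f. iso_arrow C X Y f)"

definition zero_object :: "('k, 'o, 'm) lincat \<Rightarrow> 'o \<Rightarrow> bool" where
  "zero_object C X \<longleftrightarrow> X \<in> Ob C \<and> Id C X = Zero C X X"

definition is_biproduct :: "('k, 'o, 'm) lincat \<Rightarrow> 'o \<Rightarrow> 'o \<Rightarrow> 'o \<Rightarrow> bool" where
  "is_biproduct C X Y Z \<longleftrightarrow>
     (\<exists>i \<in> Hom C Y X. \<exists>j \<in> Hom C Z X. \<exists>p \<in> Hom C X Y. \<exists>q \<in> Hom C X Z.
        Comp C Y X Y p i = Id C Y \<and> Comp C Z X Z q j = Id C Z \<and>
        Comp C Z X Y p j = Zero C Z Y \<and> Comp C Y X Z q i = Zero C Y Z \<and>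
        Add C X X (Comp C X Y X i p) (Comp C X Z X j q) = Id C X)"

definition indecomposable :: "('k, 'o, 'm) lincat \<Rightarrow> 'o \<Rightarrow> bool" where
  "indecomposable C X \<longleftrightarrow> X \<in> Ob C \<and> \<not> zero_object C X \<and>
     (\<forall>Y \<in> Ob C. \<forall>Z \<in> Ob C. is_biproduct C X Y Z \<longrightarrow> zero_object C Y \<or> zero_object C Z)"

record ('o1, 'm1, 'o2, 'm2) functor_data =
  on_ob :: "'o1 \<Rightarrow> 'o2"
  on_hom :: "'o1 \<Rightarrow> 'o1 \<Rightarrow> 'm1 \<Rightarrow> 'm2"

definition is_functor ::
  "('k, 'o1, 'm1) lincat \<Rightarrow> ('k, 'o2, 'm2) lincat \<Rightarrow> ('o1, 'm1, 'o2, 'm2) functor_data \<Rightarrow> bool" where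
  "is_functor C D T \<longleftrightarrow>
     (\<forall>X \<in> Ob C. on_ob T X \<in> Ob D) \<and>
     (\<forall>X \<in> Ob C. \<forall>Y \<in> Ob C. \<forall>f \<in> Hom C X Y. on_hom T X Y f \<in> Hom D (on_ob T X) (on_ob T Y)) \<and>
     (\<forall>X \<in> Ob C. on_hom T X X (Id C X) = Id D (on_ob T X)) \<and>
     (\<forall>X \<in> Ob C. \<forall>Y \<in> Ob C. \<forall>Z \<in> Ob C. \<forall>f \<in> Hom C X Y. \<forall>g \<in> Hom C Y Z.
        on_hom T X Z (Comp C X Y Z g f) =
        Comp D (on_ob T X) (on_ob T Y) (on_ob T Z) (on_hom T Y Z g) (on_hom T X Y f))"

definition additive_functor ::
  "('k, 'o1, 'm1) lincat \<Rightarrow> ('k, 'o2, 'm2) lincat \<Rightarrow> ('o1, 'm1, 'o2, 'm2) functor_data \<Rightarrow> bool" where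
  "additive_functor C D T \<longleftrightarrow> is_functor C D T \<and>
     (\<forall>X \<in> Ob C. \<forall>Y \<in> Ob C. \<forall>f \<in> Hom C X Y. \<forall>g \<in> Hom C X Y.
        on_hom T X Y (Add C X Y f g) =
        Add D (on_ob T X) (on_ob T Y) (on_hom T X Y f) (on_hom T X Y g))"

definition linear_functor ::
  "('k, 'o1, 'm1) lincat \<Rightarrow> ('k, 'o2, 'm2) lincat \<Rightarrow> ('o1, 'm1, 'o2, 'm2) functor_data \<Rightarrow> bool" where
  "linear_functor C D T \<longleftrightarrow> additive_functor C D T \<and>
     (\<forall>X \<in> Ob C. \<forall>Y \<in> Ob C. \<forall>c. \<forall>f \<in> Hom C X Y.
        on_hom T X Y (Scale C X Y c f) = Scale D (on_ob T X) (on_ob T Y) c (on_hom T X Y f))"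

definition exact_functor ::
  "('k, 'o1, 'm1) lincat \<Rightarrow> ('k, 'o2, 'm2) lincat \<Rightarrow> ('o1, 'm1, 'o2, 'm2) functor_data \<Rightarrow> bool" where
  "exact_functor C D T \<longleftrightarrow> additive_functor C D T \<and>
     (\<forall>X \<in> Ob C. \<forall>Y \<in> Ob C. \<forall>Z \<in> Ob C. \<forall>f \<in> Hom C X Y. \<forall>g \<in> Hom C Y Z.
        Ses C X Y Z f g \<longrightarrow>
        Ses D (on_ob T X) (on_ob T Y) (on_ob T Z) (on_hom T X Y f) (on_hom T Y Z g))"

definition functor_comp ::
  "('o2, 'm2, 'o3, 'm3) functor_data \<Rightarrow> ('o1, 'm1, 'o2, 'm2) functor_data
     \<Rightarrow> ('o1, 'm1, 'o3, 'm3) functor_data" where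
  "functor_comp S T =
     \<lparr>on_ob = (\<lambda>X. on_ob S (on_ob T X)),
      on_hom = (\<lambda>X Y f. on_hom S (on_ob T X) (on_ob T Y) (on_hom T X Y f))\<rparr>"

definition naturally_iso_identity ::
  "('k, 'o, 'm) lincat \<Rightarrow> ('o, 'm, 'o, 'm) functor_data \<Rightarrow> bool" where
  "naturally_iso_identity C T \<longleftrightarrow>
     (\<exists>\<eta>. (\<forall>X \<in> Ob C. iso_arrow C (on_ob T X) X (\<eta> X)) \<and>
       (\<forall>X \<in> Ob C. \<forall>Y \<in> Ob C. \<forall>f \<in> Hom C X Y.
          Comp C (on_ob T X) (on_ob T Y) Y (\<eta> Y) (on_hom T X Y f) =
          Comp C (on_ob T X) X Y f (\<eta> X)))"

definition exact_retract :: "('k, 'o1, 'm1) lincat \<Rightarrow> ('k, 'o2, 'm2) lincat \<Rightarrow> bool" where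
  "exact_retract C D \<longleftrightarrow>
     (\<exists>S T. exact_functor C D S \<and> exact_functor D C T \<and>
            naturally_iso_identity C (functor_comp T S))"

definition representation_embedding ::
  "('k, 'o1, 'm1) lincat \<Rightarrow> ('k, 'o2, 'm2) lincat \<Rightarrow> ('o1, 'm1, 'o2, 'm2) functor_data \<Rightarrow> bool" where
  "representation_embedding C D T \<longleftrightarrow> linear_functor C D T \<and> exact_functor C D T \<and>
     (\<forall>X \<in> Ob C. \<forall>Y \<in> Ob C. isomorphic D (on_ob T X) (on_ob T Y) \<longrightarrow> isomorphic C X Y) \<and>
     (\<forall>X \<in> Ob C. indecomposable C X \<longrightarrow> indecomposable D (on_ob T X))"


section \<open>Monoid algebras and their modules\<close>

text \<open>
  The algebra over \<open>'k\<close> of the submonoid \<open>S\<close> of \<open>'w\<close>, spanned by the monomials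
  \<open>Poly_Mapping.single w 1\<close> with \<open>w \<in> S\<close>. For \<open>S = {0}\<close> it is the field \<open>'k\<close> itself,
  as the subring of scalars \<open>Poly_Mapping.single 0 c\<close>.
\<close>

definition monoid_algebra :: "'w set \<Rightarrow> ('w::monoid_add \<Rightarrow>\<^sub>0 'k::field) ring" where
  "monoid_algebra S =
     \<lparr>carrier = {p. Poly_Mapping.keys p \<subseteq> S}, monoid.mult = (*), one = 1,
      ring.zero = 0, ring.add = (+)\<rparr>"

text \<open>The library locale \<open>module\<close> requires a commutative ring.\<close>

locale left_module = R?: ring R + M?: abelian_group M
  for R (structure) and M :: "('a, 'b, 'c) module_scheme" (structure) +
  assumes smult_closed:
      "\<lbrakk>a \<in> carrier R; x \<in> carrier M\<rbrakk> \<Longrightarrow> a \<odot>\<^bsub>M\<^esub> x \<in> carrier M"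
    and smult_l_distr:
      "\<lbrakk>a \<in> carrier R; b \<in> carrier R; x \<in> carrier M\<rbrakk>
       \<Longrightarrow> (a \<oplus>\<^bsub>R\<^esub> b) \<odot>\<^bsub>M\<^esub> x = a \<odot>\<^bsub>M\<^esub> x \<oplus>\<^bsub>M\<^esub> b \<odot>\<^bsub>M\<^esub> x"
    and smult_r_distr:
      "\<lbrakk>a \<in> carrier R; x \<in> carrier M; y \<in> carrier M\<rbrakk>
       \<Longrightarrow> a \<odot>\<^bsub>M\<^esub> (x \<oplus>\<^bsub>M\<^esub> y) = a \<odot>\<^bsub>M\<^esub> x \<oplus>\<^bsub>M\<^esub> a \<odot>\<^bsub>M\<^esub> y"
    and smult_assoc:
      "\<lbrakk>a \<in> carrier R; b \<in> carrier R; x \<in> carrier M\<rbrakk>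
       \<Longrightarrow> (a \<otimes>\<^bsub>R\<^esub> b) \<odot>\<^bsub>M\<^esub> x = a \<odot>\<^bsub>M\<^esub> (b \<odot>\<^bsub>M\<^esub> x)"
    and smult_one:
      "x \<in> carrier M \<Longrightarrow> \<one>\<^bsub>R\<^esub> \<odot>\<^bsub>M\<^esub> x = x"

definition finitely_generated :: "('a, 'r) ring_scheme \<Rightarrow> ('a, 'v, 'z) module_scheme \<Rightarrow> bool" where
  "finitely_generated A M \<longleftrightarrow>
     (\<exists>S. finite S \<and> S \<subseteq> carrier M \<and>
        (\<forall>x \<in> carrier M. \<exists>c \<in> S \<rightarrow> carrier A. x = (\<Oplus>\<^bsub>M\<^esub> s \<in> S. c s \<odot>\<^bsub>M\<^esub> s)))"

text \<open>
  Linear maps are extensional, so that equality of functions is equality of linear maps. If \<open>A\<close> is a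
  subring of the ring over which \<open>N\<close> is a module, \<open>N\<close> is tacitly restricted to \<open>A\<close>.
\<close>

definition linear_maps ::
  "('a, 'r) ring_scheme \<Rightarrow> ('a, 'v, 'y) module_scheme \<Rightarrow> ('a, 'w, 'z) module_scheme
     \<Rightarrow> ('v \<Rightarrow> 'w) set" where
  "linear_maps A M N =
     {f \<in> carrier M \<rightarrow>\<^sub>E carrier N.
        (\<forall>x \<in> carrier M. \<forall>y \<in> carrier M. f (x \<oplus>\<^bsub>M\<^esub> y) = f x \<oplus>\<^bsub>N\<^esub> f y) \<and>
        (\<forall>a \<in> carrier A. \<forall>x \<in> carrier M. f (a \<odot>\<^bsub>M\<^esub> x) = a \<odot>\<^bsub>N\<^esub> f x)}"

text \<open>
  The linear category with a given class of modules as objects, given sets of linear maps between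
  them as arrows, and all other structure the usual one.
\<close>

definition module_category ::
  "('w::monoid_add \<Rightarrow>\<^sub>0 'k::field, 'v, 'z) module_scheme set \<Rightarrow>
   (('w \<Rightarrow>\<^sub>0 'k, 'v, 'z) module_scheme \<Rightarrow> ('w \<Rightarrow>\<^sub>0 'k, 'v, 'z) module_scheme \<Rightarrow> ('v \<Rightarrow> 'v) set) \<Rightarrow>
   ('k, ('w \<Rightarrow>\<^sub>0 'k, 'v, 'z) module_scheme, 'v \<Rightarrow> 'v) lincat" where
  "module_category Obs Homs =
     \<lparr>Ob = Obs,
      Hom = Homs,
      Id = (\<lambda>M. \<lambda>x \<in> carrier M. x),
      Comp = (\<lambda>L M N g f. compose (carrier L) g f),
      Zero = (\<lambda>M N. \<lambda>x \<in> carrier M. \<zero>\<^bsub>N\<^esub>),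
      Add = (\<lambda>M N f g. \<lambda>x \<in> carrier M. f x \<oplus>\<^bsub>N\<^esub> g x),
      Scale = (\<lambda>M N c f. \<lambda>x \<in> carrier M. Poly_Mapping.single 0 c \<odot>\<^bsub>N\<^esub> f x),
      Ses = (\<lambda>L M N f g. inj_on f (carrier L) \<and>
               f ` carrier L = {x \<in> carrier M. g x = \<zero>\<^bsub>N\<^esub>} \<and>
               g ` carrier M = carrier N)\<rparr>"

text \<open>
  For \<open>A\<close> a subring of \<open>B\<close> and \<open>M\<close> an \<open>A\<close>-module, \<open>base_change A B M\<close> is the abelian group
  underlying \<open>B \<otimes>\<^sub>A M\<close>: the free abelian group on the symbols \<open>(b, x)\<close>, modulo
  bilinearity and \<open>A\<close>-balancedness. The class of \<open>(b, x)\<close> is \<open>pure_tensor A B M b x\<close>.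
\<close>

definition tensor_relations ::
  "('a, 'r) ring_scheme \<Rightarrow> ('a, 's) ring_scheme \<Rightarrow> ('a, 'v, 'z) module_scheme
     \<Rightarrow> ('a \<times> 'v \<Rightarrow>\<^sub>0 int) set" where
  "tensor_relations A B M =
     generate (free_Abelian_group (carrier B \<times> carrier M))
       ({frag_of (b \<oplus>\<^bsub>B\<^esub> b', x) - frag_of (b, x) - frag_of (b', x) | b b' x.
           b \<in> carrier B \<and> b' \<in> carrier B \<and> x \<in> carrier M} \<union>
        {frag_of (b, x \<oplus>\<^bsub>M\<^esub> x') - frag_of (b, x) - frag_of (b, x') | b x x'.
           b \<in> carrier B \<and> x \<in> carrier M \<and> x' \<in> carrier M} \<union>
        {frag_of (b \<otimes>\<^bsub>B\<^esub> a, x) - frag_of (b, a \<odot>\<^bsub>M\<^esub> x) | a b x.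
           a \<in> carrier A \<and> b \<in> carrier B \<and> x \<in> carrier M})"

definition base_change ::
  "('a, 'r) ring_scheme \<Rightarrow> ('a, 's) ring_scheme \<Rightarrow> ('a, 'v, 'z) module_scheme
     \<Rightarrow> ('a \<times> 'v \<Rightarrow>\<^sub>0 int) set monoid" where
  "base_change A B M = free_Abelian_group (carrier B \<times> carrier M) Mod tensor_relations A B M"

definition pure_tensor ::
  "('a, 'r) ring_scheme \<Rightarrow> ('a, 's) ring_scheme \<Rightarrow> ('a, 'v, 'z) module_scheme
     \<Rightarrow> 'a \<Rightarrow> 'v \<Rightarrow> ('a \<times> 'v \<Rightarrow>\<^sub>0 int) set" where
  "pure_tensor A B M b x =
     tensor_relations A B M #>\<^bsub>free_Abelian_group (carrier B \<times> carrier M)\<^esub> frag_of (b, x)"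

text \<open>
  The map \<open>B \<otimes>\<^sub>A M \<rightarrow> N\<close> induced by \<open>\<phi>\<close> is the unique additive map \<open>h\<close> with
  \<open>h (b \<otimes> x) = b \<cdot> \<phi> x\<close>. It is automatically \<open>B\<close>-linear (and preserves degrees if \<open>\<phi>\<close>
  does), so it is an isomorphism as soon as it is an isomorphism of abelian groups.
\<close>

definition induces_base_change_iso ::
  "('a, 'r) ring_scheme \<Rightarrow> ('a, 's) ring_scheme \<Rightarrow> ('a, 'v, 'y) module_scheme
     \<Rightarrow> ('a, 'w, 'z) module_scheme \<Rightarrow> ('v \<Rightarrow> 'w) \<Rightarrow> bool" where
  "induces_base_change_iso A B M N \<phi> \<longleftrightarrow>
     (\<exists>h \<in> iso (base_change A B M) (add_monoid N).
        \<forall>b \<in> carrier B. \<forall>x \<in> carrier M. h (pure_tensor A B M b x) = b \<odot>\<^bsub>N\<^esub> \<phi> x)"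


section \<open>Multigraded modules over localised polynomial rings\<close>

text \<open>
  Degrees in \<open>\<int>\<^sup>m\<close> are functions vanishing outside \<open>{1..m}\<close>. The ring \<open>loc_ring m \<sigma>\<close> is
  \<open>R\<^sub>\<sigma>\<close> inside the Laurent polynomials; \<open>t\<^sub>i\<close> is \<open>Poly_Mapping.single e\<^sub>i 1\<close> for the
  \<open>i\<close>-th unit vector \<open>e\<^sub>i\<close>.
\<close>

type_synonym multidegree = "nat \<Rightarrow> int"

type_synonym 'k laurent = "multidegree \<Rightarrow>\<^sub>0 'k"

definition degrees :: "nat \<Rightarrow> nat set \<Rightarrow> multidegree set" where
  "degrees m \<sigma> = {d. (\<forall>i. i \<notin> {1..m} \<longrightarrow> d i = 0) \<and> (\<forall>i \<in> {1..m} - \<sigma>. 0 \<le> d i)}"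

definition loc_ring :: "nat \<Rightarrow> nat set \<Rightarrow> ('k::field) laurent ring" where
  "loc_ring m \<sigma> = monoid_algebra (degrees m \<sigma>)"

record ('a, 'v) graded_module = "('a, 'v) module" +
  component :: "multidegree \<Rightarrow> 'v set"

type_synonym ('k, 'v) gmod = "('k laurent, 'v) graded_module"

text \<open>
  Carriers are subsets of a type \<open>'v\<close>, which plays the role of a universe. The modules considered
  here have countable dimension over \<open>'k\<close>, so every isomorphism type of them occurs as soon as
  there is an injection of \<open>nat \<Rightarrow>\<^sub>0 'k\<close> into \<open>'v\<close>.

  The grading is extended by zero to all multidegrees.
\<close>

definition is_graded_module :: "nat \<Rightarrow> nat set \<Rightarrow> ('k::field, 'v) gmod \<Rightarrow> bool" where
  "is_graded_module m \<sigma> M \<longleftrightarrow>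
     module (loc_ring m \<sigma>) M \<and>
     (\<forall>d. subgroup (component M d) (add_monoid M)) \<and>
     (\<forall>d. d \<notin> degrees m \<sigma> \<longrightarrow> component M d = {\<zero>\<^bsub>M\<^esub>}) \<and>
     (\<forall>x \<in> carrier M. \<exists>!u. (\<forall>d. u d \<in> component M d) \<and> finite {d. u d \<noteq> \<zero>\<^bsub>M\<^esub>} \<and>
        x = (\<Oplus>\<^bsub>M\<^esub> d \<in> {d. u d \<noteq> \<zero>\<^bsub>M\<^esub>}. u d)) \<and>
     (\<forall>e \<in> degrees m \<sigma>. \<forall>d. \<forall>c. \<forall>x \<in> component M d.
        Poly_Mapping.single e c \<odot>\<^bsub>M\<^esub> x \<in> component M (d + e))"

definition fg_graded_modules :: "nat \<Rightarrow> nat set \<Rightarrow> ('k::field, 'v) gmod set" where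
  "fg_graded_modules m \<sigma> =
     {M. is_graded_module m \<sigma> M \<and> finitely_generated (loc_ring m \<sigma>) M}"

definition graded_maps ::
  "nat \<Rightarrow> nat set \<Rightarrow> ('k::field, 'v) gmod \<Rightarrow> ('k, 'v) gmod \<Rightarrow> ('v \<Rightarrow> 'v) set" where
  "graded_maps m \<sigma> M N =
     {f \<in> linear_maps (loc_ring m \<sigma>) M N. \<forall>d. f ` component M d \<subseteq> component N d}"

definition graded_mod :: "nat \<Rightarrow> nat set \<Rightarrow> ('k::field, ('k, 'v) gmod, 'v \<Rightarrow> 'v) lincat" where
  "graded_mod m \<sigma> = module_category (fg_graded_modules m \<sigma>) (graded_maps m \<sigma>)"

text \<open>\<open>k[s,t]\<close> is the polynomial ring in two variables, with \<open>s = t\<^sub>1\<close> and \<open>t = t\<^sub>2\<close>.\<close>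

definition kst_mod :: "('k::field, ('k, 'v) gmod, 'v \<Rightarrow> 'v) lincat" where
  "kst_mod = graded_mod 2 {}"


section \<open>The category of a simplicial complex\<close>

definition simplicial_complex :: "nat \<Rightarrow> nat set set \<Rightarrow> bool" where
  "simplicial_complex m K \<longleftrightarrow> K \<subseteq> Pow {1..m} \<and> (\<forall>\<sigma> \<in> K. \<forall>\<tau>. \<tau> \<subseteq> \<sigma> \<longrightarrow> \<tau> \<in> K)"

definition missing_faces :: "nat \<Rightarrow> nat set set \<Rightarrow> nat set set" where
  "missing_faces m K = Pow {1..m} - K"

record ('a, 'v) L_data =
  part :: "nat set \<Rightarrow> ('a, 'v) graded_module"
  transition :: "nat set \<Rightarrow> nat set \<Rightarrow> 'v \<Rightarrow> 'v"

type_synonym ('k, 'v) L_object = "('k laurent, 'v) L_data"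

definition L_objects :: "nat \<Rightarrow> nat set set \<Rightarrow> ('k::field, 'v) L_object set" where
  "L_objects m K =
     {M. (\<forall>\<sigma> \<in> missing_faces m K. part M \<sigma> \<in> fg_graded_modules m \<sigma>) \<and>
         (\<forall>\<sigma> \<in> missing_faces m K. \<forall>\<tau> \<in> missing_faces m K. \<sigma> \<subseteq> \<tau> \<longrightarrow>
            transition M \<sigma> \<tau> \<in> graded_maps m \<sigma> (part M \<sigma>) (part M \<tau>) \<and>
            induces_base_change_iso (loc_ring m \<sigma>) (loc_ring m \<tau>) (part M \<sigma>) (part M \<tau>)
              (transition M \<sigma> \<tau>)) \<and>
         (\<forall>\<sigma> \<in> missing_faces m K. \<forall>x \<in> carrier (part M \<sigma>). transition M \<sigma> \<sigma> x = x) \<and>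
         (\<forall>\<sigma> \<in> missing_faces m K. \<forall>\<tau> \<in> missing_faces m K. \<forall>\<upsilon> \<in> missing_faces m K.
            \<sigma> \<subseteq> \<tau> \<longrightarrow> \<tau> \<subseteq> \<upsilon> \<longrightarrow>
            (\<forall>x \<in> carrier (part M \<sigma>). transition M \<tau> \<upsilon> (transition M \<sigma> \<tau> x) = transition M \<sigma> \<upsilon> x))}"

definition L_maps ::
  "nat \<Rightarrow> nat set set \<Rightarrow> ('k::field, 'v) L_object \<Rightarrow> ('k, 'v) L_object
     \<Rightarrow> (nat set \<Rightarrow> 'v \<Rightarrow> 'v) set" where
  "L_maps m K M N =
     {f \<in> (\<Pi>\<^sub>E \<sigma> \<in> missing_faces m K. graded_maps m \<sigma> (part M \<sigma>) (part N \<sigma>)).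
        \<forall>\<sigma> \<in> missing_faces m K. \<forall>\<tau> \<in> missing_faces m K. \<sigma> \<subseteq> \<tau> \<longrightarrow>
          (\<forall>x \<in> carrier (part M \<sigma>). f \<tau> (transition M \<sigma> \<tau> x) = transition N \<sigma> \<tau> (f \<sigma> x))}"

text \<open>
  All structure is pointwise. This includes exactness, since kernels and cokernels in this category
  are computed pointwise.
\<close>

definition L_cat ::
  "nat \<Rightarrow> nat set set \<Rightarrow> ('k::field, ('k, 'v) L_object, nat set \<Rightarrow> 'v \<Rightarrow> 'v) lincat" where
  "L_cat m K =
     \<lparr>Ob = L_objects m K,
      Hom = L_maps m K,
      Id = (\<lambda>M. \<lambda>\<sigma> \<in> missing_faces m K. Id (graded_mod m \<sigma>) (part M \<sigma>)),
      Comp = (\<lambda>L M N g f. \<lambda>\<sigma> \<in> missing_faces m K.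
                Comp (graded_mod m \<sigma>) (part L \<sigma>) (part M \<sigma>) (part N \<sigma>) (g \<sigma>) (f \<sigma>)),
      Zero = (\<lambda>M N. \<lambda>\<sigma> \<in> missing_faces m K. Zero (graded_mod m \<sigma>) (part M \<sigma>) (part N \<sigma>)),
      Add = (\<lambda>M N f g. \<lambda>\<sigma> \<in> missing_faces m K.
                Add (graded_mod m \<sigma>) (part M \<sigma>) (part N \<sigma>) (f \<sigma>) (g \<sigma>)),
      Scale = (\<lambda>M N c f. \<lambda>\<sigma> \<in> missing_faces m K.
                Scale (graded_mod m \<sigma>) (part M \<sigma>) (part N \<sigma>) c (f \<sigma>)),
      Ses = (\<lambda>L M N f g. \<forall>\<sigma> \<in> missing_faces m K.
                Ses (graded_mod m \<sigma>) (part L \<sigma>) (part M \<sigma>) (part N \<sigma>) (f \<sigma>) (g \<sigma>))\<rparr>"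


section \<open>Wild representation type\<close>

datatype generator = X1 | X2

datatype free_word = Word "generator list"

instantiation free_word :: monoid_add
begin

definition zero_free_word :: free_word where
  "0 = Word []"

fun plus_free_word :: "free_word \<Rightarrow> free_word \<Rightarrow> free_word" where
  "Word u + Word v = Word (u @ v)"

instance
proof
  fix a b c :: free_word
  show "a + b + c = a + (b + c)"
    by (cases a; cases b; cases c) simp
  show "0 + a = a" and "a + 0 = a"
    by (cases a; simp add: zero_free_word_def)+
qed

end

definition free_algebra :: "(free_word \<Rightarrow>\<^sub>0 'k::field) ring" where
  "free_algebra = monoid_algebra UNIV"

definition fd_free_algebra_mod ::
  "('k::field, (free_word \<Rightarrow>\<^sub>0 'k, 'v) module, 'v \<Rightarrow> 'v) lincat" where
  "fd_free_algebra_mod =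
     module_category
       {M. left_module free_algebra M \<and> finitely_generated (monoid_algebra {0}) M}
       (linear_maps free_algebra)"

text \<open>
  The type argument is the universe for the carriers of the modules over the free algebra; every
  finite-dimensional module occurs up to isomorphism once \<open>'v\<close> is large enough, as above.
\<close>

definition wild_representation_type :: "'v itself \<Rightarrow> ('k::field, 'o, 'm) lincat \<Rightarrow> bool" where
  "wild_representation_type _ C \<longleftrightarrow>
     (\<exists>T. representation_embedding
            (fd_free_algebra_mod :: ('k, (free_word \<Rightarrow>\<^sub>0 'k, 'v) module, 'v \<Rightarrow> 'v) lincat) C T)"

end

theory Submission
  imports Defs
begin

text \<open>
  Since \<open>K\<close> is properly contained in the complex of all sets with at most \<open>m - 2\<close> elements, there are
  \<open>a \<noteq> b\<close> such that \<open>\<sigma>\<^sub>0 = {1..m} - {a, b}\<close> is a missing face. Let \<open>s\<close> and \<open>t\<close> act as \<open>t\<^sub>a\<close> and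
  \<open>t\<^sub>b\<close>, extend a bigraded module \<open>N\<close> to the multigraded module \<open>R \<otimes> N\<close> by adjoining the other
  variables freely, and localise this module at every missing face: this is an exact functor \<open>S\<close> into
  the category of \<open>K\<close> (\<open>spread\<close>). Conversely, the homogeneous elements of \<open>M\<^sub>\<sigma>\<close>, \<open>\<sigma> = \<sigma>\<^sub>0\<close>, whose
  degree vanishes outside \<open>{a, b}\<close> form a bigraded module, since \<open>t\<^sub>a\<close> and \<open>t\<^sub>b\<close> are not inverted
  there; it is finitely generated because all other variables are. This is an exact functor \<open>R\<close> in the
  other direction (\<open>slice\<close>), and \<open>R S N\<close> is isomorphic to \<open>N\<close>, naturally in \<open>N\<close> (\<open>slice_spread\<close>).

  All modules that have to be constructed are direct sums \<open>Tot\<close> of homogeneous pieces, and almost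
  everything about \<open>Tot\<close> is checked on the pieces. The piece of degree \<open>d\<close> of the localisation of
  \<open>R \<otimes> N\<close> at \<open>\<sigma>\<close> is a sequential colimit of components of \<open>N\<close>, whose elements are represented by germs
  at infinity of sequences in \<open>N\<close>. That the transition maps exhibit \<open>M\<^sub>\<tau>\<close> as a base change of \<open>M\<^sub>\<sigma>\<close>
  follows from the usual two conditions on a localisation: every element is a fraction, and an element
  which becomes zero is killed by a denominator (\<open>induces_base_change_isoI\<close>).

  For wildness it suffices to compose \<open>S\<close> with a suitable functor from the modules over the free
  algebra. An arrow \<open>F : S N \<rightarrow> S N'\<close> is determined by \<open>R F\<close> (\<open>slice_faithful_on_spread\<close>): the module at
  \<open>\<sigma>\<^sub>0\<close> and those at larger faces are generated, up to units, by \<open>R S N\<close>, and the module at any \<open>\<sigma>\<close>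
  embeds into the one at \<open>\<sigma> \<union> \<sigma>\<^sub>0\<close>, because only freely adjoined variables get inverted. Hence \<open>S\<close> is
  full and faithful. A vector space \<open>U\<close> with two endomorphisms is encoded by five subspaces of
  \<open>U \<oplus> U\<close>, namely the two summands, the diagonal and the graphs of the endomorphisms. Placing them in the
  five bidegrees of total degree 4, and \<open>U \<oplus> U\<close> in all bidegrees of larger total degree, gives an
  exact, full and faithful functor \<open>five\<close> into bigraded modules. Finally, a full and faithful exact
  linear functor is a representation embedding if idempotents split in its source
  (\<open>fully_faithful_imp_representation_embedding\<close>).
\<close>

section \<open>Modules over monoid algebras\<close>

abbreviation monomial :: "'w \<Rightarrow> 'k \<Rightarrow> ('w \<Rightarrow>\<^sub>0 'k::zero)" where
  "monomial \<equiv> Poly_Mapping.single"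

definition add_submonoid :: "'w::monoid_add set \<Rightarrow> bool" where
  "add_submonoid S \<longleftrightarrow> 0 \<in> S \<and> (\<forall>x \<in> S. \<forall>y \<in> S. x + y \<in> S)"

lemma monoid_algebra_simps [simp]:
  "p \<in> carrier (monoid_algebra S) \<longleftrightarrow> Poly_Mapping.keys p \<subseteq> S"
  "p \<otimes>\<^bsub>monoid_algebra S\<^esub> q = p * q"
  "p \<oplus>\<^bsub>monoid_algebra S\<^esub> q = p + q"
  "\<one>\<^bsub>monoid_algebra S\<^esub> = 1"
  "\<zero>\<^bsub>monoid_algebra S\<^esub> = 0"
  by (simp_all add: monoid_algebra_def)

lemma keys_add_subset: "Poly_Mapping.keys p \<subseteq> S \<Longrightarrow> Poly_Mapping.keys q \<subseteq> S \<Longrightarrow> Poly_Mapping.keys (p + q) \<subseteq> S"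
  using keys_add[of p q] by blast

lemma keys_mult_subset:
  assumes "add_submonoid S" "Poly_Mapping.keys p \<subseteq> S" "Poly_Mapping.keys q \<subseteq> S"
  shows "Poly_Mapping.keys (p * q) \<subseteq> S"
  proof
  fix w assume "w \<in> Poly_Mapping.keys (p * q)"
  then obtain a b where "w = a + b" "a \<in> Poly_Mapping.keys p" "b \<in> Poly_Mapping.keys q"
    using keys_mult[of p q] by auto
  then show "w \<in> S" using assms unfolding add_submonoid_def by blast
qed

lemma keys_single_subset: "w \<in> S \<Longrightarrow> Poly_Mapping.keys (monomial w c) \<subseteq> S"
  by (cases "c = 0") auto

lemma ring_monoid_algebra:
  assumes S: "add_submonoid (S :: 'w::monoid_add set)"
  shows "ring (monoid_algebra S :: ('w \<Rightarrow>\<^sub>0 'k::field) ring)"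
proof -
  have "abelian_group (monoid_algebra S :: ('w \<Rightarrow>\<^sub>0 'k) ring)"
  proof (rule abelian_groupI)
    fix p :: "'w \<Rightarrow>\<^sub>0 'k" assume "p \<in> carrier (monoid_algebra S)"
    then show "\<exists>y\<in>carrier (monoid_algebra S). y \<oplus>\<^bsub>monoid_algebra S\<^esub> p = \<zero>\<^bsub>monoid_algebra S\<^esub>"
      by (intro bexI[of _ "- p"]) (auto simp: keys_minus)
  qed (simp_all add: add.assoc keys_add_subset add.commute)
  moreover have "Group.monoid (monoid_algebra S :: ('w \<Rightarrow>\<^sub>0 'k) ring)"
    using S keys_single_subset[of 0 S "1::'k"]
    by (intro monoidI) (simp_all add: mult.assoc keys_mult_subset add_submonoid_def)
  ultimately show ?thesis
    by (intro ringI) (simp_all add: algebra_simps)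
qed

lemma cring_monoid_algebra:
  assumes "add_submonoid (S :: 'w::comm_monoid_add set)"
  shows "cring (monoid_algebra S :: ('w \<Rightarrow>\<^sub>0 'k::field) ring)"
  by (intro cring.intro ring_monoid_algebra comm_monoid.intro comm_monoid_axioms.intro assms
      ring.is_monoid[OF ring_monoid_algebra[OF assms]]) (simp add: mult.commute)

lemma monoid_algebra_induct [consumes 1, case_names zero add]:
  fixes p :: "'w \<Rightarrow>\<^sub>0 'k::field"
  assumes "Poly_Mapping.keys p \<subseteq> S"
    and "P 0"
    and step: "\<And>w c p. w \<in> S \<Longrightarrow> Poly_Mapping.keys p \<subseteq> S \<Longrightarrow> P p \<Longrightarrow> P (monomial w c + p)"
  shows "P p"
proof -
  have "finite A \<Longrightarrow> A \<subseteq> S \<Longrightarrow> P (\<Sum>w\<in>A. monomial w (Poly_Mapping.lookup p w))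
          \<and> Poly_Mapping.keys (\<Sum>w\<in>A. monomial w (Poly_Mapping.lookup p w)) \<subseteq> S" for A
  proof (induction A rule: finite_induct)
    case (insert w A)
    then show ?case
      using step[of w "\<Sum>w\<in>A. monomial w (Poly_Mapping.lookup p w)" "Poly_Mapping.lookup p w"]
      by (auto dest: subsetD[OF keys_add_subset[OF keys_single_subset]])
  qed (use assms in auto)
  moreover have "(\<Sum>w\<in>Poly_Mapping.keys p. monomial w (Poly_Mapping.lookup p w)) = p"
    by (rule poly_mapping_eqI) (auto simp: lookup_sum lookup_single when_def in_keys_iff)
  ultimately show ?thesis
    using assms(1) by (metis finite_keys)
qed

lemma (in abelian_monoid) finsum_mono_neutral:
  assumes "finite B" "A \<subseteq> B" "\<And>i. i \<in> B - A \<Longrightarrow> f i = \<zero>" "f \<in> A \<rightarrow> carrier G"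
  shows "finsum G f A = finsum G f B"
proof (rule add.finprod_mono_neutral_cong_left)
qed (use assms in \<open>auto intro: finite_subset\<close>)

lemma additive_zero:
  assumes M: "abelian_group M" and N: "abelian_group N"
    and f: "f \<in> carrier M \<rightarrow> carrier N"
    and add: "\<And>x y. x \<in> carrier M \<Longrightarrow> y \<in> carrier M \<Longrightarrow> f (x \<oplus>\<^bsub>M\<^esub> y) = f x \<oplus>\<^bsub>N\<^esub> f y"
  shows "f \<zero>\<^bsub>M\<^esub> = \<zero>\<^bsub>N\<^esub>"
proof -
  interpret M: abelian_group M by fact
  interpret N: abelian_group N by fact
  have c: "f \<zero>\<^bsub>M\<^esub> \<in> carrier N" using f by auto
  have "f \<zero>\<^bsub>M\<^esub> \<oplus>\<^bsub>N\<^esub> f \<zero>\<^bsub>M\<^esub> = f \<zero>\<^bsub>M\<^esub>" using add[of "\<zero>\<^bsub>M\<^esub>" "\<zero>\<^bsub>M\<^esub>"] by simp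
  then show ?thesis using c by (metis N.add.r_cancel_one')
qed

lemma additive_minus:
  assumes M: "abelian_group M" and N: "abelian_group N"
    and f: "f \<in> carrier M \<rightarrow> carrier N"
    and add: "\<And>x y. x \<in> carrier M \<Longrightarrow> y \<in> carrier M \<Longrightarrow> f (x \<oplus>\<^bsub>M\<^esub> y) = f x \<oplus>\<^bsub>N\<^esub> f y"
    and x: "x \<in> carrier M"
  shows "f (\<ominus>\<^bsub>M\<^esub> x) = \<ominus>\<^bsub>N\<^esub> f x"
proof -
  interpret M: abelian_group M by fact
  interpret N: abelian_group N by fact
  have "f (\<ominus>\<^bsub>M\<^esub> x) \<oplus>\<^bsub>N\<^esub> f x = \<zero>\<^bsub>N\<^esub>"
    using add[of "\<ominus>\<^bsub>M\<^esub> x" x] additive_zero[OF assms(1-4)] x by (simp add: M.l_neg)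
  then show ?thesis using f x by (auto intro!: N.minus_equality[symmetric])
qed

lemma additive_finsum:
  assumes M: "abelian_group M" and N: "abelian_group N"
    and f: "f \<in> carrier M \<rightarrow> carrier N"
    and add: "\<And>x y. x \<in> carrier M \<Longrightarrow> y \<in> carrier M \<Longrightarrow> f (x \<oplus>\<^bsub>M\<^esub> y) = f x \<oplus>\<^bsub>N\<^esub> f y"
    and g: "finite A" "g \<in> A \<rightarrow> carrier M"
  shows "f (finsum M g A) = finsum N (\<lambda>i. f (g i)) A"
proof -
  interpret M: abelian_group M by fact
  interpret N: abelian_group N by fact
  show ?thesis using g
  proof (induction A rule: finite_induct)
    case empty
    then show ?case using additive_zero[OF assms(1-4)] by simp
  next
    case (insert i A)
    then show ?case
      using f by (subst M.finsum_insert, auto simp: Pi_def add)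
  qed
qed

lemma module_imp_left_module: "module R M \<Longrightarrow> left_module R M"
  by (auto simp: module_def module_axioms_def left_module_def left_module_axioms_def cring_def)

locale monoid_algebra_module =
  fixes S :: "'w::monoid_add set" and M :: "('w \<Rightarrow>\<^sub>0 'k::field, 'v, 'z) module_scheme" (structure)
  assumes submonoid: "add_submonoid S"
    and left_module: "left_module (monoid_algebra S) M"
begin

sublocale LM: left_module "monoid_algebra S" M
  by (rule left_module)

lemma zero_mem: "0 \<in> S" and add_mem: "x \<in> S \<Longrightarrow> y \<in> S \<Longrightarrow> x + y \<in> S"
  using submonoid by (auto simp: add_submonoid_def)

lemma act_closed: "e \<in> S \<Longrightarrow> x \<in> carrier M \<Longrightarrow> monomial e c \<odot> x \<in> carrier M"
  by (intro LM.smult_closed) (auto simp: keys_single_subset)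

lemma act_plus: "e \<in> S \<Longrightarrow> x \<in> carrier M \<Longrightarrow> y \<in> carrier M \<Longrightarrow>
    monomial e c \<odot> (x \<oplus> y) = monomial e c \<odot> x \<oplus> monomial e c \<odot> y"
  by (intro LM.smult_r_distr) (auto simp: keys_single_subset)

lemma act_coeff_plus: "e \<in> S \<Longrightarrow> x \<in> carrier M \<Longrightarrow>
    monomial e (c + c') \<odot> x = monomial e c \<odot> x \<oplus> monomial e c' \<odot> x"
  using LM.smult_l_distr[of "monomial e c" "monomial e c'" x] by (simp add: keys_single_subset single_add)

lemma act_act: "e \<in> S \<Longrightarrow> f \<in> S \<Longrightarrow> x \<in> carrier M \<Longrightarrow>
    monomial e c \<odot> (monomial f d \<odot> x) = monomial (e + f) (c * d) \<odot> x"
  using LM.smult_assoc[of "monomial e c" "monomial f d" x] by (simp add: keys_single_subset mult_single)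

lemma act_one: "x \<in> carrier M \<Longrightarrow> monomial 0 1 \<odot> x = x"
  using LM.smult_one[of x] by simp

lemma smult_zero_right: "Poly_Mapping.keys p \<subseteq> S \<Longrightarrow> p \<odot> \<zero> = \<zero>"
  by (rule additive_zero[of M M]) (auto intro!: LM.smult_closed LM.smult_r_distr LM.abelian_group_axioms)

lemma act_zero: "e \<in> S \<Longrightarrow> monomial e c \<odot> \<zero> = \<zero>"
  by (intro smult_zero_right keys_single_subset)

lemma smult_zero_left: "x \<in> carrier M \<Longrightarrow> 0 \<odot> x = \<zero>"
  using LM.smult_l_distr[of 0 0 x] LM.smult_closed[of 0 x] by simp

lemma smult_plus_left: "Poly_Mapping.keys p \<subseteq> S \<Longrightarrow> Poly_Mapping.keys q \<subseteq> S \<Longrightarrow> x \<in> carrier M \<Longrightarrow>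
   (p + q) \<odot> x = p \<odot> x \<oplus> q \<odot> x"
  using LM.smult_l_distr[of p q x] by simp

end

text \<open>Monomials generate a monoid algebra additively, so they suffice to test linearity.\<close>

lemma linear_maps_monomialI:
  assumes M: "monoid_algebra_module S M" and N: "monoid_algebra_module S' N" and "S \<subseteq> S'"
    and f: "f \<in> carrier M \<rightarrow>\<^sub>E carrier N"
    and add: "\<And>x y. x \<in> carrier M \<Longrightarrow> y \<in> carrier M \<Longrightarrow> f (x \<oplus>\<^bsub>M\<^esub> y) = f x \<oplus>\<^bsub>N\<^esub> f y"
    and act: "\<And>e c x. e \<in> S \<Longrightarrow> x \<in> carrier M \<Longrightarrow> f (monomial e c \<odot>\<^bsub>M\<^esub> x) = monomial e c \<odot>\<^bsub>N\<^esub> f x"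
  shows "f \<in> linear_maps (monoid_algebra S) M N"
proof -
  interpret M: monoid_algebra_module S M by fact
  interpret N: monoid_algebra_module S' N by fact
  have f0: "f \<zero>\<^bsub>M\<^esub> = \<zero>\<^bsub>N\<^esub>"
    using f add additive_zero[OF M.LM.abelian_group_axioms N.LM.abelian_group_axioms, of f] by auto
  have "f (p \<odot>\<^bsub>M\<^esub> x) = p \<odot>\<^bsub>N\<^esub> f x" if "Poly_Mapping.keys p \<subseteq> S" "x \<in> carrier M" for p x
    using that
  proof (induction p rule: monoid_algebra_induct)
    case zero
    then have "f x \<in> carrier N" using f by auto
    then show ?case using zero f0 by (simp add: M.smult_zero_left N.smult_zero_left)
  next
    case (add w c p)
    have fx: "f x \<in> carrier N" using f add by auto
    have "f ((monomial w c + p) \<odot>\<^bsub>M\<^esub> x) = f (monomial w c \<odot>\<^bsub>M\<^esub> x \<oplus>\<^bsub>M\<^esub> p \<odot>\<^bsub>M\<^esub> x)"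
      using add by (simp add: M.smult_plus_left keys_single_subset)
    also have "\<dots> = f (monomial w c \<odot>\<^bsub>M\<^esub> x) \<oplus>\<^bsub>N\<^esub> f (p \<odot>\<^bsub>M\<^esub> x)"
      using add by (intro assms(5)) (auto intro!: M.act_closed M.LM.smult_closed)
    also have "\<dots> = (monomial w c + p) \<odot>\<^bsub>N\<^esub> f x"
      using add fx \<open>S \<subseteq> S'\<close> act[of w x c] by (subst N.smult_plus_left) (auto simp: keys_single_subset)
    finally show ?case .
  qed
  then show ?thesis using f add by (auto simp: linear_maps_def)
qed

text \<open>
  Closure under negatives is a consequence of closure under multiplication by \<open>- 1\<close>.
\<close>

definition is_submodule :: "('a, 'r) ring_scheme \<Rightarrow> ('a, 'v, 'z) module_scheme \<Rightarrow> 'v set \<Rightarrow> bool" where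
  "is_submodule A M H \<longleftrightarrow> H \<subseteq> carrier M \<and> \<zero>\<^bsub>M\<^esub> \<in> H \<and> (\<forall>x \<in> H. \<forall>y \<in> H. x \<oplus>\<^bsub>M\<^esub> y \<in> H) \<and>
     (\<forall>a \<in> carrier A. \<forall>x \<in> H. a \<odot>\<^bsub>M\<^esub> x \<in> H)"

lemma is_submodule_monomialI:
  assumes M: "monoid_algebra_module S M"
    and "H \<subseteq> carrier M" "\<zero>\<^bsub>M\<^esub> \<in> H" "\<And>x y. x \<in> H \<Longrightarrow> y \<in> H \<Longrightarrow> x \<oplus>\<^bsub>M\<^esub> y \<in> H"
    and act: "\<And>e c x. e \<in> S \<Longrightarrow> x \<in> H \<Longrightarrow> monomial e c \<odot>\<^bsub>M\<^esub> x \<in> H"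
  shows "is_submodule (monoid_algebra S) M H"
proof -
  interpret M: monoid_algebra_module S M by fact
  have "p \<odot>\<^bsub>M\<^esub> x \<in> H" if "Poly_Mapping.keys p \<subseteq> S" "x \<in> H" for p x
    using that
  proof (induction p rule: monoid_algebra_induct)
    case zero
    then show ?case using assms by (auto simp: M.smult_zero_left)
  next
    case (add w c p)
    then show ?case using assms by (subst M.smult_plus_left) (auto simp: keys_single_subset)
  qed
  then show ?thesis using assms by (auto simp: is_submodule_def)
qed

text \<open>
  Phrased with submodules, finite generation can be transported along constructions without ever
  writing down linear combinations.
\<close>

lemma finitely_generated_iff:
  assumes "left_module A M"
  shows "finitely_generated A M \<longleftrightarrow>
    (\<exists>S. finite S \<and> S \<subseteq> carrier M \<and> (\<forall>H. is_submodule A M H \<longrightarrow> S \<subseteq> H \<longrightarrow> carrier M \<subseteq> H))"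
proof -
  interpret left_module A M by fact
  have smult_zero: "a \<odot>\<^bsub>M\<^esub> \<zero>\<^bsub>M\<^esub> = \<zero>\<^bsub>M\<^esub>" if "a \<in> carrier A" for a
    using additive_zero[of M M "\<lambda>x. a \<odot>\<^bsub>M\<^esub> x"] M.abelian_group_axioms that
    by (auto intro!: smult_closed smult_r_distr)
  have zero_smult: "\<zero>\<^bsub>A\<^esub> \<odot>\<^bsub>M\<^esub> x = \<zero>\<^bsub>M\<^esub>" if "x \<in> carrier M" for x
    using smult_l_distr[of "\<zero>\<^bsub>A\<^esub>" "\<zero>\<^bsub>A\<^esub>" x] smult_closed[of "\<zero>\<^bsub>A\<^esub>" x] that by simp
  have fin_in: "finsum M (\<lambda>s. c s \<odot>\<^bsub>M\<^esub> s) S \<in> H"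
    if "is_submodule A M H" "finite S" "S \<subseteq> H" "c \<in> S \<rightarrow> carrier A" for H S c
    using that(2-)
  proof (induction S rule: finite_induct)
    case empty
    then show ?case using that(1) by (simp add: is_submodule_def)
  next
    case (insert s S)
    then show ?case using that(1)
      by (subst M.finsum_insert) (auto simp: is_submodule_def intro!: smult_closed)
  qed
  have span: "is_submodule A M {x. \<exists>c \<in> S \<rightarrow> carrier A. x = (\<Oplus>\<^bsub>M\<^esub> s \<in> S. c s \<odot>\<^bsub>M\<^esub> s)}"
    (is "is_submodule A M ?H") if S: "finite S" "S \<subseteq> carrier M" for S
    unfolding is_submodule_def
  proof (intro conjI ballI)
    show "?H \<subseteq> carrier M" using S by (auto intro!: M.finsum_closed smult_closed)
    have "(\<Oplus>\<^bsub>M\<^esub> s \<in> S. \<zero>\<^bsub>A\<^esub> \<odot>\<^bsub>M\<^esub> s) = (\<Oplus>\<^bsub>M\<^esub> s \<in> S. \<zero>\<^bsub>M\<^esub>)"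
      using S by (intro M.finsum_cong') (auto simp: zero_smult)
    then show "\<zero>\<^bsub>M\<^esub> \<in> ?H" by (intro CollectI bexI[of _ "\<lambda>s. \<zero>\<^bsub>A\<^esub>"]) (auto simp: M.finsum_zero)
  next
    fix x y assume "x \<in> ?H" "y \<in> ?H"
    then obtain c d where cd: "c \<in> S \<rightarrow> carrier A" "x = (\<Oplus>\<^bsub>M\<^esub> s \<in> S. c s \<odot>\<^bsub>M\<^esub> s)"
      "d \<in> S \<rightarrow> carrier A" "y = (\<Oplus>\<^bsub>M\<^esub> s \<in> S. d s \<odot>\<^bsub>M\<^esub> s)" by auto
    have "x \<oplus>\<^bsub>M\<^esub> y = (\<Oplus>\<^bsub>M\<^esub> s \<in> S. (c s \<oplus>\<^bsub>A\<^esub> d s) \<odot>\<^bsub>M\<^esub> s)"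
      unfolding cd using S cd(1,3)
      by (subst M.finsum_addf[symmetric]) (auto intro!: smult_closed M.finsum_cong' simp: smult_l_distr subset_eq Pi_def)
    then show "x \<oplus>\<^bsub>M\<^esub> y \<in> ?H" using cd by (intro CollectI bexI[of _ "\<lambda>s. c s \<oplus>\<^bsub>A\<^esub> d s"]) auto
  next
    fix a x assume a: "a \<in> carrier A" and "x \<in> ?H"
    then obtain c where c: "c \<in> S \<rightarrow> carrier A" "x = (\<Oplus>\<^bsub>M\<^esub> s \<in> S. c s \<odot>\<^bsub>M\<^esub> s)" by auto
    have "a \<odot>\<^bsub>M\<^esub> x = (\<Oplus>\<^bsub>M\<^esub> s \<in> S. a \<odot>\<^bsub>M\<^esub> (c s \<odot>\<^bsub>M\<^esub> s))"
      unfolding c using S a c(1)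
      by (intro additive_finsum M.abelian_group_axioms) (auto intro!: smult_closed smult_r_distr)
    also have "\<dots> = (\<Oplus>\<^bsub>M\<^esub> s \<in> S. (a \<otimes>\<^bsub>A\<^esub> c s) \<odot>\<^bsub>M\<^esub> s)"
      using S a c(1) by (intro M.finsum_cong') (auto intro!: smult_closed simp: smult_assoc subset_eq Pi_def)
    finally show "a \<odot>\<^bsub>M\<^esub> x \<in> ?H" using c a by (intro CollectI bexI[of _ "\<lambda>s. a \<otimes>\<^bsub>A\<^esub> c s"]) auto
  qed
  have mem_span: "S \<subseteq> {x. \<exists>c \<in> S \<rightarrow> carrier A. x = (\<Oplus>\<^bsub>M\<^esub> s \<in> S. c s \<odot>\<^bsub>M\<^esub> s)}"
    if S: "finite S" "S \<subseteq> carrier M" for S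
  proof
    fix x assume x: "x \<in> S"
    have "(\<Oplus>\<^bsub>M\<^esub> s \<in> S. (if s = x then \<one>\<^bsub>A\<^esub> else \<zero>\<^bsub>A\<^esub>) \<odot>\<^bsub>M\<^esub> s) = (\<Oplus>\<^bsub>M\<^esub> s \<in> S. if x = s then s else \<zero>\<^bsub>M\<^esub>)"
      using S by (intro M.finsum_cong') (auto simp: zero_smult smult_one subset_eq)
    also have "\<dots> = x" using M.finsum_singleton[of x S "\<lambda>s. s"] S x by auto
    finally show "x \<in> {x. \<exists>c \<in> S \<rightarrow> carrier A. x = (\<Oplus>\<^bsub>M\<^esub> s \<in> S. c s \<odot>\<^bsub>M\<^esub> s)}"
      by (intro CollectI bexI[of _ "\<lambda>s. if s = x then \<one>\<^bsub>A\<^esub> else \<zero>\<^bsub>A\<^esub>"]) auto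
  qed
  show ?thesis
  proof
    assume "finitely_generated A M"
    then obtain S where S: "finite S" "S \<subseteq> carrier M"
      "\<And>x. x \<in> carrier M \<Longrightarrow> \<exists>c \<in> S \<rightarrow> carrier A. x = (\<Oplus>\<^bsub>M\<^esub> s \<in> S. c s \<odot>\<^bsub>M\<^esub> s)"
      by (auto simp: finitely_generated_def)
    then show "\<exists>S. finite S \<and> S \<subseteq> carrier M \<and> (\<forall>H. is_submodule A M H \<longrightarrow> S \<subseteq> H \<longrightarrow> carrier M \<subseteq> H)"
      by (intro exI[of _ S]) (use fin_in in blast)
  next
    assume "\<exists>S. finite S \<and> S \<subseteq> carrier M \<and> (\<forall>H. is_submodule A M H \<longrightarrow> S \<subseteq> H \<longrightarrow> carrier M \<subseteq> H)"
    then obtain S where "finite S" "S \<subseteq> carrier M" "\<forall>H. is_submodule A M H \<longrightarrow> S \<subseteq> H \<longrightarrow> carrier M \<subseteq> H"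
      by auto
    then show "finitely_generated A M"
      using span[of S] mem_span[of S] unfolding finitely_generated_def by (intro exI[of _ S]) blast
  qed
qed

text \<open>
  The module axioms are bilinear in the scalars, hence follow from the laws for monomials.
\<close>

lemma module_from_monomial_action:
  fixes M :: "('w::comm_monoid_add \<Rightarrow>\<^sub>0 'k::field, 'v, 'z) module_scheme"
  assumes S: "add_submonoid S" and M: "abelian_group M"
    and smult: "\<And>p x. Poly_Mapping.keys p \<subseteq> S \<Longrightarrow> x \<in> carrier M \<Longrightarrow>
       p \<odot>\<^bsub>M\<^esub> x = (\<Oplus>\<^bsub>M\<^esub> e \<in> Poly_Mapping.keys p. a e (Poly_Mapping.lookup p e) x)"
    and closed: "\<And>e c x. e \<in> S \<Longrightarrow> x \<in> carrier M \<Longrightarrow> a e c x \<in> carrier M"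
    and plus: "\<And>e c x y. e \<in> S \<Longrightarrow> x \<in> carrier M \<Longrightarrow> y \<in> carrier M \<Longrightarrow>
       a e c (x \<oplus>\<^bsub>M\<^esub> y) = a e c x \<oplus>\<^bsub>M\<^esub> a e c y"
    and coeff: "\<And>e c c' x. e \<in> S \<Longrightarrow> x \<in> carrier M \<Longrightarrow> a e (c + c') x = a e c x \<oplus>\<^bsub>M\<^esub> a e c' x"
    and assoc: "\<And>e f c d x. e \<in> S \<Longrightarrow> f \<in> S \<Longrightarrow> x \<in> carrier M \<Longrightarrow> a e c (a f d x) = a (e + f) (c * d) x"
    and one: "\<And>x. x \<in> carrier M \<Longrightarrow> a 0 1 x = x"
  shows "module (monoid_algebra S) M"
    and "e \<in> S \<Longrightarrow> x \<in> carrier M \<Longrightarrow> monomial e c \<odot>\<^bsub>M\<^esub> x = a e c x"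
proof -
  interpret M: abelian_group M by fact
  have coeff0: "a e 0 x = \<zero>\<^bsub>M\<^esub>" if "e \<in> S" "x \<in> carrier M" for e x
    using coeff[OF that, of 0 0] closed[OF that, of 0] by simp
  have smult': "p \<odot>\<^bsub>M\<^esub> x = (\<Oplus>\<^bsub>M\<^esub> e \<in> B. a e (Poly_Mapping.lookup p e) x)"
    if "Poly_Mapping.keys p \<subseteq> B" "B \<subseteq> S" "finite B" "x \<in> carrier M" for p x B
  proof -
    have "(\<Oplus>\<^bsub>M\<^esub> e \<in> Poly_Mapping.keys p. a e (Poly_Mapping.lookup p e) x) = (\<Oplus>\<^bsub>M\<^esub> e \<in> B. a e (Poly_Mapping.lookup p e) x)"
      using that coeff0 by (intro M.finsum_mono_neutral) (auto simp: in_keys_iff intro!: closed)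
    then show ?thesis using that by (subst smult) auto
  qed
  have cl: "p \<odot>\<^bsub>M\<^esub> x \<in> carrier M" if "Poly_Mapping.keys p \<subseteq> S" "x \<in> carrier M" for p x
    using that by (subst smult) (auto intro!: M.finsum_closed closed)
  have l: "(p + q) \<odot>\<^bsub>M\<^esub> x = p \<odot>\<^bsub>M\<^esub> x \<oplus>\<^bsub>M\<^esub> q \<odot>\<^bsub>M\<^esub> x"
    if "Poly_Mapping.keys p \<subseteq> S" "Poly_Mapping.keys q \<subseteq> S" "x \<in> carrier M" for p q x
  proof -
    let ?B = "Poly_Mapping.keys p \<union> Poly_Mapping.keys q"
    have B: "?B \<subseteq> S" using that by auto
    have "(p + q) \<odot>\<^bsub>M\<^esub> x = (\<Oplus>\<^bsub>M\<^esub> e \<in> ?B. a e (Poly_Mapping.lookup (p + q) e) x)"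
      using that keys_add[of p q] by (intro smult') auto
    also have "\<dots> = (\<Oplus>\<^bsub>M\<^esub> e \<in> ?B. a e (Poly_Mapping.lookup p e) x \<oplus>\<^bsub>M\<^esub> a e (Poly_Mapping.lookup q e) x)"
      using that B by (intro M.finsum_cong') (auto simp: lookup_add coeff intro!: closed)
    also have "\<dots> = p \<odot>\<^bsub>M\<^esub> x \<oplus>\<^bsub>M\<^esub> q \<odot>\<^bsub>M\<^esub> x"
      using that B by (subst M.finsum_addf) (auto simp: smult'[of _ ?B] intro!: closed)
    finally show ?thesis .
  qed
  have r: "p \<odot>\<^bsub>M\<^esub> (x \<oplus>\<^bsub>M\<^esub> y) = p \<odot>\<^bsub>M\<^esub> x \<oplus>\<^bsub>M\<^esub> p \<odot>\<^bsub>M\<^esub> y"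
    if "Poly_Mapping.keys p \<subseteq> S" "x \<in> carrier M" "y \<in> carrier M" for p x y
  proof -
    have "p \<odot>\<^bsub>M\<^esub> (x \<oplus>\<^bsub>M\<^esub> y) = (\<Oplus>\<^bsub>M\<^esub> e \<in> Poly_Mapping.keys p. a e (Poly_Mapping.lookup p e) x \<oplus>\<^bsub>M\<^esub> a e (Poly_Mapping.lookup p e) y)"
      using that by (subst smult) (auto intro!: M.finsum_cong' closed simp: plus subset_eq)
    also have "\<dots> = p \<odot>\<^bsub>M\<^esub> x \<oplus>\<^bsub>M\<^esub> p \<odot>\<^bsub>M\<^esub> y"
      using that by (subst M.finsum_addf) (auto simp: smult intro!: closed)
    finally show ?thesis .
  qed
  have mono: "monomial e c \<odot>\<^bsub>M\<^esub> x = a e c x" if "e \<in> S" "x \<in> carrier M" for e c x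
    using smult'[of "monomial e c" "{e}" x] that closed[OF that] keys_single_subset[of e "{e}" c] by auto
  have zero_l: "0 \<odot>\<^bsub>M\<^esub> x = \<zero>\<^bsub>M\<^esub>" if "x \<in> carrier M" for x
    using that by (subst smult) auto
  have zero_r: "p \<odot>\<^bsub>M\<^esub> \<zero>\<^bsub>M\<^esub> = \<zero>\<^bsub>M\<^esub>" if "Poly_Mapping.keys p \<subseteq> S" for p
    using r[OF that, of "\<zero>\<^bsub>M\<^esub>" "\<zero>\<^bsub>M\<^esub>"] cl[OF that, of "\<zero>\<^bsub>M\<^esub>"] by simp
  have assoc_mon: "monomial e c \<odot>\<^bsub>M\<^esub> (q \<odot>\<^bsub>M\<^esub> x) = (monomial e c * q) \<odot>\<^bsub>M\<^esub> x"
    if "Poly_Mapping.keys q \<subseteq> S" "e \<in> S" "x \<in> carrier M" for e c q x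
    using that(1)
  proof (induction q rule: monoid_algebra_induct)
    case zero
    then show ?case using that by (simp add: zero_l zero_r keys_single_subset)
  next
    case (add f d q)
    have S': "e + f \<in> S" using S that add by (auto simp: add_submonoid_def)
    have m: "monomial e c * monomial f d = monomial (e + f) (c * d)" by (simp add: mult_single)
    have "monomial e c \<odot>\<^bsub>M\<^esub> ((monomial f d + q) \<odot>\<^bsub>M\<^esub> x) = monomial e c \<odot>\<^bsub>M\<^esub> (monomial f d \<odot>\<^bsub>M\<^esub> x) \<oplus>\<^bsub>M\<^esub> monomial e c \<odot>\<^bsub>M\<^esub> (q \<odot>\<^bsub>M\<^esub> x)"
      using that add by (simp add: l r cl keys_single_subset)
    also have "monomial e c \<odot>\<^bsub>M\<^esub> (monomial f d \<odot>\<^bsub>M\<^esub> x) = (monomial e c * monomial f d) \<odot>\<^bsub>M\<^esub> x"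
      using that add S' by (simp add: mono closed assoc m)
    also have "\<dots> \<oplus>\<^bsub>M\<^esub> monomial e c \<odot>\<^bsub>M\<^esub> (q \<odot>\<^bsub>M\<^esub> x) = (monomial e c * (monomial f d + q)) \<odot>\<^bsub>M\<^esub> x"
      using that add S S' by (simp add: distrib_left l m keys_single_subset keys_mult_subset)
    finally show ?case .
  qed
  show "module (monoid_algebra S) M"
  proof (rule moduleI)
    show "cring (monoid_algebra S :: ('w \<Rightarrow>\<^sub>0 'k) ring)" by (rule cring_monoid_algebra[OF S])
    fix p q :: "'w \<Rightarrow>\<^sub>0 'k" and x
    assume q: "q \<in> carrier (monoid_algebra S)" and x: "x \<in> carrier M" and p: "p \<in> carrier (monoid_algebra S)"
    then have "Poly_Mapping.keys p \<subseteq> S" by simp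
    then show "(p \<otimes>\<^bsub>monoid_algebra S\<^esub> q) \<odot>\<^bsub>M\<^esub> x = p \<odot>\<^bsub>M\<^esub> (q \<odot>\<^bsub>M\<^esub> x)"
    proof (induction p rule: monoid_algebra_induct)
      case zero
      then show ?case using q x by (simp add: zero_l cl)
    next
      case (add e c p)
      then show ?case using q x S
        by (simp add: distrib_right l cl assoc_mon keys_single_subset keys_mult_subset)
    qed
  qed (use M cl l r S in \<open>auto simp: mono one add_submonoid_def simp flip: single_one\<close>)
  show "monomial e c \<odot>\<^bsub>M\<^esub> x = a e c x" if "e \<in> S" "x \<in> carrier M"
    using that by (rule mono)
qed

section \<open>Coordinates of graded modules\<close>

lemma add_submonoid_degrees: "add_submonoid (degrees m \<sigma>)"
  by (auto simp: add_submonoid_def degrees_def)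

lemma degrees_mono: "\<sigma> \<subseteq> \<tau> \<Longrightarrow> degrees m \<sigma> \<subseteq> degrees m \<tau>"
  by (auto simp: degrees_def)

lemma degrees_add: "d \<in> degrees m \<sigma> \<Longrightarrow> e \<in> degrees m \<sigma> \<Longrightarrow> d + e \<in> degrees m \<sigma>"
  using add_submonoid_degrees by (auto simp: add_submonoid_def)

lemma zero_degrees [simp]: "0 \<in> degrees m \<sigma>"
  by (auto simp: degrees_def)

locale gmodule =
  fixes m \<sigma> and M :: "('k::field, 'v) gmod" (structure)
  assumes graded: "is_graded_module m \<sigma> M"
begin

sublocale monoid_algebra_module "degrees m \<sigma>" M
  using graded add_submonoid_degrees[of m \<sigma>]
  by (auto simp: is_graded_module_def loc_ring_def monoid_algebra_module_def intro: module_imp_left_module)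

lemma subgroup_component: "subgroup (component M d) (add_monoid M)"
  using graded by (auto simp: is_graded_module_def)

lemma component_closed: "x \<in> component M d \<Longrightarrow> x \<in> carrier M"
  and zero_component: "\<zero> \<in> component M d"
  and plus_component: "x \<in> component M d \<Longrightarrow> y \<in> component M d \<Longrightarrow> x \<oplus> y \<in> component M d"
  and minus_component: "x \<in> component M d \<Longrightarrow> \<ominus> x \<in> component M d"
  using subgroup.subset[OF subgroup_component[of d]] subgroup.one_closed[OF subgroup_component[of d]]
    subgroup.m_closed[OF subgroup_component[of d], of x y] subgroup.m_inv_closed[OF subgroup_component[of d], of x]
  by (auto simp: a_inv_def)

lemma component_outside: "d \<notin> degrees m \<sigma> \<Longrightarrow> component M d = {\<zero>}"
  using graded by (auto simp: is_graded_module_def)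

lemma act_component: "e \<in> degrees m \<sigma> \<Longrightarrow> x \<in> component M d \<Longrightarrow> monomial e c \<odot> x \<in> component M (d + e)"
  using graded by (auto simp: is_graded_module_def)

definition decomposition :: "'v \<Rightarrow> (multidegree \<Rightarrow> 'v) \<Rightarrow> bool" where
  "decomposition x u \<longleftrightarrow> (\<forall>d. u d \<in> component M d) \<and> finite {d. u d \<noteq> \<zero>} \<and>
     x = (\<Oplus>\<^bsub>M\<^esub> d \<in> {d. u d \<noteq> \<zero>}. u d)"

lemma ex1_decomposition: "x \<in> carrier M \<Longrightarrow> \<exists>!u. decomposition x u"
  using graded by (auto simp: is_graded_module_def decomposition_def)

lemma decompositionI:
  assumes "\<And>d. u d \<in> component M d" "finite D" "\<And>d. d \<notin> D \<Longrightarrow> u d = \<zero>"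
    "x = (\<Oplus>\<^bsub>M\<^esub> d \<in> D. u d)"
  shows "decomposition x u"
proof -
  have sub: "{d. u d \<noteq> \<zero>} \<subseteq> D" using assms(3) by auto
  then have "(\<Oplus>\<^bsub>M\<^esub> d \<in> {d. u d \<noteq> \<zero>}. u d) = (\<Oplus>\<^bsub>M\<^esub> d \<in> D. u d)"
    using assms component_closed[OF assms(1)] by (intro LM.M.finsum_mono_neutral) auto
  then show ?thesis using assms sub by (auto simp: decomposition_def intro: finite_subset)
qed

text \<open>
  The components of an element serve as its coordinates: equalities, linearity and degrees of maps are
  all tested on them, which avoids sums over the support.
\<close>

definition cmp :: "'v \<Rightarrow> multidegree \<Rightarrow> 'v" where
  "cmp x = (THE u. decomposition x u)"

lemma decomposition_cmp: "x \<in> carrier M \<Longrightarrow> decomposition x (cmp x)"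
  using theI'[OF ex1_decomposition, of x] by (simp add: cmp_def)

lemma cmp_unique: "decomposition x u \<Longrightarrow> cmp x = u"
proof -
  assume u: "decomposition x u"
  then have "x \<in> carrier M"
    using component_closed by (auto simp: decomposition_def intro!: LM.M.finsum_closed)
  then show ?thesis using u ex1_decomposition[of x] decomposition_cmp[of x] by auto
qed

lemma cmp_component: "x \<in> carrier M \<Longrightarrow> cmp x d \<in> component M d"
  and finite_cmp: "x \<in> carrier M \<Longrightarrow> finite {d. cmp x d \<noteq> \<zero>}"
  using decomposition_cmp by (auto simp: decomposition_def)

lemma cmp_closed: "x \<in> carrier M \<Longrightarrow> cmp x d \<in> carrier M"
  using cmp_component component_closed by blast

lemma cmp_sum: "x \<in> carrier M \<Longrightarrow> finite D \<Longrightarrow> {d. cmp x d \<noteq> \<zero>} \<subseteq> D \<Longrightarrow> x = (\<Oplus>\<^bsub>M\<^esub> d \<in> D. cmp x d)"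
proof -
  assume *: "x \<in> carrier M" "finite D" "{d. cmp x d \<noteq> \<zero>} \<subseteq> D"
  then have "(\<Oplus>\<^bsub>M\<^esub> d \<in> {d. cmp x d \<noteq> \<zero>}. cmp x d) = (\<Oplus>\<^bsub>M\<^esub> d \<in> D. cmp x d)"
    using cmp_closed by (intro LM.M.finsum_mono_neutral) auto
  then show ?thesis using decomposition_cmp[OF *(1)] unfolding decomposition_def by metis
qed

lemma cmp_eqI:
  assumes "x \<in> carrier M" "y \<in> carrier M" "\<And>d. cmp x d = cmp y d" shows "x = y"
proof -
  have "cmp x = cmp y" using assms by auto
  then show ?thesis
    using cmp_sum[OF assms(1) finite_cmp[OF assms(1)] subset_refl]
      cmp_sum[OF assms(2) finite_cmp[OF assms(2)] subset_refl] by metis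
qed

lemma gather:
  assumes "\<And>d. u d \<in> component M d" "finite {d. u d \<noteq> \<zero>}"
  shows "\<exists>x \<in> carrier M. cmp x = u"
proof (intro bexI)
  show "cmp (\<Oplus>\<^bsub>M\<^esub> d \<in> {d. u d \<noteq> \<zero>}. u d) = u"
    using assms by (intro cmp_unique decompositionI[of _ "{d. u d \<noteq> \<zero>}"]) auto
  show "(\<Oplus>\<^bsub>M\<^esub> d \<in> {d. u d \<noteq> \<zero>}. u d) \<in> carrier M"
    using assms component_closed by (intro LM.M.finsum_closed) auto
qed

lemma cmp_homogeneous:
  assumes "x \<in> component M d" shows "cmp x d' = (if d' = d then x else \<zero>)"
proof -
  have "decomposition x (\<lambda>d'. if d' = d then x else \<zero>)"
    using assms component_closed[OF assms] zero_component by (intro decompositionI[of _ "{d}"]) auto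
  then show ?thesis by (simp add: cmp_unique)
qed

lemma cmp_zero: "cmp \<zero> d = \<zero>"
  using cmp_homogeneous[OF zero_component, of d d] by simp

lemma cmp_plus:
  assumes "x \<in> carrier M" "y \<in> carrier M"
  shows "cmp (x \<oplus> y) d = cmp x d \<oplus> cmp y d"
proof -
  let ?D = "{d. cmp x d \<noteq> \<zero>} \<union> {d. cmp y d \<noteq> \<zero>}"
  have fin: "finite ?D" using assms finite_cmp by auto
  have "x \<oplus> y = (\<Oplus>\<^bsub>M\<^esub> d \<in> ?D. cmp x d) \<oplus> (\<Oplus>\<^bsub>M\<^esub> d \<in> ?D. cmp y d)"
    using cmp_sum[OF assms(1) fin Un_upper1] cmp_sum[OF assms(2) fin Un_upper2] by metis
  also have "\<dots> = (\<Oplus>\<^bsub>M\<^esub> d \<in> ?D. cmp x d \<oplus> cmp y d)"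
    using assms cmp_closed by (intro LM.M.finsum_addf[symmetric]) auto
  finally have "decomposition (x \<oplus> y) (\<lambda>d. cmp x d \<oplus> cmp y d)"
    using assms fin by (intro decompositionI[of _ ?D] plus_component cmp_component) auto
  then show ?thesis by (simp add: cmp_unique)
qed

lemma component_iff: "x \<in> component M d \<longleftrightarrow> x \<in> carrier M \<and> (\<forall>d'. d' \<noteq> d \<longrightarrow> cmp x d' = \<zero>)"
proof
  assume x: "x \<in> carrier M \<and> (\<forall>d'. d' \<noteq> d \<longrightarrow> cmp x d' = \<zero>)"
  then have "x = (\<Oplus>\<^bsub>M\<^esub> d \<in> {d}. cmp x d)" by (intro cmp_sum) auto
  also have "\<dots> = cmp x d" using x cmp_closed by simp
  finally show "x \<in> component M d" using x cmp_component by metis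
qed (auto simp: cmp_homogeneous component_closed)

lemma homogeneous_induct [consumes 1, case_names zero plus homogeneous]:
  assumes x: "x \<in> carrier M" and z: "P \<zero>"
    and p: "\<And>x y. x \<in> carrier M \<Longrightarrow> y \<in> carrier M \<Longrightarrow> P x \<Longrightarrow> P y \<Longrightarrow> P (x \<oplus> y)"
    and h: "\<And>x d. x \<in> component M d \<Longrightarrow> d \<in> degrees m \<sigma> \<Longrightarrow> P x"
  shows "P x"
proof -
  have h': "P x" if "x \<in> component M d" for x d
    using h[of x d] z that component_outside[of d] by (cases "d \<in> degrees m \<sigma>") auto
  have "finite D \<Longrightarrow> (\<Oplus>\<^bsub>M\<^esub> d \<in> D. cmp x d) \<in> carrier M \<and> P (\<Oplus>\<^bsub>M\<^esub> d \<in> D. cmp x d)" for D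
  proof (induction D rule: finite_induct)
    case (insert d D)
    then show ?case using x cmp_closed h'[OF cmp_component[OF x]]
      by (subst (1 2) LM.M.finsum_insert) (auto intro!: p)
  qed (use z in auto)
  from this[OF finite_cmp[OF x]] show ?thesis
    using cmp_sum[OF x finite_cmp[OF x] subset_refl] by metis
qed

lemma is_submodule_loc_ringI:
  assumes "H \<subseteq> carrier M" "\<zero> \<in> H" "\<And>x y. x \<in> H \<Longrightarrow> y \<in> H \<Longrightarrow> x \<oplus> y \<in> H"
    and "\<And>e c x. e \<in> degrees m \<sigma> \<Longrightarrow> x \<in> H \<Longrightarrow> monomial e c \<odot> x \<in> H"
  shows "is_submodule (loc_ring m \<sigma>) M H"
  unfolding loc_ring_def by (rule is_submodule_monomialI[OF monoid_algebra_module_axioms]) (use assms in auto)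

lemma submodule_closed:
  assumes "is_submodule (loc_ring m \<sigma>) M H"
  shows "\<zero> \<in> H" and "x \<in> H \<Longrightarrow> y \<in> H \<Longrightarrow> x \<oplus> y \<in> H"
    and "e \<in> degrees m \<sigma> \<Longrightarrow> x \<in> H \<Longrightarrow> monomial e c \<odot> x \<in> H"
  using assms keys_single_subset[of e "degrees m \<sigma>" c] by (simp_all add: is_submodule_def loc_ring_def)

end

text \<open>
  The change \<open>s\<close> of degrees makes room for multiplication by a monomial.
\<close>

lemma cmp_additive_map:
  assumes M: "gmodule m \<sigma> M" and N: "gmodule m' \<tau> N"
    and f: "f \<in> carrier M \<rightarrow> carrier N"
    and add: "\<And>x y. x \<in> carrier M \<Longrightarrow> y \<in> carrier M \<Longrightarrow> f (x \<oplus>\<^bsub>M\<^esub> y) = f x \<oplus>\<^bsub>N\<^esub> f y"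
    and deg: "\<And>d x. x \<in> component M d \<Longrightarrow> f x \<in> component N (s d)" and s: "inj s"
    and x: "x \<in> carrier M"
  shows "gmodule.cmp N (f x) (s d) = f (gmodule.cmp M x d)"
proof -
  interpret M: gmodule m \<sigma> M by fact
  interpret N: gmodule m' \<tau> N by fact
  have f0: "f \<zero>\<^bsub>M\<^esub> = \<zero>\<^bsub>N\<^esub>"
    by (rule additive_zero[OF M.LM.abelian_group_axioms N.LM.abelian_group_axioms f add])
  show ?thesis using x
  proof (induction x rule: M.homogeneous_induct)
    case zero
    then show ?case by (simp add: M.cmp_zero N.cmp_zero f0)
  next
    case (plus x y)
    then show ?case using f by (simp add: add M.cmp_plus N.cmp_plus M.cmp_closed Pi_iff)
  next
    case (homogeneous x e)
    then show ?case using s by (auto simp: M.cmp_homogeneous N.cmp_homogeneous[OF deg] f0 inj_eq)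
  qed
qed

lemma (in gmodule) cmp_act:
  assumes e: "e \<in> degrees m \<sigma>" and x: "x \<in> carrier M"
  shows "cmp (monomial e c \<odot> x) (d + e) = monomial e c \<odot> cmp x d"
  using cmp_additive_map[OF gmodule_axioms gmodule_axioms, of "\<lambda>x. monomial e c \<odot> x" "\<lambda>d. d + e" x d] e x
  by (auto simp: act_closed act_plus act_component inj_def)

lemma (in gmodule) cmp_act_diff:
  assumes e: "e \<in> degrees m \<sigma>" and x: "x \<in> carrier M"
  shows "cmp (monomial e c \<odot> x) d = monomial e c \<odot> cmp x (d - e)"
  using cmp_act[OF assms, of c "d - e"] by simp

text \<open>
  The images under \<open>p\<close> of the finitely many homogeneous components of generators of \<open>N\<close> generate:
  for a submodule \<open>H\<close> of \<open>T\<close>, the elements of \<open>N\<close> all of whose components are mapped into \<open>H\<close> form a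
  submodule of \<open>N\<close>. The maps \<open>p\<close> are semilinear along the change \<open>\<psi>\<close> of multidegrees, since \<open>N\<close> and
  \<open>T\<close> may be modules over different rings.
\<close>

lemma finitely_generated_by_homogeneous:
  assumes N: "gmodule m \<sigma> N" and T: "gmodule m' \<tau> T" and fg: "finitely_generated (loc_ring m \<sigma>) N"
    and closed: "\<And>d x. d \<in> degrees m \<sigma> \<Longrightarrow> x \<in> component N d \<Longrightarrow> p d x \<in> carrier T"
    and plus: "\<And>d x y. d \<in> degrees m \<sigma> \<Longrightarrow> x \<in> component N d \<Longrightarrow> y \<in> component N d \<Longrightarrow>
      p d (x \<oplus>\<^bsub>N\<^esub> y) = p d x \<oplus>\<^bsub>T\<^esub> p d y"
    and \<psi>: "\<And>e. e \<in> degrees m \<sigma> \<Longrightarrow> \<psi> e \<in> degrees m' \<tau>"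
    and act: "\<And>e c d x. e \<in> degrees m \<sigma> \<Longrightarrow> d \<in> degrees m \<sigma> \<Longrightarrow> x \<in> component N d \<Longrightarrow>
      p (d + e) (monomial e c \<odot>\<^bsub>N\<^esub> x) = monomial (\<psi> e) c \<odot>\<^bsub>T\<^esub> p d x"
    and generate: "\<And>H. is_submodule (loc_ring m' \<tau>) T H \<Longrightarrow>
      (\<And>d x. d \<in> degrees m \<sigma> \<Longrightarrow> x \<in> component N d \<Longrightarrow> p d x \<in> H) \<Longrightarrow> carrier T \<subseteq> H"
  shows "finitely_generated (loc_ring m' \<tau>) T"
proof -
  interpret N: gmodule m \<sigma> N by fact
  interpret T: gmodule m' \<tau> T by fact
  have lm: "left_module (loc_ring m \<sigma>) N" "left_module (loc_ring m' \<tau>) T"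
    using N.left_module T.left_module by (simp_all add: loc_ring_def)
  obtain B where B: "finite B" "B \<subseteq> carrier N"
    "\<And>H. is_submodule (loc_ring m \<sigma>) N H \<Longrightarrow> B \<subseteq> H \<Longrightarrow> carrier N \<subseteq> H"
    using fg finitely_generated_iff[OF lm(1)] by blast
  define gens where "gens = (\<Union>x \<in> B. (\<lambda>d. p d (N.cmp x d)) ` {d. N.cmp x d \<noteq> \<zero>\<^bsub>N\<^esub>})"
  have outside: "N.cmp x d = \<zero>\<^bsub>N\<^esub>" if "x \<in> carrier N" "d \<notin> degrees m \<sigma>" for x d
    using N.cmp_component[OF that(1), of d] N.component_outside[OF that(2)] by simp
  have p0: "p d \<zero>\<^bsub>N\<^esub> = \<zero>\<^bsub>T\<^esub>" if d: "d \<in> degrees m \<sigma>" for d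
    using plus[OF d N.zero_component N.zero_component] closed[OF d N.zero_component]
    by (metis N.LM.M.l_zero N.LM.M.zero_closed T.LM.M.add.r_cancel_one')
  show ?thesis
    unfolding finitely_generated_iff[OF lm(2)]
  proof (intro exI[of _ gens] conjI allI impI)
    show "finite gens" unfolding gens_def using B(1,2) N.finite_cmp by blast
    show "gens \<subseteq> carrier T"
    proof
      fix z assume "z \<in> gens"
      then obtain x d where x: "x \<in> B" "N.cmp x d \<noteq> \<zero>\<^bsub>N\<^esub>" "z = p d (N.cmp x d)" by (auto simp: gens_def)
      then have "x \<in> carrier N" using B(2) by auto
      then show "z \<in> carrier T"
        using x outside[of x d] N.cmp_component[of x d] by (auto intro!: closed)
    qed
    fix H assume H: "is_submodule (loc_ring m' \<tau>) T H" and gens: "gens \<subseteq> H"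
    note [simp] = T.submodule_closed[OF H]
    define H' where "H' = {x \<in> carrier N. \<forall>d \<in> degrees m \<sigma>. p d (N.cmp x d) \<in> H}"
    have "is_submodule (loc_ring m \<sigma>) N H'"
    proof (rule N.is_submodule_loc_ringI)
      show "H' \<subseteq> carrier N" by (auto simp: H'_def)
      show "\<zero>\<^bsub>N\<^esub> \<in> H'" by (simp add: H'_def N.cmp_zero p0)
    next
      fix x y assume "x \<in> H'" "y \<in> H'"
      then show "x \<oplus>\<^bsub>N\<^esub> y \<in> H'" by (auto simp: H'_def N.cmp_plus plus N.cmp_component)
    next
      fix e c x assume e: "e \<in> degrees m \<sigma>" and "x \<in> H'"
      then have x: "x \<in> carrier N" and inH: "\<And>d. d \<in> degrees m \<sigma> \<Longrightarrow> p d (N.cmp x d) \<in> H"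
        by (auto simp: H'_def)
      have "p d (N.cmp (monomial e c \<odot>\<^bsub>N\<^esub> x) d) \<in> H" if d: "d \<in> degrees m \<sigma>" for d
      proof (cases "d - e \<in> degrees m \<sigma>")
        case True
        then show ?thesis
          using act[OF e True N.cmp_component[OF x], of c] inH[OF True] \<psi>[OF e] by (simp add: N.cmp_act_diff[OF e x])
      next
        case False
        then show ?thesis using d by (simp add: N.cmp_act_diff[OF e x] outside[OF x] N.act_zero[OF e] p0)
      qed
      then show "monomial e c \<odot>\<^bsub>N\<^esub> x \<in> H'" using x e by (auto simp: H'_def N.act_closed)
    qed
    moreover have "B \<subseteq> H'"
    proof
      fix x assume x: "x \<in> B"
      have "p d (N.cmp x d) \<in> H" if "d \<in> degrees m \<sigma>" for d
        using x gens that by (cases "N.cmp x d = \<zero>\<^bsub>N\<^esub>") (auto simp: gens_def p0)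
      then show "x \<in> H'" using x B(2) by (auto simp: H'_def)
    qed
    ultimately have H': "carrier N \<subseteq> H'" by (rule B(3))
    show "carrier T \<subseteq> H"
    proof (rule generate[OF H])
      fix d x assume d: "d \<in> degrees m \<sigma>" and x: "x \<in> component N d"
      have "x \<in> H'" using H' N.component_closed[OF x] by blast
      then have "p d (N.cmp x d) \<in> H" using d by (simp add: H'_def)
      then show "p d x \<in> H" by (simp add: N.cmp_homogeneous[OF x])
    qed
  qed
qed

text \<open>
  Source and target may live over different localisations, as for the transition maps.
\<close>

locale graded_map =
  fixes m \<sigma> \<tau> and M N :: "('k::field, 'v) gmod" and f
  assumes M: "is_graded_module m \<sigma> M" and N: "is_graded_module m \<tau> N"
    and sub: "\<sigma> \<subseteq> \<tau>" and map: "f \<in> graded_maps m \<sigma> M N"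
begin

sublocale M: gmodule m \<sigma> M by unfold_locales (rule M)
sublocale N: gmodule m \<tau> N by unfold_locales (rule N)

lemma ext: "f \<in> extensional (carrier M)"
  using map by (auto simp: graded_maps_def linear_maps_def PiE_def)

lemma closed: "x \<in> carrier M \<Longrightarrow> f x \<in> carrier N"
  using map by (auto simp: graded_maps_def linear_maps_def)

lemma plus: "x \<in> carrier M \<Longrightarrow> y \<in> carrier M \<Longrightarrow> f (x \<oplus>\<^bsub>M\<^esub> y) = f x \<oplus>\<^bsub>N\<^esub> f y"
  using map by (auto simp: graded_maps_def linear_maps_def)

lemma smult: "Poly_Mapping.keys p \<subseteq> degrees m \<sigma> \<Longrightarrow> x \<in> carrier M \<Longrightarrow> f (p \<odot>\<^bsub>M\<^esub> x) = p \<odot>\<^bsub>N\<^esub> f x"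
  using map by (auto simp: graded_maps_def linear_maps_def loc_ring_def)

lemma act: "e \<in> degrees m \<sigma> \<Longrightarrow> x \<in> carrier M \<Longrightarrow> f (monomial e c \<odot>\<^bsub>M\<^esub> x) = monomial e c \<odot>\<^bsub>N\<^esub> f x"
  by (intro smult) (auto simp: keys_single_subset)

lemma component: "x \<in> component M d \<Longrightarrow> f x \<in> component N d"
  using map by (auto simp: graded_maps_def)

lemma zero: "f \<zero>\<^bsub>M\<^esub> = \<zero>\<^bsub>N\<^esub>"
  by (rule additive_zero[OF M.LM.abelian_group_axioms N.LM.abelian_group_axioms]) (auto simp: closed plus)

lemma cmp: "x \<in> carrier M \<Longrightarrow> N.cmp (f x) d = f (M.cmp x d)"
  using cmp_additive_map[OF M.gmodule_axioms N.gmodule_axioms, of f "\<lambda>d. d" x d]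
  by (auto simp: closed plus component)

lemma inj_reflects_component:
  assumes "inj_on f (carrier M)" "x \<in> carrier M" "f x \<in> component N d" shows "x \<in> component M d"
proof -
  have "M.cmp x d' = \<zero>\<^bsub>M\<^esub>" if "d' \<noteq> d" for d'
  proof (rule inj_onD[OF assms(1)])
    show "f (M.cmp x d') = f \<zero>\<^bsub>M\<^esub>"
      using cmp[OF assms(2), of d'] N.cmp_homogeneous[OF assms(3), of d'] that zero by simp
  qed (use assms M.cmp_closed in auto)
  then show ?thesis using assms M.component_iff by auto
qed

lemma surj_component:
  assumes "f ` carrier M = carrier N" "y \<in> component N d" shows "\<exists>x \<in> component M d. f x = y"
proof -
  have "y \<in> f ` carrier M" using assms N.component_closed by simp
  then obtain x where x: "x \<in> carrier M" "f x = y" by (elim imageE) simp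
  have "f (M.cmp x d) = y" using cmp[OF x(1), of d] N.cmp_homogeneous[OF assms(2), of d] x by simp
  then show ?thesis using M.cmp_component[OF x(1), of d] by (intro bexI)
qed

lemma eq_on_homogeneous:
  assumes "graded_map m \<sigma> \<tau> M N g" "\<And>x d. d \<in> degrees m \<sigma> \<Longrightarrow> x \<in> component M d \<Longrightarrow> f x = g x"
  shows "f = g"
proof -
  interpret g: graded_map m \<sigma> \<tau> M N g by fact
  have "f x = g x" if "x \<in> carrier M" for x
    using that
    by (induction x rule: M.homogeneous_induct) (auto simp: zero g.zero plus g.plus assms(2))
  then show ?thesis by (intro extensionalityI[OF ext g.ext])
qed

end

lemma graded_mapI:
  assumes M: "is_graded_module m \<sigma> M" and N: "is_graded_module m \<tau> N" and sub: "\<sigma> \<subseteq> \<tau>"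
    and f: "f \<in> carrier M \<rightarrow>\<^sub>E carrier N"
    and add: "\<And>x y. x \<in> carrier M \<Longrightarrow> y \<in> carrier M \<Longrightarrow> f (x \<oplus>\<^bsub>M\<^esub> y) = f x \<oplus>\<^bsub>N\<^esub> f y"
    and act: "\<And>e c x. e \<in> degrees m \<sigma> \<Longrightarrow> x \<in> carrier M \<Longrightarrow> f (monomial e c \<odot>\<^bsub>M\<^esub> x) = monomial e c \<odot>\<^bsub>N\<^esub> f x"
    and component: "\<And>d x. x \<in> component M d \<Longrightarrow> f x \<in> component N d"
  shows "graded_map m \<sigma> \<tau> M N f"
proof -
  interpret M: gmodule m \<sigma> M by unfold_locales (rule M)
  interpret N: gmodule m \<tau> N by unfold_locales (rule N)
  show ?thesis
    using linear_maps_monomialI[OF M.monoid_algebra_module_axioms N.monoid_algebra_module_axioms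
        degrees_mono[OF sub] f add act]
    by unfold_locales (use M N sub component in \<open>auto simp: graded_maps_def loc_ring_def\<close>)
qed

section \<open>Fully faithful functors and representation embeddings\<close>

locale lincat_laws =
  fixes C :: "('k::zero, 'o, 'm) lincat"
  assumes id_closed: "X \<in> Ob C \<Longrightarrow> Id C X \<in> Hom C X X"
    and comp_closed: "\<lbrakk>X \<in> Ob C; Y \<in> Ob C; Z \<in> Ob C; f \<in> Hom C X Y; g \<in> Hom C Y Z\<rbrakk> \<Longrightarrow>
      Comp C X Y Z g f \<in> Hom C X Z"
    and assoc: "\<lbrakk>X \<in> Ob C; Y \<in> Ob C; Z \<in> Ob C; W \<in> Ob C; f \<in> Hom C X Y; g \<in> Hom C Y Z; h \<in> Hom C Z W\<rbrakk> \<Longrightarrow>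
      Comp C X Y W (Comp C Y Z W h g) f = Comp C X Z W h (Comp C X Y Z g f)"
    and id_left: "\<lbrakk>X \<in> Ob C; Y \<in> Ob C; f \<in> Hom C X Y\<rbrakk> \<Longrightarrow> Comp C X Y Y (Id C Y) f = f"
    and id_right: "\<lbrakk>X \<in> Ob C; Y \<in> Ob C; f \<in> Hom C X Y\<rbrakk> \<Longrightarrow> Comp C X X Y f (Id C X) = f"
    and zero_closed: "\<lbrakk>X \<in> Ob C; Y \<in> Ob C\<rbrakk> \<Longrightarrow> Zero C X Y \<in> Hom C X Y"
    and zero_left: "\<lbrakk>X \<in> Ob C; Y \<in> Ob C; Z \<in> Ob C; f \<in> Hom C X Y\<rbrakk> \<Longrightarrow>
      Comp C X Y Z (Zero C Y Z) f = Zero C X Z"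
    and zero_right: "\<lbrakk>X \<in> Ob C; Y \<in> Ob C; Z \<in> Ob C; f \<in> Hom C Y Z\<rbrakk> \<Longrightarrow>
      Comp C X Y Z f (Zero C X Y) = Zero C X Z"
    and scale_zero: "\<lbrakk>X \<in> Ob C; Y \<in> Ob C; f \<in> Hom C X Y\<rbrakk> \<Longrightarrow> Scale C X Y 0 f = Zero C X Y"

definition faithful :: "('k, 'o1, 'm1) lincat \<Rightarrow> ('o1, 'm1, 'o2, 'm2) functor_data \<Rightarrow> bool" where
  "faithful C T \<longleftrightarrow> (\<forall>X \<in> Ob C. \<forall>Y \<in> Ob C. \<forall>f \<in> Hom C X Y. \<forall>g \<in> Hom C X Y.
     on_hom T X Y f = on_hom T X Y g \<longrightarrow> f = g)"

definition full ::
  "('k, 'o1, 'm1) lincat \<Rightarrow> ('k, 'o2, 'm2) lincat \<Rightarrow> ('o1, 'm1, 'o2, 'm2) functor_data \<Rightarrow> bool" where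
  "full C D T \<longleftrightarrow> (\<forall>X \<in> Ob C. \<forall>Y \<in> Ob C. \<forall>f \<in> Hom D (on_ob T X) (on_ob T Y).
     \<exists>g \<in> Hom C X Y. on_hom T X Y g = f)"

definition indecomposables_have_trivial_idempotents :: "('k, 'o, 'm) lincat \<Rightarrow> bool" where
  "indecomposables_have_trivial_idempotents C \<longleftrightarrow>
     (\<forall>X e. indecomposable C X \<longrightarrow> e \<in> Hom C X X \<longrightarrow> Comp C X X X e e = e \<longrightarrow> e = Id C X \<or> e = Zero C X X)"

text \<open>
  A decomposition of \<open>T X\<close> is an idempotent endomorphism, which by full faithfulness comes from one
  of \<open>X\<close>.
\<close>

lemma fully_faithful_imp_representation_embedding:
  assumes C: "lincat_laws C" and D: "lincat_laws D"
    and lin: "linear_functor C D T" and ex: "exact_functor C D T"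
    and faith: "faithful C T" and full: "full C D T"
    and idem: "indecomposables_have_trivial_idempotents C"
  shows "representation_embedding C D T"
proof -
  interpret C: lincat_laws C by fact
  interpret D: lincat_laws D by fact
  have fn: "is_functor C D T" using lin by (simp add: linear_functor_def additive_functor_def)
  have ob: "on_ob T X \<in> Ob D" if "X \<in> Ob C" for X
    using fn that by (simp add: is_functor_def)
  have hom: "on_hom T X Y f \<in> Hom D (on_ob T X) (on_ob T Y)"
    if "X \<in> Ob C" "Y \<in> Ob C" "f \<in> Hom C X Y" for X Y f
    using fn that by (simp add: is_functor_def)
  have id: "on_hom T X X (Id C X) = Id D (on_ob T X)" if "X \<in> Ob C" for X
    using fn that by (simp add: is_functor_def)
  have comp: "on_hom T X Z (Comp C X Y Z g f) =
      Comp D (on_ob T X) (on_ob T Y) (on_ob T Z) (on_hom T Y Z g) (on_hom T X Y f)"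
    if "X \<in> Ob C" "Y \<in> Ob C" "Z \<in> Ob C" "f \<in> Hom C X Y" "g \<in> Hom C Y Z" for X Y Z f g
    using fn that by (simp add: is_functor_def)
  have zero: "on_hom T X Y (Zero C X Y) = Zero D (on_ob T X) (on_ob T Y)"
    if "X \<in> Ob C" "Y \<in> Ob C" for X Y
  proof -
    have "on_hom T X Y (Scale C X Y 0 (Zero C X Y)) = Scale D (on_ob T X) (on_ob T Y) 0 (on_hom T X Y (Zero C X Y))"
      using lin that C.zero_closed[OF that] by (simp add: linear_functor_def)
    then show ?thesis
      using that by (simp add: C.scale_zero C.zero_closed D.scale_zero ob hom)
  qed
  have faithD: "f = g" if "on_hom T X Y f = on_hom T X Y g" "X \<in> Ob C" "Y \<in> Ob C" "f \<in> Hom C X Y" "g \<in> Hom C X Y" for X Y f g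
    using faith that unfolding faithful_def by blast
  have fullD: "\<exists>g \<in> Hom C X Y. on_hom T X Y g = f"
    if "X \<in> Ob C" "Y \<in> Ob C" "f \<in> Hom D (on_ob T X) (on_ob T Y)" for X Y f
    using full that unfolding full_def by blast
  have iso: "isomorphic C X Y" if XY: "X \<in> Ob C" "Y \<in> Ob C" and iso: "isomorphic D (on_ob T X) (on_ob T Y)" for X Y
  proof -
    obtain f g where f: "f \<in> Hom D (on_ob T X) (on_ob T Y)" and g: "g \<in> Hom D (on_ob T Y) (on_ob T X)"
      and gf: "Comp D (on_ob T X) (on_ob T Y) (on_ob T X) g f = Id D (on_ob T X)"
      and fg: "Comp D (on_ob T Y) (on_ob T X) (on_ob T Y) f g = Id D (on_ob T Y)"
      using iso by (auto simp: isomorphic_def iso_arrow_def)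
    obtain f' where f': "f' \<in> Hom C X Y" "on_hom T X Y f' = f" using fullD[OF XY f] by blast
    obtain g' where g': "g' \<in> Hom C Y X" "on_hom T Y X g' = g" using fullD[OF XY(2,1) g] by blast
    have "Comp C X Y X g' f' = Id C X"
      using XY f' g' gf by (intro faithD[OF _ XY(1) XY(1)]) (simp_all add: comp id C.comp_closed C.id_closed)
    moreover have "Comp C Y X Y f' g' = Id C Y"
      using XY f' g' fg by (intro faithD[OF _ XY(2) XY(2)]) (simp_all add: comp id C.comp_closed C.id_closed)
    ultimately show ?thesis using f'(1) g'(1) by (auto simp: isomorphic_def iso_arrow_def)
  qed
  have indec: "indecomposable D (on_ob T X)" if X: "indecomposable C X" for X
    unfolding indecomposable_def
  proof (intro conjI ballI impI)
    have XO: "X \<in> Ob C" and nz: "Id C X \<noteq> Zero C X X"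
      using X by (auto simp: indecomposable_def zero_object_def)
    show TX: "on_ob T X \<in> Ob D" by (rule ob[OF XO])
    show "\<not> zero_object D (on_ob T X)"
      using nz faithD[OF _ XO XO, of "Id C X" "Zero C X X"] XO
      by (auto simp: zero_object_def id zero C.id_closed C.zero_closed)
    fix Y Z assume Y: "Y \<in> Ob D" and Z: "Z \<in> Ob D" and "is_biproduct D (on_ob T X) Y Z"
    define W where "W = on_ob T X"
    have W: "W \<in> Ob D" using TX by (simp add: W_def)
    obtain i j p q where i: "i \<in> Hom D Y W" and j: "j \<in> Hom D Z W" and p: "p \<in> Hom D W Y" and q: "q \<in> Hom D W Z"
      and pi: "Comp D Y W Y p i = Id D Y" and qj: "Comp D Z W Z q j = Id D Z"
      and pj: "Comp D Z W Y p j = Zero D Z Y" and qi: "Comp D Y W Z q i = Zero D Y Z"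
      using \<open>is_biproduct D (on_ob T X) Y Z\<close> unfolding is_biproduct_def W_def by blast
    define e where "e = Comp D W Y W i p"
    have e: "e \<in> Hom D W W" unfolding e_def by (rule D.comp_closed[OF W Y W p i])
    obtain e' where e': "e' \<in> Hom C X X" "on_hom T X X e' = e"
      using fullD[OF XO XO] e unfolding W_def by blast
    have "Comp D W W W e e = Comp D W Y W i (Comp D W W Y p e)"
      unfolding e_def using D.comp_closed[OF W Y W p i] by (rule D.assoc[OF W W Y W _ p i])
    also have "Comp D W W Y p e = Comp D W Y Y (Comp D Y W Y p i) p"
      unfolding e_def by (rule D.assoc[OF W Y W Y p i p, symmetric])
    also have "\<dots> = p" using D.id_left[OF W Y p] by (simp add: pi)
    finally have ee: "Comp D W W W e e = e" by (simp add: e_def)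
    have "Comp C X X X e' e' = e'"
      using ee e' XO by (intro faithD[OF _ XO XO]) (auto simp: comp C.comp_closed W_def)
    then consider "e' = Id C X" | "e' = Zero C X X"
      using idem X e'(1) unfolding indecomposables_have_trivial_idempotents_def by blast
    then show "zero_object D Y \<or> zero_object D Z"
    proof cases
      case 1
      then have e1: "Comp D W Y W i p = Id D W" using e'(2) id[OF XO] by (simp add: e_def W_def)
      have "Id D Z = Comp D Z W Z q (Comp D Z W W (Id D W) j)"
        using D.id_left[OF Z W j] qj by simp
      also have "\<dots> = Comp D Z W Z q (Comp D Z Y W i (Comp D Z W Y p j))"
        unfolding e1[symmetric] by (simp add: D.assoc[OF Z W Y W j p i])
      also have "\<dots> = Zero D Z Z"
        by (simp add: pj D.zero_right[OF Z Y W i] D.zero_right[OF Z W Z q])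
      finally show ?thesis using Z by (simp add: zero_object_def)
    next
      case 2
      then have e0: "Comp D W Y W i p = Zero D W W" using e'(2) zero[OF XO XO] by (simp add: e_def W_def)
      have "Id D Y = Comp D Y W Y (Comp D W Y Y (Id D Y) p) i"
        using D.id_left[OF W Y p] pi by simp
      also have "\<dots> = Comp D Y W Y (Comp D W W Y p (Comp D W Y W i p)) i"
        unfolding pi[symmetric] by (simp add: D.assoc[OF W Y W Y p i p])
      also have "\<dots> = Zero D Y Y"
        by (simp add: e0 D.zero_right[OF W W Y p] D.zero_left[OF Y W Y i])
      finally show ?thesis using Y by (simp add: zero_object_def)
    qed
  qed
  show ?thesis unfolding representation_embedding_def using lin ex iso indec by blast
qed

lemma linear_functor_comp:
  assumes "linear_functor C D S" "linear_functor D E T"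
  shows "linear_functor C E (functor_comp T S)"
  using assms by (simp add: linear_functor_def additive_functor_def is_functor_def functor_comp_def)

lemma exact_functor_comp:
  assumes "exact_functor C D S" "exact_functor D E T"
  shows "exact_functor C E (functor_comp T S)"
  using assms unfolding exact_functor_def additive_functor_def is_functor_def functor_comp_def by simp

lemma faithful_comp:
  assumes "is_functor C D S" "faithful C S" "faithful D T"
  shows "faithful C (functor_comp T S)"
  unfolding faithful_def
proof (intro ballI impI)
  fix X Y f g assume XY: "X \<in> Ob C" "Y \<in> Ob C" and fg: "f \<in> Hom C X Y" "g \<in> Hom C X Y"
    and "on_hom (functor_comp T S) X Y f = on_hom (functor_comp T S) X Y g"
  then have "on_hom T (on_ob S X) (on_ob S Y) (on_hom S X Y f) = on_hom T (on_ob S X) (on_ob S Y) (on_hom S X Y g)"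
    by (simp add: functor_comp_def)
  moreover have "on_ob S X \<in> Ob D" "on_ob S Y \<in> Ob D"
    "on_hom S X Y f \<in> Hom D (on_ob S X) (on_ob S Y)" "on_hom S X Y g \<in> Hom D (on_ob S X) (on_ob S Y)"
    using assms(1) XY fg by (simp_all add: is_functor_def)
  ultimately have "on_hom S X Y f = on_hom S X Y g"
    using assms(3) unfolding faithful_def by blast
  then show "f = g" using assms(2) XY fg by (simp add: faithful_def)
qed

lemma full_comp:
  assumes S: "is_functor C D S" "full C D S" and T: "full D E T"
  shows "full C E (functor_comp T S)"
  unfolding full_def
proof (intro ballI)
  fix X Y f assume XY: "X \<in> Ob C" "Y \<in> Ob C"
    and f: "f \<in> Hom E (on_ob (functor_comp T S) X) (on_ob (functor_comp T S) Y)"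
  have "on_ob S X \<in> Ob D" "on_ob S Y \<in> Ob D" using S(1) XY by (auto simp: is_functor_def)
  then obtain g where g: "g \<in> Hom D (on_ob S X) (on_ob S Y)" "on_hom T (on_ob S X) (on_ob S Y) g = f"
    using T f by (force simp: full_def functor_comp_def)
  then obtain h where "h \<in> Hom C X Y" "on_hom S X Y h = g"
    using S(2) XY unfolding full_def by blast
  then show "\<exists>h \<in> Hom C X Y. on_hom (functor_comp T S) X Y h = f"
    using g by (auto simp: functor_comp_def)
qed

text \<open>
  If \<open>T S\<close> is naturally isomorphic to the identity, \<open>S\<close> is faithful; and an arrow between objects
  in the image of \<open>S\<close> has the same image under \<open>T\<close> as the arrow \<open>S g\<close>, where \<open>g\<close> is obtained
  from it by transport along the natural isomorphism.
\<close>

lemma retract_fully_faithful: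
  assumes C: "lincat_laws C" and S: "is_functor C D S" and T: "is_functor D C T"
    and nat: "naturally_iso_identity C (functor_comp T S)"
    and T_faithful: "\<And>X Y f g. \<lbrakk>X \<in> Ob C; Y \<in> Ob C; f \<in> Hom D (on_ob S X) (on_ob S Y);
      g \<in> Hom D (on_ob S X) (on_ob S Y);
      on_hom T (on_ob S X) (on_ob S Y) f = on_hom T (on_ob S X) (on_ob S Y) g\<rbrakk> \<Longrightarrow> f = g"
  shows "faithful C S" and "full C D S"
proof -
  interpret C: lincat_laws C by fact
  let ?T = "\<lambda>X. on_ob T (on_ob S X)" and ?H = "\<lambda>X Y. on_hom T (on_ob S X) (on_ob S Y)"
  obtain \<eta> where \<eta>: "\<And>X. X \<in> Ob C \<Longrightarrow> iso_arrow C (?T X) X (\<eta> X)"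
    and natural: "\<And>X Y f. X \<in> Ob C \<Longrightarrow> Y \<in> Ob C \<Longrightarrow> f \<in> Hom C X Y \<Longrightarrow>
      Comp C (?T X) (?T Y) Y (\<eta> Y) (?H X Y (on_hom S X Y f)) = Comp C (?T X) X Y f (\<eta> X)"
    using nat unfolding naturally_iso_identity_def functor_comp_def functor_data.simps by blast
  have So: "on_ob S X \<in> Ob D" if "X \<in> Ob C" for X using S that by (simp add: is_functor_def)
  have TSo: "?T X \<in> Ob C" if "X \<in> Ob C" for X using T So[OF that] by (simp add: is_functor_def)
  have Sh: "on_hom S X Y f \<in> Hom D (on_ob S X) (on_ob S Y)" if "X \<in> Ob C" "Y \<in> Ob C" "f \<in> Hom C X Y" for X Y f
    using S that by (simp add: is_functor_def)
  have Th: "?H X Y F \<in> Hom C (?T X) (?T Y)"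
    if "X \<in> Ob C" "Y \<in> Ob C" "F \<in> Hom D (on_ob S X) (on_ob S Y)" for X Y F
    using T So that by (simp add: is_functor_def)
  have \<eta>h: "\<eta> X \<in> Hom C (?T X) X" if "X \<in> Ob C" for X using \<eta>[OF that] by (simp add: iso_arrow_def)
  obtain \<theta> where \<theta>: "\<And>X. X \<in> Ob C \<Longrightarrow> \<theta> X \<in> Hom C X (?T X)"
    and \<theta>\<eta>: "\<And>X. X \<in> Ob C \<Longrightarrow> Comp C (?T X) X (?T X) (\<theta> X) (\<eta> X) = Id C (?T X)"
    and \<eta>\<theta>: "\<And>X. X \<in> Ob C \<Longrightarrow> Comp C X (?T X) X (\<eta> X) (\<theta> X) = Id C X"
    using \<eta> unfolding iso_arrow_def by metis
  show "faithful C S"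
    unfolding faithful_def
  proof (intro ballI impI)
    fix X Y f g assume XY: "X \<in> Ob C" "Y \<in> Ob C" and fg: "f \<in> Hom C X Y" "g \<in> Hom C X Y"
      and eq: "on_hom S X Y f = on_hom S X Y g"
    have *: "h = Comp C X (?T X) Y (Comp C (?T X) (?T Y) Y (\<eta> Y) (?H X Y (on_hom S X Y h))) (\<theta> X)"
      if h: "h \<in> Hom C X Y" for h
      unfolding natural[OF XY h]
      using C.assoc[OF XY(1) TSo[OF XY(1)] XY \<theta>[OF XY(1)] \<eta>h[OF XY(1)] h] C.id_right[OF XY h]
      by (simp add: \<eta>\<theta>[OF XY(1)])
    show "f = g" using *[OF fg(1)] *[OF fg(2)] eq by metis
  qed
  show "full C D S"
    unfolding full_def
  proof (intro ballI)
    fix X Y F assume X: "X \<in> Ob C" and Y: "Y \<in> Ob C" and F: "F \<in> Hom D (on_ob S X) (on_ob S Y)"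
    have TX: "?T X \<in> Ob C" and TY: "?T Y \<in> Ob C" using TSo X Y by auto
    let ?G = "?H X Y F"
    have G: "?G \<in> Hom C (?T X) (?T Y)" by (rule Th[OF X Y F])
    let ?\<eta>G = "Comp C (?T X) (?T Y) Y (\<eta> Y) ?G"
    have \<eta>G: "?\<eta>G \<in> Hom C (?T X) Y" by (rule C.comp_closed[OF TX TY Y G \<eta>h[OF Y]])
    define g where "g = Comp C X (?T X) Y ?\<eta>G (\<theta> X)"
    have g: "g \<in> Hom C X Y" unfolding g_def by (rule C.comp_closed[OF X TX Y \<theta>[OF X] \<eta>G])
    let ?G' = "?H X Y (on_hom S X Y g)"
    have G': "?G' \<in> Hom C (?T X) (?T Y)" by (rule Th[OF X Y Sh[OF X Y g]])
    have "Comp C (?T X) (?T Y) Y (\<eta> Y) ?G' = Comp C (?T X) X Y g (\<eta> X)"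
      by (rule natural[OF X Y g])
    also have "\<dots> = ?\<eta>G"
      unfolding g_def
      using C.assoc[OF TX X TX Y \<eta>h[OF X] \<theta>[OF X] \<eta>G] C.id_right[OF TX Y \<eta>G] by (simp add: \<theta>\<eta>[OF X])
    finally have eq: "Comp C (?T X) (?T Y) Y (\<eta> Y) ?G' = ?\<eta>G" .
    have cancel: "H = Comp C (?T X) Y (?T Y) (\<theta> Y) (Comp C (?T X) (?T Y) Y (\<eta> Y) H)"
      if "H \<in> Hom C (?T X) (?T Y)" for H
      using C.assoc[OF TX TY Y TY that \<eta>h[OF Y] \<theta>[OF Y]] C.id_left[OF TX TY that] by (simp add: \<theta>\<eta>[OF Y])
    have "?G' = ?G" using cancel[OF G] cancel[OF G'] eq by metis
    then have "on_hom S X Y g = F" by (intro T_faithful[OF X Y Sh[OF X Y g] F])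
    then show "\<exists>g \<in> Hom C X Y. on_hom S X Y g = F" using g by blast
  qed
qed

lemma module_category_simps [simp]:
  "Ob (module_category Obs Homs) = Obs"
  "Hom (module_category Obs Homs) = Homs"
  "Id (module_category Obs Homs) M = (\<lambda>x \<in> carrier M. x)"
  "Comp (module_category Obs Homs) L M N g f = compose (carrier L) g f"
  "Zero (module_category Obs Homs) M N = (\<lambda>x \<in> carrier M. \<zero>\<^bsub>N\<^esub>)"
  "Add (module_category Obs Homs) M N f g = (\<lambda>x \<in> carrier M. f x \<oplus>\<^bsub>N\<^esub> g x)"
  "Scale (module_category Obs Homs) M N c f = (\<lambda>x \<in> carrier M. monomial 0 c \<odot>\<^bsub>N\<^esub> f x)"
  "Ses (module_category Obs Homs) L M N f g \<longleftrightarrow> inj_on f (carrier L) \<and>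
     f ` carrier L = {x \<in> carrier M. g x = \<zero>\<^bsub>N\<^esub>} \<and> g ` carrier M = carrier N"
  by (simp_all add: module_category_def)

lemma lincat_laws_module_category:
  assumes mod: "\<And>M. M \<in> Obs \<Longrightarrow> monoid_algebra_module S M"
    and lin: "\<And>M N f. M \<in> Obs \<Longrightarrow> N \<in> Obs \<Longrightarrow> f \<in> Homs M N \<Longrightarrow> f \<in> linear_maps (monoid_algebra S) M N"
    and id: "\<And>M. M \<in> Obs \<Longrightarrow> (\<lambda>x \<in> carrier M. x) \<in> Homs M M"
    and comp: "\<And>L M N f g. L \<in> Obs \<Longrightarrow> M \<in> Obs \<Longrightarrow> N \<in> Obs \<Longrightarrow> f \<in> Homs L M \<Longrightarrow> g \<in> Homs M N \<Longrightarrow>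
      compose (carrier L) g f \<in> Homs L N"
    and zero: "\<And>M N. M \<in> Obs \<Longrightarrow> N \<in> Obs \<Longrightarrow> (\<lambda>x \<in> carrier M. \<zero>\<^bsub>N\<^esub>) \<in> Homs M N"
  shows "lincat_laws (module_category Obs Homs)"
proof -
  have fn: "f \<in> carrier M \<rightarrow>\<^sub>E carrier N" if "M \<in> Obs" "N \<in> Obs" "f \<in> Homs M N" for M N f
    using lin[OF that] by (simp add: linear_maps_def)
  have f0: "f \<zero>\<^bsub>M\<^esub> = \<zero>\<^bsub>N\<^esub>" if "M \<in> Obs" "N \<in> Obs" "f \<in> Homs M N" for M N f
  proof -
    interpret M: monoid_algebra_module S M by (rule mod) fact
    interpret N: monoid_algebra_module S N by (rule mod) fact
    show ?thesis using lin[OF that] fn[OF that]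
      by (intro additive_zero M.LM.abelian_group_axioms N.LM.abelian_group_axioms) (auto simp: linear_maps_def)
  qed
  show ?thesis
  proof (unfold_locales, unfold module_category_simps)
    fix X Y f assume *: "X \<in> Obs" "Y \<in> Obs" "f \<in> Homs X Y"
    interpret Y: monoid_algebra_module S Y by (rule mod) fact
    show "compose (carrier X) (\<lambda>x\<in>carrier Y. x) f = f" and "compose (carrier X) f (\<lambda>x\<in>carrier X. x) = f"
      using fn[OF *] by (fastforce simp: compose_def PiE_def extensional_def Pi_iff restrict_def)+
    show "(\<lambda>x\<in>carrier X. monomial 0 0 \<odot>\<^bsub>Y\<^esub> f x) = (\<lambda>x\<in>carrier X. \<zero>\<^bsub>Y\<^esub>)"
      using fn[OF *] by (intro restrict_ext) (auto intro!: Y.smult_zero_left)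
  next
    fix X Y Z f assume *: "X \<in> Obs" "Y \<in> Obs" "Z \<in> Obs" "f \<in> Homs X Y"
    show "compose (carrier X) (\<lambda>x\<in>carrier Y. \<zero>\<^bsub>Z\<^esub>) f = (\<lambda>x\<in>carrier X. \<zero>\<^bsub>Z\<^esub>)"
      using fn[OF *(1,2,4)] unfolding compose_def by (intro restrict_ext) auto
  next
    fix X Y Z f assume *: "X \<in> Obs" "Y \<in> Obs" "Z \<in> Obs" "f \<in> Homs Y Z"
    show "compose (carrier X) f (\<lambda>x\<in>carrier X. \<zero>\<^bsub>Y\<^esub>) = (\<lambda>x\<in>carrier X. \<zero>\<^bsub>Z\<^esub>)"
      using f0[OF *(2-4)] unfolding compose_def by (intro restrict_ext) auto
  next
    fix X Y Z W f g h assume *: "X \<in> Obs" "Y \<in> Obs" "Z \<in> Obs" "W \<in> Obs" "f \<in> Homs X Y"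
    show "compose (carrier X) (compose (carrier Y) h g) f = compose (carrier X) h (compose (carrier X) g f)"
      using fn[OF *(1,2,5)] unfolding compose_def by (intro restrict_ext) auto
  qed (use id comp zero in auto)
qed

lemma graded_maps_iff: "M \<in> fg_graded_modules m \<sigma> \<Longrightarrow> N \<in> fg_graded_modules m \<sigma> \<Longrightarrow>
    f \<in> graded_maps m \<sigma> M N \<longleftrightarrow> graded_map m \<sigma> \<sigma> M N f"
  by (auto simp: graded_map_def fg_graded_modules_def)

lemma graded_map_compose:
  assumes "graded_map m \<sigma> \<tau> L M f" "graded_map m \<tau> \<upsilon> M N g"
  shows "graded_map m \<sigma> \<upsilon> L N (compose (carrier L) g f)"
proof -
  interpret f: graded_map m \<sigma> \<tau> L M f by fact
  interpret g: graded_map m \<tau> \<upsilon> M N g by fact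
  have sub: "\<sigma> \<subseteq> \<upsilon>" using f.sub g.sub by auto
  show ?thesis
    by (rule graded_mapI[OF f.M g.N sub])
      (use degrees_mono[OF f.sub, of m] in \<open>auto simp: compose_def f.closed f.plus f.act g.closed g.plus g.act f.M.act_closed
         f.component g.component f.M.component_closed\<close>)
qed

lemma graded_map_id:
  assumes "is_graded_module m \<sigma> M"
  shows "graded_map m \<sigma> \<sigma> M M (\<lambda>x \<in> carrier M. x)"
proof -
  interpret M: gmodule m \<sigma> M by unfold_locales fact
  show ?thesis using assms by (intro graded_mapI) (auto simp: M.act_closed M.component_closed)
qed

lemma graded_map_zero:
  assumes "is_graded_module m \<sigma> M" "is_graded_module m \<sigma> N"
  shows "graded_map m \<sigma> \<sigma> M N (\<lambda>x \<in> carrier M. \<zero>\<^bsub>N\<^esub>)"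
proof -
  interpret M: gmodule m \<sigma> M by unfold_locales fact
  interpret N: gmodule m \<sigma> N by unfold_locales fact
  show ?thesis using assms
    by (intro graded_mapI) (auto simp: M.act_closed M.component_closed N.zero_component N.act_zero)
qed

lemma lincat_laws_graded_mod: "lincat_laws (graded_mod m \<sigma> :: ('k::field, ('k, 'v) gmod, 'v \<Rightarrow> 'v) lincat)"
  unfolding graded_mod_def
proof (rule lincat_laws_module_category[where S = "degrees m \<sigma>"])
  fix M :: "('k, 'v) gmod" assume M: "M \<in> fg_graded_modules m \<sigma>"
  then have M': "is_graded_module m \<sigma> M" by (simp add: fg_graded_modules_def)
  interpret M: gmodule m \<sigma> M by unfold_locales (rule M')
  show "monoid_algebra_module (degrees m \<sigma>) M" by unfold_locales
  show "(\<lambda>x\<in>carrier M. x) \<in> graded_maps m \<sigma> M M"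
    using graded_map_id[OF M'] graded_maps_iff[OF M M] by simp
  fix N :: "('k, 'v) gmod" assume N: "N \<in> fg_graded_modules m \<sigma>"
  then have N': "is_graded_module m \<sigma> N" by (simp add: fg_graded_modules_def)
  show "(\<lambda>x\<in>carrier M. \<zero>\<^bsub>N\<^esub>) \<in> graded_maps m \<sigma> M N"
    using graded_map_zero[OF M' N'] graded_maps_iff[OF M N] by simp
  show "f \<in> graded_maps m \<sigma> M N \<Longrightarrow> f \<in> linear_maps (monoid_algebra (degrees m \<sigma>)) M N" for f
    by (simp add: graded_maps_def loc_ring_def)
  show "f \<in> graded_maps m \<sigma> M N \<Longrightarrow> g \<in> graded_maps m \<sigma> N L \<Longrightarrow> L \<in> fg_graded_modules m \<sigma> \<Longrightarrow>
     compose (carrier M) g f \<in> graded_maps m \<sigma> M L" for f g and L :: "('k, 'v) gmod"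
    using graded_map_compose[of m \<sigma> \<sigma> M N f \<sigma> L g] M N by (simp add: graded_maps_iff)
qed

lemma L_cat_simps [simp]:
  "Ob (L_cat m K) = L_objects m K"
  "Hom (L_cat m K) = L_maps m K"
  "Id (L_cat m K) M = (\<lambda>\<sigma> \<in> missing_faces m K. \<lambda>x \<in> carrier (part M \<sigma>). x)"
  "Comp (L_cat m K) L M N g f = (\<lambda>\<sigma> \<in> missing_faces m K. compose (carrier (part L \<sigma>)) (g \<sigma>) (f \<sigma>))"
  "Zero (L_cat m K) M N = (\<lambda>\<sigma> \<in> missing_faces m K. \<lambda>x \<in> carrier (part M \<sigma>). \<zero>\<^bsub>part N \<sigma>\<^esub>)"
  "Add (L_cat m K) M N f g = (\<lambda>\<sigma> \<in> missing_faces m K. \<lambda>x \<in> carrier (part M \<sigma>). f \<sigma> x \<oplus>\<^bsub>part N \<sigma>\<^esub> g \<sigma> x)"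
  "Scale (L_cat m K) M N c f = (\<lambda>\<sigma> \<in> missing_faces m K. \<lambda>x \<in> carrier (part M \<sigma>). monomial 0 c \<odot>\<^bsub>part N \<sigma>\<^esub> f \<sigma> x)"
  "Ses (L_cat m K) L M N f g \<longleftrightarrow> (\<forall>\<sigma> \<in> missing_faces m K.
     Ses (graded_mod m \<sigma>) (part L \<sigma>) (part M \<sigma>) (part N \<sigma>) (f \<sigma>) (g \<sigma>))"
  by (simp_all add: L_cat_def graded_mod_def)

lemma L_maps_graded: "f \<in> L_maps m K M N \<Longrightarrow> \<sigma> \<in> missing_faces m K \<Longrightarrow> f \<sigma> \<in> graded_maps m \<sigma> (part M \<sigma>) (part N \<sigma>)"
  by (auto simp: L_maps_def)

lemma L_objects_graded: "M \<in> L_objects m K \<Longrightarrow> \<sigma> \<in> missing_faces m K \<Longrightarrow> part M \<sigma> \<in> fg_graded_modules m \<sigma>"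
  by (auto simp: L_objects_def)

lemma L_mapsI:
  assumes "f \<in> extensional (missing_faces m K)"
    and "\<And>\<sigma>. \<sigma> \<in> missing_faces m K \<Longrightarrow> f \<sigma> \<in> graded_maps m \<sigma> (part M \<sigma>) (part N \<sigma>)"
    and "\<And>\<sigma> \<tau> x. \<sigma> \<in> missing_faces m K \<Longrightarrow> \<tau> \<in> missing_faces m K \<Longrightarrow> \<sigma> \<subseteq> \<tau> \<Longrightarrow>
      x \<in> carrier (part M \<sigma>) \<Longrightarrow> f \<tau> (transition M \<sigma> \<tau> x) = transition N \<sigma> \<tau> (f \<sigma> x)"
  shows "f \<in> L_maps m K M N"
  using assms by (auto simp: L_maps_def PiE_def)

lemma L_objects_transition:
  assumes "M \<in> L_objects m K" "\<sigma> \<in> missing_faces m K" "\<tau> \<in> missing_faces m K" "\<sigma> \<subseteq> \<tau>"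
  shows "graded_map m \<sigma> \<tau> (part M \<sigma>) (part M \<tau>) (transition M \<sigma> \<tau>)"
  using assms by (auto simp: L_objects_def fg_graded_modules_def graded_map_def)

lemma lincat_laws_L_cat: "lincat_laws (L_cat m K :: ('k::field, ('k, 'v) L_object, nat set \<Rightarrow> 'v \<Rightarrow> 'v) lincat)"
proof -
  let ?F = "missing_faces m K"
  have G: "lincat_laws (graded_mod m \<sigma> :: ('k, ('k, 'v) gmod, 'v \<Rightarrow> 'v) lincat)" for \<sigma>
    by (rule lincat_laws_graded_mod)
  note g = lincat_laws.id_closed[OF G] lincat_laws.comp_closed[OF G] lincat_laws.assoc[OF G]
    lincat_laws.id_left[OF G] lincat_laws.id_right[OF G] lincat_laws.zero_closed[OF G]
    lincat_laws.zero_left[OF G] lincat_laws.zero_right[OF G] lincat_laws.scale_zero[OF G]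
  note g' = g[unfolded graded_mod_def module_category_simps]
  have ext: "f = g" if "f \<in> extensional ?F" "g \<in> extensional ?F" "\<And>\<sigma>. \<sigma> \<in> ?F \<Longrightarrow> f \<sigma> = g \<sigma>"
    for f g :: "nat set \<Rightarrow> 'v \<Rightarrow> 'v" using that by (rule extensionalityI)
  have Lext: "f \<in> extensional ?F" if "f \<in> L_maps m K M N" for f and M N :: "('k, 'v) L_object"
    using that by (auto simp: L_maps_def PiE_def)
  have Lc: "f \<sigma> x \<in> carrier (part N \<sigma>)" if "f \<in> L_maps m K M N" "\<sigma> \<in> ?F" "x \<in> carrier (part M \<sigma>)"
    for f \<sigma> x and M N :: "('k, 'v) L_object"
    using L_maps_graded[OF that(1,2)] that(3) by (auto simp: graded_maps_def linear_maps_def)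
  have Tc: "transition M \<sigma> \<tau> x \<in> carrier (part M \<tau>)"
    if "M \<in> L_objects m K" "\<sigma> \<in> ?F" "\<tau> \<in> ?F" "\<sigma> \<subseteq> \<tau>" "x \<in> carrier (part M \<sigma>)" for M :: "('k, 'v) L_object" and \<sigma> \<tau> x
    using graded_map.closed[OF L_objects_transition[OF that(1-4)] that(5)] .
  have Tz: "transition M \<sigma> \<tau> \<zero>\<^bsub>part M \<sigma>\<^esub> = \<zero>\<^bsub>part M \<tau>\<^esub>"
    if "M \<in> L_objects m K" "\<sigma> \<in> ?F" "\<tau> \<in> ?F" "\<sigma> \<subseteq> \<tau>" for M :: "('k, 'v) L_object" and \<sigma> \<tau>
    using graded_map.zero[OF L_objects_transition[OF that(1-4)]] .
  show ?thesis
  proof (unfold_locales, unfold L_cat_simps)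
    fix X :: "('k, 'v) L_object" assume X: "X \<in> L_objects m K"
    show "(\<lambda>\<sigma>\<in>?F. \<lambda>x\<in>carrier (part X \<sigma>). x) \<in> L_maps m K X X"
      by (rule L_mapsI) (use X in \<open>auto simp: g'(1) L_objects_graded Tc\<close>)
    fix Y :: "('k, 'v) L_object" assume Y: "Y \<in> L_objects m K"
    show "(\<lambda>\<sigma>\<in>?F. \<lambda>x\<in>carrier (part X \<sigma>). \<zero>\<^bsub>part Y \<sigma>\<^esub>) \<in> L_maps m K X Y"
      by (rule L_mapsI) (use X Y in \<open>auto simp: g'(6) L_objects_graded Tc Tz\<close>)
  next
    fix X Y Z :: "('k, 'v) L_object" and f g
    assume X: "X \<in> L_objects m K" "Y \<in> L_objects m K" "Z \<in> L_objects m K" "f \<in> L_maps m K X Y" "g \<in> L_maps m K Y Z"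
    show "(\<lambda>\<sigma>\<in>?F. compose (carrier (part X \<sigma>)) (g \<sigma>) (f \<sigma>)) \<in> L_maps m K X Z"
    proof (rule L_mapsI)
      show "(\<lambda>\<sigma>\<in>?F. compose (carrier (part X \<sigma>)) (g \<sigma>) (f \<sigma>)) \<sigma> \<in> graded_maps m \<sigma> (part X \<sigma>) (part Z \<sigma>)"
        if "\<sigma> \<in> ?F" for \<sigma>
        using that g'(2)[of "part X \<sigma>" \<sigma> "part Y \<sigma>" "part Z \<sigma>" "f \<sigma>" "g \<sigma>"] X by (simp add: L_objects_graded L_maps_graded)
      show "(\<lambda>\<sigma>\<in>?F. compose (carrier (part X \<sigma>)) (g \<sigma>) (f \<sigma>)) \<tau> (transition X \<sigma> \<tau> x) =
         transition Z \<sigma> \<tau> ((\<lambda>\<sigma>\<in>?F. compose (carrier (part X \<sigma>)) (g \<sigma>) (f \<sigma>)) \<sigma> x)"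
        if "\<sigma> \<in> ?F" "\<tau> \<in> ?F" "\<sigma> \<subseteq> \<tau>" "x \<in> carrier (part X \<sigma>)" for \<sigma> \<tau> x
        using that X Lc[OF X(4)] Tc[OF X(1) that] by (simp add: compose_eq) (simp add: L_maps_def)
    qed auto
  next
    fix X Y Z W :: "('k, 'v) L_object" and f g h
    assume X: "X \<in> L_objects m K" "Y \<in> L_objects m K" "Z \<in> L_objects m K" "W \<in> L_objects m K"
      "f \<in> L_maps m K X Y" "g \<in> L_maps m K Y Z" "h \<in> L_maps m K Z W"
    show "(\<lambda>\<sigma>\<in>?F. compose (carrier (part X \<sigma>)) ((\<lambda>\<sigma>\<in>?F. compose (carrier (part Y \<sigma>)) (h \<sigma>) (g \<sigma>)) \<sigma>) (f \<sigma>)) =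
       (\<lambda>\<sigma>\<in>?F. compose (carrier (part X \<sigma>)) (h \<sigma>) ((\<lambda>\<sigma>\<in>?F. compose (carrier (part X \<sigma>)) (g \<sigma>) (f \<sigma>)) \<sigma>))"
    proof (rule restrict_ext)
      fix \<sigma> assume s: "\<sigma> \<in> ?F"
      show "compose (carrier (part X \<sigma>)) ((\<lambda>\<sigma>\<in>?F. compose (carrier (part Y \<sigma>)) (h \<sigma>) (g \<sigma>)) \<sigma>) (f \<sigma>) =
         compose (carrier (part X \<sigma>)) (h \<sigma>) ((\<lambda>\<sigma>\<in>?F. compose (carrier (part X \<sigma>)) (g \<sigma>) (f \<sigma>)) \<sigma>)"
        using g'(3)[OF X(1-4)[THEN L_objects_graded, OF s] X(5-7)[THEN L_maps_graded, OF s]] s by simp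
    qed
  next
    fix X Y :: "('k, 'v) L_object" and f assume X: "X \<in> L_objects m K" "Y \<in> L_objects m K" "f \<in> L_maps m K X Y"
    show "(\<lambda>\<sigma>\<in>?F. compose (carrier (part X \<sigma>)) ((\<lambda>\<sigma>\<in>?F. \<lambda>x\<in>carrier (part Y \<sigma>). x) \<sigma>) (f \<sigma>)) = f"
      using X by (intro ext Lext[OF X(3)]) (auto intro!: g'(4) L_objects_graded L_maps_graded)
    show "(\<lambda>\<sigma>\<in>?F. compose (carrier (part X \<sigma>)) (f \<sigma>) ((\<lambda>\<sigma>\<in>?F. \<lambda>x\<in>carrier (part X \<sigma>). x) \<sigma>)) = f"
      using X by (intro ext Lext[OF X(3)]) (auto intro!: g'(5)[where Y = "part Y _"] L_objects_graded L_maps_graded)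
    show "(\<lambda>\<sigma>\<in>?F. \<lambda>x\<in>carrier (part X \<sigma>). monomial 0 0 \<odot>\<^bsub>part Y \<sigma>\<^esub> f \<sigma> x) = (\<lambda>\<sigma>\<in>?F. \<lambda>x\<in>carrier (part X \<sigma>). \<zero>\<^bsub>part Y \<sigma>\<^esub>)"
      using X by (rule_tac restrict_ext) (rule g'(9)[OF L_objects_graded L_objects_graded L_maps_graded])
  next
    fix X Y Z :: "('k, 'v) L_object" and f
    assume X: "X \<in> L_objects m K" "Y \<in> L_objects m K" "Z \<in> L_objects m K" "f \<in> L_maps m K X Y"
    show "(\<lambda>\<sigma>\<in>?F. compose (carrier (part X \<sigma>)) ((\<lambda>\<sigma>\<in>?F. \<lambda>x\<in>carrier (part Y \<sigma>). \<zero>\<^bsub>part Z \<sigma>\<^esub>) \<sigma>) (f \<sigma>)) =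
       (\<lambda>\<sigma>\<in>?F. \<lambda>x\<in>carrier (part X \<sigma>). \<zero>\<^bsub>part Z \<sigma>\<^esub>)"
      using X by (intro restrict_ext) (simp add: g'(7)[OF X(1-3)[THEN L_objects_graded] L_maps_graded[OF X(4)]])
  next
    fix X Y Z :: "('k, 'v) L_object" and f
    assume X: "X \<in> L_objects m K" "Y \<in> L_objects m K" "Z \<in> L_objects m K" "f \<in> L_maps m K Y Z"
    show "(\<lambda>\<sigma>\<in>?F. compose (carrier (part X \<sigma>)) (f \<sigma>) ((\<lambda>\<sigma>\<in>?F. \<lambda>x\<in>carrier (part X \<sigma>). \<zero>\<^bsub>part Y \<sigma>\<^esub>) \<sigma>)) =
       (\<lambda>\<sigma>\<in>?F. \<lambda>x\<in>carrier (part X \<sigma>). \<zero>\<^bsub>part Z \<sigma>\<^esub>)"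
      using X by (intro restrict_ext) (simp add: g'(8)[OF X(1-3)[THEN L_objects_graded] L_maps_graded[OF X(4)]])
  qed
qed

section \<open>Graded modules assembled from their homogeneous pieces\<close>

text \<open>
  A system is a functor to vector spaces from the category whose objects are the degrees and whose
  arrows are the monomials. The pieces live in one common type and share their zero, but they need not
  be independent in it: the direct sum is only formed by \<open>Tot\<close> below.
\<close>

record ('k, 'y) gsys =
  piece :: "multidegree \<Rightarrow> 'y set"
  null :: 'y
  padd :: "'y \<Rightarrow> 'y \<Rightarrow> 'y"
  pact :: "multidegree \<Rightarrow> 'k \<Rightarrow> 'y \<Rightarrow> 'y"

definition families :: "('k, 'y) gsys \<Rightarrow> (multidegree \<Rightarrow> 'y) set" where
  "families Y = {u. (\<forall>d. u d \<in> piece Y d) \<and> finite {d. u d \<noteq> null Y}}"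

text \<open>
  Carriers have to be subsets of a given type \<open>'v\<close>, so families of elements of the pieces are encoded
  by an arbitrary injection into it.
\<close>

definition encode :: "('k, 'y) gsys \<Rightarrow> (multidegree \<Rightarrow> 'y) \<Rightarrow> 'v" where
  "encode Y = (SOME q. inj_on q (families Y))"

definition coord :: "('k, 'y) gsys \<Rightarrow> 'v \<Rightarrow> multidegree \<Rightarrow> 'y" where
  "coord Y = inv_into (families Y) (encode Y)"

definition place :: "('k, 'y) gsys \<Rightarrow> multidegree \<Rightarrow> 'y \<Rightarrow> 'v" where
  "place Y d x = encode Y (\<lambda>d'. if d' = d then x else null Y)"

text \<open>
  The direct sum without its scalar multiplication, which is a finite sum formed in this group.
\<close>

definition Tot_group :: "('k::field, 'y) gsys \<Rightarrow> ('k, 'v) gmod" where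
  "Tot_group Y =
     \<lparr>carrier = encode Y ` families Y, monoid.mult = undefined, one = undefined,
      ring.zero = encode Y (\<lambda>d. null Y),
      ring.add = (\<lambda>z w. encode Y (\<lambda>d. padd Y (coord Y z d) (coord Y w d))),
      module.smult = undefined,
      component = (\<lambda>d. encode Y ` {u \<in> families Y. \<forall>d'. d' \<noteq> d \<longrightarrow> u d' = null Y})\<rparr>"

definition tact :: "('k::field, 'y) gsys \<Rightarrow> multidegree \<Rightarrow> 'k \<Rightarrow> 'v \<Rightarrow> 'v" where
  "tact Y e c z = encode Y (\<lambda>d. pact Y e c (coord Y z (d - e)))"

definition Tot :: "('k::field, 'y) gsys \<Rightarrow> ('k, 'v) gmod" where
  "Tot Y = (Tot_group Y) \<lparr>smult := (\<lambda>p z. \<Oplus>\<^bsub>Tot_group Y\<^esub> e \<in> Poly_Mapping.keys p.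
     tact Y e (Poly_Mapping.lookup p e) z)\<rparr>"

lemma Tot_simps:
  "carrier (Tot Y) = encode Y ` families Y"
  "\<zero>\<^bsub>Tot Y\<^esub> = encode Y (\<lambda>d. null Y)"
  "z \<oplus>\<^bsub>Tot Y\<^esub> w = encode Y (\<lambda>d. padd Y (coord Y z d) (coord Y w d))"
  "p \<odot>\<^bsub>Tot Y\<^esub> z = (\<Oplus>\<^bsub>Tot Y\<^esub> e \<in> Poly_Mapping.keys p. tact Y e (Poly_Mapping.lookup p e) z)"
  "component (Tot Y) d = encode Y ` {u \<in> families Y. \<forall>d'. d' \<noteq> d \<longrightarrow> u d' = null Y}"
  by (simp_all add: Tot_def Tot_group_def finsum_def)

definition encodable :: "'v itself \<Rightarrow> ('k, 'y) gsys \<Rightarrow> bool" where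
  "encodable _ Y \<longleftrightarrow> (\<exists>q :: (multidegree \<Rightarrow> 'y) \<Rightarrow> 'v. inj_on q (families Y))"

locale gsystem =
  fixes m \<sigma> and Y :: "('k::field, 'y) gsys" and universe :: "'v itself"
  assumes null_piece: "null Y \<in> piece Y d"
    and padd_closed: "x \<in> piece Y d \<Longrightarrow> y \<in> piece Y d \<Longrightarrow> padd Y x y \<in> piece Y d"
    and padd_assoc: "x \<in> piece Y d \<Longrightarrow> y \<in> piece Y d \<Longrightarrow> z \<in> piece Y d \<Longrightarrow>
      padd Y (padd Y x y) z = padd Y x (padd Y y z)"
    and padd_comm: "x \<in> piece Y d \<Longrightarrow> y \<in> piece Y d \<Longrightarrow> padd Y x y = padd Y y x"
    and padd_null: "x \<in> piece Y d \<Longrightarrow> padd Y (null Y) x = x"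
    and padd_inverse: "x \<in> piece Y d \<Longrightarrow> \<exists>y \<in> piece Y d. padd Y y x = null Y"
    and piece_outside: "d \<notin> degrees m \<sigma> \<Longrightarrow> piece Y d = {null Y}"
    and pact_closed: "e \<in> degrees m \<sigma> \<Longrightarrow> x \<in> piece Y d \<Longrightarrow> pact Y e c x \<in> piece Y (d + e)"
    and pact_padd: "e \<in> degrees m \<sigma> \<Longrightarrow> x \<in> piece Y d \<Longrightarrow> y \<in> piece Y d \<Longrightarrow>
      pact Y e c (padd Y x y) = padd Y (pact Y e c x) (pact Y e c y)"
    and pact_coeff: "e \<in> degrees m \<sigma> \<Longrightarrow> x \<in> piece Y d \<Longrightarrow>
      pact Y e (c + c') x = padd Y (pact Y e c x) (pact Y e c' x)"
    and pact_pact: "e \<in> degrees m \<sigma> \<Longrightarrow> e' \<in> degrees m \<sigma> \<Longrightarrow> x \<in> piece Y d \<Longrightarrow>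
      pact Y e c (pact Y e' c' x) = pact Y (e + e') (c * c') x"
    and pact_one: "x \<in> piece Y d \<Longrightarrow> pact Y 0 1 x = x"
    and encodable: "encodable universe Y"
begin

abbreviation T :: "('k, 'v) gmod" where "T \<equiv> Tot Y"

lemma padd_null_right: "x \<in> piece Y d \<Longrightarrow> padd Y x (null Y) = x"
  using padd_comm[OF _ null_piece, of x d] padd_null[of x d] by simp

lemma padd_idem: "x \<in> piece Y d \<Longrightarrow> padd Y x x = x \<Longrightarrow> x = null Y"
  using padd_inverse[of x d] padd_assoc[of _ d x x] padd_null by metis

lemma pact_null: "e \<in> degrees m \<sigma> \<Longrightarrow> pact Y e c (null Y) = null Y"
proof -
  assume e: "e \<in> degrees m \<sigma>"
  show ?thesis
    using pact_padd[OF e null_piece null_piece, of c] padd_null[OF null_piece]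
    by (intro padd_idem[OF pact_closed[OF e null_piece[of 0]]]) simp
qed

lemma inj_encode: "inj_on (encode Y :: _ \<Rightarrow> 'v) (families Y)"
  using someI_ex[OF encodable[unfolded encodable_def]] by (simp add: encode_def)

lemma coord_encode: "u \<in> families Y \<Longrightarrow> coord Y (encode Y u :: 'v) = u"
  unfolding coord_def using inj_encode by (rule inv_into_f_f)

lemma coord_families: "z \<in> carrier T \<Longrightarrow> coord Y z \<in> families Y"
  by (auto simp: Tot_simps coord_encode)

lemma encode_coord: "z \<in> carrier T \<Longrightarrow> encode Y (coord Y z) = z"
  by (auto simp: Tot_simps coord_encode)

lemma encode_closed: "u \<in> families Y \<Longrightarrow> encode Y u \<in> carrier T"
  by (auto simp: Tot_simps)

lemma coord_piece: "z \<in> carrier T \<Longrightarrow> coord Y z d \<in> piece Y d"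
  and finite_coord: "z \<in> carrier T \<Longrightarrow> finite {d. coord Y z d \<noteq> null Y}"
  using coord_families by (auto simp: families_def)

lemma Tot_eqI: "z \<in> carrier T \<Longrightarrow> w \<in> carrier T \<Longrightarrow> (\<And>d. coord Y z d = coord Y w d) \<Longrightarrow> z = w"
  using encode_coord[of z] encode_coord[of w] by (metis ext)

lemma null_family: "(\<lambda>d. null Y) \<in> families Y"
  by (simp add: families_def null_piece)

lemma padd_family:
  assumes "u \<in> families Y" "v \<in> families Y" shows "(\<lambda>d. padd Y (u d) (v d)) \<in> families Y"
proof -
  have "{d. padd Y (u d) (v d) \<noteq> null Y} \<subseteq> {d. u d \<noteq> null Y} \<union> {d. v d \<noteq> null Y}"
    using padd_null[OF null_piece] by auto
  then show ?thesis using assms by (auto simp: families_def padd_closed elim!: finite_subset)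
qed

lemma pact_family:
  assumes "e \<in> degrees m \<sigma>" "u \<in> families Y" shows "(\<lambda>d. pact Y e c (u (d - e))) \<in> families Y"
proof -
  have "{d. pact Y e c (u (d - e)) \<noteq> null Y} \<subseteq> (\<lambda>d. d + e) ` {d. u d \<noteq> null Y}"
  proof
    fix d assume "d \<in> {d. pact Y e c (u (d - e)) \<noteq> null Y}"
    then have "u (d - e) \<noteq> null Y" using pact_null[OF assms(1)] by auto
    then show "d \<in> (\<lambda>d. d + e) ` {d. u d \<noteq> null Y}"
      by (intro image_eqI[of _ _ "d - e"]) auto
  qed
  moreover have "pact Y e c (u (d - e)) \<in> piece Y d" for d
    using pact_closed[OF assms(1), of "u (d - e)" "d - e" c] assms(2) by (auto simp: families_def)
  ultimately show ?thesis using assms(2) by (auto simp: families_def elim!: finite_subset)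
qed

lemma place_family: "x \<in> piece Y d \<Longrightarrow> (\<lambda>d'. if d' = d then x else null Y) \<in> families Y"
  by (auto simp: families_def null_piece intro: finite_subset[of _ "{d}"])

lemma coord_zero: "coord Y \<zero>\<^bsub>T\<^esub> d = null Y"
  by (simp add: Tot_simps coord_encode null_family)

lemma coord_plus: "z \<in> carrier T \<Longrightarrow> w \<in> carrier T \<Longrightarrow>
    coord Y (z \<oplus>\<^bsub>T\<^esub> w) d = padd Y (coord Y z d) (coord Y w d)"
  by (simp add: Tot_simps(3) coord_encode padd_family coord_families)

lemma plus_closed: "z \<in> carrier T \<Longrightarrow> w \<in> carrier T \<Longrightarrow> z \<oplus>\<^bsub>T\<^esub> w \<in> carrier T"
  by (simp add: Tot_simps(3) encode_closed padd_family coord_families)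

lemma coord_tact: "e \<in> degrees m \<sigma> \<Longrightarrow> z \<in> carrier T \<Longrightarrow>
    coord Y (tact Y e c z :: 'v) d = pact Y e c (coord Y z (d - e))"
  by (simp add: tact_def coord_encode pact_family coord_families)

lemma tact_closed: "e \<in> degrees m \<sigma> \<Longrightarrow> z \<in> carrier T \<Longrightarrow> tact Y e c z \<in> carrier T"
  by (simp add: tact_def encode_closed pact_family coord_families)

lemma coord_place: "x \<in> piece Y d \<Longrightarrow> coord Y (place Y d x :: 'v) d' = (if d' = d then x else null Y)"
  by (simp add: place_def coord_encode place_family)

lemma place_closed: "x \<in> piece Y d \<Longrightarrow> place Y d x \<in> carrier T"
  by (simp add: place_def encode_closed place_family)

lemma abelian_group_Tot: "abelian_group T"
proof (rule abelian_groupI)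
  show z: "\<zero>\<^bsub>T\<^esub> \<in> carrier T" by (simp add: Tot_simps null_family)
  fix x assume x: "x \<in> carrier T"
  show "\<zero>\<^bsub>T\<^esub> \<oplus>\<^bsub>T\<^esub> x = x"
    using x z padd_null coord_piece by (intro Tot_eqI) (auto simp: plus_closed coord_plus coord_zero)
  obtain v where v: "\<And>d. v d \<in> piece Y d" "\<And>d. padd Y (v d) (coord Y x d) = null Y"
    using padd_inverse[OF coord_piece[OF x]] by metis
  have "v d = null Y" if "coord Y x d = null Y" for d
    using v[of d] padd_null_right[OF v(1), of d] that by simp
  then have v_fam: "v \<in> families Y"
    using v(1) finite_coord[OF x] unfolding families_def by (auto elim!: rev_finite_subset)
  then show "\<exists>y\<in>carrier T. y \<oplus>\<^bsub>T\<^esub> x = \<zero>\<^bsub>T\<^esub>"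
    by (intro bexI[of _ "encode Y v"] Tot_eqI)
      (simp_all add: x z v encode_closed plus_closed coord_plus coord_zero coord_encode)
  fix y assume y: "y \<in> carrier T"
  show "x \<oplus>\<^bsub>T\<^esub> y \<in> carrier T" using x y by (rule plus_closed)
  show "x \<oplus>\<^bsub>T\<^esub> y = y \<oplus>\<^bsub>T\<^esub> x"
    using x y padd_comm[OF coord_piece[OF x] coord_piece[OF y]]
    by (intro Tot_eqI) (simp_all add: plus_closed coord_plus)
  fix z assume z: "z \<in> carrier T"
  show "x \<oplus>\<^bsub>T\<^esub> y \<oplus>\<^bsub>T\<^esub> z = x \<oplus>\<^bsub>T\<^esub> (y \<oplus>\<^bsub>T\<^esub> z)"
    using x y z padd_assoc[OF coord_piece[OF x] coord_piece[OF y] coord_piece[OF z]]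
    by (intro Tot_eqI) (simp_all add: plus_closed coord_plus)
qed

lemma module_Tot: "module (loc_ring m \<sigma>) T"
  and smult_eq_tact: "e \<in> degrees m \<sigma> \<Longrightarrow> z \<in> carrier T \<Longrightarrow> monomial e c \<odot>\<^bsub>T\<^esub> z = tact Y e c z"
proof -
  have 1: "tact Y e c (x \<oplus>\<^bsub>T\<^esub> y) = tact Y e c x \<oplus>\<^bsub>T\<^esub> tact Y e c y"
    if "e \<in> degrees m \<sigma>" "x \<in> carrier T" "y \<in> carrier T" for e c x y
    using that pact_padd[OF that(1) coord_piece[OF that(2)] coord_piece[OF that(3)]]
    by (intro Tot_eqI) (simp_all add: plus_closed tact_closed coord_plus coord_tact)
  have 2: "tact Y e (c + c') x = tact Y e c x \<oplus>\<^bsub>T\<^esub> tact Y e c' x"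
    if "e \<in> degrees m \<sigma>" "x \<in> carrier T" for e c c' x
    using that pact_coeff[OF that(1) coord_piece[OF that(2)]]
    by (intro Tot_eqI) (simp_all add: plus_closed tact_closed coord_plus coord_tact)
  have 3: "tact Y e c (tact Y f d x) = tact Y (e + f) (c * d) x"
    if "e \<in> degrees m \<sigma>" "f \<in> degrees m \<sigma>" "x \<in> carrier T" for e f c d and x :: 'v
  proof (rule Tot_eqI)
    fix d'
    show "coord Y (tact Y e c (tact Y f d x) :: 'v) d' = coord Y (tact Y (e + f) (c * d) x) d'"
      using that pact_pact[OF that(1,2) coord_piece[OF that(3)]]
      by (simp add: tact_closed coord_tact degrees_add diff_diff_eq)
  qed (use that in \<open>simp_all add: tact_closed degrees_add\<close>)
  have 4: "tact Y 0 1 x = x" if "x \<in> carrier T" for x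
    using that pact_one[OF coord_piece[OF that]] by (intro Tot_eqI) (simp_all add: tact_closed coord_tact)
  note * = module_from_monomial_action[OF add_submonoid_degrees abelian_group_Tot Tot_simps(4), of m \<sigma>,
      OF tact_closed 1 2 3 4]
  show "module (loc_ring m \<sigma>) T" unfolding loc_ring_def by (rule *(1))
  show "e \<in> degrees m \<sigma> \<Longrightarrow> z \<in> carrier T \<Longrightarrow> monomial e c \<odot>\<^bsub>T\<^esub> z = tact Y e c z" by (rule *(2))
qed

lemma coord_act: "e \<in> degrees m \<sigma> \<Longrightarrow> z \<in> carrier T \<Longrightarrow>
    coord Y (monomial e c \<odot>\<^bsub>T\<^esub> z) d = pact Y e c (coord Y z (d - e))"
  by (simp add: smult_eq_tact coord_tact)

lemma component_Tot: "z \<in> component T d \<longleftrightarrow> z \<in> carrier T \<and> (\<forall>d'. d' \<noteq> d \<longrightarrow> coord Y z d' = null Y)"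
proof
  assume z: "z \<in> carrier T \<and> (\<forall>d'. d' \<noteq> d \<longrightarrow> coord Y z d' = null Y)"
  then show "z \<in> component T d"
    using coord_families[of z] encode_coord[of z]
    by (auto simp: Tot_simps intro!: image_eqI[of _ _ "coord Y z"])
qed (auto simp: Tot_simps coord_encode)

lemma place_component: "x \<in> piece Y d \<Longrightarrow> place Y d x \<in> component T d"
  by (simp add: component_Tot place_closed coord_place)

lemma component_eq_place: "z \<in> component T d \<Longrightarrow> z = place Y d (coord Y z d)"
  by (intro Tot_eqI) (auto simp: component_Tot place_closed coord_place coord_piece)

lemma coord_finsum:
  assumes "finite D" "\<And>d. d \<in> D \<Longrightarrow> u d \<in> component T d"
  shows "(\<Oplus>\<^bsub>T\<^esub> d \<in> D. u d) \<in> carrier T \<and>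
    coord Y (\<Oplus>\<^bsub>T\<^esub> d \<in> D. u d) d' = (if d' \<in> D then coord Y (u d') d' else null Y)"
  using assms
proof (induction D rule: finite_induct)
  case empty
  interpret abelian_group T by (rule abelian_group_Tot)
  show ?case by (simp add: coord_zero)
next
  case (insert d D)
  interpret abelian_group T by (rule abelian_group_Tot)
  have u: "u i \<in> carrier T" if "i \<in> insert d D" for i
    using insert.prems[OF that] by (simp add: component_Tot)
  have "(\<Oplus>\<^bsub>T\<^esub> i \<in> insert d D. u i) = u d \<oplus>\<^bsub>T\<^esub> (\<Oplus>\<^bsub>T\<^esub> i \<in> D. u i)"
    using insert.hyps u by (intro finsum_insert) auto
  moreover have IH: "(\<Oplus>\<^bsub>T\<^esub> i \<in> D. u i) \<in> carrier T"
    "coord Y (\<Oplus>\<^bsub>T\<^esub> i \<in> D. u i) d' = (if d' \<in> D then coord Y (u d') d' else null Y)"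
    using insert.IH insert.prems by auto
  ultimately have "coord Y (\<Oplus>\<^bsub>T\<^esub> i \<in> insert d D. u i) d' =
      padd Y (coord Y (u d) d') (if d' \<in> D then coord Y (u d') d' else null Y)"
    using u by (simp add: coord_plus)
  moreover have "\<dots> = (if d' \<in> insert d D then coord Y (u d') d' else null Y)"
  proof (cases "d' = d")
    case True
    then show ?thesis using insert.hyps padd_null_right[OF coord_piece[OF u[of d]]] by auto
  next
    case False
    then have "coord Y (u d) d' = null Y" using insert.prems[of d] by (simp add: component_Tot)
    then show ?thesis using False padd_null[OF coord_piece[OF u]] padd_null[OF null_piece] by simp
  qed
  moreover have "(\<Oplus>\<^bsub>T\<^esub> i \<in> insert d D. u i) \<in> carrier T"
    using u by (intro finsum_closed) auto
  ultimately show ?case by simp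
qed

lemma is_graded_module_Tot: "is_graded_module m \<sigma> T"
proof -
  interpret T: module "loc_ring m \<sigma>" T by (rule module_Tot)
  have subgroup: "subgroup (component T d) (add_monoid T)" for d
  proof (rule group.subgroupI)
    show "group (add_monoid T)" by (rule T.a_group)
    show "component T d \<subseteq> carrier (add_monoid T)" by (auto simp: component_Tot)
    show "component T d \<noteq> {}" using place_component[OF null_piece] by blast
    fix x assume x: "x \<in> component T d"
    have xc: "x \<in> carrier T" using x by (simp add: component_Tot)
    have "coord Y (\<ominus>\<^bsub>T\<^esub> x) d' = null Y" if "d' \<noteq> d" for d'
    proof -
      have "padd Y (coord Y (\<ominus>\<^bsub>T\<^esub> x) d') (coord Y x d') = null Y"
        using coord_plus[of "\<ominus>\<^bsub>T\<^esub> x" x d'] xc by (simp add: T.l_neg coord_zero)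
      then show ?thesis using x that padd_null_right[OF coord_piece[of "\<ominus>\<^bsub>T\<^esub> x" d']] xc
        by (simp add: component_Tot)
    qed
    then have "\<ominus>\<^bsub>T\<^esub> x \<in> component T d" using xc by (simp add: component_Tot)
    then show "inv\<^bsub>add_monoid T\<^esub> x \<in> component T d" by (simp add: a_inv_def)
    fix y assume "y \<in> component T d"
    then show "x \<otimes>\<^bsub>add_monoid T\<^esub> y \<in> component T d"
      using x padd_null[OF null_piece] by (auto simp: component_Tot coord_plus)
  qed
  have outside: "component T d = {\<zero>\<^bsub>T\<^esub>}" if "d \<notin> degrees m \<sigma>" for d
  proof -
    have "z = \<zero>\<^bsub>T\<^esub>" if "z \<in> component T d" for z
      using that coord_piece[of z d] piece_outside[OF \<open>d \<notin> degrees m \<sigma>\<close>]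
      by (intro Tot_eqI) (auto simp: component_Tot coord_zero)
    then show ?thesis using T.zero_closed by (auto simp: component_Tot coord_zero)
  qed
  have decomp: "\<exists>!u. (\<forall>d. u d \<in> component T d) \<and> finite {d. u d \<noteq> \<zero>\<^bsub>T\<^esub>} \<and>
        z = (\<Oplus>\<^bsub>T\<^esub> d \<in> {d. u d \<noteq> \<zero>\<^bsub>T\<^esub>}. u d)" if z: "z \<in> carrier T" for z
  proof (rule ex1I)
    let ?u = "\<lambda>d. place Y d (coord Y z d)"
    have u: "?u d \<in> component T d" for d by (rule place_component[OF coord_piece[OF z]])
    have u0: "?u d = \<zero>\<^bsub>T\<^esub> \<longleftrightarrow> coord Y z d = null Y" for d
    proof
      assume "?u d = \<zero>\<^bsub>T\<^esub>"
      then have "coord Y (?u d :: 'v) d = coord Y \<zero>\<^bsub>T\<^esub> d" by simp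
      then show "coord Y z d = null Y" by (simp add: coord_place coord_piece[OF z] coord_zero)
    qed (simp add: place_def Tot_simps)
    have fin: "finite {d. ?u d \<noteq> \<zero>\<^bsub>T\<^esub>}" using finite_coord[OF z] by (simp add: u0)
    have "z = (\<Oplus>\<^bsub>T\<^esub> d \<in> {d. ?u d \<noteq> \<zero>\<^bsub>T\<^esub>}. ?u d)"
      using z coord_finsum[OF fin u] by (intro Tot_eqI) (auto simp: u0 coord_place coord_piece[OF z])
    then show "(\<forall>d. ?u d \<in> component T d) \<and> finite {d. ?u d \<noteq> \<zero>\<^bsub>T\<^esub>} \<and>
        z = (\<Oplus>\<^bsub>T\<^esub> d \<in> {d. ?u d \<noteq> \<zero>\<^bsub>T\<^esub>}. ?u d)" using u fin by blast
    fix u assume *: "(\<forall>d. u d \<in> component T d) \<and> finite {d. u d \<noteq> \<zero>\<^bsub>T\<^esub>} \<and>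
        z = (\<Oplus>\<^bsub>T\<^esub> d \<in> {d. u d \<noteq> \<zero>\<^bsub>T\<^esub>}. u d)"
    show "u = ?u"
    proof
      fix d
      have "coord Y z d = (if u d \<noteq> \<zero>\<^bsub>T\<^esub> then coord Y (u d) d else null Y)"
        using coord_finsum[of "{d. u d \<noteq> \<zero>\<^bsub>T\<^esub>}" u d] * by simp
      also have "\<dots> = coord Y (u d) d" by (simp add: coord_zero)
      finally show "u d = ?u d" using component_eq_place[of "u d" d] * by simp
    qed
  qed
  have act: "monomial e c \<odot>\<^bsub>T\<^esub> x \<in> component T (d + e)" if "e \<in> degrees m \<sigma>" "x \<in> component T d" for e d c x
  proof -
    have "d' - e \<noteq> d" if "d' \<noteq> d + e" for d' using that by (auto simp: algebra_simps)
    then show ?thesis using that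
      by (auto simp: component_Tot coord_act smult_eq_tact tact_closed coord_tact pact_null)
  qed
  show ?thesis
    unfolding is_graded_module_def using module_Tot subgroup outside decomp act by blast
qed

sublocale T: gmodule m \<sigma> T by unfold_locales (rule is_graded_module_Tot)

lemma act_place: "e \<in> degrees m \<sigma> \<Longrightarrow> x \<in> piece Y d \<Longrightarrow>
    monomial e c \<odot>\<^bsub>T\<^esub> place Y d x = place Y (d + e) (pact Y e c x)"
  by (intro Tot_eqI)
    (auto simp: T.act_closed place_closed pact_closed coord_act coord_place pact_null algebra_simps)

lemma plus_place: "x \<in> piece Y d \<Longrightarrow> y \<in> piece Y d \<Longrightarrow>
    place Y d x \<oplus>\<^bsub>T\<^esub> place Y d y = place Y d (padd Y x y)"
  by (intro Tot_eqI)
    (auto simp: place_closed padd_closed coord_plus coord_place padd_null[OF null_piece])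

lemma place_null: "place Y d (null Y) = \<zero>\<^bsub>T\<^esub>"
  by (simp add: place_def Tot_simps)

lemma submodule_eqI:
  assumes "is_submodule (loc_ring m \<sigma>) T H"
    and "\<And>d x. d \<in> degrees m \<sigma> \<Longrightarrow> x \<in> piece Y d \<Longrightarrow> place Y d x \<in> H"
  shows "carrier T \<subseteq> H"
proof
  fix z assume "z \<in> carrier T"
  then show "z \<in> H"
  proof (induction z rule: T.homogeneous_induct)
    case (homogeneous x d)
    then have "place Y d (coord Y x d) \<in> H" by (intro assms(2) coord_piece T.component_closed)
    then show ?case using component_eq_place[OF homogeneous(1)] by simp
  qed (use assms(1) in \<open>auto simp: is_submodule_def\<close>)
qed

end

definition tot_map ::
  "('k::field, 'y) gsys \<Rightarrow> ('k, 'x) gsys \<Rightarrow> (multidegree \<Rightarrow> 'y \<Rightarrow> 'x) \<Rightarrow> 'v \<Rightarrow> 'v" where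
  "tot_map Y X h = (\<lambda>z \<in> carrier (Tot Y). encode X (\<lambda>d. h d (coord Y z d)))"

locale system_map =
  Y: gsystem m \<sigma> Y universe + X: gsystem m \<tau> X universe
  for m \<sigma> \<tau> and Y :: "('k::field, 'y) gsys" and X :: "('k, 'x) gsys" and universe :: "'v itself" +
  fixes h :: "multidegree \<Rightarrow> 'y \<Rightarrow> 'x"
  assumes sub: "\<sigma> \<subseteq> \<tau>"
    and h_closed: "x \<in> piece Y d \<Longrightarrow> h d x \<in> piece X d"
    and h_padd: "x \<in> piece Y d \<Longrightarrow> y \<in> piece Y d \<Longrightarrow> h d (padd Y x y) = padd X (h d x) (h d y)"
    and h_pact: "e \<in> degrees m \<sigma> \<Longrightarrow> x \<in> piece Y d \<Longrightarrow> d \<in> degrees m \<sigma> \<Longrightarrow>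
      h (d + e) (pact Y e c x) = pact X e c (h d x)"
begin

lemma h_null: "h d (null Y) = null X"
  using h_padd[OF Y.null_piece Y.null_piece, of d] Y.padd_null[OF Y.null_piece]
    X.padd_idem[OF h_closed[OF Y.null_piece[of d]]] by simp

lemma h_family:
  assumes "u \<in> families Y" shows "(\<lambda>d. h d (u d)) \<in> families X"
proof -
  have "{d. h d (u d) \<noteq> null X} \<subseteq> {d. u d \<noteq> null Y}" by (auto simp: h_null)
  then show ?thesis using assms by (auto simp: families_def h_closed elim!: finite_subset)
qed

abbreviation F :: "'v \<Rightarrow> 'v" where "F \<equiv> tot_map Y X h"

lemma coord_map: "z \<in> carrier Y.T \<Longrightarrow> coord X (F z) d = h d (coord Y z d)"
  by (simp add: tot_map_def X.coord_encode h_family Y.coord_families)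

lemma map_closed: "z \<in> carrier Y.T \<Longrightarrow> F z \<in> carrier X.T"
  by (simp add: tot_map_def X.encode_closed h_family Y.coord_families)

lemma graded_map_tot_map: "graded_map m \<sigma> \<tau> Y.T X.T F"
proof (rule graded_mapI)
  show "F \<in> carrier Y.T \<rightarrow>\<^sub>E carrier X.T"
    using map_closed by (auto simp: tot_map_def)
  show "F (x \<oplus>\<^bsub>Y.T\<^esub> y) = F x \<oplus>\<^bsub>X.T\<^esub> F y" if "x \<in> carrier Y.T" "y \<in> carrier Y.T" for x y
    using that h_padd[OF Y.coord_piece[OF that(1)] Y.coord_piece[OF that(2)]]
    by (intro X.Tot_eqI) (simp_all add: map_closed coord_map Y.plus_closed X.plus_closed Y.coord_plus X.coord_plus)
  show "F (monomial e c \<odot>\<^bsub>Y.T\<^esub> x) = monomial e c \<odot>\<^bsub>X.T\<^esub> F x" if e: "e \<in> degrees m \<sigma>" and x: "x \<in> carrier Y.T" for e c x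
  proof (rule X.Tot_eqI)
    have e': "e \<in> degrees m \<tau>" using e degrees_mono[OF sub] by blast
    show "F (monomial e c \<odot>\<^bsub>Y.T\<^esub> x) \<in> carrier X.T" "monomial e c \<odot>\<^bsub>X.T\<^esub> F x \<in> carrier X.T"
      using e e' x by (auto intro!: map_closed Y.T.act_closed X.T.act_closed)
    fix d
    have "h d (pact Y e c (coord Y x (d - e))) = pact X e c (h (d - e) (coord Y x (d - e)))"
    proof (cases "d - e \<in> degrees m \<sigma>")
      case True
      then show ?thesis using h_pact[OF e Y.coord_piece[OF x] True] by simp
    next
      case False
      then show ?thesis
        using Y.coord_piece[OF x, of "d - e"] Y.piece_outside[OF False] e e'
        by (simp add: Y.pact_null h_null X.pact_null)
    qed
    then show "coord X (F (monomial e c \<odot>\<^bsub>Y.T\<^esub> x)) d = coord X (monomial e c \<odot>\<^bsub>X.T\<^esub> F x) d"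
      using e e' x by (simp add: map_closed coord_map Y.coord_act X.coord_act Y.T.act_closed)
  qed
  show "F x \<in> component X.T d" if "x \<in> component Y.T d" for d x
    using that by (auto simp: X.component_Tot Y.component_Tot map_closed coord_map h_null)
qed (rule Y.is_graded_module_Tot X.is_graded_module_Tot sub)+

lemma map_place: "x \<in> piece Y d \<Longrightarrow> F (place Y d x) = place X d (h d x)"
  by (intro X.Tot_eqI) (auto simp: map_closed Y.place_closed X.place_closed coord_map Y.coord_place X.coord_place h_closed h_null)

lemma tot_map_inj:
  assumes "\<And>d x y. x \<in> piece Y d \<Longrightarrow> y \<in> piece Y d \<Longrightarrow> h d x = h d y \<Longrightarrow> x = y"
  shows "inj_on F (carrier Y.T)"
proof (rule inj_onI)
  fix z w assume z: "z \<in> carrier Y.T" and w: "w \<in> carrier Y.T" and eq: "F z = F w"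
  show "z = w"
    using coord_map[OF z] coord_map[OF w] eq assms[OF Y.coord_piece[OF z] Y.coord_piece[OF w]]
    by (intro Y.Tot_eqI[OF z w]) simp
qed

end

text \<open>
  Kernels and images are computed piecewise. A preimage under a total map is assembled from preimages of
  the entries, which are chosen to be zero for zero entries, so that the support stays finite.
\<close>

lemma tot_map_exact:
  assumes f: "system_map m \<sigma> \<sigma> X Y TYPE('v) f" and g: "system_map m \<sigma> \<sigma> Y Z TYPE('v) g"
    and inj: "\<And>d x y. d \<in> degrees m \<sigma> \<Longrightarrow> x \<in> piece X d \<Longrightarrow> y \<in> piece X d \<Longrightarrow> f d x = f d y \<Longrightarrow> x = y"
    and gf: "\<And>d x. d \<in> degrees m \<sigma> \<Longrightarrow> x \<in> piece X d \<Longrightarrow> g d (f d x) = null Z"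
    and ker: "\<And>d y. d \<in> degrees m \<sigma> \<Longrightarrow> y \<in> piece Y d \<Longrightarrow> g d y = null Z \<Longrightarrow> \<exists>x \<in> piece X d. f d x = y"
    and surj: "\<And>d z. d \<in> degrees m \<sigma> \<Longrightarrow> z \<in> piece Z d \<Longrightarrow> \<exists>y \<in> piece Y d. g d y = z"
  shows "Ses (graded_mod m \<sigma>) (Tot X) (Tot Y) (Tot Z :: ('k::field, 'v) gmod) (tot_map X Y f) (tot_map Y Z g)"
proof -
  interpret f: system_map m \<sigma> \<sigma> X Y "TYPE('v)" f by fact
  interpret g: system_map m \<sigma> \<sigma> Y Z "TYPE('v)" g by fact
  have inj': "x = y" if "x \<in> piece X d" "y \<in> piece X d" "f d x = f d y" for d x y
    using inj[OF _ that] that f.Y.piece_outside by (cases "d \<in> degrees m \<sigma>") auto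
  have gf': "g d (f d x) = null Z" if "x \<in> piece X d" for d x
    using gf[OF _ that] that f.Y.piece_outside f.h_null g.h_null by (cases "d \<in> degrees m \<sigma>") auto
  have ker': "\<exists>x \<in> piece X d. f d x = y \<and> (y = null Y \<longrightarrow> x = null X)" if "y \<in> piece Y d" "g d y = null Z" for d y
  proof (cases "y = null Y")
    case True
    then show ?thesis using f.h_null f.Y.null_piece by blast
  next
    case False
    then have "d \<in> degrees m \<sigma>" using that f.X.piece_outside by blast
    then show ?thesis using ker[OF _ that] False by blast
  qed
  have surj': "\<exists>y \<in> piece Y d. g d y = z \<and> (z = null Z \<longrightarrow> y = null Y)" if "z \<in> piece Z d" for d z
  proof (cases "z = null Z")
    case True
    then show ?thesis using g.h_null f.X.null_piece by blast
  next
    case False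
    then have "d \<in> degrees m \<sigma>" using that g.X.piece_outside by blast
    then show ?thesis using surj[OF _ that] False by blast
  qed
  have "f.F ` carrier f.Y.T = {y \<in> carrier f.X.T. g.F y = \<zero>\<^bsub>g.X.T\<^esub>}"
  proof (intro equalityI subsetI)
    fix y assume "y \<in> f.F ` carrier f.Y.T"
    then obtain x where x: "x \<in> carrier f.Y.T" "y = f.F x" by blast
    have "g.F y = \<zero>\<^bsub>g.X.T\<^esub>"
      using x gf'[OF f.Y.coord_piece[OF x(1)]]
      by (intro g.X.Tot_eqI) (simp_all add: g.map_closed f.map_closed g.coord_map f.coord_map g.X.coord_zero)
    then show "y \<in> {y \<in> carrier f.X.T. g.F y = \<zero>\<^bsub>g.X.T\<^esub>}" using x f.map_closed by simp
  next
    fix y assume "y \<in> {y \<in> carrier f.X.T. g.F y = \<zero>\<^bsub>g.X.T\<^esub>}"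
    then have y: "y \<in> carrier f.X.T" "g.F y = \<zero>\<^bsub>g.X.T\<^esub>" by auto
    have "\<exists>x \<in> piece X d. f d x = coord Y y d \<and> (coord Y y d = null Y \<longrightarrow> x = null X)" for d
      using g.coord_map[OF y(1), of d] y(2) g.X.coord_zero[of d] by (intro ker' f.X.coord_piece[OF y(1)]) simp
    then obtain u where u: "\<And>d. u d \<in> piece X d" "\<And>d. f d (u d) = coord Y y d"
      "\<And>d. coord Y y d = null Y \<Longrightarrow> u d = null X" by metis
    have fam: "u \<in> families X"
      using u(1,3) f.X.finite_coord[OF y(1)] unfolding families_def by (auto elim!: rev_finite_subset)
    have "y = f.F (encode X u)"
      using y(1) fam by (intro f.X.Tot_eqI) (simp_all add: f.map_closed f.Y.encode_closed f.coord_map f.Y.coord_encode u)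
    then show "y \<in> f.F ` carrier f.Y.T" using f.Y.encode_closed[OF fam] by blast
  qed
  moreover have "carrier g.X.T \<subseteq> g.F ` carrier f.X.T"
  proof
    fix z assume z: "z \<in> carrier g.X.T"
    obtain u where u: "\<And>d. u d \<in> piece Y d" "\<And>d. g d (u d) = coord Z z d"
      "\<And>d. coord Z z d = null Z \<Longrightarrow> u d = null Y"
      using surj'[OF g.X.coord_piece[OF z]] by metis
    have fam: "u \<in> families Y"
      using u(1,3) g.X.finite_coord[OF z] unfolding families_def by (auto elim!: rev_finite_subset)
    have "z = g.F (encode Y u)"
      using z fam by (intro g.X.Tot_eqI) (simp_all add: g.map_closed f.X.encode_closed g.coord_map f.X.coord_encode u)
    then show "z \<in> g.F ` carrier f.X.T" using f.X.encode_closed[OF fam] by blast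
  qed
  moreover have "g.F ` carrier f.X.T \<subseteq> carrier g.X.T" by (intro image_subsetI g.map_closed)
  ultimately show ?thesis
    unfolding graded_mod_def module_category_simps
    by (intro conjI equalityI[of "g.F ` _"] f.tot_map_inj[OF inj'])
qed

text \<open>
  A family is determined by the finite set of its nonzero entries, labelled with their degrees; and
  an infinite set is equipotent with the set of its finite subsets.
\<close>

lemma families_encodable:
  fixes Y :: "('k, 'y) gsys"
  assumes inf: "infinite (UNIV :: 'v set)" and D: "countable D" "\<And>d. d \<notin> D \<Longrightarrow> piece Y d \<subseteq> {null Y}"
    and j: "inj_on (j :: 'y \<Rightarrow> 'v) (\<Union>d. piece Y d)"
  shows "encodable TYPE('v) Y"
proof -
  have "Fpow (UNIV :: (nat \<times> 'v) set) \<approx> (UNIV :: (nat \<times> 'v) set)"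
    using inf by (intro eqpoll_Fpow) (simp add: finite_prod)
  also have "(UNIV :: (nat \<times> 'v) set) \<lesssim> (UNIV :: 'v set) \<times> (UNIV :: 'v set)"
    unfolding UNIV_Times_UNIV[symmetric]
    by (intro times_lepoll_mono lepoll_refl) (use inf in \<open>simp add: infinite_le_lepoll\<close>)
  also have "(UNIV :: 'v set) \<times> (UNIV :: 'v set) \<approx> (UNIV :: 'v set)"
    using card_of_Times_same_infinite[OF inf] by (simp add: eqpoll_iff_card_of_ordIso)
  finally obtain r :: "(nat \<times> 'v) set \<Rightarrow> 'v" where r: "inj_on r (Fpow UNIV)"
    by (auto simp: lepoll_def)
  define q where "q u = r ((\<lambda>d. (to_nat_on D d, j (u d))) ` {d. u d \<noteq> null Y})" for u
  have "inj_on q (families Y)"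
  proof (rule inj_onI)
    have half: "u d = v d"
      if u: "u \<in> families Y" and v: "v \<in> families Y" and nn: "u d \<noteq> null Y"
        and eq: "(\<lambda>d. (to_nat_on D d, j (u d))) ` {d. u d \<noteq> null Y} = (\<lambda>d. (to_nat_on D d, j (v d))) ` {d. v d \<noteq> null Y}"
      for u v d
    proof -
      obtain d' where d': "v d' \<noteq> null Y" "to_nat_on D d = to_nat_on D d'" "j (u d) = j (v d')"
        using eq nn by (auto simp: set_eq_iff image_iff)
      have "d \<in> D" "d' \<in> D" using D(2) u v nn d'(1) by (auto simp: families_def)
      then have "d = d'" using d'(2) D(1) by simp
      moreover have "u d \<in> (\<Union>d. piece Y d)" "v d' \<in> (\<Union>d. piece Y d)"
        using u v by (auto simp: families_def)
      ultimately show ?thesis using inj_onD[OF j d'(3)] by simp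
    qed
    fix u v assume u: "u \<in> families Y" and v: "v \<in> families Y" and "q u = q v"
    then have eq: "(\<lambda>d. (to_nat_on D d, j (u d))) ` {d. u d \<noteq> null Y} = (\<lambda>d. (to_nat_on D d, j (v d))) ` {d. v d \<noteq> null Y}"
      unfolding q_def by (intro inj_onD[OF r]) (auto simp: Fpow_def families_def)
    show "u = v"
    proof
      fix d show "u d = v d" using half[OF u v _ eq] half[OF v u _ eq[symmetric]] by metis
    qed
  qed
  then show ?thesis unfolding encodable_def by blast
qed

lemma countable_degrees: "countable (degrees m \<sigma>)"
proof (rule countable_image_inj_on)
  show "inj_on (\<lambda>d. map d [1..<Suc m]) (degrees m \<sigma>)"
  proof (rule inj_onI)
    fix d e :: multidegree
    assume d: "d \<in> degrees m \<sigma>" "e \<in> degrees m \<sigma>" and "map d [1..<Suc m] = map e [1..<Suc m]"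
    then have "\<forall>i \<in> set [1..<Suc m]. d i = e i" by (simp only: map_eq_conv)
    then have "d i = e i" if "i \<in> {1..m}" for i using that by (auto simp del: upt_Suc)
    moreover have "d i = e i" if "i \<notin> {1..m}" for i using that d by (simp add: degrees_def)
    ultimately show "d = e" by blast
  qed
qed simp

section \<open>Recognising localisations\<close>

text \<open>
  The exponent of the \<open>n\<close>-th power of the product of the variables \<open>t\<^sub>i\<close>, \<open>i \<in> \<tau>\<close>.
\<close>

definition shift :: "nat set \<Rightarrow> nat \<Rightarrow> multidegree" where
  "shift \<tau> n = (\<lambda>i. if i \<in> \<tau> then int n else 0)"

lemma shift_plus: "shift \<tau> k + shift \<tau> l = shift \<tau> (k + l)"
  by (auto simp: shift_def fun_eq_iff)

lemma shift_zero [simp]: "shift \<tau> 0 = 0"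
  by (auto simp: shift_def fun_eq_iff)

lemma shift_degrees: "\<tau> \<subseteq> {1..m} \<Longrightarrow> shift \<tau> n \<in> degrees m \<sigma>"
  by (auto simp: shift_def degrees_def)

lemma minus_shift_degrees: "\<tau> \<subseteq> {1..m} \<Longrightarrow> - shift \<tau> n \<in> degrees m \<tau>"
  by (auto simp: shift_def degrees_def)


lemma clear_denominator:
  assumes \<tau>: "\<tau> \<subseteq> {1..m}" and e: "e \<in> degrees m \<tau>" shows "\<exists>n. e + shift \<tau> n \<in> degrees m {}"
proof (intro exI)
  have "0 \<le> e i + int (\<Sum>i=1..m. nat \<bar>e i\<bar>)" if "i \<in> {1..m}" for i
    using member_le_sum[of i "{1..m}" "\<lambda>i. nat \<bar>e i\<bar>"] that by (simp del: of_nat_sum)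
  \<comment> \<open>The exponent only has to exceed the absolute value of every coordinate of \<open>e\<close>.\<close>
  then show "e + shift \<tau> (\<Sum>i=1..m. nat \<bar>e i\<bar>) \<in> degrees m {}"
    using assms by (auto simp: degrees_def shift_def simp del: of_nat_sum)
qed

lemma tensor_relations_basic:
  fixes M :: "('k::field, 'v) gmod"
  assumes M: "is_graded_module m \<sigma> M" and sub: "\<sigma> \<subseteq> \<tau>"
  defines "R \<equiv> tensor_relations (loc_ring m \<sigma>) (loc_ring m \<tau>) M"
  shows "subgroup R (free_Abelian_group (carrier (loc_ring m \<tau>) \<times> carrier M))"
    and "Poly_Mapping.keys b \<subseteq> degrees m \<tau> \<Longrightarrow> Poly_Mapping.keys b' \<subseteq> degrees m \<tau> \<Longrightarrow> x \<in> carrier M \<Longrightarrow>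
      frag_of (b + b', x) - frag_of (b, x) - frag_of (b', x) \<in> R"
    and "Poly_Mapping.keys b \<subseteq> degrees m \<tau> \<Longrightarrow> x \<in> carrier M \<Longrightarrow> x' \<in> carrier M \<Longrightarrow>
      frag_of (b, x \<oplus>\<^bsub>M\<^esub> x') - frag_of (b, x) - frag_of (b, x') \<in> R"
    and "Poly_Mapping.keys b \<subseteq> degrees m \<tau> \<Longrightarrow> Poly_Mapping.keys a \<subseteq> degrees m \<sigma> \<Longrightarrow> x \<in> carrier M \<Longrightarrow>
      frag_of (b * a, x) - frag_of (b, a \<odot>\<^bsub>M\<^esub> x) \<in> R"
proof -
  interpret M: gmodule m \<sigma> M by unfold_locales (rule M)
  let ?G = "free_Abelian_group (carrier (loc_ring m \<tau> :: 'k laurent ring) \<times> carrier M)"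
  have Gin: "frag_of p - frag_of q \<in> carrier ?G" if "p \<in> carrier (loc_ring m \<tau>) \<times> carrier M" "q \<in> carrier (loc_ring m \<tau>) \<times> carrier M" for p q
    using that keys_diff[of "frag_of p" "frag_of q"] by auto
  have Gin2: "frag_of p - frag_of q - frag_of r \<in> carrier ?G"
    if "p \<in> carrier (loc_ring m \<tau>) \<times> carrier M" "q \<in> carrier (loc_ring m \<tau>) \<times> carrier M" "r \<in> carrier (loc_ring m \<tau>) \<times> carrier M" for p q r
    using that Gin[OF that(1,2)] keys_diff[of "frag_of p - frag_of q" "frag_of r"] by auto
  have mult: "b * a \<in> carrier (loc_ring m \<tau>)" if "b \<in> carrier (loc_ring m \<tau>)" "a \<in> carrier (loc_ring m \<sigma>)" for a b :: "'k laurent"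
  proof -
    have "Poly_Mapping.keys a \<subseteq> degrees m \<tau>" "Poly_Mapping.keys b \<subseteq> degrees m \<tau>"
      using that degrees_mono[OF sub, of m] by (auto simp: loc_ring_def)
    then show ?thesis using keys_mult_subset[OF add_submonoid_degrees[of m \<tau>], of b a] by (simp add: loc_ring_def)
  qed
  have plus: "b + b' \<in> carrier (loc_ring m \<tau>)" if "b \<in> carrier (loc_ring m \<tau>)" "b' \<in> carrier (loc_ring m \<tau>)" for b b' :: "'k laurent"
    using that keys_add_subset[of b "degrees m \<tau>" b'] by (simp add: loc_ring_def)
  show "subgroup R ?G"
    unfolding R_def tensor_relations_def
  proof (rule group.generate_is_subgroup[OF group_free_Abelian_group], intro Un_least subsetI; elim CollectE exE conjE; hypsubst)
    fix b b' :: "'k laurent" and x assume "b \<in> carrier (loc_ring m \<tau>)" "b' \<in> carrier (loc_ring m \<tau>)" "x \<in> carrier M"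
    then show "frag_of (b \<oplus>\<^bsub>loc_ring m \<tau>\<^esub> b', x) - frag_of (b, x) - frag_of (b', x) \<in> carrier ?G"
      using plus[of b b'] by (intro Gin2) (simp_all add: loc_ring_def)
  next
    fix b :: "'k laurent" and x x' assume "b \<in> carrier (loc_ring m \<tau>)" "x \<in> carrier M" "x' \<in> carrier M"
    then show "frag_of (b, x \<oplus>\<^bsub>M\<^esub> x') - frag_of (b, x) - frag_of (b, x') \<in> carrier ?G"
      by (intro Gin2) auto
  next
    fix a b :: "'k laurent" and x assume *: "a \<in> carrier (loc_ring m \<sigma>)" "b \<in> carrier (loc_ring m \<tau>)" "x \<in> carrier M"
    then show "frag_of (b \<otimes>\<^bsub>loc_ring m \<tau>\<^esub> a, x) - frag_of (b, a \<odot>\<^bsub>M\<^esub> x) \<in> carrier ?G"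
      using mult[OF *(2,1)] M.LM.smult_closed[of a x] by (intro Gin) (auto simp: loc_ring_def)
  qed
  show "frag_of (b + b', x) - frag_of (b, x) - frag_of (b', x) \<in> R"
    if "Poly_Mapping.keys b \<subseteq> degrees m \<tau>" "Poly_Mapping.keys b' \<subseteq> degrees m \<tau>" "x \<in> carrier M"
    unfolding R_def tensor_relations_def loc_ring_def
    by (intro generate.incl UnI1 CollectI exI[of _ b] exI[of _ b'] exI[of _ x]) (use that in simp)
  show "frag_of (b, x \<oplus>\<^bsub>M\<^esub> x') - frag_of (b, x) - frag_of (b, x') \<in> R"
    if "Poly_Mapping.keys b \<subseteq> degrees m \<tau>" "x \<in> carrier M" "x' \<in> carrier M"
    unfolding R_def tensor_relations_def loc_ring_def
    by (rule generate.incl, rule UnI1, rule UnI2, intro CollectI exI[of _ b] exI[of _ x] exI[of _ x']) (use that in simp)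
  show "frag_of (b * a, x) - frag_of (b, a \<odot>\<^bsub>M\<^esub> x) \<in> R"
    if "Poly_Mapping.keys b \<subseteq> degrees m \<tau>" "Poly_Mapping.keys a \<subseteq> degrees m \<sigma>" "x \<in> carrier M"
    unfolding R_def tensor_relations_def loc_ring_def
    by (rule generate.incl, rule UnI2, intro CollectI exI[of _ b] exI[of _ a] exI[of _ x]) (use that in simp)
qed

text \<open>
  By passing to a common denominator, every element of \<open>R\<^sub>\<tau> \<otimes> M\<close> becomes a single fraction.
\<close>

lemma tensor_common_denominator:
  fixes M :: "('k::field, 'v) gmod"
  assumes M: "is_graded_module m \<sigma> M" and sub: "\<sigma> \<subseteq> \<tau>" and \<tau>: "\<tau> \<subseteq> {1..m}"
    and z: "Poly_Mapping.keys z \<subseteq> carrier (loc_ring m \<tau>) \<times> carrier M"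
  shows "\<exists>k. \<exists>x \<in> carrier M. z - frag_of (monomial (- shift \<tau> k) 1, x)
           \<in> tensor_relations (loc_ring m \<sigma>) (loc_ring m \<tau>) M"
proof -
  interpret M: gmodule m \<sigma> M by unfold_locales (rule M)
  let ?R = "tensor_relations (loc_ring m \<sigma>) (loc_ring m \<tau>) M"
  let ?G = "free_Abelian_group (carrier (loc_ring m \<tau> :: 'k laurent ring) \<times> carrier M)"
  let ?t = "\<lambda>k. monomial (- shift \<tau> k) (1::'k)"
  note basic = tensor_relations_basic[OF M sub]
  interpret R: subgroup ?R ?G by (rule basic(1))
  have Rplus: "u + v \<in> ?R" if "u \<in> ?R" "v \<in> ?R" for u v
    using R.m_closed[OF that] by simp
  have Rminus: "- u \<in> ?R" if "u \<in> ?R" for u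
  proof -
    have "Poly_Mapping.keys u \<subseteq> carrier (loc_ring m \<tau>) \<times> carrier M"
      using subsetD[OF R.subset that] by simp
    then show ?thesis using R.m_inv_closed[OF that] by simp
  qed
  have Rdiff: "u - v \<in> ?R" if "u \<in> ?R" "v \<in> ?R" for u v
    using Rplus[OF that(1) Rminus[OF that(2)]] by simp
  have t: "Poly_Mapping.keys (?t k) \<subseteq> degrees m \<tau>" for k
    using minus_shift_degrees[OF \<tau>] by (rule keys_single_subset)
  have s: "shift \<tau> n \<in> degrees m \<sigma>" for n by (rule shift_degrees[OF \<tau>])
  have ts: "?t (k + l) * monomial (shift \<tau> l) 1 = ?t k" for k l
    by (simp add: mult_single flip: shift_plus)
  \<comment> \<open>Expanding a fraction by a power of the denominator does not change it modulo the relations.\<close>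
  have expand: "frag_of (?t k, x) - frag_of (?t (k + l), monomial (shift \<tau> l) 1 \<odot>\<^bsub>M\<^esub> x) \<in> ?R"
    if "x \<in> carrier M" for k l x
    using basic(4)[OF t[of "k + l"] keys_single_subset[OF s[of l], of 1] that] by (simp only: ts)
  define D where "D z \<longleftrightarrow> (\<exists>k. \<exists>x \<in> carrier M. z - frag_of (?t k, x) \<in> ?R)" for z
  have common: "\<exists>k x y. x \<in> carrier M \<and> y \<in> carrier M \<and> u - frag_of (?t k, x) \<in> ?R \<and> v - frag_of (?t k, y) \<in> ?R"
    if D: "D u" "D v" for u v
  proof -
    obtain k x l y where x: "x \<in> carrier M" "u - frag_of (?t k, x) \<in> ?R"
      and y: "y \<in> carrier M" "v - frag_of (?t l, y) \<in> ?R" using D unfolding D_def by blast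
    have "u - frag_of (?t (k + l), monomial (shift \<tau> l) 1 \<odot>\<^bsub>M\<^esub> x) \<in> ?R"
      using Rplus[OF x(2) expand[OF x(1), of k l]] by simp
    moreover have "v - frag_of (?t (k + l), monomial (shift \<tau> k) 1 \<odot>\<^bsub>M\<^esub> y) \<in> ?R"
      using Rplus[OF y(2) expand[OF y(1), of l k]] by (simp add: add.commute)
    ultimately show ?thesis
      using M.act_closed[OF s x(1), of l 1] M.act_closed[OF s y(1), of k 1]
      by (intro exI[of _ "k + l"] exI[of _ "monomial (shift \<tau> l) 1 \<odot>\<^bsub>M\<^esub> x"] exI[of _ "monomial (shift \<tau> k) 1 \<odot>\<^bsub>M\<^esub> y"]) auto
  qed
  have Dplus: "D (u + v)" if D: "D u" "D v" for u v
  proof -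
    obtain k x y where xy: "x \<in> carrier M" "y \<in> carrier M" "u - frag_of (?t k, x) \<in> ?R" "v - frag_of (?t k, y) \<in> ?R"
      using common[OF D] by blast
    have "u + v - frag_of (?t k, x \<oplus>\<^bsub>M\<^esub> y) =
       (u - frag_of (?t k, x)) + (v - frag_of (?t k, y)) - (frag_of (?t k, x \<oplus>\<^bsub>M\<^esub> y) - frag_of (?t k, x) - frag_of (?t k, y))"
      by (simp add: algebra_simps)
    also have "\<dots> \<in> ?R" by (intro Rdiff Rplus xy basic(3) t)
    finally show ?thesis unfolding D_def using xy(1,2) by blast
  qed
  have Ddiff: "D (u - v)" if D: "D u" "D v" for u v
  proof -
    obtain k x y where xy: "x \<in> carrier M" "y \<in> carrier M" "u - frag_of (?t k, x) \<in> ?R" "v - frag_of (?t k, y) \<in> ?R"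
      using common[OF D] by blast
    let ?d = "x \<ominus>\<^bsub>M\<^esub> y"
    have d: "?d \<in> carrier M" "?d \<oplus>\<^bsub>M\<^esub> y = x" using xy
      by (simp_all add: a_minus_def M.LM.M.a_assoc M.LM.M.l_neg)
    have "u - v - frag_of (?t k, ?d) =
       (u - frag_of (?t k, x)) - (v - frag_of (?t k, y)) + (frag_of (?t k, ?d \<oplus>\<^bsub>M\<^esub> y) - frag_of (?t k, ?d) - frag_of (?t k, y))"
      by (simp add: algebra_simps d)
    also have "\<dots> \<in> ?R" by (intro Rdiff Rplus xy basic(3) t d)
    finally show ?thesis unfolding D_def using d by blast
  qed
  have Dcong: "D v" if uv: "u - v \<in> ?R" "D u" for u v
  proof -
    obtain k x where x: "x \<in> carrier M" "u - frag_of (?t k, x) \<in> ?R" using uv unfolding D_def by blast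
    have "v - frag_of (?t k, x) = (u - frag_of (?t k, x)) - (u - v)" by simp
    also have "\<dots> \<in> ?R" by (rule Rdiff[OF x(2) uv(1)])
    finally show ?thesis unfolding D_def using x(1) by blast
  qed
  have D0: "D 0"
  proof -
    have "frag_of (?t 0, \<zero>\<^bsub>M\<^esub> \<oplus>\<^bsub>M\<^esub> \<zero>\<^bsub>M\<^esub>) - frag_of (?t 0, \<zero>\<^bsub>M\<^esub>) - frag_of (?t 0, \<zero>\<^bsub>M\<^esub>) \<in> ?R"
      by (intro basic(3) t M.LM.M.zero_closed)
    then show ?thesis unfolding D_def using M.LM.M.zero_closed by (intro exI[of _ 0] bexI) auto
  qed
  have Dfrag: "D (frag_of (b, x))" if "Poly_Mapping.keys b \<subseteq> degrees m \<tau>" "x \<in> carrier M" for b x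
    using that
  proof (induction b rule: monoid_algebra_induct)
    case zero
    have "frag_of (0 + 0, x) - frag_of (0, x) - frag_of (0, x) \<in> ?R"
      using zero by (intro basic(2)) auto
    then have "0 - frag_of (0, x) \<in> ?R" by simp
    then show ?case using D0 Dcong by blast
  next
    case (add e c p)
    obtain n where n: "e + shift \<tau> n \<in> degrees m {}" using clear_denominator[OF \<tau> add(1)] by blast
    then have n': "e + shift \<tau> n \<in> degrees m \<sigma>" using degrees_mono[of "{}" \<sigma> m] by auto
    let ?x = "monomial (e + shift \<tau> n) c \<odot>\<^bsub>M\<^esub> x"
    have "frag_of (?t n * monomial (e + shift \<tau> n) c, x) - frag_of (?t n, ?x) \<in> ?R"
      using n' add by (intro basic(4) t keys_single_subset)
    then have "frag_of (monomial e c, x) - frag_of (?t n, ?x) \<in> ?R" by (simp add: mult_single)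
    then have "D (frag_of (monomial e c, x))" unfolding D_def using M.act_closed[OF n'] add by blast
    then have "D (frag_of (monomial e c, x) + frag_of (p, x))" using Dplus add by blast
    moreover have "- (frag_of (monomial e c + p, x) - frag_of (monomial e c, x) - frag_of (p, x)) \<in> ?R"
      using add by (intro Rminus basic(2) keys_single_subset)
    then have "frag_of (monomial e c, x) + frag_of (p, x) - frag_of (monomial e c + p, x) \<in> ?R" by (simp add: algebra_simps)
    ultimately show ?case using Dcong by blast
  qed
  have "D (frag_of a)" if "a \<in> carrier (loc_ring m \<tau>) \<times> carrier M" for a
    using that Dfrag[of "fst a" "snd a"] by (auto simp: loc_ring_def)
  then have "D z" using free_Abelian_group_induct[OF z, of D] D0 Ddiff by blast
  then show ?thesis by (simp add: D_def)
qed

text \<open>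
  The homogeneous elements of \<open>N\<close> are images of tensors by the first condition, which gives
  surjectivity. An element of the kernel is a fraction \<open>1/t \<otimes> x\<close>; then \<open>\<phi> x = 0\<close> as \<open>t\<close> is a unit on
  \<open>N\<close>, and \<open>1/t \<otimes> x = 1/(t t') \<otimes> t' x\<close> vanishes for a suitable \<open>t'\<close> by the second condition.
\<close>

lemma induces_base_change_isoI:
  fixes M N :: "('k::field, 'v) gmod"
  assumes \<phi>: "graded_map m \<sigma> \<tau> M N \<phi>" and \<tau>: "\<tau> \<subseteq> {1..m}"
    and surj: "\<And>y d. d \<in> degrees m \<tau> \<Longrightarrow> y \<in> component N d \<Longrightarrow>
      \<exists>e \<in> degrees m \<tau>. \<exists>x \<in> carrier M. y = monomial e 1 \<odot>\<^bsub>N\<^esub> \<phi> x"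
    and ker: "\<And>x. x \<in> carrier M \<Longrightarrow> \<phi> x = \<zero>\<^bsub>N\<^esub> \<Longrightarrow> \<exists>n. monomial (shift \<tau> n) 1 \<odot>\<^bsub>M\<^esub> x = \<zero>\<^bsub>M\<^esub>"
  shows "induces_base_change_iso (loc_ring m \<sigma>) (loc_ring m \<tau>) M N \<phi>"
proof -
  interpret \<phi>: graded_map m \<sigma> \<tau> M N \<phi> by fact
  let ?R = "tensor_relations (loc_ring m \<sigma>) (loc_ring m \<tau>) M"
  let ?S = "carrier (loc_ring m \<tau> :: 'k laurent ring) \<times> carrier M"
  let ?G = "free_Abelian_group ?S"
  let ?t = "\<lambda>k. monomial (- shift \<tau> k) (1::'k)"
  note basic = tensor_relations_basic[OF \<phi>.M \<phi>.sub]
  interpret G: comm_group ?G by (rule abelian_free_Abelian_group)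
  obtain h0 where h0: "h0 \<in> hom ?G (add_monoid N)"
    and h0_frag: "\<And>p. p \<in> ?S \<Longrightarrow> h0 (frag_of p) = fst p \<odot>\<^bsub>N\<^esub> \<phi> (snd p)"
  proof (rule comm_group.free_Abelian_group_universal[OF \<phi>.N.LM.M.a_comm_group, of "\<lambda>p. fst p \<odot>\<^bsub>N\<^esub> \<phi> (snd p)" ?S])
    show "(\<lambda>p. fst p \<odot>\<^bsub>N\<^esub> \<phi> (snd p)) ` ?S \<subseteq> carrier (add_monoid N)"
      by (auto simp: loc_ring_def intro!: \<phi>.N.LM.smult_closed \<phi>.closed)
  qed blast
  interpret h0: group_hom ?G "add_monoid N" h0
    by (intro group_hom.intro group_hom_axioms.intro h0 G.is_group \<phi>.N.LM.M.a_group)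
  have h0_diff: "h0 (u - v) = h0 u \<ominus>\<^bsub>N\<^esub> h0 v" if "u \<in> carrier ?G" "v \<in> carrier ?G" for u v
    using h0.hom_mult[OF that(1), of "- v"] h0.hom_inv[OF that(2)] that
    by (simp add: a_minus_def a_inv_def keys_minus)
  have h0_b: "h0 (frag_of (b, x)) = b \<odot>\<^bsub>N\<^esub> \<phi> x" if "Poly_Mapping.keys b \<subseteq> degrees m \<tau>" "x \<in> carrier M" for b x
    using h0_frag[of "(b, x)"] that by (simp add: loc_ring_def)
  have S: "frag_of (b, x) \<in> carrier ?G" if "Poly_Mapping.keys b \<subseteq> degrees m \<tau>" "x \<in> carrier M" for b x
    using that by (simp add: loc_ring_def)
  have Nc: "b \<odot>\<^bsub>N\<^esub> \<phi> x \<in> carrier N" if "Poly_Mapping.keys b \<subseteq> degrees m \<tau>" "x \<in> carrier M" for b x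
    using that by (intro \<phi>.N.LM.smult_closed \<phi>.closed) auto
  have Gdiff: "u - v \<in> carrier ?G" if "u \<in> carrier ?G" "v \<in> carrier ?G" for u v
    using that keys_diff[of u v] by auto
  have kernel: "?R \<subseteq> kernel ?G (add_monoid N) h0"
    unfolding tensor_relations_def
  proof (rule G.generate_subgroup_incl[OF _ h0.subgroup_kernel], intro Un_least subsetI; elim CollectE exE conjE; hypsubst)
    fix b b' :: "'k laurent" and x assume "b \<in> carrier (loc_ring m \<tau>)" "b' \<in> carrier (loc_ring m \<tau>)" and x: "x \<in> carrier M"
    then have b: "Poly_Mapping.keys b \<subseteq> degrees m \<tau>" "Poly_Mapping.keys b' \<subseteq> degrees m \<tau>" by (auto simp: loc_ring_def)
    note k = keys_add_subset[OF b]
    have "h0 (frag_of (b + b', x) - frag_of (b, x) - frag_of (b', x)) = \<zero>\<^bsub>N\<^esub>"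
      using b k x Nc[OF b(1) x] Nc[OF b(2) x]
      by (simp only: h0_diff S Gdiff h0_b \<phi>.N.smult_plus_left \<phi>.closed)
        (simp add: \<phi>.N.LM.M.minus_eq \<phi>.N.LM.M.a_ac \<phi>.N.LM.M.r_neg \<phi>.N.LM.M.r_neg1 \<phi>.N.LM.M.r_neg2)
    then show "frag_of (b \<oplus>\<^bsub>loc_ring m \<tau>\<^esub> b', x) - frag_of (b, x) - frag_of (b', x) \<in> kernel ?G (add_monoid N) h0"
      using b k x by (simp add: kernel_def loc_ring_def Gdiff[unfolded carrier_free_Abelian_group_iff loc_ring_def])
  next
    fix b :: "'k laurent" and x x' assume "b \<in> carrier (loc_ring m \<tau>)" and x: "x \<in> carrier M" "x' \<in> carrier M"
    then have b: "Poly_Mapping.keys b \<subseteq> degrees m \<tau>" by (auto simp: loc_ring_def)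
    have "b \<odot>\<^bsub>N\<^esub> \<phi> (x \<oplus>\<^bsub>M\<^esub> x') = b \<odot>\<^bsub>N\<^esub> \<phi> x \<oplus>\<^bsub>N\<^esub> b \<odot>\<^bsub>N\<^esub> \<phi> x'"
      using b x by (simp add: \<phi>.plus \<phi>.closed \<phi>.N.LM.smult_r_distr)
    then have "h0 (frag_of (b, x \<oplus>\<^bsub>M\<^esub> x') - frag_of (b, x) - frag_of (b, x')) = \<zero>\<^bsub>N\<^esub>"
      using b x Nc[OF b x(1)] Nc[OF b x(2)]
      by (simp only: h0_diff S Gdiff h0_b \<phi>.M.LM.M.a_closed)
        (simp add: \<phi>.N.LM.M.minus_eq \<phi>.N.LM.M.a_ac \<phi>.N.LM.M.r_neg \<phi>.N.LM.M.r_neg1 \<phi>.N.LM.M.r_neg2)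
    then show "frag_of (b, x \<oplus>\<^bsub>M\<^esub> x') - frag_of (b, x) - frag_of (b, x') \<in> kernel ?G (add_monoid N) h0"
      using b x by (simp add: kernel_def loc_ring_def Gdiff[unfolded carrier_free_Abelian_group_iff loc_ring_def])
  next
    fix a b :: "'k laurent" and x assume "a \<in> carrier (loc_ring m \<sigma>)" "b \<in> carrier (loc_ring m \<tau>)" and x: "x \<in> carrier M"
    then have a: "Poly_Mapping.keys a \<subseteq> degrees m \<sigma>" and b: "Poly_Mapping.keys b \<subseteq> degrees m \<tau>" by (auto simp: loc_ring_def)
    have a': "Poly_Mapping.keys a \<subseteq> degrees m \<tau>" using a degrees_mono[OF \<phi>.sub, of m] by blast
    have ax: "a \<odot>\<^bsub>M\<^esub> x \<in> carrier M" using a x by (intro \<phi>.M.LM.smult_closed) auto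
    have ba: "Poly_Mapping.keys (b * a) \<subseteq> degrees m \<tau>" by (rule keys_mult_subset[OF add_submonoid_degrees b a'])
    have "(b * a) \<odot>\<^bsub>N\<^esub> \<phi> x = b \<odot>\<^bsub>N\<^esub> \<phi> (a \<odot>\<^bsub>M\<^esub> x)"
      using \<phi>.N.LM.smult_assoc[of b a "\<phi> x"] a a' b x by (simp add: \<phi>.smult \<phi>.closed)
    then have "h0 (frag_of (b * a, x) - frag_of (b, a \<odot>\<^bsub>M\<^esub> x)) = \<zero>\<^bsub>N\<^esub>"
      using b x ax ba Nc[OF b ax] by (simp only: h0_diff S h0_b) (simp add: \<phi>.N.LM.M.minus_eq \<phi>.N.LM.M.r_neg)
    then show "frag_of (b \<otimes>\<^bsub>loc_ring m \<tau>\<^esub> a, x) - frag_of (b, a \<odot>\<^bsub>M\<^esub> x) \<in> kernel ?G (add_monoid N) h0"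
      using b x ax ba by (simp add: kernel_def loc_ring_def Gdiff[unfolded carrier_free_Abelian_group_iff loc_ring_def])
  qed
  have normal: "?R \<lhd> ?G" using basic(1) by (rule G.subgroup_imp_normal)
  obtain g where g: "g \<in> hom (?G Mod ?R) (add_monoid N)" and g_coset: "\<And>x. x \<in> carrier ?G \<Longrightarrow> g (?R #>\<^bsub>?G\<^esub> x) = h0 x"
    using h0.FactGroup_universal_kernel[OF normal kernel] by blast
  interpret g: group_hom "?G Mod ?R" "add_monoid N" g
    by (intro group_hom.intro group_hom_axioms.intro g normal.factorgroup_is_group normal \<phi>.N.LM.M.a_group)
  have g_pure: "g (?R #>\<^bsub>?G\<^esub> frag_of (b, x)) = b \<odot>\<^bsub>N\<^esub> \<phi> x" if "Poly_Mapping.keys b \<subseteq> degrees m \<tau>" "x \<in> carrier M" for b x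
    using g_coset[OF S[OF that]] h0_b[OF that] by simp
  have coset: "?R #>\<^bsub>?G\<^esub> x \<in> carrier (?G Mod ?R)" if "x \<in> carrier ?G" for x
    using that by (simp add: carrier_FactGroup)
  have onto: "y \<in> g ` carrier (?G Mod ?R)" if "y \<in> carrier N" for y
    using that
  proof (induction y rule: \<phi>.N.homogeneous_induct)
    case zero
    show ?case using g.hom_one g.G.one_closed by (metis imageI monoid.simps(2))
  next
    case (plus x y)
    then obtain X Y where "X \<in> carrier (?G Mod ?R)" "x = g X" "Y \<in> carrier (?G Mod ?R)" "y = g Y" by blast
    then show ?case using g.hom_mult[of X Y] g.G.m_closed[of X Y] by (intro image_eqI[of _ _ "X \<otimes>\<^bsub>?G Mod ?R\<^esub> Y"]) auto
  next
    case (homogeneous y d)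
    then obtain e x where e: "e \<in> degrees m \<tau>" "x \<in> carrier M" "y = monomial e 1 \<odot>\<^bsub>N\<^esub> \<phi> x" using surj by blast
    have k: "Poly_Mapping.keys (monomial e (1::'k)) \<subseteq> degrees m \<tau>" using e(1) by (rule keys_single_subset)
    show ?case using g_pure[OF k e(2)] e(3) coset[OF S[OF k e(2)]] by (intro image_eqI) auto
  qed
  have inj: "X = \<one>\<^bsub>?G Mod ?R\<^esub>" if X: "X \<in> carrier (?G Mod ?R)" "g X = \<one>\<^bsub>add_monoid N\<^esub>" for X
  proof -
    obtain z where z: "z \<in> carrier ?G" "X = ?R #>\<^bsub>?G\<^esub> z" using X(1) by (auto simp: carrier_FactGroup)
    obtain k x where x: "x \<in> carrier M" and zx: "z - frag_of (?t k, x) \<in> ?R"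
      using tensor_common_denominator[OF \<phi>.M \<phi>.sub \<tau>, of z] z(1) by auto
    have t: "Poly_Mapping.keys (?t k) \<subseteq> degrees m \<tau>" for k
      using minus_shift_degrees[OF \<tau>] by (rule keys_single_subset)
    have s: "shift \<tau> n \<in> degrees m \<rho>" for n \<rho> by (rule shift_degrees[OF \<tau>])
    have "h0 z = \<zero>\<^bsub>N\<^esub>" using X z g_coset by simp
    moreover have "h0 (z - frag_of (?t k, x)) = \<zero>\<^bsub>N\<^esub>" using zx kernel by (auto simp: kernel_def)
    ultimately have "\<zero>\<^bsub>N\<^esub> \<ominus>\<^bsub>N\<^esub> (?t k \<odot>\<^bsub>N\<^esub> \<phi> x) = \<zero>\<^bsub>N\<^esub>"
      using h0_diff[OF z(1) S[OF t x, of k]] h0_b[OF t x, of k] by simp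
    then have tx: "?t k \<odot>\<^bsub>N\<^esub> \<phi> x = \<zero>\<^bsub>N\<^esub>"
      using Nc[OF t x, of k] by (simp add: \<phi>.N.LM.M.minus_eq \<phi>.N.LM.M.minus_equality)
    have "\<phi> x = monomial (shift \<tau> k) 1 \<odot>\<^bsub>N\<^esub> (?t k \<odot>\<^bsub>N\<^esub> \<phi> x)"
      using \<phi>.N.act_act[OF s minus_shift_degrees[OF \<tau>] \<phi>.closed[OF x]] \<phi>.N.act_one[OF \<phi>.closed[OF x]] by simp
    then have "\<phi> x = \<zero>\<^bsub>N\<^esub>" using \<phi>.N.act_zero[OF s] by (simp add: tx)
    then obtain n where n: "monomial (shift \<tau> n) 1 \<odot>\<^bsub>M\<^esub> x = \<zero>\<^bsub>M\<^esub>" using ker x by blast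
    have "?t (k + n) * monomial (shift \<tau> n) 1 = ?t k" by (simp add: mult_single flip: shift_plus)
    then have 1: "frag_of (?t k, x) - frag_of (?t (k + n), \<zero>\<^bsub>M\<^esub>) \<in> ?R"
      using basic(4)[OF t[of "k + n"] keys_single_subset[OF s[of n \<sigma>], of 1] x] by (simp add: n)
    have 2: "frag_of (?t (k + n), \<zero>\<^bsub>M\<^esub> \<oplus>\<^bsub>M\<^esub> \<zero>\<^bsub>M\<^esub>) - frag_of (?t (k + n), \<zero>\<^bsub>M\<^esub>) - frag_of (?t (k + n), \<zero>\<^bsub>M\<^esub>) \<in> ?R"
      by (intro basic(3) t \<phi>.M.LM.M.zero_closed)
    interpret R: subgroup ?R ?G by (rule basic(1))
    have "z = (z - frag_of (?t k, x)) \<otimes>\<^bsub>?G\<^esub> (frag_of (?t k, x) - frag_of (?t (k + n), \<zero>\<^bsub>M\<^esub>)) \<otimes>\<^bsub>?G\<^esub> frag_of (?t (k + n), \<zero>\<^bsub>M\<^esub>)"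
      by simp
    also have "\<dots> \<in> ?R"
    proof (intro R.m_closed zx 1)
      have "- frag_of (?t (k + n), \<zero>\<^bsub>M\<^esub>) \<in> ?R" using 2 by simp
      from R.m_inv_closed[OF this] show "frag_of (?t (k + n), \<zero>\<^bsub>M\<^esub>) \<in> ?R"
        using S[OF t \<phi>.M.LM.M.zero_closed, of "k + n"] by (simp add: keys_minus)
    qed
    finally show ?thesis using G.coset_join2[OF z(1) basic(1)] z(2) by simp
  qed
  have "g \<in> iso (?G Mod ?R) (add_monoid N)"
    using onto inj by (auto simp: g.iso_iff)
  then show ?thesis
    unfolding induces_base_change_iso_def base_change_def pure_tensor_def
    using g_pure by (intro bexI[of _ g]) (auto simp: loc_ring_def)
qed

section \<open>Germs at infinity\<close>

text \<open>
  An element of a sequential colimit is represented by any sequence that follows the transition maps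
  from some index on, and two such sequences represent the same element if and only if they agree from
  some index on.
\<close>

quotient_type 'v germ = "nat \<Rightarrow> 'v" / "\<lambda>u v. \<forall>\<^sub>F n in sequentially. u n = v n"
  by (intro equivpI reflpI sympI transpI) (auto elim: eventually_mono eventually_elim2)

lift_definition germ :: "(nat \<Rightarrow> 'v) \<Rightarrow> 'v germ" is "\<lambda>u. u" .

lift_definition germ_map :: "(nat \<Rightarrow> 'v \<Rightarrow> 'w) \<Rightarrow> 'v germ \<Rightarrow> 'w germ" is "\<lambda>f u n. f n (u n)"
  by (auto elim: eventually_mono)

lift_definition germ_map2 :: "('v \<Rightarrow> 'v \<Rightarrow> 'v) \<Rightarrow> 'v germ \<Rightarrow> 'v germ \<Rightarrow> 'v germ" is "\<lambda>f u v n. f (u n) (v n)"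
  by (auto elim: eventually_elim2)

lemma germ_eq_iff: "germ u = germ v \<longleftrightarrow> (\<forall>\<^sub>F n in sequentially. u n = v n)"
  by transfer simp

lemma germ_map_germ [simp]: "germ_map f (germ u) = germ (\<lambda>n. f n (u n))"
  by transfer simp

lemma germ_map2_germ [simp]: "germ_map2 f (germ u) (germ v) = germ (\<lambda>n. f (u n) (v n))"
  by transfer simp

section \<open>Multidegrees and bidegrees\<close>

text \<open>
  A bidegree is a multidegree supported on \<open>{1, 2}\<close>; the variables \<open>s\<close> and \<open>t\<close> with these indices
  correspond to \<open>t\<^sub>a\<close> and \<open>t\<^sub>b\<close>.
\<close>

definition corner_proj :: "nat \<Rightarrow> nat \<Rightarrow> multidegree \<Rightarrow> multidegree" where
  "corner_proj a b d = (\<lambda>i. if i = 1 then d a else if i = 2 then d b else 0)"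

definition corner_incl :: "nat \<Rightarrow> nat \<Rightarrow> multidegree \<Rightarrow> multidegree" where
  "corner_incl a b \<delta> = (\<lambda>i. if i = a then \<delta> 1 else if i = b then \<delta> 2 else 0)"

definition off :: "nat set \<Rightarrow> multidegree \<Rightarrow> multidegree" where
  "off \<sigma> e = (\<lambda>i. if i \<in> \<sigma> then 0 else e i)"

text \<open>
  Multiplication by the invertible variables identifies the components of a localisation whose degrees
  differ only in coordinates belonging to \<open>\<sigma>\<close>. Hence these coordinates can be forgotten and replaced
  by the index of a sequence.
\<close>

definition clamp :: "nat set \<Rightarrow> nat \<Rightarrow> multidegree \<Rightarrow> multidegree" where
  "clamp \<sigma> n d = (\<lambda>i. if i \<in> \<sigma> then int n else d i)"

text \<open>
  The exponent of the monomial that leads from degree \<open>d\<close> to degree \<open>clamp \<sigma> n d\<close>.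
\<close>

definition gap :: "nat set \<Rightarrow> nat \<Rightarrow> multidegree \<Rightarrow> multidegree" where
  "gap \<sigma> n d = (\<lambda>i. if i \<in> \<sigma> then int n - d i else 0)"

lemma off_degrees: "e \<in> degrees m \<sigma> \<Longrightarrow> off \<sigma> e \<in> degrees m {}"
  by (auto simp: off_def degrees_def)

lemma gap_degrees:
  assumes "\<rho> \<subseteq> {1..m}" shows "\<forall>\<^sub>F n in sequentially. gap \<rho> n d \<in> degrees m {}"
proof -
  have "finite \<rho>" using assms finite_subset by blast
  have "\<forall>\<^sub>F n in sequentially. \<forall>i \<in> \<rho>. d i \<le> int n"
    using \<open>finite \<rho>\<close>
  proof (rule eventually_ball_finite, intro ballI)
    fix i show "\<forall>\<^sub>F n in sequentially. d i \<le> int n"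
      using eventually_ge_at_top[of "nat (d i)"] by eventually_elim linarith
  qed
  then show ?thesis by eventually_elim (use assms in \<open>auto simp: gap_def degrees_def\<close>)
qed

lemma clamp_degrees: "d \<in> degrees m \<sigma> \<Longrightarrow> \<sigma> \<subseteq> {1..m} \<Longrightarrow> clamp \<sigma> n d \<in> degrees m {}"
  by (auto simp: clamp_def degrees_def)

lemma diff_clamp_degrees: "d \<in> degrees m \<sigma> \<Longrightarrow> \<sigma> \<subseteq> {1..m} \<Longrightarrow> d - clamp \<sigma> n d \<in> degrees m \<sigma>"
  by (auto simp: clamp_def degrees_def)

lemma clamp_plus_off: "clamp \<sigma> n d + off \<sigma> e = clamp \<sigma> n (d + e)"
  and clamp_plus_gap: "\<sigma> \<subseteq> \<tau> \<Longrightarrow> clamp \<sigma> n d + gap (\<tau> - \<sigma>) n d = clamp \<tau> n d"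
  and plus_gap: "d + gap \<sigma> n d = clamp \<sigma> n d"
  and gap_plus_shift: "gap \<sigma> n d + shift \<sigma> 1 = gap \<sigma> (Suc n) d"
  and shift_diff_plus: "\<sigma> \<subseteq> \<tau> \<Longrightarrow> shift (\<tau> - \<sigma>) n + shift \<sigma> n = shift \<tau> n"
  and gap_plus_off: "\<sigma> \<subseteq> \<tau> \<Longrightarrow> gap (\<tau> - \<sigma>) n (d + e) + off \<sigma> e = gap (\<tau> - \<sigma>) n d + off \<tau> e"
  and gap_plus: "gap \<sigma> n (d + e) + e = gap \<sigma> n d + off \<sigma> e"
  and gap_plus_gap: "\<sigma> \<subseteq> \<tau> \<Longrightarrow> \<tau> \<subseteq> \<upsilon> \<Longrightarrow> gap (\<upsilon> - \<tau>) n d + gap (\<tau> - \<sigma>) n d = gap (\<upsilon> - \<sigma>) n d"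
  and gap_plus_gap': "\<sigma> \<subseteq> \<tau> \<Longrightarrow> gap (\<tau> - \<sigma>) n d + gap \<sigma> n d = gap \<tau> n d"
  and off_plus: "off \<sigma> e + off \<sigma> e' = off \<sigma> (e + e')"
  and off_diff_clamp: "off \<sigma> (d - clamp \<sigma> n d) = 0"
  and gap_clamp: "n0 \<le> n \<Longrightarrow> gap \<sigma> n (clamp \<sigma> n0 d) = shift \<sigma> (n - n0)"
  and off_shift: "\<sigma> \<subseteq> \<tau> \<Longrightarrow> off \<sigma> (shift \<tau> n) = shift (\<tau> - \<sigma>) n"
  and off_zero: "off \<sigma> 0 = 0"
  and gap_empty: "gap {} n d = 0"
  by (auto simp: clamp_def off_def gap_def shift_def fun_eq_iff)

locale corner =
  fixes m a b :: nat
  assumes ab: "a \<in> {1..m}" "b \<in> {1..m}" "a \<noteq> b"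
begin

abbreviation \<pi> where "\<pi> \<equiv> corner_proj a b"
abbreviation \<iota> where "\<iota> \<equiv> corner_incl a b"

lemma proj_plus: "\<pi> (d + e) = \<pi> d + \<pi> e"
  and proj_diff: "\<pi> (d - e) = \<pi> d - \<pi> e"
  and proj_zero: "\<pi> 0 = 0"
  and incl_plus: "\<iota> (d + e) = \<iota> d + \<iota> e"
  by (auto simp: corner_proj_def corner_incl_def fun_eq_iff)

lemma proj_degrees: "d \<in> degrees m {} \<Longrightarrow> \<pi> d \<in> degrees 2 {}"
  using ab by (auto simp: degrees_def corner_proj_def)

lemma incl_degrees: "\<delta> \<in> degrees 2 {} \<Longrightarrow> \<iota> \<delta> \<in> degrees m \<sigma>"
  using ab by (auto simp: degrees_def corner_incl_def)

lemma proj_incl: "\<delta> \<in> degrees 2 {} \<Longrightarrow> \<pi> (\<iota> \<delta>) = \<delta>"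
  using ab by (auto simp: degrees_def corner_incl_def corner_proj_def fun_eq_iff)

lemma diff_incl_proj_degrees: "d \<in> degrees m {} \<Longrightarrow> d - \<iota> (\<pi> d) \<in> degrees m {}"
  using ab by (auto simp: degrees_def corner_incl_def corner_proj_def)

end

section \<open>Extending and localising a bigraded module\<close>

text \<open>
  The pieces of \<open>R\<^sub>\<sigma> \<otimes> N\<close>. In degree \<open>d\<close> an element is represented by a sequence whose \<open>n\<close>-th entry
  has the bidegree of \<open>clamp \<sigma> n d\<close> and which eventually is compatible with multiplication by the
  product of the variables in \<open>\<sigma>\<close>. The invertible variables act on germs as the identity, changing
  only the piece in which the germ is considered; this is why \<open>off \<sigma>\<close> appears in the action.
\<close>

definition germ_sys ::
  "nat \<Rightarrow> nat \<Rightarrow> nat \<Rightarrow> ('k::field, 'v) gmod \<Rightarrow> nat set \<Rightarrow> ('k, 'v germ) gsys" where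
  "germ_sys m a b N \<sigma> =
     \<lparr>piece = (\<lambda>d. if d \<in> degrees m \<sigma> then
        {germ u | u. \<forall>\<^sub>F n in sequentially. u n \<in> component N (corner_proj a b (clamp \<sigma> n d)) \<and>
           u (Suc n) = monomial (corner_proj a b (shift \<sigma> 1)) 1 \<odot>\<^bsub>N\<^esub> u n}
        else {germ (\<lambda>n. \<zero>\<^bsub>N\<^esub>)}),
      null = germ (\<lambda>n. \<zero>\<^bsub>N\<^esub>),
      padd = germ_map2 (ring.add N),
      pact = (\<lambda>e c. germ_map (\<lambda>n x. monomial (corner_proj a b (off \<sigma> e)) c \<odot>\<^bsub>N\<^esub> x))\<rparr>"

locale kst_module = corner m a b + N: gmodule 2 "{}" N
  for m a b and N :: "('k::field, 'v) gmod" +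
  assumes infinite_universe: "infinite (UNIV :: 'v set)"
begin

abbreviation Y :: "nat set \<Rightarrow> ('k, 'v germ) gsys" where "Y \<equiv> germ_sys m a b N"

text \<open>
  The polynomial ring \<open>R\<close> acts on \<open>N\<close> through the two variables \<open>t\<^sub>a\<close> and \<open>t\<^sub>b\<close>, the others acting
  as the identity; accordingly \<open>N\<close> is regarded as graded by multidegrees, with components \<open>NN\<close>.
\<close>

definition ract :: "multidegree \<Rightarrow> 'k \<Rightarrow> 'v \<Rightarrow> 'v" where
  "ract e c x = monomial (\<pi> e) c \<odot>\<^bsub>N\<^esub> x"

definition NN :: "multidegree \<Rightarrow> 'v set" where
  "NN d = component N (\<pi> d)"

lemma ract_NN: "e \<in> degrees m {} \<Longrightarrow> x \<in> NN d \<Longrightarrow> ract e c x \<in> NN (d + e)"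
  by (simp add: ract_def NN_def proj_plus N.act_component proj_degrees)

lemma NN_closed: "x \<in> NN d \<Longrightarrow> x \<in> carrier N"
  by (auto simp: NN_def N.component_closed)

lemma zero_NN: "\<zero>\<^bsub>N\<^esub> \<in> NN d"
  and plus_NN: "x \<in> NN d \<Longrightarrow> y \<in> NN d \<Longrightarrow> x \<oplus>\<^bsub>N\<^esub> y \<in> NN d"
  and minus_NN: "x \<in> NN d \<Longrightarrow> \<ominus>\<^bsub>N\<^esub> x \<in> NN d"
  by (simp_all add: NN_def N.zero_component N.plus_component N.minus_component)

lemma ract_closed: "e \<in> degrees m {} \<Longrightarrow> x \<in> carrier N \<Longrightarrow> ract e c x \<in> carrier N"
  by (simp add: ract_def N.act_closed proj_degrees)

lemma ract_plus: "e \<in> degrees m {} \<Longrightarrow> x \<in> carrier N \<Longrightarrow> y \<in> carrier N \<Longrightarrow>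
    ract e c (x \<oplus>\<^bsub>N\<^esub> y) = ract e c x \<oplus>\<^bsub>N\<^esub> ract e c y"
  by (simp add: ract_def N.act_plus proj_degrees)

lemma ract_coeff: "e \<in> degrees m {} \<Longrightarrow> x \<in> carrier N \<Longrightarrow> ract e (c + c') x = ract e c x \<oplus>\<^bsub>N\<^esub> ract e c' x"
  by (simp add: ract_def N.act_coeff_plus proj_degrees)

lemma ract_ract: "e \<in> degrees m {} \<Longrightarrow> e' \<in> degrees m {} \<Longrightarrow> x \<in> carrier N \<Longrightarrow>
    ract e c (ract e' c' x) = ract (e + e') (c * c') x"
  by (simp add: ract_def N.act_act proj_degrees proj_plus)

lemma ract_zero: "e \<in> degrees m {} \<Longrightarrow> ract e c \<zero>\<^bsub>N\<^esub> = \<zero>\<^bsub>N\<^esub>"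
  by (simp add: ract_def N.act_zero proj_degrees)

lemma ract_one: "x \<in> carrier N \<Longrightarrow> ract 0 1 x = x"
  using N.act_one[of x] by (simp add: ract_def proj_zero)

lemma ract_corner_free: "\<pi> e = 0 \<Longrightarrow> x \<in> carrier N \<Longrightarrow> ract e 1 x = x"
  using N.act_one[of x] by (simp add: ract_def)

definition coherent :: "nat set \<Rightarrow> multidegree \<Rightarrow> (nat \<Rightarrow> 'v) \<Rightarrow> bool" where
  "coherent \<sigma> d u \<longleftrightarrow>
     (\<forall>\<^sub>F n in sequentially. u n \<in> NN (clamp \<sigma> n d) \<and> u (Suc n) = ract (shift \<sigma> 1) 1 (u n))"

lemma germ_sys_simps:
  "piece (Y \<sigma>) d = (if d \<in> degrees m \<sigma> then germ ` Collect (coherent \<sigma> d) else {germ (\<lambda>n. \<zero>\<^bsub>N\<^esub>)})"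
  "null (Y \<sigma>) = germ (\<lambda>n. \<zero>\<^bsub>N\<^esub>)"
  "padd (Y \<sigma>) = germ_map2 (ring.add N)"
  "pact (Y \<sigma>) e c = germ_map (\<lambda>n. ract (off \<sigma> e) c)"
proof -
  have "ract e c = (\<lambda>x. monomial (\<pi> e) c \<odot>\<^bsub>N\<^esub> x)" for e c by (rule ext) (rule ract_def)
  then show "pact (Y \<sigma>) e c = germ_map (\<lambda>n. ract (off \<sigma> e) c)" by (simp add: germ_sys_def)
qed (auto simp: germ_sys_def coherent_def ract_def NN_def)

lemma coherent_zero: "\<sigma> \<subseteq> {1..m} \<Longrightarrow> coherent \<sigma> d (\<lambda>n. \<zero>\<^bsub>N\<^esub>)"
  by (simp add: coherent_def zero_NN ract_zero shift_degrees)

lemma pieceE: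
  assumes "x \<in> piece (Y \<sigma>) d" "\<sigma> \<subseteq> {1..m}"
  obtains u where "x = germ u" "coherent \<sigma> d u"
  using assms coherent_zero by (auto simp: germ_sys_simps split: if_splits)

lemma pieceI: "d \<in> degrees m \<sigma> \<Longrightarrow> coherent \<sigma> d u \<Longrightarrow> germ u \<in> piece (Y \<sigma>) d"
  by (auto simp: germ_sys_simps)

lemma coherent_closed: "coherent \<sigma> d u \<Longrightarrow> \<forall>\<^sub>F n in sequentially. u n \<in> carrier N"
  by (auto simp: coherent_def NN_closed elim!: eventually_mono)

lemma coherent_plus:
  assumes \<sigma>: "\<sigma> \<subseteq> {1..m}" and u: "coherent \<sigma> d u" and v: "coherent \<sigma> d v"
  shows "coherent \<sigma> d (\<lambda>n. u n \<oplus>\<^bsub>N\<^esub> v n)"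
  using u v unfolding coherent_def
  by eventually_elim (auto simp: plus_NN NN_closed ract_plus shift_degrees[OF \<sigma>])

lemma coherent_minus:
  assumes \<sigma>: "\<sigma> \<subseteq> {1..m}" and u: "coherent \<sigma> d u"
  shows "coherent \<sigma> d (\<lambda>n. \<ominus>\<^bsub>N\<^esub> u n)"
proof -
  have "ract e 1 (\<ominus>\<^bsub>N\<^esub> x) = \<ominus>\<^bsub>N\<^esub> ract e 1 x" if "e \<in> degrees m {}" "x \<in> carrier N" for e x
    using that by (intro additive_minus[of N N] N.LM.abelian_group_axioms) (auto simp: ract_closed ract_plus)
  then show ?thesis
    using u unfolding coherent_def
    by (elim eventually_mono) (auto simp: minus_NN NN_closed shift_degrees[OF \<sigma>])
qed

lemma coherent_ract:
  assumes \<sigma>: "\<sigma> \<subseteq> {1..m}" and u: "coherent \<sigma> d u" and e: "e \<in> degrees m \<sigma>"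
  shows "coherent \<sigma> (d + e) (\<lambda>n. ract (off \<sigma> e) c (u n))"
  using u unfolding coherent_def
proof eventually_elim
  case (elim n)
  then have "ract (off \<sigma> e) c (u n) \<in> NN (clamp \<sigma> n (d + e))"
    using ract_NN[OF off_degrees[OF e], of "u n" "clamp \<sigma> n d" c] by (simp only: clamp_plus_off)
  moreover have "u n \<in> carrier N" using elim NN_closed by blast
  ultimately show ?case
    using elim by (simp add: ract_ract off_degrees[OF e] shift_degrees[OF \<sigma>] add.commute)
qed

lemma coherent_iterate:
  assumes \<sigma>: "\<sigma> \<subseteq> {1..m}"
    and "\<And>n. n \<ge> n0 \<Longrightarrow> u n \<in> carrier N \<and> u (Suc n) = ract (shift \<sigma> 1) 1 (u n)"
  shows "u (n0 + k) = ract (shift \<sigma> k) 1 (u n0)"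
proof (induction k)
  case (Suc k)
  then show ?case using assms(2)[of "n0 + k"] assms(2)[of n0] shift_plus[of \<sigma> 1 k]
    by (simp add: ract_ract shift_degrees[OF \<sigma>])
qed (use assms(2)[of n0] ract_one[of "u n0"] in \<open>simp only: shift_zero add_0_right\<close>)

text \<open>
  A germ is determined by an index from which on it is compatible and its entry at that index.
\<close>

lemma encodable_germ_sys:
  assumes \<sigma>: "\<sigma> \<subseteq> {1..m}" shows "encodable TYPE('v) (Y \<sigma>)"
proof -
  have "\<exists>n u. g = germ u \<and> (\<forall>k. u (n + k) = ract (shift \<sigma> k) 1 (u n))" if g: "g \<in> (\<Union>d. piece (Y \<sigma>) d)" for g
  proof -
    obtain d where "g \<in> piece (Y \<sigma>) d" using g by blast
    then obtain u where u: "g = germ u" "coherent \<sigma> d u" using \<sigma> by (rule pieceE)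
    then obtain n where "\<And>i. i \<ge> n \<Longrightarrow> u i \<in> carrier N \<and> u (Suc i) = ract (shift \<sigma> 1) 1 (u i)"
      unfolding coherent_def eventually_sequentially using NN_closed by blast
    then have "\<forall>k. u (n + k) = ract (shift \<sigma> k) 1 (u n)" by (intro allI coherent_iterate[OF \<sigma>])
    then show ?thesis using u(1) by blast
  qed
  then obtain n u where nu: "\<And>g. g \<in> (\<Union>d. piece (Y \<sigma>) d) \<Longrightarrow>
      g = germ (u g) \<and> (\<forall>k. u g (n g + k) = ract (shift \<sigma> k) 1 (u g (n g)))" by metis
  have "(UNIV :: (nat \<times> 'v) set) \<lesssim> (UNIV :: 'v set) \<times> (UNIV :: 'v set)"
    unfolding UNIV_Times_UNIV[symmetric]
    by (intro times_lepoll_mono lepoll_refl) (use infinite_universe in \<open>simp add: infinite_le_lepoll\<close>)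
  also have "(UNIV :: 'v set) \<times> (UNIV :: 'v set) \<approx> (UNIV :: 'v set)"
    using card_of_Times_same_infinite[OF infinite_universe] by (simp add: eqpoll_iff_card_of_ordIso)
  finally obtain p :: "nat \<times> 'v \<Rightarrow> 'v" where p: "inj p" by (auto simp: lepoll_def)
  have "inj_on (\<lambda>g. p (n g, u g (n g))) (\<Union>d. piece (Y \<sigma>) d)"
  proof (rule inj_onI)
    fix g h assume g: "g \<in> (\<Union>d. piece (Y \<sigma>) d)" and h: "h \<in> (\<Union>d. piece (Y \<sigma>) d)"
      and "p (n g, u g (n g)) = p (n h, u h (n h))"
    then have eq: "n g = n h" "u g (n g) = u h (n h)" using p by (auto dest: injD)
    have "u g i = u h i" if "i \<ge> n g" for i
      using nu[OF g] nu[OF h] eq that by (metis le_add_diff_inverse)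
    then have "germ (u g) = germ (u h)" unfolding germ_eq_iff eventually_sequentially by blast
    then show "g = h" using nu[OF g] nu[OF h] by simp
  qed
  then show ?thesis
    by (intro families_encodable[OF infinite_universe countable_degrees[of m \<sigma>]]) (auto simp: germ_sys_simps)
qed

lemma gsystem_germ_sys:
  assumes \<sigma>: "\<sigma> \<subseteq> {1..m}" shows "gsystem m \<sigma> (Y \<sigma>) TYPE('v)"
proof
  show null: "null (Y \<sigma>) \<in> piece (Y \<sigma>) d" for d
    using coherent_zero[OF \<sigma>] by (auto simp: germ_sys_simps)
  note c = coherent_closed
  show "padd (Y \<sigma>) x y \<in> piece (Y \<sigma>) d" if "x \<in> piece (Y \<sigma>) d" "y \<in> piece (Y \<sigma>) d" for x y d
    using that coherent_plus[OF \<sigma>] by (auto simp: germ_sys_simps split: if_splits)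
  show "padd (Y \<sigma>) (padd (Y \<sigma>) x y) z = padd (Y \<sigma>) x (padd (Y \<sigma>) y z)"
    if x: "x \<in> piece (Y \<sigma>) d" and y: "y \<in> piece (Y \<sigma>) d" and z: "z \<in> piece (Y \<sigma>) d" for x y z d
  proof -
    obtain u where u: "x = germ u" "coherent \<sigma> d u" using x \<sigma> by (rule pieceE)
    obtain v where v: "y = germ v" "coherent \<sigma> d v" using y \<sigma> by (rule pieceE)
    obtain w where w: "z = germ w" "coherent \<sigma> d w" using z \<sigma> by (rule pieceE)
    have "\<forall>\<^sub>F n in sequentially. u n \<oplus>\<^bsub>N\<^esub> v n \<oplus>\<^bsub>N\<^esub> w n = u n \<oplus>\<^bsub>N\<^esub> (v n \<oplus>\<^bsub>N\<^esub> w n)"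
      using c[OF u(2)] c[OF v(2)] c[OF w(2)] by eventually_elim (rule N.LM.M.a_assoc)
    then show ?thesis by (simp add: u v w germ_sys_simps germ_eq_iff)
  qed
  show "padd (Y \<sigma>) x y = padd (Y \<sigma>) y x" if x: "x \<in> piece (Y \<sigma>) d" and y: "y \<in> piece (Y \<sigma>) d" for x y d
  proof -
    obtain u where u: "x = germ u" "coherent \<sigma> d u" using x \<sigma> by (rule pieceE)
    obtain v where v: "y = germ v" "coherent \<sigma> d v" using y \<sigma> by (rule pieceE)
    have "\<forall>\<^sub>F n in sequentially. u n \<oplus>\<^bsub>N\<^esub> v n = v n \<oplus>\<^bsub>N\<^esub> u n"
      using c[OF u(2)] c[OF v(2)] by eventually_elim (rule N.LM.M.a_comm)
    then show ?thesis by (simp add: u v germ_sys_simps germ_eq_iff)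
  qed
  show "padd (Y \<sigma>) (null (Y \<sigma>)) x = x" if x: "x \<in> piece (Y \<sigma>) d" for x d
  proof -
    obtain u where u: "x = germ u" "coherent \<sigma> d u" using x \<sigma> by (rule pieceE)
    have "\<forall>\<^sub>F n in sequentially. \<zero>\<^bsub>N\<^esub> \<oplus>\<^bsub>N\<^esub> u n = u n"
      using c[OF u(2)] by eventually_elim (rule N.LM.M.l_zero)
    then show ?thesis by (simp add: u germ_sys_simps germ_eq_iff)
  qed
  show "\<exists>y \<in> piece (Y \<sigma>) d. padd (Y \<sigma>) y x = null (Y \<sigma>)" if x: "x \<in> piece (Y \<sigma>) d" for x d
  proof (cases "d \<in> degrees m \<sigma>")
    case True
    obtain u where u: "x = germ u" "coherent \<sigma> d u" using x \<sigma> by (rule pieceE)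
    have "\<forall>\<^sub>F n in sequentially. \<ominus>\<^bsub>N\<^esub> u n \<oplus>\<^bsub>N\<^esub> u n = \<zero>\<^bsub>N\<^esub>"
      using c[OF u(2)] by eventually_elim (rule N.LM.M.l_neg)
    then have "padd (Y \<sigma>) (germ (\<lambda>n. \<ominus>\<^bsub>N\<^esub> u n)) x = null (Y \<sigma>)"
      by (simp add: u germ_sys_simps germ_eq_iff)
    then show ?thesis using pieceI[OF True coherent_minus[OF \<sigma> u(2)]] by blast
  next
    case False
    then show ?thesis using x by (auto simp: germ_sys_simps)
  qed
  show "piece (Y \<sigma>) d = {null (Y \<sigma>)}" if "d \<notin> degrees m \<sigma>" for d
    using that by (simp add: germ_sys_simps)
  show "pact (Y \<sigma>) e c x \<in> piece (Y \<sigma>) (d + e)" if e: "e \<in> degrees m \<sigma>" and x: "x \<in> piece (Y \<sigma>) d" for e c x d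
  proof (cases "d \<in> degrees m \<sigma>")
    case True
    obtain u where u: "x = germ u" "coherent \<sigma> d u" using x \<sigma> by (rule pieceE)
    show ?thesis using pieceI[OF degrees_add[OF True e] coherent_ract[OF \<sigma> u(2) e]]
      by (simp add: u germ_sys_simps(4))
  next
    case False
    then have "pact (Y \<sigma>) e c x = null (Y \<sigma>)"
      using x e by (simp add: germ_sys_simps ract_zero off_degrees)
    then show ?thesis using null by simp
  qed
  show "pact (Y \<sigma>) e c (padd (Y \<sigma>) x y) = padd (Y \<sigma>) (pact (Y \<sigma>) e c x) (pact (Y \<sigma>) e c y)"
    if e: "e \<in> degrees m \<sigma>" and x: "x \<in> piece (Y \<sigma>) d" and y: "y \<in> piece (Y \<sigma>) d" for e c x y d
  proof -
    obtain u where u: "x = germ u" "coherent \<sigma> d u" using x \<sigma> by (rule pieceE)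
    obtain v where v: "y = germ v" "coherent \<sigma> d v" using y \<sigma> by (rule pieceE)
    have "\<forall>\<^sub>F n in sequentially. ract (off \<sigma> e) c (u n \<oplus>\<^bsub>N\<^esub> v n) = ract (off \<sigma> e) c (u n) \<oplus>\<^bsub>N\<^esub> ract (off \<sigma> e) c (v n)"
      using c[OF u(2)] c[OF v(2)] by eventually_elim (rule ract_plus[OF off_degrees[OF e]])
    then show ?thesis by (simp add: u v germ_sys_simps germ_eq_iff)
  qed
  show "pact (Y \<sigma>) e (c + c') x = padd (Y \<sigma>) (pact (Y \<sigma>) e c x) (pact (Y \<sigma>) e c' x)"
    if e: "e \<in> degrees m \<sigma>" and x: "x \<in> piece (Y \<sigma>) d" for e c c' x d
  proof -
    obtain u where u: "x = germ u" "coherent \<sigma> d u" using x \<sigma> by (rule pieceE)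
    have "\<forall>\<^sub>F n in sequentially. ract (off \<sigma> e) (c + c') (u n) = ract (off \<sigma> e) c (u n) \<oplus>\<^bsub>N\<^esub> ract (off \<sigma> e) c' (u n)"
      using coherent_closed[OF u(2)] by eventually_elim (rule ract_coeff[OF off_degrees[OF e]])
    then show ?thesis by (simp add: u germ_sys_simps germ_eq_iff)
  qed
  show "pact (Y \<sigma>) e c (pact (Y \<sigma>) e' c' x) = pact (Y \<sigma>) (e + e') (c * c') x"
    if e: "e \<in> degrees m \<sigma>" "e' \<in> degrees m \<sigma>" and x: "x \<in> piece (Y \<sigma>) d" for e e' c c' x d
  proof -
    obtain u where u: "x = germ u" "coherent \<sigma> d u" using x \<sigma> by (rule pieceE)
    have "\<forall>\<^sub>F n in sequentially. ract (off \<sigma> e) c (ract (off \<sigma> e') c' (u n)) = ract (off \<sigma> (e + e')) (c * c') (u n)"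
      using coherent_closed[OF u(2)] by eventually_elim (simp add: ract_ract off_degrees e off_plus)
    then show ?thesis by (simp add: u germ_sys_simps germ_eq_iff)
  qed
  show "pact (Y \<sigma>) 0 1 x = x" if x: "x \<in> piece (Y \<sigma>) d" for x d
  proof -
    obtain u where u: "x = germ u" "coherent \<sigma> d u" using x \<sigma> by (rule pieceE)
    have "\<forall>\<^sub>F n in sequentially. ract (off \<sigma> 0) 1 (u n) = u n"
      using coherent_closed[OF u(2)] by eventually_elim (simp add: ract_one off_zero)
    then show ?thesis by (simp add: u germ_sys_simps germ_eq_iff)
  qed
  show "encodable TYPE('v) (Y \<sigma>)" by (rule encodable_germ_sys[OF \<sigma>])
qed

text \<open>
  The image in the localisation of the element \<open>x\<close> of degree \<open>d\<close>, that is, the fraction \<open>x/1\<close>.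
\<close>

definition fraction :: "nat set \<Rightarrow> multidegree \<Rightarrow> 'v \<Rightarrow> 'v germ" where
  "fraction \<sigma> d x = germ (\<lambda>n. ract (gap \<sigma> n d) 1 x)"

lemma coherent_fraction:
  assumes \<sigma>: "\<sigma> \<subseteq> {1..m}" and x: "x \<in> NN d"
  shows "coherent \<sigma> d (\<lambda>n. ract (gap \<sigma> n d) 1 x)"
  unfolding coherent_def using gap_degrees[OF \<sigma>, of d]
proof eventually_elim
  case (elim n)
  have "ract (shift \<sigma> 1) 1 (ract (gap \<sigma> n d) 1 x) = ract (shift \<sigma> 1 + gap \<sigma> n d) 1 x"
    using ract_ract[OF shift_degrees[OF \<sigma>] elim NN_closed[OF x]] by simp
  then show ?case
    using ract_NN[OF elim x, of 1] gap_plus_shift[of \<sigma> n d] by (simp add: plus_gap add.commute)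
qed

lemma fraction_piece: "\<sigma> \<subseteq> {1..m} \<Longrightarrow> d \<in> degrees m \<sigma> \<Longrightarrow> x \<in> NN d \<Longrightarrow> fraction \<sigma> d x \<in> piece (Y \<sigma>) d"
  unfolding fraction_def by (intro pieceI coherent_fraction)

lemma fraction_zero:
  assumes "\<sigma> \<subseteq> {1..m}" shows "fraction \<sigma> d \<zero>\<^bsub>N\<^esub> = null (Y \<sigma>)"
  unfolding fraction_def germ_sys_simps germ_eq_iff
  using gap_degrees[OF assms, of d] by eventually_elim (rule ract_zero)

lemma fraction_plus:
  assumes "\<sigma> \<subseteq> {1..m}" "x \<in> carrier N" "y \<in> carrier N"
  shows "fraction \<sigma> d (x \<oplus>\<^bsub>N\<^esub> y) = padd (Y \<sigma>) (fraction \<sigma> d x) (fraction \<sigma> d y)"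
  unfolding fraction_def germ_sys_simps germ_map2_germ germ_eq_iff
  using gap_degrees[OF assms(1), of d] by eventually_elim (simp add: ract_plus assms)

lemma fraction_ract:
  assumes "\<sigma> \<subseteq> {1..m}" "x \<in> carrier N" and e: "e \<in> degrees m {}"
  shows "fraction \<sigma> (d + e) (ract e c x) = pact (Y \<sigma>) e c (fraction \<sigma> d x)"
  unfolding fraction_def germ_sys_simps germ_map_germ germ_eq_iff
  using gap_degrees[OF assms(1), of d] gap_degrees[OF assms(1), of "d + e"]
proof eventually_elim
  case (elim n)
  have "off \<sigma> e \<in> degrees m {}" using off_degrees[of e m \<sigma>] e degrees_mono[of "{}" \<sigma> m] by auto
  then show ?case
    using elim e assms(2) by (simp add: ract_ract gap_plus add.commute[of "off \<sigma> e"])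
qed

text \<open>
  The numerator is any late entry of a sequence representing the germ. The denominator has exponent
  \<open>clamp \<sigma> n d - d\<close>, which is supported on \<open>\<sigma>\<close>.
\<close>

lemma piece_eq_fraction:
  assumes \<sigma>: "\<sigma> \<subseteq> {1..m}" and d: "d \<in> degrees m \<sigma>" and g: "g \<in> piece (Y \<sigma>) d"
  obtains n x where "x \<in> NN (clamp \<sigma> n d)"
    "g = pact (Y \<sigma>) (d - clamp \<sigma> n d) 1 (fraction \<sigma> (clamp \<sigma> n d) x)"
proof -
  obtain u where u: "g = germ u" "coherent \<sigma> d u" using g \<sigma> by (rule pieceE)
  then obtain n0 where n0: "\<And>n. n \<ge> n0 \<Longrightarrow> u n \<in> NN (clamp \<sigma> n d) \<and> u (Suc n) = ract (shift \<sigma> 1) 1 (u n)"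
    unfolding coherent_def eventually_sequentially by blast
  have it: "u (n0 + k) = ract (shift \<sigma> k) 1 (u n0)" for k
    using n0 NN_closed by (intro coherent_iterate[OF \<sigma>]) blast
  have un0: "u n0 \<in> NN (clamp \<sigma> n0 d)" using n0 by blast
  have "\<forall>\<^sub>F n in sequentially. u n = ract (off \<sigma> (d - clamp \<sigma> n0 d)) 1 (ract (gap \<sigma> n (clamp \<sigma> n0 d)) 1 (u n0))"
    using eventually_ge_at_top[of n0]
  proof eventually_elim
    case (elim n)
    then show ?case using it[of "n - n0"] NN_closed[OF un0]
      by (simp add: off_diff_clamp gap_clamp ract_one ract_closed shift_degrees[OF \<sigma>])
  qed
  then show thesis
    using that[OF un0] by (simp add: u(1) fraction_def germ_sys_simps(4) germ_eq_iff)
qed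

text \<open>
  The missing powers of the variables in \<open>\<tau> - \<sigma>\<close> are supplied; their exponents \<open>n - d i\<close> are
  nonnegative for large \<open>n\<close>.
\<close>

definition trans :: "nat set \<Rightarrow> nat set \<Rightarrow> multidegree \<Rightarrow> 'v germ \<Rightarrow> 'v germ" where
  "trans \<sigma> \<tau> d = germ_map (\<lambda>n. ract (gap (\<tau> - \<sigma>) n d) 1)"

lemma system_map_trans:
  assumes \<tau>: "\<tau> \<subseteq> {1..m}" and sub: "\<sigma> \<subseteq> \<tau>"
  shows "system_map m \<sigma> \<tau> (Y \<sigma>) (Y \<tau>) TYPE('v) (trans \<sigma> \<tau>)"
proof -
  have \<sigma>: "\<sigma> \<subseteq> {1..m}" and \<rho>: "\<tau> - \<sigma> \<subseteq> {1..m}" using \<tau> sub by auto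
  interpret S: gsystem m \<sigma> "Y \<sigma>" "TYPE('v)" by (rule gsystem_germ_sys[OF \<sigma>])
  interpret T: gsystem m \<tau> "Y \<tau>" "TYPE('v)" by (rule gsystem_germ_sys[OF \<tau>])
  have null: "trans \<sigma> \<tau> d (null (Y \<sigma>)) = null (Y \<tau>)" for d
    unfolding trans_def germ_sys_simps germ_map_germ germ_eq_iff
    using gap_degrees[OF \<rho>, of d] by eventually_elim (rule ract_zero)
  show ?thesis
  proof
    show "\<sigma> \<subseteq> \<tau>" by (rule sub)
    show "trans \<sigma> \<tau> d x \<in> piece (Y \<tau>) d" if x: "x \<in> piece (Y \<sigma>) d" for x d
    proof (cases "d \<in> degrees m \<sigma>")
      case True
      obtain u where u: "x = germ u" "coherent \<sigma> d u" using x \<sigma> by (rule pieceE)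
      have "coherent \<tau> d (\<lambda>n. ract (gap (\<tau> - \<sigma>) n d) 1 (u n))"
        unfolding coherent_def
        using gap_degrees[OF \<rho>, of d] eventually_all_ge_at_top[OF gap_degrees[OF \<rho>, of d]] u(2)[unfolded coherent_def]
      proof eventually_elim
        case (elim n)
        have g: "gap (\<tau> - \<sigma>) (Suc n) d \<in> degrees m {}" using elim(2) by (meson le_SucI order_refl)
        have un: "u n \<in> carrier N" using elim(3) NN_closed by blast
        have "gap (\<tau> - \<sigma>) (Suc n) d + shift \<sigma> 1 = gap (\<tau> - \<sigma>) n d + (shift (\<tau> - \<sigma>) 1 + shift \<sigma> 1)"
          by (simp only: gap_plus_shift[symmetric] add.assoc)
        also have "\<dots> = shift \<tau> 1 + gap (\<tau> - \<sigma>) n d" by (simp only: shift_diff_plus[OF sub] add.commute[of _ "shift \<tau> 1"])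
        finally have "ract (gap (\<tau> - \<sigma>) (Suc n) d) 1 (u (Suc n)) = ract (shift \<tau> 1) 1 (ract (gap (\<tau> - \<sigma>) n d) 1 (u n))"
          using elim g un by (simp add: ract_ract shift_degrees[OF \<sigma>] shift_degrees[OF \<tau>])
        moreover have "ract (gap (\<tau> - \<sigma>) n d) 1 (u n) \<in> NN (clamp \<tau> n d)"
          using ract_NN[OF elim(1), of "u n" "clamp \<sigma> n d" 1] elim(3) by (simp add: clamp_plus_gap[OF sub])
        ultimately show ?case by simp
      qed
      then show ?thesis using pieceI[of d \<tau>] True degrees_mono[OF sub, of m] by (auto simp: u trans_def)
    next
      case False
      then show ?thesis using x null T.null_piece S.piece_outside by auto
    qed
    show "trans \<sigma> \<tau> d (padd (Y \<sigma>) x y) = padd (Y \<tau>) (trans \<sigma> \<tau> d x) (trans \<sigma> \<tau> d y)"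
      if x: "x \<in> piece (Y \<sigma>) d" and y: "y \<in> piece (Y \<sigma>) d" for x y d
    proof -
      obtain u where u: "x = germ u" "coherent \<sigma> d u" using x \<sigma> by (rule pieceE)
      obtain v where v: "y = germ v" "coherent \<sigma> d v" using y \<sigma> by (rule pieceE)
      show ?thesis
        unfolding u v trans_def germ_sys_simps germ_map_germ germ_map2_germ germ_eq_iff
        using coherent_closed[OF u(2)] coherent_closed[OF v(2)] gap_degrees[OF \<rho>, of d]
        by eventually_elim (simp add: ract_plus)
    qed
    show "trans \<sigma> \<tau> (d + e) (pact (Y \<sigma>) e c x) = pact (Y \<tau>) e c (trans \<sigma> \<tau> d x)"
      if e: "e \<in> degrees m \<sigma>" and x: "x \<in> piece (Y \<sigma>) d" for e c x d
    proof -
      obtain u where u: "x = germ u" "coherent \<sigma> d u" using x \<sigma> by (rule pieceE)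
      have e': "off \<sigma> e \<in> degrees m {}" "off \<tau> e \<in> degrees m {}"
        using e degrees_mono[OF sub, of m] off_degrees by blast+
      show ?thesis
        unfolding u trans_def germ_sys_simps germ_map_germ germ_eq_iff
        using coherent_closed[OF u(2)] gap_degrees[OF \<rho>, of d] gap_degrees[OF \<rho>, of "d + e"]
      proof eventually_elim
        case (elim n)
        then show ?case using e' by (simp add: ract_ract gap_plus_off[OF sub] add.commute[of "off \<tau> e"])
      qed
    qed
  qed
qed

lemma trans_fraction:
  assumes \<tau>: "\<tau> \<subseteq> {1..m}" and sub: "\<sigma> \<subseteq> \<tau>" and x: "x \<in> carrier N"
  shows "trans \<sigma> \<tau> d (fraction \<sigma> d x) = fraction \<tau> d x"
proof -
  have \<sigma>: "\<sigma> \<subseteq> {1..m}" and \<rho>: "\<tau> - \<sigma> \<subseteq> {1..m}" using \<tau> sub by auto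
  show ?thesis
    unfolding trans_def fraction_def germ_map_germ germ_eq_iff
    using gap_degrees[OF \<rho>, of d] gap_degrees[OF \<sigma>, of d]
    by eventually_elim (simp add: ract_ract x gap_plus_gap'[OF sub])
qed

lemma trans_killed:
  assumes \<tau>: "\<tau> \<subseteq> {1..m}" and sub: "\<sigma> \<subseteq> \<tau>" and d: "d \<in> degrees m \<sigma>"
    and g: "g \<in> piece (Y \<sigma>) d" and zero: "trans \<sigma> \<tau> d g = null (Y \<tau>)"
  shows "\<exists>n0. \<forall>k \<ge> n0. pact (Y \<sigma>) (shift \<tau> k) 1 g = null (Y \<sigma>)"
proof -
  have \<sigma>: "\<sigma> \<subseteq> {1..m}" and \<rho>: "\<tau> - \<sigma> \<subseteq> {1..m}" using \<tau> sub by auto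
  obtain u where u: "g = germ u" "coherent \<sigma> d u" using g \<sigma> by (rule pieceE)
  have "\<forall>\<^sub>F n in sequentially. ract (gap (\<tau> - \<sigma>) n d) 1 (u n) = \<zero>\<^bsub>N\<^esub>"
    using zero by (simp add: u trans_def germ_sys_simps germ_eq_iff)
  with gap_degrees[OF \<rho>, of d] u(2)[unfolded coherent_def]
  have "\<forall>\<^sub>F n in sequentially. gap (\<tau> - \<sigma>) n d \<in> degrees m {} \<and> u n \<in> carrier N \<and> u (Suc n) = ract (shift \<sigma> 1) 1 (u n)
      \<and> ract (gap (\<tau> - \<sigma>) n d) 1 (u n) = \<zero>\<^bsub>N\<^esub>"
    by eventually_elim (auto simp: NN_closed)
  then obtain n0 where n0: "\<And>n. n \<ge> n0 \<Longrightarrow> gap (\<tau> - \<sigma>) n d \<in> degrees m {} \<and> u n \<in> carrier N \<and>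
      u (Suc n) = ract (shift \<sigma> 1) 1 (u n) \<and> ract (gap (\<tau> - \<sigma>) n d) 1 (u n) = \<zero>\<^bsub>N\<^esub>"
    unfolding eventually_sequentially by blast
  have it: "u (n0 + k) = ract (shift \<sigma> k) 1 (u n0)" for k
    using n0 by (intro coherent_iterate[OF \<sigma>]) blast
  show ?thesis
  proof (intro exI allI impI)
    fix k assume k: "n0 \<le> k"
    let ?r = "shift (\<tau> - \<sigma>) k - gap (\<tau> - \<sigma>) n0 d"
    \<comment> \<open>The index \<open>n0\<close> itself is a large enough exponent because \<open>d\<close> is nonnegative outside \<open>\<sigma>\<close>.\<close>
    have "0 \<le> d i" if "i \<in> \<tau> - \<sigma>" for i using d \<rho> that by (auto simp: degrees_def)
    then have "int n0 - d i \<le> int k" if "i \<in> \<tau> - \<sigma>" for i using k that by force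
    then have r: "?r \<in> degrees m {}" using \<rho> by (auto simp: degrees_def shift_def gap_def)
    have *: "shift (\<tau> - \<sigma>) k = ?r + gap (\<tau> - \<sigma>) n0 d" by simp
    have kill: "ract (shift (\<tau> - \<sigma>) k) 1 (u n0) = \<zero>\<^bsub>N\<^esub>"
      using n0[of n0] ract_ract[OF r, of "gap (\<tau> - \<sigma>) n0 d" "u n0" 1 1] ract_zero[OF r, of 1] by simp
    have "\<forall>\<^sub>F n in sequentially. ract (off \<sigma> (shift \<tau> k)) 1 (u n) = \<zero>\<^bsub>N\<^esub>"
      using eventually_ge_at_top[of n0]
    proof eventually_elim
      case (elim n)
      have "ract (shift (\<tau> - \<sigma>) k) 1 (u n) = ract (shift (\<tau> - \<sigma>) k) 1 (ract (shift \<sigma> (n - n0)) 1 (u n0))"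
        using it[of "n - n0"] elim by simp
      also have "\<dots> = ract (shift \<sigma> (n - n0)) 1 (ract (shift (\<tau> - \<sigma>) k) 1 (u n0))"
        using n0[of n0] by (simp add: ract_ract shift_degrees[OF \<sigma>] shift_degrees[OF \<rho>] add.commute)
      also have "\<dots> = \<zero>\<^bsub>N\<^esub>" by (simp add: kill ract_zero shift_degrees[OF \<sigma>])
      finally show ?case by (simp add: off_shift[OF sub])
    qed
    then show "pact (Y \<sigma>) (shift \<tau> k) 1 g = null (Y \<sigma>)" by (simp add: u germ_sys_simps germ_eq_iff)
  qed
qed

lemma trans_generates:
  assumes \<tau>: "\<tau> \<subseteq> {1..m}" and sub: "\<sigma> \<subseteq> \<tau>"
    and d: "d \<in> degrees m \<tau>" and y: "y \<in> component (Tot (Y \<tau>) :: ('k, 'v) gmod) d"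
  shows "\<exists>e \<in> degrees m \<tau>. \<exists>x \<in> carrier (Tot (Y \<sigma>) :: ('k, 'v) gmod).
    y = monomial e 1 \<odot>\<^bsub>Tot (Y \<tau>)\<^esub> tot_map (Y \<sigma>) (Y \<tau>) (trans \<sigma> \<tau>) x"
proof -
  have \<sigma>: "\<sigma> \<subseteq> {1..m}" using \<tau> sub by auto
  interpret F: system_map m \<sigma> \<tau> "Y \<sigma>" "Y \<tau>" "TYPE('v)" "trans \<sigma> \<tau>" by (rule system_map_trans[OF \<tau> sub])
  have g: "coord (Y \<tau>) y d \<in> piece (Y \<tau>) d"
    using F.X.coord_piece[OF F.X.T.component_closed[OF y]] .
  obtain n x where x: "x \<in> NN (clamp \<tau> n d)"
    "coord (Y \<tau>) y d = pact (Y \<tau>) (d - clamp \<tau> n d) 1 (fraction \<tau> (clamp \<tau> n d) x)"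
    using piece_eq_fraction[OF \<tau> d g] by blast
  define d' where "d' = clamp \<tau> n d"
  have d': "d' \<in> degrees m {}" "d - d' \<in> degrees m \<tau>"
    unfolding d'_def using d \<tau> by (simp_all add: clamp_degrees diff_clamp_degrees)
  have dd: "d' \<in> degrees m \<rho>" for \<rho> using d'(1) degrees_mono[of "{}" \<rho> m] by auto
  have fr: "fraction \<rho> d' x \<in> piece (Y \<rho>) d'" if "\<rho> \<subseteq> {1..m}" for \<rho>
    using x(1) dd that unfolding d'_def by (intro fraction_piece)
  have "y = place (Y \<tau>) d (coord (Y \<tau>) y d)" by (rule F.X.component_eq_place[OF y])
  also have "\<dots> = place (Y \<tau>) (d' + (d - d')) (pact (Y \<tau>) (d - d') 1 (fraction \<tau> d' x))"
    using x(2) by (simp add: d'_def)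
  also have "\<dots> = monomial (d - d') 1 \<odot>\<^bsub>F.X.T\<^esub> place (Y \<tau>) d' (fraction \<tau> d' x)"
    by (rule F.X.act_place[OF d'(2) fr[OF \<tau>], symmetric])
  also have "place (Y \<tau>) d' (fraction \<tau> d' x) = F.F (place (Y \<sigma>) d' (fraction \<sigma> d' x))"
    using F.map_place[OF fr[OF \<sigma>]] trans_fraction[OF \<tau> sub NN_closed[OF x(1)], of d'] by simp
  finally show ?thesis
    using d'(2) F.Y.place_closed[OF fr[OF \<sigma>]] by blast
qed

lemma induces_base_change_iso_trans:
  assumes \<tau>: "\<tau> \<subseteq> {1..m}" and sub: "\<sigma> \<subseteq> \<tau>"
  shows "induces_base_change_iso (loc_ring m \<sigma>) (loc_ring m \<tau>) (Tot (Y \<sigma>) :: ('k, 'v) gmod) (Tot (Y \<tau>))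
    (tot_map (Y \<sigma>) (Y \<tau>) (trans \<sigma> \<tau>))"
proof -
  interpret F: system_map m \<sigma> \<tau> "Y \<sigma>" "Y \<tau>" "TYPE('v)" "trans \<sigma> \<tau>" by (rule system_map_trans[OF \<tau> sub])
  show ?thesis
  proof (rule induces_base_change_isoI[OF F.graded_map_tot_map \<tau>])
    fix y d assume "d \<in> degrees m \<tau>" "y \<in> component F.X.T d"
    then show "\<exists>e\<in>degrees m \<tau>. \<exists>x\<in>carrier F.Y.T. y = monomial e 1 \<odot>\<^bsub>F.X.T\<^esub> F.F x"
      by (rule trans_generates[OF \<tau> sub])
  next
    fix x assume x: "x \<in> carrier F.Y.T" and zero: "F.F x = \<zero>\<^bsub>F.X.T\<^esub>"
    have "\<exists>n0. \<forall>k \<ge> n0. pact (Y \<sigma>) (shift \<tau> k) 1 (coord (Y \<sigma>) x d) = null (Y \<sigma>)" for d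
    proof (cases "d \<in> degrees m \<sigma>")
      case True
      then show ?thesis
        using F.coord_map[OF x, of d] zero F.X.coord_zero[of d] F.Y.coord_piece[OF x]
        by (intro trans_killed[OF \<tau> sub]) auto
    next
      case False
      then show ?thesis
        using F.Y.coord_piece[OF x, of d] F.Y.piece_outside[OF False] F.Y.pact_null[OF shift_degrees[OF \<tau>]] by auto
    qed
    then obtain n0 where n0: "\<And>d k. k \<ge> n0 d \<Longrightarrow> pact (Y \<sigma>) (shift \<tau> k) 1 (coord (Y \<sigma>) x d) = null (Y \<sigma>)" by metis
    \<comment> \<open>One exponent works for the finitely many nonzero coordinates simultaneously.\<close>
    define k where "k = Max (insert 0 (n0 ` {d. coord (Y \<sigma>) x d \<noteq> null (Y \<sigma>)}))"
    have k: "pact (Y \<sigma>) (shift \<tau> k) 1 (coord (Y \<sigma>) x d) = null (Y \<sigma>)" for d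
    proof (cases "coord (Y \<sigma>) x d = null (Y \<sigma>)")
      case True
      then show ?thesis using F.Y.pact_null[OF shift_degrees[OF \<tau>]] by simp
    next
      case False
      then show ?thesis using F.Y.finite_coord[OF x] unfolding k_def by (intro n0 Max_ge) auto
    qed
    show "\<exists>n. monomial (shift \<tau> n) 1 \<odot>\<^bsub>F.Y.T\<^esub> x = \<zero>\<^bsub>F.Y.T\<^esub>"
      using x k by (intro exI[of _ k] F.Y.Tot_eqI)
        (auto simp: F.Y.T.act_closed shift_degrees[OF \<tau>] F.Y.coord_act F.Y.coord_zero)
  qed
qed

lemma finitely_generated_germ_sys:
  assumes \<sigma>: "\<sigma> \<subseteq> {1..m}" and fg: "finitely_generated (loc_ring 2 {}) N"
  shows "finitely_generated (loc_ring m \<sigma>) (Tot (Y \<sigma>) :: ('k, 'v) gmod)"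
proof -
  interpret G: gsystem m \<sigma> "Y \<sigma>" "TYPE('v)" by (rule gsystem_germ_sys[OF \<sigma>])
  let ?p = "\<lambda>\<delta> x. place (Y \<sigma>) (\<iota> \<delta>) (fraction \<sigma> (\<iota> \<delta>) x) :: 'v"
  have fr: "fraction \<sigma> (\<iota> \<delta>) x \<in> piece (Y \<sigma>) (\<iota> \<delta>)" if "\<delta> \<in> degrees 2 {}" "x \<in> component N \<delta>" for \<delta> x
    using that by (intro fraction_piece[OF \<sigma>] incl_degrees) (simp_all add: NN_def proj_incl)
  show ?thesis
  proof (rule finitely_generated_by_homogeneous[OF N.gmodule_axioms G.T.gmodule_axioms fg, where p = ?p and \<psi> = \<iota>])
    show "?p \<delta> x \<in> carrier G.T" if "\<delta> \<in> degrees 2 {}" "x \<in> component N \<delta>" for \<delta> x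
      by (rule G.place_closed[OF fr[OF that]])
    show "?p \<delta> (x \<oplus>\<^bsub>N\<^esub> y) = ?p \<delta> x \<oplus>\<^bsub>G.T\<^esub> ?p \<delta> y"
      if "\<delta> \<in> degrees 2 {}" "x \<in> component N \<delta>" "y \<in> component N \<delta>" for \<delta> x y
      using that by (simp add: G.plus_place fr fraction_plus[OF \<sigma>] N.component_closed)
    show "\<iota> e \<in> degrees m \<sigma>" if "e \<in> degrees 2 {}" for e using that by (rule incl_degrees)
    show "?p (\<delta> + e) (monomial e c \<odot>\<^bsub>N\<^esub> x) = monomial (\<iota> e) c \<odot>\<^bsub>G.T\<^esub> ?p \<delta> x"
      if e: "e \<in> degrees 2 {}" and \<delta>: "\<delta> \<in> degrees 2 {}" and x: "x \<in> component N \<delta>" for e c \<delta> x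
    proof -
      have "monomial e c \<odot>\<^bsub>N\<^esub> x = ract (\<iota> e) c x" by (simp add: ract_def proj_incl[OF e])
      then show ?thesis
        using e by (simp add: incl_plus fraction_ract[OF \<sigma>] N.component_closed[OF x] incl_degrees G.act_place fr[OF \<delta> x])
    qed
    fix H assume H: "is_submodule (loc_ring m \<sigma>) G.T H"
      "\<And>\<delta> x. \<delta> \<in> degrees 2 {} \<Longrightarrow> x \<in> component N \<delta> \<Longrightarrow> ?p \<delta> x \<in> H"
    note submodule_act = G.T.submodule_closed(3)[OF H(1)]
    show "carrier G.T \<subseteq> H"
    proof (rule G.submodule_eqI[OF H(1)])
      fix d g assume d: "d \<in> degrees m \<sigma>" and g: "g \<in> piece (Y \<sigma>) d"
      obtain n x where x: "x \<in> NN (clamp \<sigma> n d)"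
        and gx: "g = pact (Y \<sigma>) (d - clamp \<sigma> n d) 1 (fraction \<sigma> (clamp \<sigma> n d) x)"
        by (rule piece_eq_fraction[OF \<sigma> d g])
      define d' where "d' = clamp \<sigma> n d"
      define r where "r = d' - \<iota> (\<pi> d')"
      have d': "d' \<in> degrees m {}" and dd': "d - d' \<in> degrees m \<sigma>"
        unfolding d'_def using d \<sigma> by (simp_all add: clamp_degrees diff_clamp_degrees)
      have r: "r \<in> degrees m {}" "r \<in> degrees m \<sigma>"
        using diff_incl_proj_degrees[OF d'] degrees_mono[of "{}" \<sigma> m] by (auto simp: r_def)
      have \<pi>d': "\<pi> d' \<in> degrees 2 {}" by (rule proj_degrees[OF d'])
      have "\<pi> r = 0" by (simp add: r_def proj_diff proj_incl[OF \<pi>d'])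
      then have rx: "ract r 1 x = x" using NN_closed[OF x] by (rule ract_corner_free)
      have xc: "x \<in> component N (\<pi> d')" using x by (simp add: NN_def d'_def)
      from H(2)[OF \<pi>d' xc]
      have "?p (\<pi> d') x \<in> H" .
      from submodule_act[OF r(2) this, of 1]
      have "place (Y \<sigma>) (\<iota> (\<pi> d') + r) (pact (Y \<sigma>) r 1 (fraction \<sigma> (\<iota> (\<pi> d')) x)) \<in> H"
        by (simp add: G.act_place[OF r(2) fr[OF \<pi>d' xc]])
      then have "place (Y \<sigma>) (\<iota> (\<pi> d') + r) (fraction \<sigma> (\<iota> (\<pi> d') + r) (ract r 1 x)) \<in> H"
        by (simp add: fraction_ract[OF \<sigma> NN_closed[OF x] r(1)])
      then have in_H: "place (Y \<sigma>) d' (fraction \<sigma> d' x) \<in> H" by (simp add: rx) (simp add: r_def)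
      have "d' \<in> degrees m \<sigma>" using d' degrees_mono[of "{}" \<sigma> m] by auto
      then have "fraction \<sigma> d' x \<in> piece (Y \<sigma>) d'" using x by (intro fraction_piece[OF \<sigma>]) (simp_all add: d'_def)
      from submodule_act[OF dd' in_H, of 1] G.act_place[OF dd' this, of 1] show "place (Y \<sigma>) d g \<in> H"
        by (simp add: gx d'_def[symmetric])
    qed
  qed
qed

lemma Tot_germ_sys_fg:
  assumes "\<sigma> \<subseteq> {1..m}" "finitely_generated (loc_ring 2 {}) N"
  shows "Tot (Y \<sigma>) \<in> (fg_graded_modules m \<sigma> :: ('k, 'v) gmod set)"
  using gsystem.is_graded_module_Tot[OF gsystem_germ_sys[OF assms(1)]] finitely_generated_germ_sys[OF assms]
  by (simp add: fg_graded_modules_def)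

end

section \<open>Functoriality of totals\<close>

lemma tot_map_id:
  assumes "gsystem m \<sigma> Y TYPE('v)" "\<And>d x. x \<in> piece Y d \<Longrightarrow> h d x = x"
  shows "(tot_map Y Y h :: 'v \<Rightarrow> 'v) = (\<lambda>z \<in> carrier (Tot Y). z)"
proof -
  interpret gsystem m \<sigma> Y "TYPE('v)" by fact
  show ?thesis unfolding tot_map_def by (intro restrict_ext) (simp add: assms(2) coord_piece encode_coord)
qed

lemma tot_map_compose:
  assumes "system_map m \<sigma> \<tau> Y X TYPE('v) h" "system_map m \<tau> \<upsilon> X Z TYPE('v) h'"
    and "\<And>d x. x \<in> piece Y d \<Longrightarrow> h'' d x = h' d (h d x)"
  shows "compose (carrier (Tot Y)) (tot_map X Z h') (tot_map Y X h :: 'v \<Rightarrow> 'v) = tot_map Y Z h''"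
proof -
  interpret h: system_map m \<sigma> \<tau> Y X "TYPE('v)" h by fact
  interpret h': system_map m \<tau> \<upsilon> X Z "TYPE('v)" h' by fact
  show ?thesis
    unfolding compose_def tot_map_def[of Y Z]
  proof (rule restrict_ext)
    fix z assume z: "z \<in> carrier h.Y.T"
    have "h'.F (h.F z) = encode Z (\<lambda>d. h' d (coord X (h.F z) d))"
      using h.map_closed[OF z] by (simp add: tot_map_def[of X Z])
    then show "h'.F (h.F z) = encode Z (\<lambda>d. h'' d (coord Y z d))"
      using z by (simp add: h.coord_map assms(3) h.Y.coord_piece)
  qed
qed

lemma tot_map_plus:
  assumes "system_map m \<sigma> \<tau> Y X TYPE('v) h" "system_map m \<sigma> \<tau> Y X TYPE('v) h'"
    and "\<And>d x. x \<in> piece Y d \<Longrightarrow> h'' d x = padd X (h d x) (h' d x)"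
  shows "(\<lambda>z \<in> carrier (Tot Y). tot_map Y X h z \<oplus>\<^bsub>Tot X\<^esub> tot_map Y X h' z) = (tot_map Y X h'' :: 'v \<Rightarrow> 'v)"
proof -
  interpret h: system_map m \<sigma> \<tau> Y X "TYPE('v)" h by fact
  interpret h': system_map m \<sigma> \<tau> Y X "TYPE('v)" h' by fact
  show ?thesis
    unfolding tot_map_def[of Y X h'']
  proof (rule restrict_ext)
    fix z assume z: "z \<in> carrier h.Y.T"
    show "h.F z \<oplus>\<^bsub>h.X.T\<^esub> h'.F z = encode X (\<lambda>d. h'' d (coord Y z d))"
      using z by (simp add: Tot_simps(3) h.coord_map h'.coord_map assms(3) h.Y.coord_piece)
  qed
qed

lemma tot_map_scale:
  assumes "system_map m \<sigma> \<tau> Y X TYPE('v) h"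
    and "\<And>d x. x \<in> piece Y d \<Longrightarrow> h'' d x = pact X 0 c (h d x)"
  shows "(\<lambda>z \<in> carrier (Tot Y). monomial 0 c \<odot>\<^bsub>Tot X\<^esub> tot_map Y X h z) = (tot_map Y X h'' :: 'v \<Rightarrow> 'v)"
proof -
  interpret h: system_map m \<sigma> \<tau> Y X "TYPE('v)" h by fact
  show ?thesis
    unfolding tot_map_def[of Y X h'']
  proof (rule restrict_ext)
    fix z assume z: "z \<in> carrier h.Y.T"
    show "monomial 0 c \<odot>\<^bsub>h.X.T\<^esub> h.F z = encode X (\<lambda>d. h'' d (coord Y z d))"
      using z by (simp add: h.X.smult_eq_tact h.map_closed tact_def h.coord_map assms(2) h.Y.coord_piece)
  qed
qed

section \<open>The functor from bigraded modules\<close>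

definition germ_fmap :: "('v \<Rightarrow> 'w) \<Rightarrow> multidegree \<Rightarrow> 'v germ \<Rightarrow> 'w germ" where
  "germ_fmap f d = germ_map (\<lambda>n. f)"

lemma germ_fmap_germ: "germ_fmap f d (germ u) = germ (\<lambda>n. f (u n))"
  by (simp add: germ_fmap_def)

locale kst_map =
  X: kst_module m a b X + Z: kst_module m a b Z + f: graded_map 2 "{}" "{}" X Z f
  for m a b and X Z :: "('k::field, 'v) gmod" and f
begin

lemma f_NN: "x \<in> X.NN d \<Longrightarrow> f x \<in> Z.NN d"
  by (simp add: X.NN_def Z.NN_def f.component)

lemma f_ract: "e \<in> degrees m {} \<Longrightarrow> x \<in> carrier X \<Longrightarrow> f (X.ract e c x) = Z.ract e c (f x)"
  by (simp add: X.ract_def Z.ract_def f.act X.proj_degrees)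

abbreviation fmap where "fmap \<equiv> germ_fmap f"

lemma coherent_f:
  assumes \<sigma>: "\<sigma> \<subseteq> {1..m}" and u: "X.coherent \<sigma> d u"
  shows "Z.coherent \<sigma> d (\<lambda>n. f (u n))"
  using u unfolding X.coherent_def Z.coherent_def
  by eventually_elim (auto simp: f_NN f_ract shift_degrees[OF \<sigma>] X.NN_closed)

lemma system_map_fmap:
  assumes \<sigma>: "\<sigma> \<subseteq> {1..m}"
  shows "system_map m \<sigma> \<sigma> (X.Y \<sigma>) (Z.Y \<sigma>) TYPE('v) fmap"
proof -
  interpret S: gsystem m \<sigma> "X.Y \<sigma>" "TYPE('v)" by (rule X.gsystem_germ_sys[OF \<sigma>])
  interpret T: gsystem m \<sigma> "Z.Y \<sigma>" "TYPE('v)" by (rule Z.gsystem_germ_sys[OF \<sigma>])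
  have null: "fmap d (null (X.Y \<sigma>)) = null (Z.Y \<sigma>)" for d
    by (simp add: X.germ_sys_simps Z.germ_sys_simps germ_fmap_germ f.zero)
  show ?thesis
  proof
    show "fmap d x \<in> piece (Z.Y \<sigma>) d" if x: "x \<in> piece (X.Y \<sigma>) d" for x d
    proof (cases "d \<in> degrees m \<sigma>")
      case True
      obtain u where u: "x = germ u" "X.coherent \<sigma> d u" using x \<sigma> by (rule X.pieceE)
      show ?thesis using Z.pieceI[OF True coherent_f[OF \<sigma> u(2)]] by (simp add: u germ_fmap_germ)
    next
      case False
      then show ?thesis using x null T.null_piece S.piece_outside by auto
    qed
    show "fmap d (padd (X.Y \<sigma>) x y) = padd (Z.Y \<sigma>) (fmap d x) (fmap d y)"
      if x: "x \<in> piece (X.Y \<sigma>) d" and y: "y \<in> piece (X.Y \<sigma>) d" for x y d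
    proof -
      obtain u where u: "x = germ u" "X.coherent \<sigma> d u" using x \<sigma> by (rule X.pieceE)
      obtain v where v: "y = germ v" "X.coherent \<sigma> d v" using y \<sigma> by (rule X.pieceE)
      show ?thesis
        unfolding u v X.germ_sys_simps Z.germ_sys_simps germ_map2_germ germ_fmap_germ germ_eq_iff
        using X.coherent_closed[OF u(2)] X.coherent_closed[OF v(2)] by eventually_elim (rule f.plus)
    qed
    show "fmap (d + e) (pact (X.Y \<sigma>) e c x) = pact (Z.Y \<sigma>) e c (fmap d x)"
      if e: "e \<in> degrees m \<sigma>" and x: "x \<in> piece (X.Y \<sigma>) d" for e c x d
    proof -
      obtain u where u: "x = germ u" "X.coherent \<sigma> d u" using x \<sigma> by (rule X.pieceE)
      show ?thesis
        unfolding u X.germ_sys_simps Z.germ_sys_simps germ_map_germ germ_fmap_germ germ_eq_iff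
        using X.coherent_closed[OF u(2)] by eventually_elim (rule f_ract[OF off_degrees[OF e]])
    qed
  qed simp
qed

lemma fmap_fraction:
  assumes "\<sigma> \<subseteq> {1..m}" "x \<in> carrier X"
  shows "fmap d (X.fraction \<sigma> d' x) = Z.fraction \<sigma> d' (f x)"
  unfolding X.fraction_def Z.fraction_def germ_fmap_germ germ_eq_iff
  using gap_degrees[OF assms(1), of d'] by eventually_elim (simp add: f_ract assms(2))

lemma fmap_trans:
  assumes \<tau>: "\<tau> \<subseteq> {1..m}" and sub: "\<sigma> \<subseteq> \<tau>" and x: "x \<in> piece (X.Y \<sigma>) d"
  shows "fmap d (X.trans \<sigma> \<tau> d x) = Z.trans \<sigma> \<tau> d (fmap d x)"
proof -
  have \<sigma>: "\<sigma> \<subseteq> {1..m}" and \<rho>: "\<tau> - \<sigma> \<subseteq> {1..m}" using \<tau> sub by auto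
  obtain u where u: "x = germ u" "X.coherent \<sigma> d u" using x \<sigma> by (rule X.pieceE)
  show ?thesis
    unfolding u X.trans_def Z.trans_def germ_map_germ germ_fmap_germ germ_eq_iff
    using X.coherent_closed[OF u(2)] gap_degrees[OF \<rho>, of d] by eventually_elim (simp add: f_ract)
qed

end

text \<open>
  Sequential colimits are exact. In the middle, preimages of the entries of a sequence are compatible by
  injectivity; on the right, it suffices to lift the numerator of a fraction.
\<close>

lemma kst_map_exact:
  assumes f: "kst_map m a b X Y f" and g: "kst_map m a b Y Z g"
    and ses: "Ses (kst_mod :: ('k::field, ('k, 'v) gmod, 'v \<Rightarrow> 'v) lincat) X Y Z f g"
    and \<sigma>: "\<sigma> \<subseteq> {1..m}"
  shows "Ses (graded_mod m \<sigma>) (Tot (germ_sys m a b X \<sigma>)) (Tot (germ_sys m a b Y \<sigma>)) (Tot (germ_sys m a b Z \<sigma>) :: ('k, 'v) gmod)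
    (tot_map (germ_sys m a b X \<sigma>) (germ_sys m a b Y \<sigma>) (germ_fmap f))
    (tot_map (germ_sys m a b Y \<sigma>) (germ_sys m a b Z \<sigma>) (germ_fmap g))"
proof -
  interpret f: kst_map m a b X Y f by fact
  interpret g: kst_map m a b Y Z g by fact
  have inj: "inj_on f (carrier X)" and mid: "f ` carrier X = {x \<in> carrier Y. g x = \<zero>\<^bsub>Z\<^esub>}"
    and surj: "g ` carrier Y = carrier Z"
    using ses by (simp_all add: kst_mod_def graded_mod_def)
  show ?thesis
  proof (rule tot_map_exact[OF f.system_map_fmap[OF \<sigma>] g.system_map_fmap[OF \<sigma>]])
    fix d x y assume x: "x \<in> piece (f.X.Y \<sigma>) d" and y: "y \<in> piece (f.X.Y \<sigma>) d" and eq: "f.fmap d x = f.fmap d y"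
    obtain u where u: "x = germ u" "f.X.coherent \<sigma> d u" using x \<sigma> by (rule f.X.pieceE)
    obtain v where v: "y = germ v" "f.X.coherent \<sigma> d v" using y \<sigma> by (rule f.X.pieceE)
    have "\<forall>\<^sub>F n in sequentially. f (u n) = f (v n)" using eq by (simp add: u v germ_fmap_germ germ_eq_iff)
    then show "x = y"
      unfolding u v germ_eq_iff
      using f.X.coherent_closed[OF u(2)] f.X.coherent_closed[OF v(2)]
      by eventually_elim (rule inj_onD[OF inj])
  next
    fix d x assume x: "x \<in> piece (f.X.Y \<sigma>) d"
    obtain u where u: "x = germ u" "f.X.coherent \<sigma> d u" using x \<sigma> by (rule f.X.pieceE)
    show "g.fmap d (f.fmap d x) = null (g.Z.Y \<sigma>)"
      unfolding u germ_fmap_germ germ_fmap_germ g.Z.germ_sys_simps germ_eq_iff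
      using f.X.coherent_closed[OF u(2)] by eventually_elim (use mid in blast)
  next
    fix d y assume d: "d \<in> degrees m \<sigma>" and y: "y \<in> piece (f.Z.Y \<sigma>) d" and zero: "g.fmap d y = null (g.Z.Y \<sigma>)"
    obtain v where v: "y = germ v" "f.Z.coherent \<sigma> d v" using y \<sigma> by (rule f.Z.pieceE)
    define u where "u n = (SOME x. x \<in> carrier X \<and> f x = v n)" for n
    have "\<forall>\<^sub>F n in sequentially. g (v n) = \<zero>\<^bsub>Z\<^esub>" using zero by (simp add: v germ_fmap_germ g.Z.germ_sys_simps germ_eq_iff)
    with f.Z.coherent_closed[OF v(2)] have u: "\<forall>\<^sub>F n in sequentially. u n \<in> carrier X \<and> f (u n) = v n"
    proof eventually_elim
      case (elim n)
      then have "v n \<in> f ` carrier X" by (simp add: mid)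
      then have "\<exists>x. x \<in> carrier X \<and> f x = v n" by (elim imageE) auto
      then show ?case unfolding u_def by (rule someI_ex)
    qed
    have "f.X.coherent \<sigma> d u"
      using u eventually_all_ge_at_top[OF u] v(2) unfolding f.X.coherent_def f.Z.coherent_def
    proof eventually_elim
      case (elim n)
      have "u n \<in> f.X.NN (clamp \<sigma> n d)"
        using elim f.f.inj_reflects_component[OF inj] by (simp add: f.X.NN_def f.Z.NN_def)
      moreover have "u (Suc n) = f.X.ract (shift \<sigma> 1) 1 (u n)"
      proof (rule inj_onD[OF inj])
        show "u (Suc n) \<in> carrier X" using elim(2) by (meson le_SucI order_refl)
        have "f (u (Suc n)) = v (Suc n)" using elim(2) by (meson le_SucI order_refl)
        then show "f (u (Suc n)) = f (f.X.ract (shift \<sigma> 1) 1 (u n))"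
          using elim by (simp add: f.f_ract shift_degrees[OF \<sigma>])
      qed (use elim f.X.ract_closed shift_degrees[OF \<sigma>] in auto)
      ultimately show ?case by blast
    qed
    moreover have "f.fmap d (germ u) = y"
      unfolding v germ_fmap_germ germ_eq_iff using u by (auto elim: eventually_mono)
    ultimately show "\<exists>x \<in> piece (f.X.Y \<sigma>) d. f.fmap d x = y" using f.X.pieceI[OF d] by blast
  next
    fix d z assume d: "d \<in> degrees m \<sigma>" and z: "z \<in> piece (g.Z.Y \<sigma>) d"
    obtain n w where w: "w \<in> g.Z.NN (clamp \<sigma> n d)"
      and zw: "z = pact (g.Z.Y \<sigma>) (d - clamp \<sigma> n d) 1 (g.Z.fraction \<sigma> (clamp \<sigma> n d) w)"
      by (rule g.Z.piece_eq_fraction[OF \<sigma> d z])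
    obtain y where y: "y \<in> f.Z.NN (clamp \<sigma> n d)" "g y = w"
      using g.f.surj_component[OF surj, of w] w by (auto simp: f.Z.NN_def g.Z.NN_def)
    have cl: "clamp \<sigma> n d \<in> degrees m \<sigma>" "d - clamp \<sigma> n d \<in> degrees m \<sigma>"
      using clamp_degrees[OF d \<sigma>] diff_clamp_degrees[OF d \<sigma>] degrees_mono[of "{}" \<sigma> m] by auto
    interpret G: system_map m \<sigma> \<sigma> "f.Z.Y \<sigma>" "g.Z.Y \<sigma>" "TYPE('v)" "g.fmap" by (rule g.system_map_fmap[OF \<sigma>])
    have fr: "f.Z.fraction \<sigma> (clamp \<sigma> n d) y \<in> piece (f.Z.Y \<sigma>) (clamp \<sigma> n d)"
      by (rule f.Z.fraction_piece[OF \<sigma> cl(1) y(1)])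
    show "\<exists>y \<in> piece (f.Z.Y \<sigma>) d. g.fmap d y = z"
    proof (rule bexI)
      show "pact (f.Z.Y \<sigma>) (d - clamp \<sigma> n d) 1 (f.Z.fraction \<sigma> (clamp \<sigma> n d) y) \<in> piece (f.Z.Y \<sigma>) d"
        using G.Y.pact_closed[OF cl(2) fr] by simp
      show "g.fmap d (pact (f.Z.Y \<sigma>) (d - clamp \<sigma> n d) 1 (f.Z.fraction \<sigma> (clamp \<sigma> n d) y)) = z"
        using G.h_pact[OF cl(2) fr cl(1), of 1] g.fmap_fraction[OF \<sigma> f.Z.NN_closed[OF y(1)]] y(2) by (simp add: zw)
    qed
  qed
qed

definition spread ::
  "nat \<Rightarrow> nat set set \<Rightarrow> nat \<Rightarrow> nat \<Rightarrow> (('k::field, 'v) gmod, 'v \<Rightarrow> 'v, ('k, 'v) L_object, nat set \<Rightarrow> 'v \<Rightarrow> 'v) functor_data" where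
  "spread m K a b =
     \<lparr>on_ob = (\<lambda>N. \<lparr>part = (\<lambda>\<sigma>. Tot (germ_sys m a b N \<sigma>)),
        transition = (\<lambda>\<sigma> \<tau>. tot_map (germ_sys m a b N \<sigma>) (germ_sys m a b N \<tau>) (kst_module.trans a b N \<sigma> \<tau>))\<rparr>),
      on_hom = (\<lambda>X Z f. \<lambda>\<sigma> \<in> missing_faces m K. tot_map (germ_sys m a b X \<sigma>) (germ_sys m a b Z \<sigma>) (germ_fmap f))\<rparr>"

lemma spread_simps [simp]:
  "part (on_ob (spread m K a b) N) \<sigma> = Tot (germ_sys m a b N \<sigma>)"
  "transition (on_ob (spread m K a b) N) \<sigma> \<tau> =
     tot_map (germ_sys m a b N \<sigma>) (germ_sys m a b N \<tau>) (kst_module.trans a b N \<sigma> \<tau>)"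
  "on_hom (spread m K a b) X Z f = (\<lambda>\<sigma> \<in> missing_faces m K. tot_map (germ_sys m a b X \<sigma>) (germ_sys m a b Z \<sigma>) (germ_fmap f))"
  by (simp_all add: spread_def)

lemma kst_mod_simps:
  "Ob (kst_mod :: ('k::field, ('k, 'v) gmod, 'v \<Rightarrow> 'v) lincat) = fg_graded_modules 2 {}"
  "Hom kst_mod X (Z :: ('k::field, 'v) gmod) = graded_maps 2 {} X Z"
  "Id kst_mod X = (\<lambda>x \<in> carrier (X :: ('k::field, 'v) gmod). x)"
  "Comp kst_mod X Y (Z :: ('k::field, 'v) gmod) g f = compose (carrier X) g f"
  "Zero kst_mod X (Z :: ('k::field, 'v) gmod) = (\<lambda>x \<in> carrier X. \<zero>\<^bsub>Z\<^esub>)"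
  "Add kst_mod X (Z :: ('k::field, 'v) gmod) f g = (\<lambda>x \<in> carrier X. f x \<oplus>\<^bsub>Z\<^esub> g x)"
  "Scale kst_mod X (Z :: ('k::field, 'v) gmod) c f = (\<lambda>x \<in> carrier X. monomial 0 c \<odot>\<^bsub>Z\<^esub> f x)"
  by (simp_all add: kst_mod_def graded_mod_def)

text \<open>
  A constant rather than an abbreviation, so that the set difference is not rewritten in proofs.
\<close>

definition corner_face :: "nat \<Rightarrow> nat \<Rightarrow> nat \<Rightarrow> nat set" where
  "corner_face m a b = {1..m} - {a, b}"

locale corner_complex = corner m a b for m a b +
  fixes K :: "nat set set" and universe :: "'v itself"
  assumes complex: "simplicial_complex m K" and base_missing: "corner_face m a b \<notin> K"
    and infinite_universe: "infinite (UNIV :: 'v set)"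
begin

abbreviation "\<sigma>\<^sub>0 \<equiv> corner_face m a b"
abbreviation "faces \<equiv> missing_faces m K"

abbreviation kst :: "('k::field, ('k, 'v) gmod, 'v \<Rightarrow> 'v) lincat" where "kst \<equiv> kst_mod"
abbreviation L :: "('k::field, ('k, 'v) L_object, nat set \<Rightarrow> 'v \<Rightarrow> 'v) lincat" where "L \<equiv> L_cat m K"
abbreviation S :: "(('k::field, 'v) gmod, 'v \<Rightarrow> 'v, ('k, 'v) L_object, nat set \<Rightarrow> 'v \<Rightarrow> 'v) functor_data" where
  "S \<equiv> spread m K a b"

lemma faces_subset: "\<sigma> \<in> faces \<Longrightarrow> \<sigma> \<subseteq> {1..m}"
  by (auto simp: missing_faces_def)

lemma base_face: "\<sigma>\<^sub>0 \<in> faces"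
  using base_missing by (auto simp: missing_faces_def corner_face_def)

lemma faces_up: "\<sigma> \<in> faces \<Longrightarrow> \<sigma> \<subseteq> \<tau> \<Longrightarrow> \<tau> \<subseteq> {1..m} \<Longrightarrow> \<tau> \<in> faces"
  using complex unfolding missing_faces_def simplicial_complex_def by blast

lemma kst_moduleI: "X \<in> Ob kst \<Longrightarrow> kst_module m a b X"
  using infinite_universe corner_axioms
  by (simp add: kst_module_def kst_module_axioms_def gmodule_def kst_mod_simps fg_graded_modules_def)

lemma kst_mapI: "X \<in> Ob kst \<Longrightarrow> Z \<in> Ob kst \<Longrightarrow> f \<in> Hom kst X Z \<Longrightarrow> kst_map m a b X Z f"
  using kst_moduleI[of X] kst_moduleI[of Z] by (simp add: kst_map_def kst_mod_simps graded_maps_iff)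

lemma spread_ob: "(X :: ('k::field, 'v) gmod) \<in> Ob kst \<Longrightarrow> on_ob S X \<in> Ob L"
proof -
  assume X: "X \<in> Ob kst"
  interpret X: kst_module m a b X by (rule kst_moduleI[OF X])
  have tm: "system_map m \<sigma> \<tau> (X.Y \<sigma>) (X.Y \<tau>) TYPE('v) (X.trans \<sigma> \<tau>)"
    if "\<sigma> \<in> faces" "\<tau> \<in> faces" "\<sigma> \<subseteq> \<tau>" for \<sigma> \<tau>
    using X.system_map_trans[OF faces_subset] that by blast
  have fg: "Tot (X.Y \<sigma>) \<in> (fg_graded_modules m \<sigma> :: ('k, 'v) gmod set)" if "\<sigma> \<in> faces" for \<sigma>
    using X.Tot_germ_sys_fg[OF faces_subset[OF that]] X by (simp add: kst_mod_simps fg_graded_modules_def)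
  show ?thesis
    unfolding L_cat_simps L_objects_def spread_simps mem_Collect_eq
  proof (intro conjI ballI impI)
    fix \<sigma> \<tau> assume *: "\<sigma> \<in> faces" "\<tau> \<in> faces" "\<sigma> \<subseteq> \<tau>"
    show "tot_map (X.Y \<sigma>) (X.Y \<tau>) (X.trans \<sigma> \<tau>) \<in> graded_maps m \<sigma> (Tot (X.Y \<sigma>)) (Tot (X.Y \<tau>) :: ('k, 'v) gmod)"
      using system_map.graded_map_tot_map[OF tm[OF *]] by (simp add: graded_map_def)
    show "induces_base_change_iso (loc_ring m \<sigma>) (loc_ring m \<tau>) (Tot (X.Y \<sigma>)) (Tot (X.Y \<tau>) :: ('k, 'v) gmod)
        (tot_map (X.Y \<sigma>) (X.Y \<tau>) (X.trans \<sigma> \<tau>))"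
      by (rule X.induces_base_change_iso_trans[OF faces_subset[OF *(2)] *(3)])
  next
    fix \<sigma> x assume \<sigma>: "\<sigma> \<in> faces" and x: "x \<in> carrier (Tot (X.Y \<sigma>) :: ('k, 'v) gmod)"
    have "tot_map (X.Y \<sigma>) (X.Y \<sigma>) (X.trans \<sigma> \<sigma>) = (\<lambda>z \<in> carrier (Tot (X.Y \<sigma>) :: ('k, 'v) gmod). z)"
    proof (rule tot_map_id[OF X.gsystem_germ_sys[OF faces_subset[OF \<sigma>]]])
      fix d g assume g: "g \<in> piece (X.Y \<sigma>) d"
      obtain u where u: "g = germ u" "X.coherent \<sigma> d u" using g faces_subset[OF \<sigma>] by (rule X.pieceE)
      show "X.trans \<sigma> \<sigma> d g = g"
        unfolding u X.trans_def germ_map_germ germ_eq_iff Diff_cancel gap_empty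
        using X.coherent_closed[OF u(2)] by eventually_elim (rule X.ract_one)
    qed
    then show "tot_map (X.Y \<sigma>) (X.Y \<sigma>) (X.trans \<sigma> \<sigma>) x = x" using x by simp
  next
    fix \<sigma> \<tau> \<upsilon> x assume *: "\<sigma> \<in> faces" "\<tau> \<in> faces" "\<upsilon> \<in> faces" "\<sigma> \<subseteq> \<tau>" "\<tau> \<subseteq> \<upsilon>"
      and x: "x \<in> carrier (Tot (X.Y \<sigma>) :: ('k, 'v) gmod)"
    have "compose (carrier (Tot (X.Y \<sigma>) :: ('k, 'v) gmod)) (tot_map (X.Y \<tau>) (X.Y \<upsilon>) (X.trans \<tau> \<upsilon>)) (tot_map (X.Y \<sigma>) (X.Y \<tau>) (X.trans \<sigma> \<tau>))
       = tot_map (X.Y \<sigma>) (X.Y \<upsilon>) (X.trans \<sigma> \<upsilon>)"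
    proof (rule tot_map_compose[OF tm tm])
      fix d g assume g: "g \<in> piece (X.Y \<sigma>) d"
      obtain u where u: "g = germ u" "X.coherent \<sigma> d u" using g faces_subset[OF *(1)] by (rule X.pieceE)
      have \<rho>: "\<tau> - \<sigma> \<subseteq> {1..m}" "\<upsilon> - \<tau> \<subseteq> {1..m}" using faces_subset * by blast+
      show "X.trans \<sigma> \<upsilon> d g = X.trans \<tau> \<upsilon> d (X.trans \<sigma> \<tau> d g)"
        unfolding u X.trans_def germ_map_germ germ_eq_iff
        using X.coherent_closed[OF u(2)] gap_degrees[OF \<rho>(1), of d] gap_degrees[OF \<rho>(2), of d]
        by eventually_elim (simp add: X.ract_ract gap_plus_gap[OF *(4,5)])
    qed (use * in auto)
    from fun_cong[OF this, of x]
    show "tot_map (X.Y \<tau>) (X.Y \<upsilon>) (X.trans \<tau> \<upsilon>) (tot_map (X.Y \<sigma>) (X.Y \<tau>) (X.trans \<sigma> \<tau>) x)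
       = tot_map (X.Y \<sigma>) (X.Y \<upsilon>) (X.trans \<sigma> \<upsilon>) x"
      by (simp only: compose_eq[OF x])
  qed (rule fg)
qed

lemma spread_hom:
  assumes X: "(X :: ('k::field, 'v) gmod) \<in> Ob kst" and Z: "Z \<in> Ob kst" and f: "f \<in> Hom kst X Z"
  shows "on_hom S X Z f \<in> Hom L (on_ob S X) (on_ob S Z)"
  unfolding L_cat_simps
proof (rule L_mapsI)
  interpret f: kst_map m a b X Z f by (rule kst_mapI[OF assms])
  have sm: "system_map m \<sigma> \<sigma> (f.X.Y \<sigma>) (f.Z.Y \<sigma>) TYPE('v) f.fmap" if "\<sigma> \<in> faces" for \<sigma>
    by (rule f.system_map_fmap[OF faces_subset[OF that]])
  fix \<sigma> assume \<sigma>: "\<sigma> \<in> faces"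
  show "on_hom S X Z f \<sigma> \<in> graded_maps m \<sigma> (part (on_ob S X) \<sigma>) (part (on_ob S Z) \<sigma>)"
    using system_map.graded_map_tot_map[OF sm[OF \<sigma>]] \<sigma> by (simp add: graded_map_def)
  fix \<tau> x assume \<tau>: "\<tau> \<in> faces" and sub: "\<sigma> \<subseteq> \<tau>" and x: "x \<in> carrier (part (on_ob S X) \<sigma>)"
  note tX = f.X.system_map_trans[OF faces_subset[OF \<tau>] sub] and tZ = f.Z.system_map_trans[OF faces_subset[OF \<tau>] sub]
  have "compose (carrier (Tot (f.X.Y \<sigma>) :: ('k, 'v) gmod)) (tot_map (f.X.Y \<tau>) (f.Z.Y \<tau>) f.fmap) (tot_map (f.X.Y \<sigma>) (f.X.Y \<tau>) (f.X.trans \<sigma> \<tau>))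
      = tot_map (f.X.Y \<sigma>) (f.Z.Y \<tau>) (\<lambda>d g. f.fmap d (f.X.trans \<sigma> \<tau> d g))"
    by (rule tot_map_compose[OF tX sm[OF \<tau>]]) simp
  also have "\<dots> = compose (carrier (Tot (f.X.Y \<sigma>) :: ('k, 'v) gmod)) (tot_map (f.Z.Y \<sigma>) (f.Z.Y \<tau>) (f.Z.trans \<sigma> \<tau>)) (tot_map (f.X.Y \<sigma>) (f.Z.Y \<sigma>) f.fmap)"
    by (rule tot_map_compose[OF sm[OF \<sigma>] tZ, symmetric]) (rule f.fmap_trans[OF faces_subset[OF \<tau>] sub])
  finally have eq: "compose (carrier (Tot (f.X.Y \<sigma>) :: ('k, 'v) gmod)) (tot_map (f.X.Y \<tau>) (f.Z.Y \<tau>) f.fmap) (tot_map (f.X.Y \<sigma>) (f.X.Y \<tau>) (f.X.trans \<sigma> \<tau>))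
      = compose (carrier (Tot (f.X.Y \<sigma>) :: ('k, 'v) gmod)) (tot_map (f.Z.Y \<sigma>) (f.Z.Y \<tau>) (f.Z.trans \<sigma> \<tau>)) (tot_map (f.X.Y \<sigma>) (f.Z.Y \<sigma>) f.fmap)" .
  have x': "x \<in> carrier (Tot (f.X.Y \<sigma>) :: ('k, 'v) gmod)" using x by simp
  show "on_hom S X Z f \<tau> (transition (on_ob S X) \<sigma> \<tau> x) = transition (on_ob S Z) \<sigma> \<tau> (on_hom S X Z f \<sigma> x)"
    using fun_cong[OF eq, of x] \<sigma> \<tau> by (simp add: compose_eq[OF x'])
qed simp

lemma linear_spread: "linear_functor kst L (S :: (('k::field, 'v) gmod, _, _, _) functor_data)"
  unfolding linear_functor_def additive_functor_def is_functor_def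
proof (intro conjI ballI allI)
  fix X :: "('k, 'v) gmod" assume X: "X \<in> Ob kst"
  show "on_ob S X \<in> Ob L" by (rule spread_ob[OF X])
  interpret X: kst_module m a b X by (rule kst_moduleI[OF X])
  have "(\<lambda>x\<in>carrier X. x) \<in> Hom kst X X"
    using X graded_map_id[of 2 "{}" X] by (simp add: kst_mod_simps graded_maps_iff) (simp add: fg_graded_modules_def)
  then interpret i: kst_map m a b X X "\<lambda>x\<in>carrier X. x" by (rule kst_mapI[OF X X])
  have "tot_map (X.Y \<sigma>) (X.Y \<sigma>) i.fmap = (\<lambda>z \<in> carrier (Tot (X.Y \<sigma>) :: ('k, 'v) gmod). z)" if \<sigma>: "\<sigma> \<in> faces" for \<sigma>
  proof (rule tot_map_id[OF X.gsystem_germ_sys[OF faces_subset[OF \<sigma>]]])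
    fix d g assume g: "g \<in> piece (X.Y \<sigma>) d"
    obtain u where u: "g = germ u" "X.coherent \<sigma> d u" using g faces_subset[OF \<sigma>] by (rule X.pieceE)
    show "i.fmap d g = g"
      unfolding u germ_fmap_germ germ_eq_iff using X.coherent_closed[OF u(2)] by eventually_elim simp
  qed
  then show "on_hom S X X (Id kst X) = Id L (on_ob S X)"
    by (auto simp: kst_mod_simps intro!: restrict_ext)
next
  fix X Z :: "('k, 'v) gmod" and f assume X: "X \<in> Ob kst" and Z: "Z \<in> Ob kst" and f: "f \<in> Hom kst X Z"
  show "on_hom S X Z f \<in> Hom L (on_ob S X) (on_ob S Z)" by (rule spread_hom[OF X Z f])
  interpret f: kst_map m a b X Z f by (rule kst_mapI[OF X Z f])
  note sm = f.system_map_fmap[OF faces_subset]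
  { fix c
    have "tot_map (f.X.Y \<sigma>) (f.Z.Y \<sigma>) (germ_fmap (Scale kst X Z c f)) =
        (\<lambda>z \<in> carrier (Tot (f.X.Y \<sigma>) :: ('k, 'v) gmod). monomial 0 c \<odot>\<^bsub>Tot (f.Z.Y \<sigma>)\<^esub> tot_map (f.X.Y \<sigma>) (f.Z.Y \<sigma>) f.fmap z)"
      if \<sigma>: "\<sigma> \<in> faces" for \<sigma>
    proof (rule tot_map_scale[OF sm[OF \<sigma>], symmetric])
      fix d g assume g: "g \<in> piece (f.X.Y \<sigma>) d"
      obtain u where u: "g = germ u" "f.X.coherent \<sigma> d u" using g faces_subset[OF \<sigma>] by (rule f.X.pieceE)
      show "germ_fmap (Scale kst X Z c f) d g = pact (f.Z.Y \<sigma>) 0 c (f.fmap d g)"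
        unfolding u germ_fmap_germ f.Z.germ_sys_simps germ_map_germ germ_eq_iff off_zero
        using f.X.coherent_closed[OF u(2)] by eventually_elim (simp add: kst_mod_simps f.Z.ract_def proj_zero)
    qed
    then show "on_hom S X Z (Scale kst X Z c f) = Scale L (on_ob S X) (on_ob S Z) c (on_hom S X Z f)"
      by (auto intro!: restrict_ext) }
  fix g assume g: "g \<in> Hom kst X Z"
  interpret g: kst_map m a b X Z g by (rule kst_mapI[OF X Z g])
  note sm' = g.system_map_fmap[OF faces_subset]
  have "tot_map (f.X.Y \<sigma>) (f.Z.Y \<sigma>) (germ_fmap (Add kst X Z f g)) =
      (\<lambda>z \<in> carrier (Tot (f.X.Y \<sigma>) :: ('k, 'v) gmod). tot_map (f.X.Y \<sigma>) (f.Z.Y \<sigma>) f.fmap z \<oplus>\<^bsub>Tot (f.Z.Y \<sigma>)\<^esub> tot_map (f.X.Y \<sigma>) (f.Z.Y \<sigma>) g.fmap z)"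
    if \<sigma>: "\<sigma> \<in> faces" for \<sigma>
  proof (rule tot_map_plus[OF sm[OF \<sigma>] sm'[OF \<sigma>], symmetric])
    fix d x assume x: "x \<in> piece (f.X.Y \<sigma>) d"
    obtain u where u: "x = germ u" "f.X.coherent \<sigma> d u" using x faces_subset[OF \<sigma>] by (rule f.X.pieceE)
    show "germ_fmap (Add kst X Z f g) d x = padd (f.Z.Y \<sigma>) (f.fmap d x) (g.fmap d x)"
      unfolding u germ_fmap_germ germ_fmap_germ f.Z.germ_sys_simps germ_map2_germ germ_map_germ germ_eq_iff
      using f.X.coherent_closed[OF u(2)] by eventually_elim (simp add: kst_mod_simps)
  qed
  then show "on_hom S X Z (Add kst X Z f g) = Add L (on_ob S X) (on_ob S Z) (on_hom S X Z f) (on_hom S X Z g)"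
    by (auto intro!: restrict_ext)
next
  fix X Y Z :: "('k, 'v) gmod" and f g
  assume X: "X \<in> Ob kst" and Y: "Y \<in> Ob kst" and Z: "Z \<in> Ob kst" and f: "f \<in> Hom kst X Y" and g: "g \<in> Hom kst Y Z"
  interpret f: kst_map m a b X Y f by (rule kst_mapI[OF X Y f])
  interpret g: kst_map m a b Y Z g by (rule kst_mapI[OF Y Z g])
  have "tot_map (f.X.Y \<sigma>) (g.Z.Y \<sigma>) (germ_fmap (Comp kst X Y Z g f)) =
      compose (carrier (Tot (f.X.Y \<sigma>) :: ('k, 'v) gmod)) (tot_map (f.Z.Y \<sigma>) (g.Z.Y \<sigma>) g.fmap) (tot_map (f.X.Y \<sigma>) (f.Z.Y \<sigma>) f.fmap)"
    if \<sigma>: "\<sigma> \<in> faces" for \<sigma>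
  proof (rule tot_map_compose[OF f.system_map_fmap[OF faces_subset[OF \<sigma>]] g.system_map_fmap[OF faces_subset[OF \<sigma>]], symmetric])
    fix d x assume x: "x \<in> piece (f.X.Y \<sigma>) d"
    obtain u where u: "x = germ u" "f.X.coherent \<sigma> d u" using x faces_subset[OF \<sigma>] by (rule f.X.pieceE)
    show "germ_fmap (Comp kst X Y Z g f) d x = g.fmap d (f.fmap d x)"
      unfolding u germ_fmap_germ germ_fmap_germ germ_map_germ germ_eq_iff
      using f.X.coherent_closed[OF u(2)] by eventually_elim (simp add: kst_mod_simps compose_eq)
  qed
  then show "on_hom S X Z (Comp kst X Y Z g f) =
      Comp L (on_ob S X) (on_ob S Y) (on_ob S Z) (on_hom S Y Z g) (on_hom S X Y f)"
    by (auto intro!: restrict_ext)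
qed

lemma exact_spread: "exact_functor kst L (S :: (('k::field, 'v) gmod, _, _, _) functor_data)"
  unfolding exact_functor_def
proof (intro conjI ballI impI)
  show "additive_functor kst L (S :: (('k::field, 'v) gmod, _, _, _) functor_data)"
    by (rule conjunct1[OF linear_spread[unfolded linear_functor_def]])
  fix X Y Z :: "('k, 'v) gmod" and f g
  assume X: "X \<in> Ob kst" and Y: "Y \<in> Ob kst" and Z: "Z \<in> Ob kst" and f: "f \<in> Hom kst X Y" and g: "g \<in> Hom kst Y Z"
    and ses: "Ses kst X Y Z f g"
  show "Ses L (on_ob S X) (on_ob S Y) (on_ob S Z) (on_hom S X Y f) (on_hom S Y Z g)"
    using kst_map_exact[OF kst_mapI[OF X Y f] kst_mapI[OF Y Z g] ses faces_subset] by simp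
qed

end

section \<open>The retraction\<close>

text \<open>
  The homogeneous elements whose degrees are supported on \<open>{a, b}\<close>.
\<close>

definition slice_sys :: "nat \<Rightarrow> nat \<Rightarrow> ('k::field, 'v) gmod \<Rightarrow> ('k, 'v) gsys" where
  "slice_sys a b P =
     \<lparr>piece = (\<lambda>\<delta>. if \<delta> \<in> degrees 2 {} then component P (corner_incl a b \<delta>) else {\<zero>\<^bsub>P\<^esub>}),
      null = \<zero>\<^bsub>P\<^esub>, padd = ring.add P, pact = (\<lambda>e c x. monomial (corner_incl a b e) c \<odot>\<^bsub>P\<^esub> x)\<rparr>"

lemma slice_sys_simps:
  "piece (slice_sys a b P) \<delta> = (if \<delta> \<in> degrees 2 {} then component P (corner_incl a b \<delta>) else {\<zero>\<^bsub>P\<^esub>})"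
  "null (slice_sys a b P) = \<zero>\<^bsub>P\<^esub>"
  "padd (slice_sys a b P) = ring.add P"
  "pact (slice_sys a b P) e c x = monomial (corner_incl a b e) c \<odot>\<^bsub>P\<^esub> x"
  by (simp_all add: slice_sys_def)

definition slice ::
  "nat \<Rightarrow> nat \<Rightarrow> nat \<Rightarrow> (('k::field, 'v) L_object, nat set \<Rightarrow> 'v \<Rightarrow> 'v, ('k, 'v) gmod, 'v \<Rightarrow> 'v) functor_data" where
  "slice m a b =
     \<lparr>on_ob = (\<lambda>M. Tot (slice_sys a b (part M (corner_face m a b)))),
      on_hom = (\<lambda>M N F. tot_map (slice_sys a b (part M (corner_face m a b))) (slice_sys a b (part N (corner_face m a b)))
         (\<lambda>d. F (corner_face m a b)))\<rparr>"

lemma slice_simps [simp]: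
  "on_ob (slice m a b) M = Tot (slice_sys a b (part M (corner_face m a b)))"
  "on_hom (slice m a b) M N F =
     tot_map (slice_sys a b (part M (corner_face m a b))) (slice_sys a b (part N (corner_face m a b))) (\<lambda>d. F (corner_face m a b))"
  by (simp_all add: slice_def)

context corner_complex
begin

abbreviation R :: "(('k::field, 'v) L_object, nat set \<Rightarrow> 'v \<Rightarrow> 'v, ('k, 'v) gmod, 'v \<Rightarrow> 'v) functor_data" where
  "R \<equiv> slice m a b"

lemma gsystem_slice_sys:
  assumes "is_graded_module m \<sigma> (P :: ('k::field, 'v) gmod)"
  shows "gsystem 2 {} (slice_sys a b P) TYPE('v)"
proof -
  interpret P: gmodule m \<sigma> P by unfold_locales fact
  have pc: "x \<in> component P (\<iota> d)" if "x \<in> piece (slice_sys a b P) d" for x d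
    using that P.zero_component by (auto simp: slice_sys_simps split: if_splits)
  note cl = P.component_closed[OF pc]
  show ?thesis
  proof (unfold_locales, goal_cases)
    case (6 x d)
    then have "\<ominus>\<^bsub>P\<^esub> x \<in> piece (slice_sys a b P) d"
      by (auto simp: slice_sys_simps P.minus_component split: if_splits)
    moreover have "padd (slice_sys a b P) (\<ominus>\<^bsub>P\<^esub> x) x = null (slice_sys a b P)"
      using cl[OF 6] by (simp add: slice_sys_simps P.LM.M.l_neg)
    ultimately show ?case by blast
  next
    case (8 e x d c)
    then show ?case
      using P.act_component[OF incl_degrees[OF 8(1)] pc[OF 8(2)], of c] P.zero_component P.act_zero[OF incl_degrees[OF 8(1)]]
      by (auto simp: slice_sys_simps incl_plus degrees_add split: if_splits)
  next
    case 13
    show ?case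
      by (rule families_encodable[OF infinite_universe countable_degrees[of 2 "{}"], where j = "\<lambda>x. x"])
        (auto simp: slice_sys_simps)
  next
    case (3 x d y z)
    then show ?case using cl by (simp add: slice_sys_simps P.LM.M.a_assoc)
  next
    case (4 x d y)
    then show ?case using cl by (simp add: slice_sys_simps P.LM.M.a_comm)
  next
    case (5 x d)
    then show ?case using cl by (simp add: slice_sys_simps)
  next
    case (9 e x d y c)
    then show ?case using cl by (simp add: slice_sys_simps P.act_plus[OF incl_degrees])
  next
    case (10 e x d c c')
    then show ?case using cl by (simp add: slice_sys_simps P.act_coeff_plus[OF incl_degrees])
  next
    case (11 e e' x d c c')
    then show ?case using cl by (simp add: slice_sys_simps P.act_act[OF incl_degrees incl_degrees] incl_plus)
  next
    case (12 x d)
    have "\<iota> 0 = 0" by (simp add: corner_incl_def fun_eq_iff)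
    then show ?case using P.act_one[OF cl[OF 12]] by (simp add: slice_sys_simps)
  qed (auto simp: slice_sys_simps P.zero_component P.plus_component split: if_splits)
qed

text \<open>
  Over \<open>\<sigma>\<^sub>0\<close> only the coordinates \<open>a\<close> and \<open>b\<close> of a degree are bounded below, so each degree differs
  from one supported on \<open>{a, b}\<close> by the exponent of a unit.
\<close>

lemma slice_degrees:
  assumes "d \<in> degrees m \<sigma>\<^sub>0"
  shows "\<pi> d \<in> degrees 2 {}" and "d - \<iota> (\<pi> d) \<in> degrees m \<sigma>\<^sub>0" and "\<iota> (\<pi> d) - d \<in> degrees m \<sigma>\<^sub>0"
  using assms ab by (auto simp: degrees_def corner_proj_def corner_incl_def corner_face_def)

text \<open>
  Homogeneous generators can be moved into the slice by multiplication with units.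
\<close>

lemma finitely_generated_slice_sys:
  assumes P: "P \<in> (fg_graded_modules m \<sigma>\<^sub>0 :: ('k::field, 'v) gmod set)"
  shows "finitely_generated (loc_ring 2 {}) (Tot (slice_sys a b P) :: ('k, 'v) gmod)"
proof -
  have P': "is_graded_module m \<sigma>\<^sub>0 P" and fg: "finitely_generated (loc_ring m \<sigma>\<^sub>0) P"
    using P by (auto simp: fg_graded_modules_def)
  interpret P: gmodule m \<sigma>\<^sub>0 P by unfold_locales (rule P')
  interpret G: gsystem 2 "{}" "slice_sys a b P" "TYPE('v)" by (rule gsystem_slice_sys[OF P'])
  let ?q = "\<lambda>d x. monomial (\<iota> (\<pi> d) - d) 1 \<odot>\<^bsub>P\<^esub> x"
  let ?p = "\<lambda>d x. place (slice_sys a b P) (\<pi> d) (?q d x) :: 'v"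
  have q: "?q d x \<in> piece (slice_sys a b P) (\<pi> d)" if "d \<in> degrees m \<sigma>\<^sub>0" "x \<in> component P d" for d x
    using P.act_component[OF slice_degrees(3)[OF that(1)] that(2), of 1] slice_degrees(1)[OF that(1)]
    by (simp add: slice_sys_simps)
  show ?thesis
  proof (rule finitely_generated_by_homogeneous[OF P.gmodule_axioms G.T.gmodule_axioms fg, where p = ?p and \<psi> = \<pi>])
    show "?p d x \<in> carrier G.T" if "d \<in> degrees m \<sigma>\<^sub>0" "x \<in> component P d" for d x
      by (rule G.place_closed[OF q[OF that]])
    show "?p d (x \<oplus>\<^bsub>P\<^esub> y) = ?p d x \<oplus>\<^bsub>G.T\<^esub> ?p d y"
      if d: "d \<in> degrees m \<sigma>\<^sub>0" and xy: "x \<in> component P d" "y \<in> component P d" for d x y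
      using G.plus_place[OF q[OF d xy(1)] q[OF d xy(2)]] xy[THEN P.component_closed]
      by (simp add: P.act_plus[OF slice_degrees(3)[OF d]] slice_sys_simps)
    show "\<pi> e \<in> degrees 2 {}" if "e \<in> degrees m \<sigma>\<^sub>0" for e by (rule slice_degrees(1)[OF that])
    show "?p (d + e) (monomial e c \<odot>\<^bsub>P\<^esub> x) = monomial (\<pi> e) c \<odot>\<^bsub>G.T\<^esub> ?p d x"
      if e: "e \<in> degrees m \<sigma>\<^sub>0" and d: "d \<in> degrees m \<sigma>\<^sub>0" and x: "x \<in> component P d" for e c d x
    proof -
      have xc: "x \<in> carrier P" by (rule P.component_closed[OF x])
      have ee: "\<iota> (\<pi> (d + e)) - (d + e) + e = \<iota> (\<pi> e) + (\<iota> (\<pi> d) - d)"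
        by (simp add: proj_plus incl_plus)
      have "?q (d + e) (monomial e c \<odot>\<^bsub>P\<^esub> x) = monomial (\<iota> (\<pi> (d + e)) - (d + e) + e) c \<odot>\<^bsub>P\<^esub> x"
        using P.act_act[OF slice_degrees(3)[OF degrees_add[OF d e]] e xc] by simp
      also have "\<dots> = monomial (\<iota> (\<pi> e)) c \<odot>\<^bsub>P\<^esub> ?q d x"
        using P.act_act[OF incl_degrees[OF slice_degrees(1)[OF e]] slice_degrees(3)[OF d] xc, of c 1]
        by (simp only: ee mult_1_right)
      finally show ?thesis
        using G.act_place[OF slice_degrees(1)[OF e] q[OF d x], of c] by (simp add: slice_sys_simps proj_plus)
    qed
    fix H assume H: "is_submodule (loc_ring 2 {}) G.T H"
      "\<And>d x. d \<in> degrees m \<sigma>\<^sub>0 \<Longrightarrow> x \<in> component P d \<Longrightarrow> ?p d x \<in> H"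
    show "carrier G.T \<subseteq> H"
    proof (rule G.submodule_eqI[OF H(1)])
      fix \<delta> x assume \<delta>: "\<delta> \<in> degrees 2 {}" and "x \<in> piece (slice_sys a b P) \<delta>"
      then have x: "x \<in> component P (\<iota> \<delta>)" by (simp add: slice_sys_simps)
      from H(2)[OF incl_degrees[OF \<delta>] x] show "place (slice_sys a b P) \<delta> x \<in> H"
        using P.act_one[OF P.component_closed[OF x]] by (simp add: proj_incl[OF \<delta>])
    qed
  qed
qed

lemma system_map_slice:
  assumes "graded_map m \<sigma> \<sigma> P Q F"
  shows "system_map 2 {} {} (slice_sys a b P) (slice_sys a b Q :: ('k::field, 'v) gsys) TYPE('v) (\<lambda>d. F)"
proof -
  interpret F: graded_map m \<sigma> \<sigma> P Q F by fact
  interpret P: gsystem 2 "{}" "slice_sys a b P" "TYPE('v)" by (rule gsystem_slice_sys[OF F.M])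
  interpret Q: gsystem 2 "{}" "slice_sys a b Q" "TYPE('v)" by (rule gsystem_slice_sys[OF F.N])
  have cl: "x \<in> carrier P" if "x \<in> piece (slice_sys a b P) d" for x d
    using that by (auto simp: slice_sys_simps F.M.component_closed split: if_splits)
  show ?thesis
    by unfold_locales
      (auto simp: slice_sys_simps(2-) F.plus F.act incl_degrees cl,
       auto simp: slice_sys_simps F.zero F.component)
qed

lemma exact_slice: "exact_functor L kst (R :: (('k::field, 'v) L_object, _, _, _) functor_data)"
  unfolding exact_functor_def additive_functor_def is_functor_def
proof (intro conjI ballI impI)
  fix M :: "('k, 'v) L_object" assume M: "M \<in> Ob L"
  then have P: "part M \<sigma>\<^sub>0 \<in> fg_graded_modules m \<sigma>\<^sub>0" using L_objects_graded[OF _ base_face] by simp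
  then have P': "is_graded_module m \<sigma>\<^sub>0 (part M \<sigma>\<^sub>0)" by (simp add: fg_graded_modules_def)
  note G = gsystem_slice_sys[OF P']
  show "on_ob R M \<in> Ob kst"
    using gsystem.is_graded_module_Tot[OF G] finitely_generated_slice_sys[OF P]
    by (simp add: kst_mod_simps fg_graded_modules_def)
  show "on_hom R M M (Id L M) = Id kst (on_ob R M)"
    unfolding slice_simps kst_mod_simps
  proof (rule tot_map_id[OF G])
    interpret P: gmodule m \<sigma>\<^sub>0 "part M \<sigma>\<^sub>0" by unfold_locales (rule P')
    fix d x assume "x \<in> piece (slice_sys a b (part M \<sigma>\<^sub>0)) d"
    then have "x \<in> carrier (part M \<sigma>\<^sub>0)" by (auto simp: slice_sys_simps P.component_closed split: if_splits)
    then show "Id L M \<sigma>\<^sub>0 x = x" using base_face by simp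
  qed
next
  fix M N :: "('k, 'v) L_object" and F assume M: "M \<in> Ob L" and N: "N \<in> Ob L" and F: "F \<in> Hom L M N"
  have gm: "graded_map m \<sigma>\<^sub>0 \<sigma>\<^sub>0 (part M \<sigma>\<^sub>0) (part N \<sigma>\<^sub>0) (F \<sigma>\<^sub>0)" if "F \<in> Hom L M N" for F
    using M N that base_face graded_maps_iff[of "part M \<sigma>\<^sub>0" m \<sigma>\<^sub>0 "part N \<sigma>\<^sub>0"] L_maps_graded[of F m K M N \<sigma>\<^sub>0]
    by (simp add: L_objects_graded)
  interpret F: graded_map m \<sigma>\<^sub>0 \<sigma>\<^sub>0 "part M \<sigma>\<^sub>0" "part N \<sigma>\<^sub>0" "F \<sigma>\<^sub>0" by (rule gm[OF F])
  note sF = system_map_slice[OF gm[OF F]]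
  show "on_hom R M N F \<in> Hom kst (on_ob R M) (on_ob R N)"
    using system_map.graded_map_tot_map[OF sF] by (simp add: kst_mod_simps graded_map_def)
  fix G assume G: "G \<in> Hom L M N"
  show "on_hom R M N (Add L M N F G) = Add kst (on_ob R M) (on_ob R N) (on_hom R M N F) (on_hom R M N G)"
    unfolding slice_simps kst_mod_simps
  proof (rule tot_map_plus[OF sF system_map_slice[OF gm[OF G]], symmetric])
    fix d x assume "x \<in> piece (slice_sys a b (part M \<sigma>\<^sub>0)) d"
    then have "x \<in> carrier (part M \<sigma>\<^sub>0)" by (auto simp: slice_sys_simps F.M.component_closed split: if_splits)
    then show "Add L M N F G \<sigma>\<^sub>0 x = padd (slice_sys a b (part N \<sigma>\<^sub>0)) (F \<sigma>\<^sub>0 x) (G \<sigma>\<^sub>0 x)"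
      using base_face by (simp add: slice_sys_simps)
  qed
next
  fix M N Q :: "('k, 'v) L_object" and F G
  assume M: "M \<in> Ob L" and N: "N \<in> Ob L" and Q: "Q \<in> Ob L" and F: "F \<in> Hom L M N" and G: "G \<in> Hom L N Q"
  have F': "graded_map m \<sigma>\<^sub>0 \<sigma>\<^sub>0 (part M \<sigma>\<^sub>0) (part N \<sigma>\<^sub>0) (F \<sigma>\<^sub>0)"
    using M N F base_face graded_maps_iff[of "part M \<sigma>\<^sub>0" m \<sigma>\<^sub>0 "part N \<sigma>\<^sub>0"] L_maps_graded[of F m K M N \<sigma>\<^sub>0]
    by (simp add: L_objects_graded)
  have G': "graded_map m \<sigma>\<^sub>0 \<sigma>\<^sub>0 (part N \<sigma>\<^sub>0) (part Q \<sigma>\<^sub>0) (G \<sigma>\<^sub>0)"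
    using N Q G base_face graded_maps_iff[of "part N \<sigma>\<^sub>0" m \<sigma>\<^sub>0 "part Q \<sigma>\<^sub>0"] L_maps_graded[of G m K N Q \<sigma>\<^sub>0]
    by (simp add: L_objects_graded)
  interpret F: graded_map m \<sigma>\<^sub>0 \<sigma>\<^sub>0 "part M \<sigma>\<^sub>0" "part N \<sigma>\<^sub>0" "F \<sigma>\<^sub>0" by (rule F')
  interpret G: graded_map m \<sigma>\<^sub>0 \<sigma>\<^sub>0 "part N \<sigma>\<^sub>0" "part Q \<sigma>\<^sub>0" "G \<sigma>\<^sub>0" by (rule G')
  note sF = system_map_slice[OF F'] and sG = system_map_slice[OF G']
  show "on_hom R M Q (Comp L M N Q G F) = Comp kst (on_ob R M) (on_ob R N) (on_ob R Q) (on_hom R N Q G) (on_hom R M N F)"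
    unfolding slice_simps kst_mod_simps
  proof (rule tot_map_compose[OF sF sG, symmetric])
    fix d x assume "x \<in> piece (slice_sys a b (part M \<sigma>\<^sub>0)) d"
    then have "x \<in> carrier (part M \<sigma>\<^sub>0)" by (auto simp: slice_sys_simps F.M.component_closed split: if_splits)
    then show "Comp L M N Q G F \<sigma>\<^sub>0 x = G \<sigma>\<^sub>0 (F \<sigma>\<^sub>0 x)"
      using base_face by (simp add: compose_eq)
  qed
  assume "Ses L M N Q F G"
  then have "Ses (graded_mod m \<sigma>\<^sub>0) (part M \<sigma>\<^sub>0) (part N \<sigma>\<^sub>0) (part Q \<sigma>\<^sub>0) (F \<sigma>\<^sub>0) (G \<sigma>\<^sub>0)"
    using base_face by simp
  then have inj: "inj_on (F \<sigma>\<^sub>0) (carrier (part M \<sigma>\<^sub>0))"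
    and mid: "F \<sigma>\<^sub>0 ` carrier (part M \<sigma>\<^sub>0) = {x \<in> carrier (part N \<sigma>\<^sub>0). G \<sigma>\<^sub>0 x = \<zero>\<^bsub>part Q \<sigma>\<^sub>0\<^esub>}"
    and surj: "G \<sigma>\<^sub>0 ` carrier (part N \<sigma>\<^sub>0) = carrier (part Q \<sigma>\<^sub>0)"
    by (simp_all add: graded_mod_def)
  show "Ses kst (on_ob R M) (on_ob R N) (on_ob R Q) (on_hom R M N F) (on_hom R N Q G)"
    unfolding slice_simps kst_mod_def
  proof (rule tot_map_exact[OF sF sG])
    fix d assume d: "d \<in> degrees 2 {}"
    have pc: "piece (slice_sys a b P) d = component P (\<iota> d)" for P :: "('k, 'v) gmod"
      using d by (simp add: slice_sys_simps)
    show "x = y" if "x \<in> piece (slice_sys a b (part M \<sigma>\<^sub>0)) d" "y \<in> piece (slice_sys a b (part M \<sigma>\<^sub>0)) d" "F \<sigma>\<^sub>0 x = F \<sigma>\<^sub>0 y" for x y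
      using that by (auto simp: pc F.M.component_closed intro: inj_onD[OF inj])
    show "G \<sigma>\<^sub>0 (F \<sigma>\<^sub>0 x) = null (slice_sys a b (part Q \<sigma>\<^sub>0))" if "x \<in> piece (slice_sys a b (part M \<sigma>\<^sub>0)) d" for x
    proof -
      have "F \<sigma>\<^sub>0 x \<in> F \<sigma>\<^sub>0 ` carrier (part M \<sigma>\<^sub>0)" using that by (simp add: pc F.M.component_closed)
      then show ?thesis unfolding mid by (simp add: slice_sys_simps)
    qed
    show "\<exists>x\<in>piece (slice_sys a b (part M \<sigma>\<^sub>0)) d. F \<sigma>\<^sub>0 x = y"
      if y: "y \<in> piece (slice_sys a b (part N \<sigma>\<^sub>0)) d" "G \<sigma>\<^sub>0 y = null (slice_sys a b (part Q \<sigma>\<^sub>0))" for y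
    proof -
      have yc: "y \<in> component (part N \<sigma>\<^sub>0) (\<iota> d)" using y by (simp add: pc)
      then have "y \<in> F \<sigma>\<^sub>0 ` carrier (part M \<sigma>\<^sub>0)"
        unfolding mid using y(2) by (simp add: F.N.component_closed slice_sys_simps)
      then obtain x where x: "x \<in> carrier (part M \<sigma>\<^sub>0)" "F \<sigma>\<^sub>0 x = y" by (elim imageE) auto
      then show ?thesis using F.inj_reflects_component[OF inj x(1), of "\<iota> d"] yc by (auto simp: pc)
    qed
    show "\<exists>y\<in>piece (slice_sys a b (part N \<sigma>\<^sub>0)) d. G \<sigma>\<^sub>0 y = z" if "z \<in> piece (slice_sys a b (part Q \<sigma>\<^sub>0)) d" for z
      using G.surj_component[OF surj, of z "\<iota> d"] that by (simp add: pc)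
  qed
qed

text \<open>
  At \<open>\<sigma>\<^sub>0\<close> neither \<open>t\<^sub>a\<close> nor \<open>t\<^sub>b\<close> is inverted, and compatible sequences in \<open>N\<close> are eventually
  constant.
\<close>

lemma
  assumes N: "kst_module m a b N" and \<delta>: "\<delta> \<in> degrees 2 {}"
  shows inj_fraction_corner: "x \<in> component N \<delta> \<Longrightarrow> y \<in> component N \<delta> \<Longrightarrow>
      kst_module.fraction a b N \<sigma>\<^sub>0 (\<iota> \<delta>) x = kst_module.fraction a b N \<sigma>\<^sub>0 (\<iota> \<delta>) y \<Longrightarrow> x = y"
    and surj_fraction_corner: "g \<in> piece (germ_sys m a b N \<sigma>\<^sub>0) (\<iota> \<delta>) \<Longrightarrow>
      \<exists>x \<in> component N \<delta>. kst_module.fraction a b N \<sigma>\<^sub>0 (\<iota> \<delta>) x = g"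
proof -
  interpret N: kst_module m a b N by fact
  have \<sigma>: "\<sigma>\<^sub>0 \<subseteq> {1..m}" by (auto simp: corner_face_def)
  have \<pi>0: "\<pi> (gap \<sigma>\<^sub>0 n d) = 0" for n d by (auto simp: corner_proj_def gap_def corner_face_def fun_eq_iff)
  have fr: "N.fraction \<sigma>\<^sub>0 d x = germ (\<lambda>n. x)" if "x \<in> carrier N" for d x
    unfolding N.fraction_def using N.ract_corner_free[OF \<pi>0 that] by simp
  show "x = y" if x: "x \<in> component N \<delta>" "y \<in> component N \<delta>"
    and eq: "N.fraction \<sigma>\<^sub>0 (\<iota> \<delta>) x = N.fraction \<sigma>\<^sub>0 (\<iota> \<delta>) y" for x y
    using eq x by (simp add: fr N.N.component_closed germ_eq_iff)
  show "\<exists>x \<in> component N \<delta>. N.fraction \<sigma>\<^sub>0 (\<iota> \<delta>) x = g" if g: "g \<in> piece (N.Y \<sigma>\<^sub>0) (\<iota> \<delta>)"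
  proof -
    obtain n x where x: "x \<in> N.NN (clamp \<sigma>\<^sub>0 n (\<iota> \<delta>))"
      and gx: "g = pact (N.Y \<sigma>\<^sub>0) (\<iota> \<delta> - clamp \<sigma>\<^sub>0 n (\<iota> \<delta>)) 1 (N.fraction \<sigma>\<^sub>0 (clamp \<sigma>\<^sub>0 n (\<iota> \<delta>)) x)"
      by (rule N.piece_eq_fraction[OF \<sigma> incl_degrees[OF \<delta>] g])
    have "\<pi> (clamp \<sigma>\<^sub>0 n (\<iota> \<delta>)) = \<pi> (\<iota> \<delta>)" by (auto simp: corner_proj_def clamp_def corner_face_def fun_eq_iff)
    then have xc: "x \<in> component N \<delta>" using x by (simp add: N.NN_def proj_incl[OF \<delta>])
    then have xN: "x \<in> carrier N" by (rule N.N.component_closed)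
    have "g = germ (\<lambda>n. x)"
      using N.ract_one[OF xN] by (simp add: gx fr[OF xN] N.germ_sys_simps off_diff_clamp)
    then show ?thesis using xc fr[OF xN] by auto
  qed
qed

text \<open>
  The isomorphism from \<open>N\<close> to \<open>R S N\<close>, which maps each component \<open>x\<close> to the fraction \<open>x/1\<close>.
\<close>

definition unit :: "('k::field, 'v) gmod \<Rightarrow> 'v \<Rightarrow> 'v" where
  "unit N = (\<lambda>x \<in> carrier N. encode (slice_sys a b (Tot (germ_sys m a b N \<sigma>\<^sub>0) :: ('k, 'v) gmod))
     (\<lambda>\<delta>. place (germ_sys m a b N \<sigma>\<^sub>0) (\<iota> \<delta>) (kst_module.fraction a b N \<sigma>\<^sub>0 (\<iota> \<delta>) (gmodule.cmp N x \<delta>))))"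

lemma
  assumes N: "kst_module m a b (N :: ('k::field, 'v) gmod)"
  shows unit_graded_map: "graded_map 2 {} {} N (on_ob R (on_ob S N)) (unit N)"
    and bij_unit: "bij_betw (unit N) (carrier N) (carrier (on_ob R (on_ob S N)))"
    and coord_unit: "x \<in> carrier N \<Longrightarrow> coord (slice_sys a b (Tot (germ_sys m a b N \<sigma>\<^sub>0) :: ('k, 'v) gmod)) (unit N x) \<delta> =
       place (germ_sys m a b N \<sigma>\<^sub>0) (\<iota> \<delta>) (kst_module.fraction a b N \<sigma>\<^sub>0 (\<iota> \<delta>) (gmodule.cmp N x \<delta>))"
proof -
  interpret N: kst_module m a b N by fact
  have \<sigma>: "\<sigma>\<^sub>0 \<subseteq> {1..m}" by (auto simp: corner_face_def)
  interpret G: gsystem m \<sigma>\<^sub>0 "N.Y \<sigma>\<^sub>0" "TYPE('v)" by (rule N.gsystem_germ_sys[OF \<sigma>])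
  interpret Q: gsystem 2 "{}" "slice_sys a b G.T" "TYPE('v)" by (rule gsystem_slice_sys[OF G.is_graded_module_Tot])
  let ?h = "\<lambda>\<delta> y. place (N.Y \<sigma>\<^sub>0) (\<iota> \<delta>) (N.fraction \<sigma>\<^sub>0 (\<iota> \<delta>) y) :: 'v"
  have h0: "?h \<delta> \<zero>\<^bsub>N\<^esub> = \<zero>\<^bsub>G.T\<^esub>" for \<delta> by (simp add: N.fraction_zero[OF \<sigma>] G.place_null)
  have fr: "N.fraction \<sigma>\<^sub>0 (\<iota> \<delta>) y \<in> piece (N.Y \<sigma>\<^sub>0) (\<iota> \<delta>)" if "\<delta> \<in> degrees 2 {}" "y \<in> component N \<delta>" for \<delta> y
    using that by (intro N.fraction_piece[OF \<sigma>] incl_degrees) (simp_all add: N.NN_def proj_incl)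
  have outside: "y = \<zero>\<^bsub>N\<^esub>" if "\<delta> \<notin> degrees 2 {}" "y \<in> component N \<delta>" for \<delta> y
    using that N.N.component_outside by auto
  have h: "?h \<delta> y \<in> piece (slice_sys a b G.T) \<delta>" if "y \<in> component N \<delta>" for \<delta> y
    using that G.place_component[OF fr] outside h0 by (auto simp: slice_sys_simps)
  have h_plus: "?h \<delta> (y \<oplus>\<^bsub>N\<^esub> y') = ?h \<delta> y \<oplus>\<^bsub>G.T\<^esub> ?h \<delta> y'" if y: "y \<in> component N \<delta>" "y' \<in> component N \<delta>" for \<delta> y y'
  proof (cases "\<delta> \<in> degrees 2 {}")
    case True
    then show ?thesis using y by (simp add: N.fraction_plus[OF \<sigma>] N.N.component_closed G.plus_place fr)
  next
    case False
    then show ?thesis using y[THEN outside[OF False]] by (simp add: h0)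
  qed
  have h_act: "?h (\<delta> + e) (monomial e c \<odot>\<^bsub>N\<^esub> y) = monomial (\<iota> e) c \<odot>\<^bsub>G.T\<^esub> ?h \<delta> y"
    if e: "e \<in> degrees 2 {}" and y: "y \<in> component N \<delta>" for \<delta> e c y
  proof (cases "\<delta> \<in> degrees 2 {}")
    case True
    have "N.fraction \<sigma>\<^sub>0 (\<iota> \<delta> + \<iota> e) (N.ract (\<iota> e) c y) = pact (N.Y \<sigma>\<^sub>0) (\<iota> e) c (N.fraction \<sigma>\<^sub>0 (\<iota> \<delta>) y)"
      by (rule N.fraction_ract[OF \<sigma> N.N.component_closed[OF y] incl_degrees[OF e]])
    then show ?thesis
      by (simp add: G.act_place[OF incl_degrees[OF e] fr[OF True y]] incl_plus N.ract_def proj_incl[OF e])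
  next
    case False
    then show ?thesis using outside[OF False y] by (simp add: h0 N.N.act_zero[OF e] G.T.act_zero[OF incl_degrees[OF e]])
  qed
  have fam: "(\<lambda>\<delta>. ?h \<delta> (N.N.cmp x \<delta>)) \<in> families (slice_sys a b G.T)" if x: "x \<in> carrier N" for x
  proof -
    have "{\<delta>. ?h \<delta> (N.N.cmp x \<delta>) \<noteq> \<zero>\<^bsub>G.T\<^esub>} \<subseteq> {\<delta>. N.N.cmp x \<delta> \<noteq> \<zero>\<^bsub>N\<^esub>}" using h0 by auto
    then show ?thesis
      using h[OF N.N.cmp_component[OF x]] finite_subset[OF _ N.N.finite_cmp[OF x]]
      by (simp add: families_def slice_sys_simps(2))
  qed
  have co: "coord (slice_sys a b G.T) (unit N x) \<delta> = ?h \<delta> (N.N.cmp x \<delta>)" if "x \<in> carrier N" for x \<delta>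
    using that by (simp add: unit_def Q.coord_encode fam)
  have cl: "unit N x \<in> carrier Q.T" if "x \<in> carrier N" for x
    using that by (simp add: unit_def Q.encode_closed fam)
  show "coord (slice_sys a b G.T) (unit N x) \<delta> = ?h \<delta> (N.N.cmp x \<delta>)" if "x \<in> carrier N" for x
    using that by (rule co)
  have inj_h: "y = y'" if "y \<in> component N \<delta>" "y' \<in> component N \<delta>" "?h \<delta> y = ?h \<delta> y'" for \<delta> y y'
  proof (cases "\<delta> \<in> degrees 2 {}")
    case True
    have "coord (N.Y \<sigma>\<^sub>0) (?h \<delta> y) (\<iota> \<delta>) = coord (N.Y \<sigma>\<^sub>0) (?h \<delta> y') (\<iota> \<delta>)" using that(3) by (simp only:)
    then have "N.fraction \<sigma>\<^sub>0 (\<iota> \<delta>) y = N.fraction \<sigma>\<^sub>0 (\<iota> \<delta>) y'"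
      by (simp only: G.coord_place[OF fr[OF True that(1)]] G.coord_place[OF fr[OF True that(2)]] if_True simp_thms)
    then show ?thesis by (rule inj_fraction_corner[OF N True that(1,2)])
  next
    case False
    then show ?thesis using that outside by auto
  qed
  have surj_h: "\<exists>y \<in> component N \<delta>. ?h \<delta> y = z \<and> (z = \<zero>\<^bsub>G.T\<^esub> \<longrightarrow> y = \<zero>\<^bsub>N\<^esub>)" if z: "z \<in> piece (slice_sys a b G.T) \<delta>" for \<delta> z
  proof (cases "z = \<zero>\<^bsub>G.T\<^esub>")
    case True
    then show ?thesis using h0 N.N.zero_component by blast
  next
    case False
    then have \<delta>: "\<delta> \<in> degrees 2 {}" and zc: "z \<in> component G.T (\<iota> \<delta>)" using z by (auto simp: slice_sys_simps split: if_splits)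
    obtain y where y: "y \<in> component N \<delta>" "N.fraction \<sigma>\<^sub>0 (\<iota> \<delta>) y = coord (N.Y \<sigma>\<^sub>0) z (\<iota> \<delta>)"
      using surj_fraction_corner[OF N \<delta> G.coord_piece[OF G.T.component_closed[OF zc], of "\<iota> \<delta>"]] by blast
    have "?h \<delta> y = z" by (simp only: y(2) G.component_eq_place[OF zc, symmetric])
    then show ?thesis using y(1) False by blast
  qed
  show "bij_betw (unit N) (carrier N) (carrier (on_ob R (on_ob S N)))"
    unfolding bij_betw_def slice_simps spread_simps
  proof (intro conjI equalityI subsetI)
    show "inj_on (unit N) (carrier N)"
    proof (rule inj_onI)
      fix x y assume x: "x \<in> carrier N" and y: "y \<in> carrier N" and eq: "unit N x = unit N y"
      show "x = y"
        using co[OF x] co[OF y] eq inj_h[OF N.N.cmp_component[OF x] N.N.cmp_component[OF y]]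
        by (intro N.N.cmp_eqI[OF x y]) simp
    qed
    show "z \<in> carrier Q.T" if "z \<in> unit N ` carrier N" for z using that cl by auto
    fix z assume z: "z \<in> carrier Q.T"
    obtain u where u: "\<And>\<delta>. u \<delta> \<in> component N \<delta>" "\<And>\<delta>. ?h \<delta> (u \<delta>) = coord (slice_sys a b G.T) z \<delta>"
      "\<And>\<delta>. coord (slice_sys a b G.T) z \<delta> = \<zero>\<^bsub>G.T\<^esub> \<Longrightarrow> u \<delta> = \<zero>\<^bsub>N\<^esub>"
      using surj_h[OF Q.coord_piece[OF z]] by metis
    have "finite {\<delta>. u \<delta> \<noteq> \<zero>\<^bsub>N\<^esub>}"
      using u(3) Q.finite_coord[OF z] by (auto simp: slice_sys_simps(2) elim!: rev_finite_subset)
    then obtain x where x: "x \<in> carrier N" "N.N.cmp x = u" using N.N.gather[OF u(1)] by blast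
    have "unit N x = z" using x u(2) by (intro Q.Tot_eqI[OF cl[OF x(1)] z]) (simp add: co)
    then show "z \<in> unit N ` carrier N" using x(1) by blast
  qed
  show "graded_map 2 {} {} N (on_ob R (on_ob S N)) (unit N)"
    unfolding slice_simps spread_simps
  proof (rule graded_mapI[OF N.N.graded Q.is_graded_module_Tot])
    show "unit N \<in> carrier N \<rightarrow>\<^sub>E carrier Q.T" using cl by (auto simp: unit_def)
    show "unit N (x \<oplus>\<^bsub>N\<^esub> y) = unit N x \<oplus>\<^bsub>Q.T\<^esub> unit N y" if "x \<in> carrier N" "y \<in> carrier N" for x y
      using that
      by (rule_tac Q.Tot_eqI) (simp_all add: cl Q.plus_closed Q.coord_plus co N.N.cmp_plus h_plus N.N.cmp_component slice_sys_simps(3))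
    show "unit N (monomial e c \<odot>\<^bsub>N\<^esub> x) = monomial e c \<odot>\<^bsub>Q.T\<^esub> unit N x" if e: "e \<in> degrees 2 {}" and x: "x \<in> carrier N" for e c x
    proof (rule Q.Tot_eqI)
      fix \<delta>
      show "coord (slice_sys a b G.T) (unit N (monomial e c \<odot>\<^bsub>N\<^esub> x)) \<delta> = coord (slice_sys a b G.T) (monomial e c \<odot>\<^bsub>Q.T\<^esub> unit N x) \<delta>"
        using h_act[OF e N.N.cmp_component[OF x, of "\<delta> - e"], of c]
        by (simp add: Q.coord_act[OF e cl[OF x]] co x N.N.act_closed[OF e x] N.N.cmp_act_diff[OF e x] slice_sys_simps(4))
    qed (use e x in \<open>simp_all add: cl N.N.act_closed Q.T.act_closed\<close>)
    show "unit N x \<in> component Q.T d" if "x \<in> component N d" for d x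
      using that by (simp add: Q.component_Tot cl N.N.component_closed co N.N.cmp_homogeneous h0 slice_sys_simps(2))
  qed simp
qed

lemma graded_map_inverse:
  assumes f: "graded_map m' \<sigma> \<sigma> M N f" and bij: "bij_betw f (carrier M) (carrier N)"
  defines "g \<equiv> \<lambda>y \<in> carrier N. inv_into (carrier M) f y"
  shows "graded_map m' \<sigma> \<sigma> N M g"
    and "compose (carrier M) g f = (\<lambda>x \<in> carrier M. x)" and "compose (carrier N) f g = (\<lambda>y \<in> carrier N. y)"
proof -
  interpret f: graded_map m' \<sigma> \<sigma> M N f by fact
  have inj: "inj_on f (carrier M)" and surj: "f ` carrier M = carrier N" using bij by (auto simp: bij_betw_def)
  have gf: "g (f x) = x" if "x \<in> carrier M" for x using that inj by (simp add: g_def f.closed)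
  have fg: "f (g y) = y" if "y \<in> carrier N" for y using that surj by (simp add: g_def f_inv_into_f)
  have gc: "g y \<in> carrier M" if "y \<in> carrier N" for y using that surj inv_into_into[of y f "carrier M"] by (simp add: g_def)
  show "graded_map m' \<sigma> \<sigma> N M g"
  proof (rule graded_mapI[OF f.N f.M f.sub])
    show "g \<in> carrier N \<rightarrow>\<^sub>E carrier M" using gc by (auto simp: g_def)
    show "g (x \<oplus>\<^bsub>N\<^esub> y) = g x \<oplus>\<^bsub>M\<^esub> g y" if "x \<in> carrier N" "y \<in> carrier N" for x y
      using that by (rule_tac inj_onD[OF inj]) (simp_all add: fg gc f.plus)
    show "g (monomial e c \<odot>\<^bsub>N\<^esub> x) = monomial e c \<odot>\<^bsub>M\<^esub> g x" if "e \<in> degrees m' \<sigma>" "x \<in> carrier N" for e c x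
      using that by (rule_tac inj_onD[OF inj]) (simp_all add: fg gc f.act f.M.act_closed f.N.act_closed)
    show "g x \<in> component M d" if "x \<in> component N d" for d x
      using that f.N.component_closed[OF that] by (intro f.inj_reflects_component[OF inj]) (simp_all add: fg gc)
  qed
  show "compose (carrier M) g f = (\<lambda>x \<in> carrier M. x)" "compose (carrier N) f g = (\<lambda>y \<in> carrier N. y)"
    unfolding compose_def by (auto intro!: restrict_ext simp: gf fg)
qed

lemma unit_natural:
  assumes X: "X \<in> Ob kst" and Z: "Z \<in> Ob kst" and f: "f \<in> Hom kst X (Z :: ('k::field, 'v) gmod)" and x: "x \<in> carrier X"
  shows "on_hom R (on_ob S X) (on_ob S Z) (on_hom S X Z f) (unit X x) = unit Z (f x)"
proof -
  have \<sigma>: "\<sigma>\<^sub>0 \<subseteq> {1..m}" by (auto simp: corner_face_def)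
  interpret f: kst_map m a b X Z f by (rule kst_mapI[OF X Z f])
  interpret F: system_map m \<sigma>\<^sub>0 \<sigma>\<^sub>0 "f.X.Y \<sigma>\<^sub>0" "f.Z.Y \<sigma>\<^sub>0" "TYPE('v)" f.fmap by (rule f.system_map_fmap[OF \<sigma>])
  interpret Q: system_map 2 "{}" "{}" "slice_sys a b F.Y.T" "slice_sys a b F.X.T" "TYPE('v)" "\<lambda>d. F.F"
    by (rule system_map_slice[OF F.graded_map_tot_map])
  have hom: "on_hom R (on_ob S X) (on_ob S Z) (on_hom S X Z f) = Q.F"
    using base_face by simp
  have ux: "unit X x \<in> carrier Q.Y.T"
    using graded_map.closed[OF unit_graded_map[OF f.X.kst_module_axioms] x] by simp
  have fx: "f x \<in> carrier Z" using x by (rule f.f.closed)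
  have ufx: "unit Z (f x) \<in> carrier Q.X.T"
    using graded_map.closed[OF unit_graded_map[OF f.Z.kst_module_axioms] fx] by simp
  show ?thesis
    unfolding hom
  proof (rule Q.X.Tot_eqI[OF Q.map_closed[OF ux] ufx])
    fix \<delta>
    have pc: "f.X.fraction \<sigma>\<^sub>0 (\<iota> \<delta>) (f.X.N.cmp x \<delta>) \<in> piece (f.X.Y \<sigma>\<^sub>0) (\<iota> \<delta>)"
    proof (cases "\<delta> \<in> degrees 2 {}")
      case True
      then show ?thesis using f.X.N.cmp_component[OF x, of \<delta>]
        by (intro f.X.fraction_piece[OF \<sigma>] incl_degrees) (simp_all add: f.X.NN_def proj_incl)
    next
      case False
      then have "f.X.N.cmp x \<delta> = \<zero>\<^bsub>X\<^esub>"
        using f.X.N.cmp_component[OF x, of \<delta>] f.X.N.component_outside[OF False] by simp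
      then show ?thesis by (simp add: f.X.fraction_zero[OF \<sigma>] F.Y.null_piece)
    qed
    show "coord (slice_sys a b F.X.T) (Q.F (unit X x)) \<delta> = coord (slice_sys a b F.X.T) (unit Z (f x)) \<delta>"
      using F.map_place[OF pc]
      by (simp add: Q.coord_map[OF ux] coord_unit[OF f.X.kst_module_axioms x] coord_unit[OF f.Z.kst_module_axioms fx]
          f.fmap_fraction[OF \<sigma> f.X.N.cmp_closed[OF x]] f.f.cmp[OF x])
  qed
qed

lemma slice_spread: "naturally_iso_identity (kst :: ('k::field, ('k, 'v) gmod, _) lincat) (functor_comp R S)"
  unfolding naturally_iso_identity_def
proof (intro exI conjI ballI)
  let ?\<eta> = "\<lambda>X :: ('k, 'v) gmod. \<lambda>z \<in> carrier (on_ob R (on_ob S X)). inv_into (carrier X) (unit X) z"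
  have R: "on_ob R (on_ob S X) \<in> Ob kst" if "X \<in> Ob kst" for X :: "('k, 'v) gmod"
    using exact_slice spread_ob[OF that] unfolding exact_functor_def additive_functor_def is_functor_def by blast
  fix X :: "('k, 'v) gmod" assume X: "X \<in> Ob kst"
  have u: "graded_map 2 {} {} X (on_ob R (on_ob S X)) (unit X)" "bij_betw (unit X) (carrier X) (carrier (on_ob R (on_ob S X)))"
    using unit_graded_map[OF kst_moduleI[OF X]] bij_unit[OF kst_moduleI[OF X]] .
  note inv = graded_map_inverse[OF u]
  have XX: "X \<in> fg_graded_modules 2 {}" "on_ob R (on_ob S X) \<in> fg_graded_modules 2 {}"
    using X R[OF X] by (simp_all only: kst_mod_simps)
  show "iso_arrow kst (on_ob (functor_comp R S) X) X (?\<eta> X)"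
    unfolding iso_arrow_def functor_comp_def functor_data.simps kst_mod_simps
  proof (intro conjI bexI)
    show "?\<eta> X \<in> graded_maps 2 {} (on_ob R (on_ob S X)) X" using inv(1) graded_maps_iff[OF XX(2,1)] by (simp only:)
    show "unit X \<in> graded_maps 2 {} X (on_ob R (on_ob S X))" using u(1) graded_maps_iff[OF XX] by (simp only:)
  qed (rule inv(2,3))+
  fix Z :: "('k, 'v) gmod" and f assume Z: "Z \<in> Ob kst" and f: "f \<in> Hom kst X Z"
  interpret f: kst_map m a b X Z f by (rule kst_mapI[OF X Z f])
  have uZ: "bij_betw (unit Z) (carrier Z) (carrier (on_ob R (on_ob S Z)))" "graded_map 2 {} {} Z (on_ob R (on_ob S Z)) (unit Z)"
    using bij_unit[OF kst_moduleI[OF Z]] unit_graded_map[OF kst_moduleI[OF Z]] .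
  show "Comp kst (on_ob (functor_comp R S) X) (on_ob (functor_comp R S) Z) Z (?\<eta> Z) (on_hom (functor_comp R S) X Z f) =
      Comp kst (on_ob (functor_comp R S) X) X Z f (?\<eta> X)"
    unfolding functor_comp_def functor_data.simps kst_mod_simps compose_def
  proof (rule restrict_ext)
    fix z assume z: "z \<in> carrier (on_ob R (on_ob S X))"
    obtain x where x: "x \<in> carrier X" "z = unit X x" using z u(2) by (auto simp: bij_betw_def)
    have "?\<eta> X z = x" using x z u(2) by (simp add: bij_betw_def)
    moreover have "?\<eta> Z (unit Z (f x)) = f x"
      using uZ(1) graded_map.closed[OF uZ(2) f.f.closed[OF x(1)]] f.f.closed[OF x(1)] by (simp add: bij_betw_def)
    ultimately show "?\<eta> Z (on_hom R (on_ob S X) (on_ob S Z) (on_hom S X Z f) z) = f (?\<eta> X z)"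
      by (simp only: x(2) unit_natural[OF X Z f x(1)])
  qed
qed

text \<open>
  Equality of two arrows is propagated from the slice to \<open>\<sigma>\<^sub>0\<close> by multiplication with units, from there to
  all faces containing \<open>\<sigma>\<^sub>0\<close> because these modules are localisations, and then to an arbitrary face
  \<open>\<sigma>\<close> because the localisation from \<open>\<sigma>\<close> to \<open>\<sigma> \<union> \<sigma>\<^sub>0\<close> is injective: the variables that it inverts
  were adjoined freely.
\<close>

lemma slice_faithful_on_spread:
  assumes X: "X \<in> Ob kst" and Z: "Z \<in> Ob (kst :: ('k::field, ('k, 'v) gmod, _) lincat)"
    and F: "F \<in> Hom L (on_ob S X) (on_ob S Z)" and G: "G \<in> Hom L (on_ob S X) (on_ob S Z)"
    and eq: "on_hom R (on_ob S X) (on_ob S Z) F = on_hom R (on_ob S X) (on_ob S Z) G"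
  shows "F = G"
proof -
  interpret X: kst_module m a b X by (rule kst_moduleI[OF X])
  interpret Z: kst_module m a b Z by (rule kst_moduleI[OF Z])
  have \<sigma>: "\<sigma>\<^sub>0 \<subseteq> {1..m}" by (auto simp: corner_face_def)
  have gm: "graded_map m \<sigma> \<sigma> (Tot (X.Y \<sigma>)) (Tot (Z.Y \<sigma>)) (A \<sigma>)" if "A \<in> Hom L (on_ob S X) (on_ob S Z)" "\<sigma> \<in> faces" for A \<sigma>
    using L_maps_graded[of A m K "on_ob S X" "on_ob S Z" \<sigma>] that
      gsystem.is_graded_module_Tot[OF X.gsystem_germ_sys[OF faces_subset]] gsystem.is_graded_module_Tot[OF Z.gsystem_germ_sys[OF faces_subset]]
    by (simp add: graded_map_def)
  have comm: "A \<tau> (tot_map (X.Y \<sigma>) (X.Y \<tau>) (X.trans \<sigma> \<tau>) x) = tot_map (Z.Y \<sigma>) (Z.Y \<tau>) (Z.trans \<sigma> \<tau>) (A \<sigma> x)"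
    if "A \<in> Hom L (on_ob S X) (on_ob S Z)" "\<sigma> \<in> faces" "\<tau> \<in> faces" "\<sigma> \<subseteq> \<tau>" "x \<in> carrier (Tot (X.Y \<sigma>) :: ('k, 'v) gmod)" for A \<sigma> \<tau> x
    using that by (auto simp: L_maps_def)
  have base: "F \<sigma>\<^sub>0 = G \<sigma>\<^sub>0"
  proof -
    interpret F: graded_map m \<sigma>\<^sub>0 \<sigma>\<^sub>0 "Tot (X.Y \<sigma>\<^sub>0)" "Tot (Z.Y \<sigma>\<^sub>0)" "F \<sigma>\<^sub>0" by (rule gm[OF F base_face])
    interpret G: graded_map m \<sigma>\<^sub>0 \<sigma>\<^sub>0 "Tot (X.Y \<sigma>\<^sub>0)" "Tot (Z.Y \<sigma>\<^sub>0)" "G \<sigma>\<^sub>0" by (rule gm[OF G base_face])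
    interpret QF: system_map 2 "{}" "{}" "slice_sys a b (Tot (X.Y \<sigma>\<^sub>0) :: ('k, 'v) gmod)" "slice_sys a b (Tot (Z.Y \<sigma>\<^sub>0) :: ('k, 'v) gmod)" "TYPE('v)" "\<lambda>d. F \<sigma>\<^sub>0"
      by (rule system_map_slice[OF gm[OF F base_face]])
    interpret QG: system_map 2 "{}" "{}" "slice_sys a b (Tot (X.Y \<sigma>\<^sub>0) :: ('k, 'v) gmod)" "slice_sys a b (Tot (Z.Y \<sigma>\<^sub>0) :: ('k, 'v) gmod)" "TYPE('v)" "\<lambda>d. G \<sigma>\<^sub>0"
      by (rule system_map_slice[OF gm[OF G base_face]])
    have eq': "QF.F = QG.F" using eq by simp
    have corner: "F \<sigma>\<^sub>0 y = G \<sigma>\<^sub>0 y" if \<delta>: "\<delta> \<in> degrees 2 {}" and y: "y \<in> component (Tot (X.Y \<sigma>\<^sub>0) :: ('k, 'v) gmod) (\<iota> \<delta>)" for \<delta> y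
    proof -
      have p: "y \<in> piece (slice_sys a b (Tot (X.Y \<sigma>\<^sub>0) :: ('k, 'v) gmod)) \<delta>" using \<delta> y by (simp add: slice_sys_simps)
      show ?thesis
        using QF.coord_map[OF QF.Y.place_closed[OF p], of \<delta>] QG.coord_map[OF QF.Y.place_closed[OF p], of \<delta>]
          QF.Y.coord_place[OF p, of \<delta>] by (simp add: eq')
    qed
    show ?thesis
    proof (rule F.eq_on_homogeneous[OF gm[OF G base_face]])
      fix x d assume d: "d \<in> degrees m \<sigma>\<^sub>0" and x: "x \<in> component (Tot (X.Y \<sigma>\<^sub>0) :: ('k, 'v) gmod) d"
      let ?y = "monomial (\<iota> (\<pi> d) - d) 1 \<odot>\<^bsub>Tot (X.Y \<sigma>\<^sub>0) :: ('k, 'v) gmod\<^esub> x"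
      note sd = slice_degrees[OF d]
      have xc: "x \<in> carrier (Tot (X.Y \<sigma>\<^sub>0) :: ('k, 'v) gmod)" by (rule F.M.component_closed[OF x])
      have y: "?y \<in> component (Tot (X.Y \<sigma>\<^sub>0) :: ('k, 'v) gmod) (\<iota> (\<pi> d))"
        using F.M.act_component[OF sd(3) x, of 1] by simp
      have xy: "x = monomial (d - \<iota> (\<pi> d)) 1 \<odot>\<^bsub>Tot (X.Y \<sigma>\<^sub>0) :: ('k, 'v) gmod\<^esub> ?y"
        using F.M.act_act[OF sd(2,3) xc, of 1 1] F.M.act_one[OF xc] by simp
      show "F \<sigma>\<^sub>0 x = G \<sigma>\<^sub>0 x"
        using F.act[OF sd(2) F.M.component_closed[OF y], of 1] G.act[OF sd(2) F.M.component_closed[OF y], of 1]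
          corner[OF sd(1) y] xy by metis
    qed
  qed
  have above: "F \<tau> = G \<tau>" if \<tau>: "\<tau> \<in> faces" and sub: "\<sigma>\<^sub>0 \<subseteq> \<tau>" for \<tau>
  proof -
    interpret F: graded_map m \<tau> \<tau> "Tot (X.Y \<tau>)" "Tot (Z.Y \<tau>)" "F \<tau>" by (rule gm[OF F \<tau>])
    interpret G: graded_map m \<tau> \<tau> "Tot (X.Y \<tau>)" "Tot (Z.Y \<tau>)" "G \<tau>" by (rule gm[OF G \<tau>])
    show ?thesis
    proof (rule F.eq_on_homogeneous[OF gm[OF G \<tau>]])
      fix y d assume d: "d \<in> degrees m \<tau>" and y: "y \<in> component (Tot (X.Y \<tau>) :: ('k, 'v) gmod) d"
      let ?\<phi> = "tot_map (X.Y \<sigma>\<^sub>0) (X.Y \<tau>) (X.trans \<sigma>\<^sub>0 \<tau>) :: 'v \<Rightarrow> 'v"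
      obtain e x where e: "e \<in> degrees m \<tau>" and x: "x \<in> carrier (Tot (X.Y \<sigma>\<^sub>0) :: ('k, 'v) gmod)"
        and y_eq: "y = monomial e 1 \<odot>\<^bsub>Tot (X.Y \<tau>) :: ('k, 'v) gmod\<^esub> ?\<phi> x"
        using X.trans_generates[OF faces_subset[OF \<tau>] sub d y] by blast
      have \<phi>x: "?\<phi> x \<in> carrier (Tot (X.Y \<tau>) :: ('k, 'v) gmod)"
        by (rule system_map.map_closed[OF X.system_map_trans[OF faces_subset[OF \<tau>] sub] x])
      show "F \<tau> y = G \<tau> y"
        unfolding y_eq F.act[OF e \<phi>x] G.act[OF e \<phi>x] comm[OF F base_face \<tau> sub x] comm[OF G base_face \<tau> sub x] base ..
    qed
  qed
  have all: "F \<sigma> = G \<sigma>" if \<sigma>: "\<sigma> \<in> faces" for \<sigma>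
  proof -
    let ?\<tau> = "\<sigma> \<union> \<sigma>\<^sub>0"
    have sub: "\<sigma> \<subseteq> ?\<tau>" by blast
    have \<tau>: "?\<tau> \<in> faces" using faces_up[OF \<sigma> sub] faces_subset[OF \<sigma>] faces_subset[OF base_face] by blast
    interpret F: graded_map m \<sigma> \<sigma> "Tot (X.Y \<sigma>)" "Tot (Z.Y \<sigma>)" "F \<sigma>" by (rule gm[OF F \<sigma>])
    interpret G: graded_map m \<sigma> \<sigma> "Tot (X.Y \<sigma>)" "Tot (Z.Y \<sigma>)" "G \<sigma>" by (rule gm[OF G \<sigma>])
    interpret t: system_map m \<sigma> ?\<tau> "Z.Y \<sigma>" "Z.Y ?\<tau>" "TYPE('v)" "Z.trans \<sigma> ?\<tau>"
      by (rule Z.system_map_trans[OF faces_subset[OF \<tau>] sub])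
    have "x = y" if x: "x \<in> piece (Z.Y \<sigma>) d" and y: "y \<in> piece (Z.Y \<sigma>) d" and eq: "Z.trans \<sigma> ?\<tau> d x = Z.trans \<sigma> ?\<tau> d y" for d x y
    proof -
      obtain u where u: "x = germ u" "Z.coherent \<sigma> d u" using x faces_subset[OF \<sigma>] by (rule Z.pieceE)
      obtain v where v: "y = germ v" "Z.coherent \<sigma> d v" using y faces_subset[OF \<sigma>] by (rule Z.pieceE)
      have \<pi>0: "\<pi> (gap (?\<tau> - \<sigma>) n d) = 0" for n by (auto simp: corner_proj_def gap_def corner_face_def fun_eq_iff)
      have "\<forall>\<^sub>F n in sequentially. Z.ract (gap (?\<tau> - \<sigma>) n d) 1 (u n) = Z.ract (gap (?\<tau> - \<sigma>) n d) 1 (v n)"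
        using eq by (simp only: u v Z.trans_def germ_map_germ germ_eq_iff)
      then show "x = y"
        unfolding u v germ_eq_iff using Z.coherent_closed[OF u(2)] Z.coherent_closed[OF v(2)]
        by eventually_elim (simp only: Z.ract_corner_free[OF \<pi>0])
    qed
    then have inj: "inj_on t.F (carrier t.Y.T)" by (rule t.tot_map_inj)
    have eq\<tau>: "F ?\<tau> = G ?\<tau>" by (rule above[OF \<tau>]) blast
    show ?thesis
    proof (rule extensionalityI[OF F.ext G.ext])
      fix x assume x: "x \<in> carrier (Tot (X.Y \<sigma>) :: ('k, 'v) gmod)"
      show "F \<sigma> x = G \<sigma> x"
        using comm[OF F \<sigma> \<tau> sub x] comm[OF G \<sigma> \<tau> sub x] eq\<tau>
        by (intro inj_onD[OF inj _ F.closed[OF x] G.closed[OF x]]) simp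
    qed
  qed
  show ?thesis
  proof (rule extensionalityI[of _ faces])
    show "F \<in> extensional faces" "G \<in> extensional faces"
      using F G by (auto simp: L_maps_def PiE_def)
  qed (rule all)
qed

lemma spread_fully_faithful:
  shows "faithful (kst :: ('k::field, ('k, 'v) gmod, _) lincat) S" and "full (kst :: ('k, ('k, 'v) gmod, _) lincat) L S"
proof -
  have f: "is_functor (kst :: ('k, ('k, 'v) gmod, _) lincat) L S" "is_functor L (kst :: ('k, ('k, 'v) gmod, _) lincat) R"
    using exact_spread exact_slice unfolding exact_functor_def additive_functor_def by blast+
  have laws: "lincat_laws (kst :: ('k, ('k, 'v) gmod, _) lincat)"
    unfolding kst_mod_def by (rule lincat_laws_graded_mod)
  show "faithful (kst :: ('k, ('k, 'v) gmod, _) lincat) S" "full (kst :: ('k, ('k, 'v) gmod, _) lincat) L S"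
    by (rule retract_fully_faithful[OF laws f slice_spread slice_faithful_on_spread]; assumption)+
qed

end

section \<open>Idempotents of modules over the free algebra\<close>

lemma monoid_algebra_module_subset:
  assumes "monoid_algebra_module S M" "add_submonoid S'" "S' \<subseteq> S"
  shows "monoid_algebra_module S' M"
proof -
  interpret M: monoid_algebra_module S M by fact
  have "left_module (monoid_algebra S') M"
    using assms(3)
    by (intro left_module.intro ring_monoid_algebra assms(2) M.LM.abelian_group_axioms left_module_axioms.intro)
      (auto simp: subset_trans intro!: M.LM.smult_closed M.smult_plus_left M.LM.smult_r_distr
        M.LM.smult_assoc[simplified] M.LM.smult_one[simplified])
  then show ?thesis using assms(2) by (simp add: monoid_algebra_module_def)
qed

lemma left_module_submodule:
  assumes "left_module A M" "is_submodule A M H"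
  shows "left_module A (M\<lparr>carrier := H\<rparr>)"
proof -
  interpret left_module A M by fact
  have H: "H \<subseteq> carrier M" "\<zero>\<^bsub>M\<^esub> \<in> H" "\<And>x y. x \<in> H \<Longrightarrow> y \<in> H \<Longrightarrow> x \<oplus>\<^bsub>M\<^esub> y \<in> H"
    "\<And>a x. a \<in> carrier A \<Longrightarrow> x \<in> H \<Longrightarrow> a \<odot>\<^bsub>M\<^esub> x \<in> H"
    using assms(2) by (auto simp: is_submodule_def)
  have "abelian_group (M\<lparr>carrier := H\<rparr>)"
  proof (rule abelian_groupI)
    fix x assume "x \<in> carrier (M\<lparr>carrier := H\<rparr>)"
    then have x: "x \<in> H" "x \<in> carrier M" using H(1) by auto
    have one: "\<ominus>\<^bsub>A\<^esub> \<one>\<^bsub>A\<^esub> \<in> carrier A" by simp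
    have "(\<ominus>\<^bsub>A\<^esub> \<one>\<^bsub>A\<^esub>) \<odot>\<^bsub>M\<^esub> x \<oplus>\<^bsub>M\<^esub> x = (\<ominus>\<^bsub>A\<^esub> \<one>\<^bsub>A\<^esub> \<oplus>\<^bsub>A\<^esub> \<one>\<^bsub>A\<^esub>) \<odot>\<^bsub>M\<^esub> x"
      using smult_l_distr[OF one R.one_closed x(2)] smult_one[OF x(2)] by simp
    also have "\<dots> = \<zero>\<^bsub>A\<^esub> \<odot>\<^bsub>M\<^esub> x" by (simp add: R.l_neg)
    also have "\<dots> = \<zero>\<^bsub>M\<^esub>"
      using smult_l_distr[of "\<zero>\<^bsub>A\<^esub>" "\<zero>\<^bsub>A\<^esub>" x] smult_closed[of "\<zero>\<^bsub>A\<^esub>" x] x(2) by simp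
    finally show "\<exists>y\<in>carrier (M\<lparr>carrier := H\<rparr>). y \<oplus>\<^bsub>M\<lparr>carrier := H\<rparr>\<^esub> x = \<zero>\<^bsub>M\<lparr>carrier := H\<rparr>\<^esub>"
      using H(4)[OF one x(1)] by auto
  qed (use H in \<open>auto simp: subset_eq M.a_assoc intro: M.a_comm\<close>)
  then show ?thesis
    by (intro left_module.intro R.ring_axioms left_module_axioms.intro)
      (use H in \<open>auto simp: subset_eq smult_l_distr smult_r_distr smult_assoc smult_one\<close>)
qed

lemma finitely_generated_image:
  assumes M: "left_module A M" and N: "left_module A N" and fg: "finitely_generated A M"
    and plus: "\<And>x y. x \<in> carrier M \<Longrightarrow> y \<in> carrier M \<Longrightarrow> f (x \<oplus>\<^bsub>M\<^esub> y) = f x \<oplus>\<^bsub>N\<^esub> f y"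
    and smult: "\<And>a x. a \<in> carrier A \<Longrightarrow> x \<in> carrier M \<Longrightarrow> f (a \<odot>\<^bsub>M\<^esub> x) = a \<odot>\<^bsub>N\<^esub> f x"
    and surj: "f ` carrier M = carrier N"
  shows "finitely_generated A N"
proof -
  interpret M: left_module A M by fact
  interpret N: left_module A N by fact
  have f0: "f \<zero>\<^bsub>M\<^esub> = \<zero>\<^bsub>N\<^esub>"
    by (rule additive_zero[OF M.M.abelian_group_axioms N.M.abelian_group_axioms]) (use surj plus in auto)
  obtain B where B: "finite B" "B \<subseteq> carrier M" "\<And>H. is_submodule A M H \<Longrightarrow> B \<subseteq> H \<Longrightarrow> carrier M \<subseteq> H"
    using fg finitely_generated_iff[OF M] by blast
  show ?thesis
    unfolding finitely_generated_iff[OF N]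
  proof (intro exI[of _ "f ` B"] conjI allI impI)
    show "finite (f ` B)" using B(1) by simp
    show "f ` B \<subseteq> carrier N" using B(2) surj by blast
    fix H assume H: "is_submodule A N H" "f ` B \<subseteq> H"
    have "is_submodule A M {x \<in> carrier M. f x \<in> H}"
      using H(1) by (auto simp: is_submodule_def f0 plus smult intro!: M.smult_closed)
    then have "carrier M \<subseteq> {x \<in> carrier M. f x \<in> H}" by (rule B(3)) (use B(2) H(2) in auto)
    then have "f ` carrier M \<subseteq> H" by auto
    then show "carrier N \<subseteq> H" by (simp only: surj)
  qed
qed

abbreviation fd :: "('k::field, (free_word \<Rightarrow>\<^sub>0 'k, 'v) module, 'v \<Rightarrow> 'v) lincat" where
  "fd \<equiv> fd_free_algebra_mod"

lemma fd_simps: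
  "Ob (fd :: ('k::field, (free_word \<Rightarrow>\<^sub>0 'k, 'v) module, 'v \<Rightarrow> 'v) lincat) =
     {M. left_module (monoid_algebra UNIV) M \<and> finitely_generated (monoid_algebra {0}) M}"
  "Hom fd U (V :: (free_word \<Rightarrow>\<^sub>0 'k::field, 'v) module) = linear_maps (monoid_algebra UNIV) U V"
  "Id fd U = (\<lambda>x \<in> carrier (U :: (free_word \<Rightarrow>\<^sub>0 'k::field, 'v) module). x)"
  "Comp fd U V (W :: (free_word \<Rightarrow>\<^sub>0 'k::field, 'v) module) g f = compose (carrier U) g f"
  "Zero fd U (V :: (free_word \<Rightarrow>\<^sub>0 'k::field, 'v) module) = (\<lambda>x \<in> carrier U. \<zero>\<^bsub>V\<^esub>)"
  "Add fd U (V :: (free_word \<Rightarrow>\<^sub>0 'k::field, 'v) module) f g = (\<lambda>x \<in> carrier U. f x \<oplus>\<^bsub>V\<^esub> g x)"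
  "Scale fd U (V :: (free_word \<Rightarrow>\<^sub>0 'k::field, 'v) module) c f = (\<lambda>x \<in> carrier U. monomial 0 c \<odot>\<^bsub>V\<^esub> f x)"
  by (simp_all add: fd_free_algebra_mod_def free_algebra_def)

lemma add_submonoid_UNIV: "add_submonoid UNIV" and add_submonoid_zero: "add_submonoid {0}"
  by (auto simp: add_submonoid_def)

lemma fd_ob_module:
  "U \<in> Ob fd \<Longrightarrow> monoid_algebra_module UNIV U"
  "U \<in> Ob fd \<Longrightarrow> left_module (monoid_algebra {0}) U"
  using monoid_algebra_module_subset[of UNIV U "{0}"]
  by (auto simp: fd_simps monoid_algebra_module_def add_submonoid_UNIV add_submonoid_zero)

locale fd_map =
  U: monoid_algebra_module "UNIV :: free_word set" U + V: monoid_algebra_module "UNIV :: free_word set" V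
  for U V :: "(free_word \<Rightarrow>\<^sub>0 'k::field, 'v) module" +
  fixes f
  assumes f: "f \<in> linear_maps (monoid_algebra UNIV) U V"
begin

lemma ext: "f \<in> extensional (carrier U)"
  using f by (auto simp: linear_maps_def PiE_def)

lemma closed: "x \<in> carrier U \<Longrightarrow> f x \<in> carrier V"
  using f by (auto simp: linear_maps_def)

lemma plus: "x \<in> carrier U \<Longrightarrow> y \<in> carrier U \<Longrightarrow> f (x \<oplus>\<^bsub>U\<^esub> y) = f x \<oplus>\<^bsub>V\<^esub> f y"
  using f by (auto simp: linear_maps_def)

lemma smult: "x \<in> carrier U \<Longrightarrow> f (a \<odot>\<^bsub>U\<^esub> x) = a \<odot>\<^bsub>V\<^esub> f x"
  using f by (auto simp: linear_maps_def)

lemma zero: "f \<zero>\<^bsub>U\<^esub> = \<zero>\<^bsub>V\<^esub>"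
  by (rule additive_zero[OF U.LM.abelian_group_axioms V.LM.abelian_group_axioms]) (auto simp: closed plus)

end

lemma fd_mapI: "U \<in> Ob fd \<Longrightarrow> V \<in> Ob fd \<Longrightarrow> f \<in> Hom fd U V \<Longrightarrow> fd_map U V f"
  using fd_ob_module(1)[of U] fd_ob_module(1)[of V] by (simp add: fd_map_def fd_map_axioms_def fd_simps)

lemma lincat_laws_fd: "lincat_laws (fd :: ('k::field, (free_word \<Rightarrow>\<^sub>0 'k, 'v) module, 'v \<Rightarrow> 'v) lincat)"
  unfolding fd_free_algebra_mod_def free_algebra_def
proof (rule lincat_laws_module_category[where S = UNIV], goal_cases)
  case (1 M)
  then show ?case by (simp add: monoid_algebra_module_def add_submonoid_UNIV)
next
  case (3 M)
  then interpret left_module "monoid_algebra UNIV" M by simp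
  show ?case by (auto simp: linear_maps_def intro: smult_closed)
next
  case (4 L M N f g)
  then interpret left_module "monoid_algebra UNIV" L by simp
  have "f x \<in> carrier M" if "x \<in> carrier L" for x using 4(4) that by (auto simp: linear_maps_def)
  then show ?case using 4 by (auto simp: linear_maps_def compose_def intro!: smult_closed)
next
  case (5 M N)
  then interpret M: left_module "monoid_algebra UNIV" M by simp
  interpret N: monoid_algebra_module UNIV N using 5 by (simp add: monoid_algebra_module_def add_submonoid_UNIV)
  show ?case by (auto simp: linear_maps_def N.smult_zero_right intro!: M.smult_closed)
qed simp

text \<open>
  An idempotent splits its module as the sum of its image and its kernel, both of which are again finite
  dimensional.
\<close>

lemma fd_trivial_idempotents:
  "indecomposables_have_trivial_idempotents (fd :: ('k::field, (free_word \<Rightarrow>\<^sub>0 'k, 'v) module, 'v \<Rightarrow> 'v) lincat)"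
  unfolding indecomposables_have_trivial_idempotents_def
proof (intro allI impI)
  fix U :: "(free_word \<Rightarrow>\<^sub>0 'k, 'v) module" and e
  assume ind: "indecomposable fd U" and eh: "e \<in> Hom fd U U" and ee: "Comp fd U U U e e = e"
  have U: "U \<in> Ob fd" using ind by (simp add: indecomposable_def)
  interpret e: fd_map U U e by (rule fd_mapI[OF U U eh])
  have idem: "e (e x) = e x" if "x \<in> carrier U" for x
    using fun_cong[OF ee, of x] that by (simp add: fd_simps compose_eq)
  let ?q = "\<lambda>x. x \<ominus>\<^bsub>U\<^esub> e x"
  let ?Y = "U\<lparr>carrier := e ` carrier U\<rparr>" and ?Z = "U\<lparr>carrier := {x \<in> carrier U. e x = \<zero>\<^bsub>U\<^esub>}\<rparr>"
  have subY: "is_submodule (monoid_algebra UNIV) U (e ` carrier U)"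
    unfolding is_submodule_def
  proof (intro conjI ballI)
    show "e ` carrier U \<subseteq> carrier U" using e.closed by auto
    show "\<zero>\<^bsub>U\<^esub> \<in> e ` carrier U" using e.zero by (metis imageI e.U.LM.M.zero_closed)
  next
    fix x y assume "x \<in> e ` carrier U" "y \<in> e ` carrier U"
    then obtain x' y' where "x' \<in> carrier U" "x = e x'" "y' \<in> carrier U" "y = e y'" by blast
    then show "x \<oplus>\<^bsub>U\<^esub> y \<in> e ` carrier U" using e.plus[of x' y'] by (intro image_eqI[of _ _ "x' \<oplus>\<^bsub>U\<^esub> y'"]) auto
  next
    fix a x assume "x \<in> e ` carrier U"
    then obtain x' where "x' \<in> carrier U" "x = e x'" by blast
    then show "a \<odot>\<^bsub>U\<^esub> x \<in> e ` carrier U" using e.smult[of x' a]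
      by (intro image_eqI[of _ _ "a \<odot>\<^bsub>U\<^esub> x'"]) (auto intro!: e.U.LM.smult_closed)
  qed
  have subZ: "is_submodule (monoid_algebra UNIV) U {x \<in> carrier U. e x = \<zero>\<^bsub>U\<^esub>}"
    by (auto simp: is_submodule_def e.zero e.plus e.smult e.U.smult_zero_right intro!: e.U.LM.smult_closed)
  have lY: "left_module (monoid_algebra UNIV) ?Y" and lZ: "left_module (monoid_algebra UNIV) ?Z"
    using left_module_submodule[OF e.U.left_module subY] left_module_submodule[OF e.U.left_module subZ] .
  have lY0: "left_module (monoid_algebra {0}) ?Y" and lZ0: "left_module (monoid_algebra {0}) ?Z"
    using lY lZ monoid_algebra_module_subset[of UNIV ?Y "{0}"] monoid_algebra_module_subset[of UNIV ?Z "{0}"]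
    by (auto simp: monoid_algebra_module_def add_submonoid_UNIV add_submonoid_zero)
  have qc: "?q x \<in> carrier U" if "x \<in> carrier U" for x using that e.closed by simp
  have eq0: "e (?q x) = \<zero>\<^bsub>U\<^esub>" if x: "x \<in> carrier U" for x
  proof -
    have "e (?q x) \<oplus>\<^bsub>U\<^esub> e (e x) = e x"
      using e.plus[OF qc[OF x] e.closed[OF x]] x e.closed[OF x]
      by (simp add: e.U.LM.M.minus_eq e.U.LM.M.a_assoc e.U.LM.M.l_neg)
    then show ?thesis using idem[OF x] e.closed[OF x] e.closed[OF qc[OF x]]
      by (metis e.U.LM.M.add.r_cancel_one')
  qed
  have q_plus: "?q (x \<oplus>\<^bsub>U\<^esub> y) = ?q x \<oplus>\<^bsub>U\<^esub> ?q y" if "x \<in> carrier U" "y \<in> carrier U" for x y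
    using that e.closed[OF that(1)] e.closed[OF that(2)]
    by (simp add: e.plus e.U.LM.M.minus_eq e.U.LM.M.minus_add e.U.LM.M.a_ac)
  have q_smult: "?q (a \<odot>\<^bsub>U\<^esub> x) = a \<odot>\<^bsub>U\<^esub> ?q x" if x: "x \<in> carrier U" for a x
  proof -
    have c: "a \<in> carrier (monoid_algebra UNIV)" by simp
    have "a \<odot>\<^bsub>U\<^esub> (\<ominus>\<^bsub>U\<^esub> e x) = \<ominus>\<^bsub>U\<^esub> (a \<odot>\<^bsub>U\<^esub> e x)"
      using e.closed[OF x] c
      by (intro additive_minus[OF e.U.LM.abelian_group_axioms e.U.LM.abelian_group_axioms])
        (auto intro!: e.U.LM.smult_closed e.U.LM.smult_r_distr)
    then show ?thesis using x c e.closed[OF x]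
      by (simp add: e.smult e.U.LM.M.minus_eq e.U.LM.smult_r_distr)
  qed
  have q_id: "?q x = x" if "x \<in> carrier U" "e x = \<zero>\<^bsub>U\<^esub>" for x
    using that by (simp add: e.U.LM.M.minus_eq)
  have fgU: "finitely_generated (monoid_algebra {0}) U" using U by (simp add: fd_simps)
  have fgY: "finitely_generated (monoid_algebra {0}) ?Y"
    by (rule finitely_generated_image[OF fd_ob_module(2)[OF U] lY0 fgU, of e]) (auto simp: e.plus e.smult)
  have fgZ: "finitely_generated (monoid_algebra {0}) ?Z"
  proof (rule finitely_generated_image[OF fd_ob_module(2)[OF U] lZ0 fgU, of ?q])
    show "?q ` carrier U = carrier ?Z"
    proof (intro equalityI subsetI)
      fix x assume "x \<in> ?q ` carrier U"
      then show "x \<in> carrier ?Z" using qc eq0 by auto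
    next
      fix x assume "x \<in> carrier ?Z"
      then show "x \<in> ?q ` carrier U" using q_id[of x] by (intro image_eqI[of _ _ x]) auto
    qed
  qed (simp_all add: q_plus q_smult)
  have Y: "?Y \<in> Ob fd" and Z: "?Z \<in> Ob fd" using lY lZ fgY fgZ by (simp_all add: fd_simps)
  have i: "(\<lambda>x \<in> e ` carrier U. x) \<in> Hom fd ?Y U"
    using subY by (auto simp: fd_simps linear_maps_def is_submodule_def)
  have j: "(\<lambda>x \<in> {x \<in> carrier U. e x = \<zero>\<^bsub>U\<^esub>}. x) \<in> Hom fd ?Z U"
    using subZ by (auto simp: fd_simps linear_maps_def is_submodule_def)
  have p: "e \<in> Hom fd U ?Y"
    using e.f by (auto simp: fd_simps linear_maps_def PiE_def)
  have q: "(\<lambda>x \<in> carrier U. ?q x) \<in> Hom fd U ?Z"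
    using qc eq0 by (auto simp: fd_simps linear_maps_def q_plus q_smult intro!: e.U.LM.smult_closed)
  have "is_biproduct fd U ?Y ?Z"
    unfolding is_biproduct_def
  proof (intro bexI[OF _ i] bexI[OF _ j] bexI[OF _ p] bexI[OF _ q] conjI)
    show "Comp fd ?Y U ?Y e (\<lambda>x\<in>e ` carrier U. x) = Id fd ?Y"
      by (auto simp: fd_simps compose_def idem intro!: restrict_ext)
    show "Comp fd ?Z U ?Z (\<lambda>x\<in>carrier U. ?q x) (\<lambda>x\<in>{x \<in> carrier U. e x = \<zero>\<^bsub>U\<^esub>}. x) = Id fd ?Z"
      by (auto simp: fd_simps compose_def e.U.LM.M.minus_eq intro!: restrict_ext)
    show "Comp fd ?Z U ?Y e (\<lambda>x\<in>{x \<in> carrier U. e x = \<zero>\<^bsub>U\<^esub>}. x) = Zero fd ?Z ?Y"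
      by (auto simp: fd_simps compose_def intro!: restrict_ext)
    show "Comp fd ?Y U ?Z (\<lambda>x\<in>carrier U. ?q x) (\<lambda>x\<in>e ` carrier U. x) = Zero fd ?Y ?Z"
      by (auto simp: fd_simps compose_def idem e.closed e.U.LM.M.minus_eq e.U.LM.M.r_neg intro!: restrict_ext)
    have "e x \<oplus>\<^bsub>U\<^esub> ?q x = x" if "x \<in> carrier U" for x
      using that e.closed[OF that] by (simp add: e.U.LM.M.minus_eq e.U.LM.M.a_comm[of x] e.U.LM.M.r_neg2)
    then show "Add fd U U (Comp fd U ?Y U (\<lambda>x\<in>e ` carrier U. x) e)
        (Comp fd U ?Z U (\<lambda>x\<in>{x \<in> carrier U. e x = \<zero>\<^bsub>U\<^esub>}. x) (\<lambda>x\<in>carrier U. ?q x)) = Id fd U"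
      using qc eq0 by (auto simp: fd_simps compose_def intro!: restrict_ext)
  qed
  then have "zero_object fd ?Y \<or> zero_object fd ?Z"
    using ind Y Z unfolding indecomposable_def by blast
  then show "e = Id fd U \<or> e = Zero fd U U"
  proof
    assume "zero_object fd ?Y"
    then have *: "(\<lambda>x\<in>e ` carrier U. x) = (\<lambda>x\<in>e ` carrier U. \<zero>\<^bsub>U\<^esub>)" by (simp add: zero_object_def fd_simps)
    have "e x = \<zero>\<^bsub>U\<^esub>" if "x \<in> carrier U" for x using fun_cong[OF *, of "e x"] that by simp
    then have "e = Zero fd U U"
      by (intro extensionalityI[OF e.ext]) (auto simp: fd_simps)
    then show ?thesis ..
  next
    assume "zero_object fd ?Z"
    then have *: "(\<lambda>x\<in>{x \<in> carrier U. e x = \<zero>\<^bsub>U\<^esub>}. x) = (\<lambda>x\<in>{x \<in> carrier U. e x = \<zero>\<^bsub>U\<^esub>}. \<zero>\<^bsub>U\<^esub>)"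
      by (simp add: zero_object_def fd_simps)
    have "e x = x" if x: "x \<in> carrier U" for x
    proof -
      have "?q x = \<zero>\<^bsub>U\<^esub>" using fun_cong[OF *, of "?q x"] qc[OF x] eq0[OF x] by simp
      then have "\<ominus>\<^bsub>U\<^esub> (\<ominus>\<^bsub>U\<^esub> e x) = x"
        using x e.closed[OF x] by (intro e.U.LM.M.minus_equality) (simp_all add: e.U.LM.M.minus_eq)
      then show ?thesis using e.closed[OF x] by simp
    qed
    then have "e = Id fd U"
      by (intro extensionalityI[OF e.ext]) (auto simp: fd_simps)
    then show ?thesis ..
  qed
qed

section \<open>Five subspaces of a double vector space\<close>

definition bideg :: "int \<Rightarrow> int \<Rightarrow> multidegree" where
  "bideg i j = (\<lambda>n. if n = 1 then i else if n = 2 then j else 0)"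

lemma bideg_simps [simp]: "bideg i j 1 = i" "bideg i j (Suc 0) = i" "bideg i j 2 = j"
  by (simp_all add: bideg_def)

lemma bideg_degrees: "0 \<le> i \<Longrightarrow> 0 \<le> j \<Longrightarrow> bideg i j \<in> degrees 2 {}"
  by (auto simp: bideg_def degrees_def)

lemma degrees_2: "d \<in> degrees 2 {} \<longleftrightarrow> d = bideg (d 1) (d 2) \<and> 0 \<le> d 1 \<and> 0 \<le> d 2"
proof
  assume d: "d \<in> degrees 2 {}"
  have "d n = bideg (d 1) (d 2) n" for n
  proof (cases "n \<in> {1..2}")
    case True
    then have "n = 1 \<or> n = 2" by auto
    then show ?thesis by (auto simp: bideg_def)
  next
    case False
    then show ?thesis using d by (auto simp: bideg_def degrees_def)
  qed
  then have "d = bideg (d 1) (d 2)" by (rule ext)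
  moreover have "0 \<le> d 1" "0 \<le> d 2" using d by (auto simp: degrees_def)
  ultimately show "d = bideg (d 1) (d 2) \<and> 0 \<le> d 1 \<and> 0 \<le> d 2" by (intro conjI)
qed (metis bideg_degrees)

abbreviation gen :: "(free_word \<Rightarrow>\<^sub>0 'k::field, 'v) module \<Rightarrow> generator \<Rightarrow> 'v \<Rightarrow> 'v" where
  "gen U g x \<equiv> monomial (Word [g]) 1 \<odot>\<^bsub>U\<^esub> x"

text \<open>
  In total degree 4 the five subspaces of \<open>U \<oplus> U\<close> are, by increasing first degree: both summands, the
  diagonal, and the graphs of the actions of \<open>X1\<close> and \<open>X2\<close>.
\<close>

definition five_rel :: "(free_word \<Rightarrow>\<^sub>0 'k::field, 'v) module \<Rightarrow> multidegree \<Rightarrow> 'v \<Rightarrow> 'v \<Rightarrow> bool" where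
  "five_rel U d x y \<longleftrightarrow>
     (if d \<notin> degrees 2 {} \<or> d 1 + d 2 < 4 then x = \<zero>\<^bsub>U\<^esub> \<and> y = \<zero>\<^bsub>U\<^esub>
      else if d 1 + d 2 = 4 then
        (if d 1 = 0 then y = \<zero>\<^bsub>U\<^esub> else if d 1 = 1 then x = \<zero>\<^bsub>U\<^esub> else if d 1 = 2 then y = x
         else if d 1 = 3 then y = gen U X1 x else y = gen U X2 x)
      else True)"

definition five_sys :: "(free_word \<Rightarrow>\<^sub>0 'k::field, 'v) module \<Rightarrow> ('k, 'v \<times> 'v) gsys" where
  "five_sys U =
     \<lparr>piece = (\<lambda>d. {(x, y). x \<in> carrier U \<and> y \<in> carrier U \<and> five_rel U d x y}),
      null = (\<zero>\<^bsub>U\<^esub>, \<zero>\<^bsub>U\<^esub>),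
      padd = (\<lambda>p q. (fst p \<oplus>\<^bsub>U\<^esub> fst q, snd p \<oplus>\<^bsub>U\<^esub> snd q)),
      pact = (\<lambda>e c p. (monomial 0 c \<odot>\<^bsub>U\<^esub> fst p, monomial 0 c \<odot>\<^bsub>U\<^esub> snd p))\<rparr>"

lemma five_sys_simps:
  "(x, y) \<in> piece (five_sys U) d \<longleftrightarrow> x \<in> carrier U \<and> y \<in> carrier U \<and> five_rel U d x y"
  "null (five_sys U) = (\<zero>\<^bsub>U\<^esub>, \<zero>\<^bsub>U\<^esub>)"
  "padd (five_sys U) (x, y) (x', y') = (x \<oplus>\<^bsub>U\<^esub> x', y \<oplus>\<^bsub>U\<^esub> y')"
  "pact (five_sys U) e c (x, y) = (monomial 0 c \<odot>\<^bsub>U\<^esub> x, monomial 0 c \<odot>\<^bsub>U\<^esub> y)"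
  by (simp_all add: five_sys_def)

context monoid_algebra_module
begin

lemma act_commute_scalar:
  assumes "w \<in> S" "x \<in> carrier M" shows "monomial w 1 \<odot> (monomial 0 c \<odot> x) = monomial 0 c \<odot> (monomial w 1 \<odot> x)"
  using assms by (simp add: act_act zero_mem)

lemma act_minus: "e \<in> S \<Longrightarrow> x \<in> carrier M \<Longrightarrow> monomial e c \<odot> (\<ominus> x) = \<ominus> (monomial e c \<odot> x)"
  by (intro additive_minus[OF LM.abelian_group_axioms LM.abelian_group_axioms]) (auto simp: act_closed act_plus)

end

locale large_universe =
  fixes universe :: "'v itself"
  assumes infinite_universe: "infinite (UNIV :: 'v set)"
begin

lemma gsystem_five_sys:
  assumes U: "monoid_algebra_module UNIV (U :: (free_word \<Rightarrow>\<^sub>0 'k::field, 'v) module)"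
  shows "gsystem 2 {} (five_sys U) TYPE('v)"
proof -
  interpret U: monoid_algebra_module UNIV U by fact
  have zero: "five_rel U d \<zero>\<^bsub>U\<^esub> \<zero>\<^bsub>U\<^esub>" for d
    by (simp add: five_rel_def U.act_zero)
  have level: "five_rel U (d + e) x y"
    if "five_rel U d x y" "e \<in> degrees 2 {}" for d e x y
  proof (cases "d \<in> degrees 2 {} \<and> 4 \<le> d 1 + d 2")
    case True
    have e: "0 \<le> e 1" "0 \<le> e 2" "e = bideg (e 1) (e 2)" using that(2) degrees_2[of e] by blast+
    have de: "d + e \<in> degrees 2 {}" using True that(2) by (intro degrees_add) auto
    show ?thesis
    proof (cases "(d + e) 1 + (d + e) 2 = 4")
      case eq: True
      then have "e 1 = 0" "e 2 = 0" using True e(1,2) by auto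
      then have "e = bideg 0 0" using e(3) by metis
      then have "e = 0" by (auto simp: bideg_def fun_eq_iff)
      then show ?thesis using that(1) by simp
    next
      case False
      then show ?thesis using True e de by (simp add: five_rel_def)
    qed
  next
    case False
    then have "x = \<zero>\<^bsub>U\<^esub>" "y = \<zero>\<^bsub>U\<^esub>" using that(1) by (auto simp: five_rel_def split: if_splits)
    then show ?thesis by (simp add: zero)
  qed
  show ?thesis
  proof (unfold_locales, goal_cases)
    case (1 d)
    then show ?case by (simp add: five_sys_simps zero)
  next
    case (2 x d y)
    then show ?case
      by (cases x; cases y) (auto simp: five_sys_simps five_rel_def U.act_plus split: if_splits)
  next
    case (3 x d y z)
    then show ?case by (cases x; cases y; cases z) (simp add: five_sys_simps U.LM.M.a_assoc)
  next
    case (4 x d y)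
    then show ?case by (cases x; cases y) (simp add: five_sys_simps U.LM.M.a_comm)
  next
    case (5 x d)
    then show ?case by (cases x) (simp add: five_sys_simps)
  next
    case (6 x d)
    obtain u v where x: "x = (u, v)" by (cases x)
    have "(\<ominus>\<^bsub>U\<^esub> u, \<ominus>\<^bsub>U\<^esub> v) \<in> piece (five_sys U) d"
      using 6 by (auto simp: x five_sys_simps five_rel_def U.act_minus split: if_splits)
    moreover have "padd (five_sys U) (\<ominus>\<^bsub>U\<^esub> u, \<ominus>\<^bsub>U\<^esub> v) x = null (five_sys U)"
      using 6 by (simp add: x five_sys_simps U.LM.M.l_neg)
    ultimately show ?case by blast
  next
    case (7 d)
    then show ?case by (auto simp: five_sys_def five_rel_def)
  next
    case (8 e x d c)
    obtain u v where x: "x = (u, v)" by (cases x)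
    have uv: "u \<in> carrier U" "v \<in> carrier U" "five_rel U d u v" using 8 by (simp_all add: x five_sys_simps)
    then have "five_rel U d (monomial 0 c \<odot>\<^bsub>U\<^esub> u) (monomial 0 c \<odot>\<^bsub>U\<^esub> v)"
      by (auto simp: five_rel_def U.act_zero U.act_commute_scalar split: if_splits)
    then show ?case using level[OF _ 8(1)] uv by (simp add: x five_sys_simps U.act_closed)
  next
    case (9 e x d y c)
    then show ?case by (cases x; cases y) (simp add: five_sys_simps U.act_plus)
  next
    case (10 e x d c c')
    then show ?case by (cases x) (simp add: five_sys_simps U.act_coeff_plus)
  next
    case (11 e e' x d c c')
    then show ?case by (cases x) (simp add: five_sys_simps U.act_act)
  next
    case (12 x d)
    obtain u v where x: "x = (u, v)" by (cases x)
    show ?case using 12 U.act_one[of u] U.act_one[of v] by (simp add: x five_sys_simps)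
  next
    case 13
    have "(UNIV :: 'v set) \<times> (UNIV :: 'v set) \<approx> (UNIV :: 'v set)"
      using card_of_Times_same_infinite[OF infinite_universe] by (simp add: eqpoll_iff_card_of_ordIso)
    then obtain p :: "'v \<times> 'v \<Rightarrow> 'v" where p: "inj p" by (auto simp: eqpoll_def bij_betw_def)
    show ?case
      by (rule families_encodable[OF infinite_universe countable_degrees[of 2 "{}"] _ inj_on_subset[OF p subset_UNIV]])
        (auto simp: five_sys_def five_rel_def)
  qed
qed

text \<open>
  Each of the five subspaces, and each summand of \<open>U \<oplus> U\<close>, is a linear image of \<open>U\<close>; so a basis of \<open>U\<close>
  yields generators in the bidegrees of total degree 4 and 5, and these generate all higher bidegrees
  since there the variables act as the identity of \<open>U \<oplus> U\<close>.
\<close>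

lemma finitely_generated_five_sys:
  assumes U: "U \<in> Ob (fd :: ('k::field, (free_word \<Rightarrow>\<^sub>0 'k, 'v) module, 'v \<Rightarrow> 'v) lincat)"
  shows "finitely_generated (loc_ring 2 {}) (Tot (five_sys U) :: ('k, 'v) gmod)"
proof -
  interpret U: monoid_algebra_module UNIV U by (rule fd_ob_module(1)[OF U])
  interpret U0: monoid_algebra_module "{0}" U
    using fd_ob_module(2)[OF U] by (simp add: monoid_algebra_module_def add_submonoid_zero)
  interpret G: gsystem 2 "{}" "five_sys U" "TYPE('v)" by (rule gsystem_five_sys[OF U.monoid_algebra_module_axioms])
  have lm: "left_module (loc_ring 2 {}) G.T" using G.T.left_module by (simp add: loc_ring_def)
  obtain B where B: "finite B" "B \<subseteq> carrier U" "\<And>H. is_submodule (monoid_algebra {0}) U H \<Longrightarrow> B \<subseteq> H \<Longrightarrow> carrier U \<subseteq> H"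
    using U finitely_generated_iff[OF fd_ob_module(2)[OF U]] by (auto simp: fd_simps)
  define W where "W = {\<lambda>u. (u, \<zero>\<^bsub>U\<^esub>), \<lambda>u. (\<zero>\<^bsub>U\<^esub>, u), \<lambda>u. (u, u), \<lambda>u. (u, gen U X1 u), \<lambda>u. (u, gen U X2 u)}"
  define D where "D = (\<lambda>(i, j). bideg i j) ` ({0..5} \<times> {0..5})"
  define gens where "gens = (\<lambda>(d, w, u). place (five_sys U) d (w u) :: 'v) ` {(d, w, u). (d, w, u) \<in> D \<times> W \<times> B \<and> w u \<in> piece (five_sys U) d}"
  show ?thesis
    unfolding finitely_generated_iff[OF lm]
  proof (intro exI[of _ gens] conjI allI impI)
    have "finite (D \<times> W \<times> B)" using B(1) by (simp add: D_def W_def)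
    then show "finite gens" unfolding gens_def by (rule finite_imageI[OF finite_subset[rotated]]) auto
    show "gens \<subseteq> carrier G.T" by (auto simp: gens_def intro: G.place_closed)
    fix H assume H: "is_submodule (loc_ring 2 {}) G.T H" and gens: "gens \<subseteq> H"
    note H0 = G.T.submodule_closed(1)[OF H] and Hplus = G.T.submodule_closed(2)[OF H] and Hact = G.T.submodule_closed(3)[OF H]
    have image: "place (five_sys U) d (w u) \<in> H"
      if d: "d \<in> D" and w: "w \<in> W" and piece: "\<And>u. u \<in> carrier U \<Longrightarrow> w u \<in> piece (five_sys U) d" and u: "u \<in> carrier U" for d w u
    proof -
      have w0: "w \<zero>\<^bsub>U\<^esub> = null (five_sys U)" using w by (auto simp: W_def five_sys_simps U.act_zero)
      have wplus: "w (x \<oplus>\<^bsub>U\<^esub> y) = padd (five_sys U) (w x) (w y)" if "x \<in> carrier U" "y \<in> carrier U" for x y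
        using w that by (auto simp: W_def five_sys_simps U.act_plus)
      have wact: "w (monomial 0 c \<odot>\<^bsub>U\<^esub> x) = pact (five_sys U) 0 c (w x)" if "x \<in> carrier U" for c x
        using w that by (auto simp: W_def five_sys_simps U.act_zero U.act_commute_scalar)
      have "is_submodule (monoid_algebra {0}) U {u \<in> carrier U. place (five_sys U) d (w u) \<in> H}"
      proof (rule is_submodule_monomialI[OF U0.monoid_algebra_module_axioms])
        show "\<zero>\<^bsub>U\<^esub> \<in> {u \<in> carrier U. place (five_sys U) d (w u) \<in> H}" by (simp add: w0 G.place_null H0)
      next
        fix x y assume "x \<in> {u \<in> carrier U. place (five_sys U) d (w u) \<in> H}" "y \<in> {u \<in> carrier U. place (five_sys U) d (w u) \<in> H}"
        then show "x \<oplus>\<^bsub>U\<^esub> y \<in> {u \<in> carrier U. place (five_sys U) d (w u) \<in> H}"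
          using Hplus[of "place (five_sys U) d (w x)" "place (five_sys U) d (w y)"] by (simp add: wplus G.plus_place piece)
      next
        fix e c x assume "e \<in> {0 :: free_word}" "x \<in> {u \<in> carrier U. place (five_sys U) d (w u) \<in> H}"
        then have e: "e = 0" and x: "x \<in> carrier U" "place (five_sys U) d (w x) \<in> H" by auto
        show "monomial e c \<odot>\<^bsub>U\<^esub> x \<in> {u \<in> carrier U. place (five_sys U) d (w u) \<in> H}"
          using Hact[OF zero_degrees x(2), of c] G.act_place[OF zero_degrees piece[OF x(1)], of c] x(1)
          by (simp add: e wact U.act_closed)
      qed auto
      moreover have "B \<subseteq> {u \<in> carrier U. place (five_sys U) d (w u) \<in> H}"
      proof
        fix u assume u: "u \<in> B"
        then have "u \<in> carrier U" using B(2) by blast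
        moreover have "place (five_sys U) d (w u) \<in> gens"
          unfolding gens_def
          by (rule image_eqI[of _ _ "(d, w, u)"]) (use d w u piece[OF \<open>u \<in> carrier U\<close>] in simp_all)
        ultimately show "u \<in> {u \<in> carrier U. place (five_sys U) d (w u) \<in> H}" using gens by blast
      qed
      ultimately have "carrier U \<subseteq> {u \<in> carrier U. place (five_sys U) d (w u) \<in> H}" by (rule B(3))
      then show ?thesis using u by blast
    qed
    have pl: "place (five_sys U) d (x, y) \<in> H"
      if d: "d \<in> D" and xy: "x \<in> carrier U" "y \<in> carrier U" and "5 = d 1 + d 2" and dd: "d \<in> degrees 2 {}" for d x y
    proof -
      \<comment> \<open>In total degree 5 there is no condition on pairs.\<close>
      have r: "five_rel U d x y" for x y using that by (simp add: five_rel_def)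
      have "place (five_sys U) d (x, \<zero>\<^bsub>U\<^esub>) \<in> H"
        by (rule image[OF d, of "\<lambda>u. (u, \<zero>\<^bsub>U\<^esub>)"]) (auto simp: W_def five_sys_simps r xy)
      moreover have "place (five_sys U) d (\<zero>\<^bsub>U\<^esub>, y) \<in> H"
        by (rule image[OF d, of "\<lambda>u. (\<zero>\<^bsub>U\<^esub>, u)"]) (auto simp: W_def five_sys_simps r xy)
      ultimately show ?thesis
        using Hplus G.plus_place[of "(x, \<zero>\<^bsub>U\<^esub>)" d "(\<zero>\<^bsub>U\<^esub>, y)"] xy by (fastforce simp: five_sys_simps r)
    qed
    show "carrier G.T \<subseteq> H"
    proof (rule G.submodule_eqI[OF H])
      fix d p assume d: "d \<in> degrees 2 {}" and p: "p \<in> piece (five_sys U) d"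
      obtain x y where xy: "p = (x, y)" by (cases p)
      have c: "x \<in> carrier U" "y \<in> carrier U" "five_rel U d x y" using p by (simp_all add: xy five_sys_simps)
      have d2: "d = bideg (d 1) (d 2)" "0 \<le> d 1" "0 \<le> d 2" using d degrees_2[of d] by blast+
      consider "d 1 + d 2 < 4" | "d 1 + d 2 = 4" | "d 1 + d 2 \<ge> 5" by linarith
      then show "place (five_sys U) d p \<in> H"
      proof cases
        case 1
        then have "p = null (five_sys U)" using c by (simp add: xy five_rel_def five_sys_simps)
        then show ?thesis by (simp add: G.place_null H0)
      next
        case 2
        have dD: "d \<in> D" unfolding D_def
        proof (rule image_eqI)
          show "d = (\<lambda>(i, j). bideg i j) (d 1, d 2)" unfolding prod.case by (rule d2(1))
        qed (use d2(2,3) 2 in auto)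
        consider "d 1 = 0" | "d 1 = 1" | "d 1 = 2" | "d 1 = 3" | "d 1 = 4" using d2(2,3) 2 by linarith
        then show ?thesis
        proof cases
          case 1
          then have "p = (\<lambda>u. (u, \<zero>\<^bsub>U\<^esub>)) x" using c 2 d by (simp add: xy five_rel_def)
          then show ?thesis using image[OF dD, of "\<lambda>u. (u, \<zero>\<^bsub>U\<^esub>)" x] c 1 2 d by (simp add: W_def five_sys_simps five_rel_def)
        next
          case 2
          then have "p = (\<lambda>u. (\<zero>\<^bsub>U\<^esub>, u)) y" using c \<open>d 1 + d 2 = 4\<close> d by (simp add: xy five_rel_def)
          then show ?thesis using image[OF dD, of "\<lambda>u. (\<zero>\<^bsub>U\<^esub>, u)" y] c 2 \<open>d 1 + d 2 = 4\<close> d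
            by (simp add: W_def five_sys_simps five_rel_def)
        next
          case 3
          then have "p = (\<lambda>u. (u, u)) x" using c \<open>d 1 + d 2 = 4\<close> d by (simp add: xy five_rel_def)
          then show ?thesis using image[OF dD, of "\<lambda>u. (u, u)" x] c 3 \<open>d 1 + d 2 = 4\<close> d
            by (simp add: W_def five_sys_simps five_rel_def)
        next
          case 4
          then have "p = (\<lambda>u. (u, gen U X1 u)) x" using c \<open>d 1 + d 2 = 4\<close> d by (simp add: xy five_rel_def)
          then show ?thesis using image[OF dD, of "\<lambda>u. (u, gen U X1 u)" x] c 4 \<open>d 1 + d 2 = 4\<close> d
            by (simp add: W_def five_sys_simps five_rel_def U.act_closed)
        next
          case 5
          then have "p = (\<lambda>u. (u, gen U X2 u)) x" using c \<open>d 1 + d 2 = 4\<close> d by (simp add: xy five_rel_def)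
          then show ?thesis using image[OF dD, of "\<lambda>u. (u, gen U X2 u)" x] c 5 \<open>d 1 + d 2 = 4\<close> d
            by (simp add: W_def five_sys_simps five_rel_def U.act_closed)
        qed
      next
        case 3
        \<comment> \<open>Any bidegree of total degree 5 below \<open>d\<close> will do.\<close>
        define i where "i = min (d 1) 5"
        let ?d' = "bideg i (5 - i)"
        have i: "0 \<le> i" "i \<le> 5" "i \<le> d 1" "5 - i \<le> d 2" using d2(2,3) 3 by (auto simp: i_def)
        have d': "?d' \<in> D" "?d' \<in> degrees 2 {}" using i by (auto simp: D_def intro!: bideg_degrees)
        have "0 \<le> (d - ?d') n" if "n \<in> {1..2}" for n
        proof -
          have "n = 1 \<or> n = 2" using that by auto
          then show ?thesis using i by auto
        qed
        moreover have "(d - ?d') n = 0" if "n \<notin> {1..2}" for n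
          using d that by (auto simp: degrees_def bideg_def)
        ultimately have e: "d - ?d' \<in> degrees 2 {}" by (simp add: degrees_def)
        have pd: "p \<in> piece (five_sys U) ?d'" using c d' by (simp add: xy five_sys_simps five_rel_def)
        have pact: "pact (five_sys U) (d - ?d') 1 p = p"
          using U.act_one[OF c(1)] U.act_one[OF c(2)] by (simp add: xy five_sys_simps)
        have "place (five_sys U) ?d' p \<in> H" unfolding xy using c d' by (intro pl) simp_all
        from Hact[OF e this, of 1] show ?thesis
          unfolding G.act_place[OF e pd] pact by simp
      qed
    qed
  qed
qed

end

definition five :: "((free_word \<Rightarrow>\<^sub>0 'k::field, 'v) module, 'v \<Rightarrow> 'v, ('k, 'v) gmod, 'v \<Rightarrow> 'v) functor_data" where
  "five = \<lparr>on_ob = (\<lambda>U. Tot (five_sys U)),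
     on_hom = (\<lambda>U V f. tot_map (five_sys U) (five_sys V) (\<lambda>d. map_prod f f))\<rparr>"

lemma five_simps [simp]:
  "on_ob five U = Tot (five_sys U)"
  "on_hom five U V f = tot_map (five_sys U) (five_sys V) (\<lambda>d. map_prod f f)"
  by (simp_all add: five_def)

lemma (in fd_map) five_rel_map:
  assumes "x \<in> carrier U" "y \<in> carrier U" "five_rel U d x y" shows "five_rel V d (f x) (f y)"
  using assms by (auto simp: five_rel_def zero smult split: if_splits)

lemma (in fd_map) five_rel_reflect:
  assumes inj: "inj_on f (carrier U)" and "x \<in> carrier U" "y \<in> carrier U" "five_rel V d (f x) (f y)"
  shows "five_rel U d x y"
proof -
  note i = inj_onD[OF inj _ assms(2) U.LM.M.zero_closed] inj_onD[OF inj _ assms(3) U.LM.M.zero_closed]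
    inj_onD[OF inj _ assms(3,2)] inj_onD[OF inj _ assms(3) U.act_closed[OF UNIV_I assms(2)]]
  show ?thesis
    using assms(2-) i by (auto simp: five_rel_def zero smult split: if_splits)
qed

context large_universe
begin

abbreviation kst :: "('k::field, ('k, 'v) gmod, 'v \<Rightarrow> 'v) lincat" where "kst \<equiv> kst_mod"

lemma system_map_five:
  assumes "fd_map U V (f :: 'v \<Rightarrow> 'v)"
  shows "system_map 2 {} {} (five_sys U) (five_sys V) TYPE('v) (\<lambda>d. map_prod f f)"
proof -
  interpret f: fd_map U V f by fact
  interpret U: gsystem 2 "{}" "five_sys U" "TYPE('v)" by (rule gsystem_five_sys[OF f.U.monoid_algebra_module_axioms])
  interpret V: gsystem 2 "{}" "five_sys V" "TYPE('v)" by (rule gsystem_five_sys[OF f.V.monoid_algebra_module_axioms])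
  show ?thesis
    by unfold_locales (auto simp: five_sys_simps f.closed f.five_rel_map f.plus f.smult)
qed

lemma linear_five: "linear_functor (fd :: ('k::field, (free_word \<Rightarrow>\<^sub>0 'k, 'v) module, 'v \<Rightarrow> 'v) lincat) kst five"
  unfolding linear_functor_def additive_functor_def is_functor_def
proof (intro conjI ballI allI)
  fix U :: "(free_word \<Rightarrow>\<^sub>0 'k, 'v) module" assume U: "U \<in> Ob fd"
  note G = gsystem_five_sys[OF fd_ob_module(1)[OF U]]
  show "on_ob five U \<in> Ob kst"
    using gsystem.is_graded_module_Tot[OF G] finitely_generated_five_sys[OF U] by (simp add: kst_mod_simps fg_graded_modules_def)
  show "on_hom five U U (Id fd U) = Id kst (on_ob five U)"
    unfolding five_simps kst_mod_simps by (rule tot_map_id[OF G]) (auto simp: five_sys_def fd_simps)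
next
  fix U V :: "(free_word \<Rightarrow>\<^sub>0 'k, 'v) module" and f
  assume U: "U \<in> Ob fd" and V: "V \<in> Ob fd" and f: "f \<in> Hom fd U V"
  interpret f: fd_map U V f by (rule fd_mapI[OF U V f])
  note sf = system_map_five[OF f.fd_map_axioms]
  show "on_hom five U V f \<in> Hom kst (on_ob five U) (on_ob five V)"
    using system_map.graded_map_tot_map[OF sf] by (simp add: kst_mod_simps graded_map_def)
  show "on_hom five U V (Scale fd U V c f) = Scale kst (on_ob five U) (on_ob five V) c (on_hom five U V f)" for c
    unfolding five_simps kst_mod_simps
    by (rule tot_map_scale[OF sf, symmetric]) (auto simp: five_sys_def fd_simps)
  fix g assume g: "g \<in> Hom fd U V"
  show "on_hom five U V (Add fd U V f g) = Add kst (on_ob five U) (on_ob five V) (on_hom five U V f) (on_hom five U V g)"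
    unfolding five_simps kst_mod_simps
    by (rule tot_map_plus[OF sf system_map_five[OF fd_mapI[OF U V g]], symmetric]) (auto simp: five_sys_def fd_simps)
next
  fix U V W :: "(free_word \<Rightarrow>\<^sub>0 'k, 'v) module" and f g
  assume U: "U \<in> Ob fd" and V: "V \<in> Ob fd" and W: "W \<in> Ob fd" and f: "f \<in> Hom fd U V" and g: "g \<in> Hom fd V W"
  show "on_hom five U W (Comp fd U V W g f) =
      Comp kst (on_ob five U) (on_ob five V) (on_ob five W) (on_hom five V W g) (on_hom five U V f)"
    unfolding five_simps kst_mod_simps
    by (rule tot_map_compose[OF system_map_five[OF fd_mapI[OF U V f]] system_map_five[OF fd_mapI[OF V W g]], symmetric])
      (auto simp: five_sys_def fd_simps compose_eq)
qed

lemma exact_five: "exact_functor (fd :: ('k::field, (free_word \<Rightarrow>\<^sub>0 'k, 'v) module, 'v \<Rightarrow> 'v) lincat) kst five"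
  unfolding exact_functor_def
proof (intro conjI ballI impI)
  show "additive_functor (fd :: ('k::field, (free_word \<Rightarrow>\<^sub>0 'k, 'v) module, 'v \<Rightarrow> 'v) lincat) kst five"
    by (rule conjunct1[OF linear_five[unfolded linear_functor_def]])
  fix U V W :: "(free_word \<Rightarrow>\<^sub>0 'k, 'v) module" and f g
  assume U: "U \<in> Ob fd" and V: "V \<in> Ob fd" and W: "W \<in> Ob fd" and f: "f \<in> Hom fd U V" and g: "g \<in> Hom fd V W"
    and "Ses fd U V W f g"
  then have inj: "inj_on f (carrier U)" and mid: "f ` carrier U = {x \<in> carrier V. g x = \<zero>\<^bsub>W\<^esub>}"
    and surj: "g ` carrier V = carrier W"
    by (simp_all add: fd_free_algebra_mod_def)
  interpret f: fd_map U V f by (rule fd_mapI[OF U V f])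
  interpret g: fd_map V W g by (rule fd_mapI[OF V W g])
  show "Ses kst (on_ob five U) (on_ob five V) (on_ob five W) (on_hom five U V f) (on_hom five V W g)"
    unfolding five_simps kst_mod_def
  proof (rule tot_map_exact[OF system_map_five[OF f.fd_map_axioms] system_map_five[OF g.fd_map_axioms]], goal_cases)
    case (1 d p q)
    then show ?case by (cases p; cases q) (auto simp: five_sys_simps dest: inj_onD[OF inj])
  next
    case (2 d p)
    have "g (f x) = \<zero>\<^bsub>W\<^esub>" if "x \<in> carrier U" for x
    proof -
      have "f x \<in> f ` carrier U" using that by simp
      then show ?thesis unfolding mid by simp
    qed
    then show ?case using 2 by (cases p) (simp add: five_sys_simps)
  next
    case (3 d p)
    obtain y y' where p: "p = (y, y')" by (cases p)
    have y: "y \<in> carrier V" "y' \<in> carrier V" "five_rel V d y y'" "g y = \<zero>\<^bsub>W\<^esub>" "g y' = \<zero>\<^bsub>W\<^esub>"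
      using 3 by (simp_all add: p five_sys_simps)
    have "y \<in> f ` carrier U" "y' \<in> f ` carrier U" unfolding mid using y by simp_all
    then obtain x x' where x: "x \<in> carrier U" "y = f x" "x' \<in> carrier U" "y' = f x'" by blast
    have "five_rel U d x x'" using f.five_rel_reflect[OF inj x(1,3)] y(3) by (simp add: x)
    then show ?case using x by (intro bexI[of _ "(x, x')"]) (simp_all add: p five_sys_simps)
  next
    case (4 d p)
    obtain z z' where p: "p = (z, z')" by (cases p)
    have z: "z \<in> carrier W" "z' \<in> carrier W" "five_rel W d z z'"
      using 4 by (simp_all add: p five_sys_simps)
    have "z \<in> g ` carrier V" "z' \<in> g ` carrier V" unfolding surj using z by simp_all
    then obtain y y' where y: "y \<in> carrier V" "z = g y" "y' \<in> carrier V" "z' = g y'" by blast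
    have "\<exists>u u'. u \<in> carrier V \<and> u' \<in> carrier V \<and> five_rel V d u u' \<and> g u = z \<and> g u' = z'"
    proof (cases "d 1 + d 2 < 4")
      case True
      then have "z = \<zero>\<^bsub>W\<^esub>" "z' = \<zero>\<^bsub>W\<^esub>" using z(3) by (simp_all add: five_rel_def)
      then show ?thesis using True by (intro exI[of _ "\<zero>\<^bsub>V\<^esub>"]) (simp add: five_rel_def g.zero)
    next
      case ge: False
      show ?thesis
      proof (cases "d 1 + d 2 = 4")
        case True
        consider "d 1 = 0" | "d 1 = 1" | "d 1 = 2" | "d 1 = 3" | "d 1 = 4"
          using conjunct2[OF iffD1[OF degrees_2 4(1)]] True by linarith
        then show ?thesis
        proof cases
          case 1
          then show ?thesis using z(3) y True 4(1) by (intro exI[of _ y] exI[of _ "\<zero>\<^bsub>V\<^esub>"]) (simp add: five_rel_def g.zero)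
        next
          case 2
          then show ?thesis using z(3) y True 4(1) by (intro exI[of _ "\<zero>\<^bsub>V\<^esub>"] exI[of _ y']) (simp add: five_rel_def g.zero)
        next
          case 3
          then show ?thesis using z(3) y True 4(1) by (intro exI[of _ y]) (simp add: five_rel_def)
        next
          case 4
          then show ?thesis using z(3) y True \<open>d \<in> degrees 2 {}\<close>
            by (intro exI[of _ y] exI[of _ "gen V X1 y"]) (simp add: five_rel_def g.smult f.V.act_closed)
        next
          case 5
          then show ?thesis using z(3) y True \<open>d \<in> degrees 2 {}\<close>
            by (intro exI[of _ y] exI[of _ "gen V X2 y"]) (simp add: five_rel_def g.smult f.V.act_closed)
        qed
      next
        case False
        then show ?thesis using y ge 4(1) by (intro exI[of _ y] exI[of _ y']) (simp add: five_rel_def)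
      qed
    qed
    then obtain u u' where "u \<in> carrier V" "u' \<in> carrier V" "five_rel V d u u'" "g u = z" "g u' = z'" by blast
    then show ?case by (intro bexI[of _ "(u, u')"]) (simp_all add: p five_sys_simps)
  qed
qed

lemma faithful_five: "faithful (fd :: ('k::field, (free_word \<Rightarrow>\<^sub>0 'k, 'v) module, 'v \<Rightarrow> 'v) lincat) five"
  unfolding faithful_def
proof (intro ballI impI)
  fix U V :: "(free_word \<Rightarrow>\<^sub>0 'k, 'v) module" and f g
  assume U: "U \<in> Ob fd" and V: "V \<in> Ob fd" and f: "f \<in> Hom fd U V" and g: "g \<in> Hom fd U V"
    and eq: "on_hom five U V f = on_hom five U V g"
  interpret f: fd_map U V f by (rule fd_mapI[OF U V f])
  interpret g: fd_map U V g by (rule fd_mapI[OF U V g])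
  interpret F: system_map 2 "{}" "{}" "five_sys U" "five_sys V" "TYPE('v)" "\<lambda>d. map_prod f f"
    by (rule system_map_five[OF f.fd_map_axioms])
  interpret G: system_map 2 "{}" "{}" "five_sys U" "five_sys V" "TYPE('v)" "\<lambda>d. map_prod g g"
    by (rule system_map_five[OF g.fd_map_axioms])
  have eq': "F.F = G.F" using eq by simp
  show "f = g"
  proof (rule extensionalityI[OF f.ext g.ext])
    fix x assume x: "x \<in> carrier U"
    have p: "(x, x) \<in> piece (five_sys U) (bideg 5 0)"
      using x bideg_degrees[of 5 0] by (simp add: five_sys_simps five_rel_def)
    have "map_prod f f (x, x) = map_prod g g (x, x)"
      using F.coord_map[OF F.Y.place_closed[OF p], of "bideg 5 0"] G.coord_map[OF F.Y.place_closed[OF p], of "bideg 5 0"]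
        F.Y.coord_place[OF p, of "bideg 5 0"] by (simp only: eq' if_True simp_thms)
    then show "f x = g x" by simp
  qed
qed

text \<open>
  A graded map induces one and the same endomorphism of the double vector space in all bidegrees, as all
  of them map identically into common larger ones. Preserving the summands and the diagonal forces it to
  be \<open>h \<oplus> h\<close> for a linear map \<open>h\<close>, and preserving the graphs means that \<open>h\<close> commutes with both
  generators.
\<close>

lemma full_five: "full (fd :: ('k::field, (free_word \<Rightarrow>\<^sub>0 'k, 'v) module, 'v \<Rightarrow> 'v) lincat) kst five"
  unfolding full_def
proof (intro ballI)
  fix U V :: "(free_word \<Rightarrow>\<^sub>0 'k, 'v) module" and \<Phi>
  assume U: "U \<in> Ob fd" and V: "V \<in> Ob fd" and \<Phi>: "\<Phi> \<in> Hom kst (on_ob five U) (on_ob five V)"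
  interpret U: monoid_algebra_module UNIV U by (rule fd_ob_module(1)[OF U])
  interpret V: monoid_algebra_module UNIV V by (rule fd_ob_module(1)[OF V])
  interpret GU: gsystem 2 "{}" "five_sys U" "TYPE('v)" by (rule gsystem_five_sys[OF U.monoid_algebra_module_axioms])
  interpret GV: gsystem 2 "{}" "five_sys V" "TYPE('v)" by (rule gsystem_five_sys[OF V.monoid_algebra_module_axioms])
  interpret \<Phi>: graded_map 2 "{}" "{}" GU.T GV.T \<Phi>
    using \<Phi> GU.is_graded_module_Tot GV.is_graded_module_Tot by (simp add: graded_map_def kst_mod_simps)
  define \<phi> where "\<phi> d p = coord (five_sys V) (\<Phi> (place (five_sys U) d p)) d" for d p
  have \<Phi>_place: "\<Phi> (place (five_sys U) d p) = place (five_sys V) d (\<phi> d p)" if "p \<in> piece (five_sys U) d" for d p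
    unfolding \<phi>_def by (rule GV.component_eq_place[OF \<Phi>.component[OF GU.place_component[OF that]]])
  have \<phi>_piece: "\<phi> d p \<in> piece (five_sys V) d" if "p \<in> piece (five_sys U) d" for d p
    unfolding \<phi>_def by (rule GV.coord_piece[OF \<Phi>.closed[OF GU.place_closed[OF that]]])
  have place_inj: "q = q'" if "place (five_sys V) d q = (place (five_sys V) d q' :: 'v)" "q \<in> piece (five_sys V) d" "q' \<in> piece (five_sys V) d" for d q q'
  proof -
    have "coord (five_sys V) (place (five_sys V) d q :: 'v) d = coord (five_sys V) (place (five_sys V) d q' :: 'v) d"
      using that(1) by simp
    then show ?thesis by (simp only: GV.coord_place[OF that(2)] GV.coord_place[OF that(3)] if_True simp_thms)
  qed
  have \<phi>_plus: "\<phi> d (padd (five_sys U) p q) = padd (five_sys V) (\<phi> d p) (\<phi> d q)"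
    if p: "p \<in> piece (five_sys U) d" and q: "q \<in> piece (five_sys U) d" for d p q
  proof (rule place_inj)
    show "place (five_sys V) d (\<phi> d (padd (five_sys U) p q)) = (place (five_sys V) d (padd (five_sys V) (\<phi> d p) (\<phi> d q)) :: 'v)"
      using \<Phi>.plus[OF GU.place_closed[OF p] GU.place_closed[OF q]]
      by (simp only: GU.plus_place[OF p q] \<Phi>_place[OF p] \<Phi>_place[OF q] \<Phi>_place[OF GU.padd_closed[OF p q]]
          GV.plus_place[OF \<phi>_piece[OF p] \<phi>_piece[OF q]])
  qed (use p q in \<open>auto intro!: \<phi>_piece GU.padd_closed GV.padd_closed\<close>)
  have \<phi>_act: "\<phi> (d + e) (pact (five_sys U) e c p) = pact (five_sys V) e c (\<phi> d p)"
    if e: "e \<in> degrees 2 {}" and p: "p \<in> piece (five_sys U) d" for d e c p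
  proof (rule place_inj)
    show "place (five_sys V) (d + e) (\<phi> (d + e) (pact (five_sys U) e c p)) = (place (five_sys V) (d + e) (pact (five_sys V) e c (\<phi> d p)) :: 'v)"
      using \<Phi>.act[OF e GU.place_closed[OF p], of c]
      by (simp only: GU.act_place[OF e p] \<Phi>_place[OF p] \<Phi>_place[OF GU.pact_closed[OF e p]] GV.act_place[OF e \<phi>_piece[OF p]])
  qed (use e p in \<open>auto intro!: \<phi>_piece GU.pact_closed GV.pact_closed\<close>)
  have pact_one: "pact (five_sys W) e 1 (x, y) = (x, y)"
    if "monoid_algebra_module UNIV W" "x \<in> carrier W" "y \<in> carrier W" for e x y and W :: "(free_word \<Rightarrow>\<^sub>0 'k, 'v) module"
    using monoid_algebra_module.act_one[OF that(1) that(2)] monoid_algebra_module.act_one[OF that(1) that(3)]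
    by (simp add: five_sys_simps)
  define d0 where "d0 = bideg 5 0"
  have d0: "d0 \<in> degrees 2 {}" using bideg_degrees by (simp add: d0_def)
  have top: "(x, y) \<in> piece (five_sys W) d0" if "x \<in> carrier W" "y \<in> carrier W" for x y and W :: "(free_word \<Rightarrow>\<^sub>0 'k, 'v) module"
    using that d0 by (simp add: five_sys_simps five_rel_def) (simp add: d0_def)
  have carr: "\<exists>x y. p = (x, y) \<and> x \<in> carrier W \<and> y \<in> carrier W" if "p \<in> piece (five_sys W) d" for p d and W :: "(free_word \<Rightarrow>\<^sub>0 'k, 'v) module"
    using that by (auto simp: five_sys_def)
  \<comment> \<open>Both sides are compared in degree \<open>d + d0\<close>, to which the variables lead by the identity.\<close>
  have \<phi>_const: "\<phi> d p = \<phi> d0 p" if d: "d \<in> degrees 2 {}" and p: "p \<in> piece (five_sys U) d" for d p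
  proof -
    obtain x y where xy: "p = (x, y)" "x \<in> carrier U" "y \<in> carrier U" using carr[OF p] by blast
    have p0: "p \<in> piece (five_sys U) d0" using top xy by simp
    have oneU: "pact (five_sys U) e 1 p = p" for e unfolding xy(1) by (rule pact_one[OF U.monoid_algebra_module_axioms xy(2,3)])
    have oneV: "pact (five_sys V) e 1 q = q" if "q \<in> piece (five_sys V) d'" for e q d'
      using carr[OF that] pact_one[OF V.monoid_algebra_module_axioms] by blast
    have "\<phi> d p = \<phi> (d + d0) p"
      using \<phi>_act[OF d0 p, of 1] by (simp only: oneU oneV[OF \<phi>_piece[OF p]])
    also have "\<dots> = \<phi> (d0 + d) p" by (simp add: add.commute)
    also have "\<dots> = \<phi> d0 p"
      using \<phi>_act[OF d p0, of 1] by (simp only: oneU oneV[OF \<phi>_piece[OF p0]])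
    finally show ?thesis .
  qed
  have in_piece: "\<phi> d0 (x, y) \<in> piece (five_sys V) (bideg i j)"
    if "(x, y) \<in> piece (five_sys U) (bideg i j)" "0 \<le> i" "0 \<le> j" for x y i j
    using \<phi>_piece[OF that(1)] \<phi>_const[OF bideg_degrees[OF that(2,3)] that(1)] by simp
  define h where "h = (\<lambda>x \<in> carrier U. fst (\<phi> d0 (x, \<zero>\<^bsub>U\<^esub>)))"
  define h' where "h' = (\<lambda>x \<in> carrier U. snd (\<phi> d0 (\<zero>\<^bsub>U\<^esub>, x)))"
  have \<phi>1: "\<phi> d0 (x, \<zero>\<^bsub>U\<^esub>) = (h x, \<zero>\<^bsub>V\<^esub>)" and hc: "h x \<in> carrier V" if "x \<in> carrier U" for x
  proof -
    have "\<phi> d0 (x, \<zero>\<^bsub>U\<^esub>) \<in> piece (five_sys V) (bideg 0 4)"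
      using that bideg_degrees[of 0 4] by (intro in_piece) (simp_all add: five_sys_simps five_rel_def)
    then show "\<phi> d0 (x, \<zero>\<^bsub>U\<^esub>) = (h x, \<zero>\<^bsub>V\<^esub>)" "h x \<in> carrier V"
      using that bideg_degrees[of 0 4] by (auto simp: h_def five_sys_def five_rel_def)
  qed
  have \<phi>2: "\<phi> d0 (\<zero>\<^bsub>U\<^esub>, x) = (\<zero>\<^bsub>V\<^esub>, h' x)" and h'c: "h' x \<in> carrier V" if "x \<in> carrier U" for x
  proof -
    have "\<phi> d0 (\<zero>\<^bsub>U\<^esub>, x) \<in> piece (five_sys V) (bideg 1 3)"
      using that bideg_degrees[of 1 3] by (intro in_piece) (simp_all add: five_sys_simps five_rel_def)
    then show "\<phi> d0 (\<zero>\<^bsub>U\<^esub>, x) = (\<zero>\<^bsub>V\<^esub>, h' x)" "h' x \<in> carrier V"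
      using that bideg_degrees[of 1 3] by (auto simp: h'_def five_sys_def five_rel_def)
  qed
  have \<phi>12: "\<phi> d0 (x, y) = (h x, h' y)" if x: "x \<in> carrier U" and y: "y \<in> carrier U" for x y
    using \<phi>_plus[OF top[OF x U.LM.M.zero_closed] top[OF U.LM.M.zero_closed y]] x y hc[OF x] h'c[OF y]
    by (simp add: five_sys_simps \<phi>1 \<phi>2)
  have hh': "h' x = h x" if x: "x \<in> carrier U" for x
  proof -
    have "\<phi> d0 (x, x) \<in> piece (five_sys V) (bideg 2 2)"
      using x bideg_degrees[of 2 2] by (intro in_piece) (simp_all add: five_sys_simps five_rel_def)
    then show ?thesis using bideg_degrees[of 2 2] by (simp add: \<phi>12 x five_sys_simps five_rel_def)
  qed
  have \<phi>h: "\<phi> d0 (x, y) = (h x, h y)" if "x \<in> carrier U" "y \<in> carrier U" for x y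
    using \<phi>12 hh' that by simp
  have h_gen: "h (gen U g x) = gen V g (h x)" if x: "x \<in> carrier U" for g x
  proof (cases g)
    case X1
    have "\<phi> d0 (x, gen U X1 x) \<in> piece (five_sys V) (bideg 3 1)"
      using x bideg_degrees[of 3 1] by (intro in_piece) (simp_all add: five_sys_simps five_rel_def U.act_closed)
    then show ?thesis using bideg_degrees[of 3 1] X1 by (simp add: \<phi>h x U.act_closed five_sys_simps five_rel_def)
  next
    case X2
    have "\<phi> d0 (x, gen U X2 x) \<in> piece (five_sys V) (bideg 4 0)"
      using x bideg_degrees[of 4 0] by (intro in_piece) (simp_all add: five_sys_simps five_rel_def U.act_closed)
    then show ?thesis using bideg_degrees[of 4 0] X2 by (simp add: \<phi>h x U.act_closed five_sys_simps five_rel_def)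
  qed
  have h_plus: "h (x \<oplus>\<^bsub>U\<^esub> y) = h x \<oplus>\<^bsub>V\<^esub> h y" if x: "x \<in> carrier U" and y: "y \<in> carrier U" for x y
    using \<phi>_plus[OF top[OF x x] top[OF y y]] x y by (simp add: five_sys_simps \<phi>h)
  have h_scalar: "h (monomial 0 c \<odot>\<^bsub>U\<^esub> x) = monomial 0 c \<odot>\<^bsub>V\<^esub> h x" if x: "x \<in> carrier U" for c x
    using \<phi>_act[OF zero_degrees top[OF x x], of c] x by (simp add: five_sys_simps \<phi>h U.act_closed)
  have h_word: "h (monomial (Word w) c \<odot>\<^bsub>U\<^esub> x) = monomial (Word w) c \<odot>\<^bsub>V\<^esub> h x" if x: "x \<in> carrier U" for w c x
  proof (induction w)
    case Nil
    then show ?case using h_scalar[OF x, of c] by (simp add: zero_free_word_def)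
  next
    case (Cons g w)
    have split: "monomial (Word (g # w)) c \<odot>\<^bsub>W\<^esub> y = gen W g (monomial (Word w) c \<odot>\<^bsub>W\<^esub> y)"
      if "monoid_algebra_module UNIV W" "y \<in> carrier W" for y and W :: "(free_word \<Rightarrow>\<^sub>0 'k, 'v) module"
      using monoid_algebra_module.act_act[OF that(1) UNIV_I UNIV_I that(2), of "Word [g]" 1 "Word w" c] by simp
    show ?case
      using Cons by (simp only: split[OF U.monoid_algebra_module_axioms x] split[OF V.monoid_algebra_module_axioms hc[OF x]]
          h_gen[OF U.act_closed[OF UNIV_I x]])
  qed
  have hom: "h \<in> Hom fd U V"
    unfolding fd_simps
  proof (rule linear_maps_monomialI[OF U.monoid_algebra_module_axioms V.monoid_algebra_module_axioms subset_refl])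
    show "h \<in> carrier U \<rightarrow>\<^sub>E carrier V" using hc by (auto simp: h_def)
    show "h (monomial e c \<odot>\<^bsub>U\<^esub> x) = monomial e c \<odot>\<^bsub>V\<^esub> h x" if "x \<in> carrier U" for e c x
      using h_word[OF that] by (cases e) simp
  qed (rule h_plus)
  interpret h: fd_map U V h by (rule fd_mapI[OF U V hom])
  interpret F: system_map 2 "{}" "{}" "five_sys U" "five_sys V" "TYPE('v)" "\<lambda>d. map_prod h h"
    by (rule system_map_five[OF h.fd_map_axioms])
  have "\<Phi> = F.F"
  proof (rule \<Phi>.eq_on_homogeneous[OF F.graded_map_tot_map])
    fix z d assume d: "d \<in> degrees 2 {}" and z: "z \<in> component GU.T d"
    define p where "p = coord (five_sys U) z d"
    have p: "p \<in> piece (five_sys U) d" unfolding p_def by (rule GU.coord_piece[OF GU.T.component_closed[OF z]])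
    obtain x y where xy: "p = (x, y)" "x \<in> carrier U" "y \<in> carrier U" using carr[OF p] by blast
    have "\<phi> d p = map_prod h h p" using \<phi>_const[OF d p] \<phi>h[OF xy(2,3)] by (simp add: xy(1))
    then have "\<Phi> (place (five_sys U) d p) = F.F (place (five_sys U) d p)"
      by (simp only: \<Phi>_place[OF p] F.map_place[OF p])
    then show "\<Phi> z = F.F z" using GU.component_eq_place[OF z] unfolding p_def by metis
  qed
  then show "\<exists>g \<in> Hom fd U V. on_hom five U V g = \<Phi>" using hom by (intro bexI[of _ h]) simp_all
qed

end

section \<open>The exact retract and wildness\<close>

lemma (in corner_complex) wild_L_cat:
  "wild_representation_type TYPE('v) (L :: ('k::field, ('k, 'v) L_object, nat set \<Rightarrow> 'v \<Rightarrow> 'v) lincat)"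
proof -
  interpret W: large_universe "TYPE('v)" by unfold_locales (rule infinite_universe)
  let ?fd = "fd :: ('k, (free_word \<Rightarrow>\<^sub>0 'k, 'v) module, 'v \<Rightarrow> 'v) lincat"
  have fS: "is_functor (kst :: ('k, ('k, 'v) gmod, 'v \<Rightarrow> 'v) lincat) L S" and fF: "is_functor ?fd kst five"
    using exact_spread W.exact_five unfolding exact_functor_def additive_functor_def by blast+
  have "representation_embedding ?fd L (functor_comp S five)"
    by (rule fully_faithful_imp_representation_embedding[OF lincat_laws_fd lincat_laws_L_cat
          linear_functor_comp[OF W.linear_five linear_spread] exact_functor_comp[OF W.exact_five exact_spread]
          faithful_comp[OF fF W.faithful_five spread_fully_faithful(1)]
          full_comp[OF fF W.full_five spread_fully_faithful(2)] fd_trivial_idempotents])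
  then show ?thesis unfolding wild_representation_type_def by blast
qed

lemma infinite_universe_of_inj:
  assumes "inj (universe :: (nat \<Rightarrow>\<^sub>0 'k::field) \<Rightarrow> 'v)" shows "infinite (UNIV :: 'v set)"
proof -
  have "inj (\<lambda>n::nat. monomial n (1::'k))" by (rule injI) (metis lookup_single_eq lookup_single_not_eq zero_neq_one)
  then have "inj (\<lambda>n. universe (monomial n 1))" using assms by (auto simp: inj_def)
  then show ?thesis using infinite_UNIV_nat finite_imageD[of "\<lambda>n. universe (monomial n 1)" UNIV] finite_subset[OF subset_UNIV] by blast
qed

theorem proposition9p7:
  fixes m :: nat and K :: "nat set set"
    and universe :: "(nat \<Rightarrow>\<^sub>0 'k::field) \<Rightarrow> 'v"
  assumes "inj universe"
    and "m \<ge> 1"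
    and "simplicial_complex m K"
    and "K \<subset> {\<sigma>. \<sigma> \<subseteq> {1..m} \<and> int (card \<sigma>) \<le> int m - 2}"
  shows "exact_retract
           (kst_mod :: ('k, ('k, 'v) gmod, 'v \<Rightarrow> 'v) lincat)
           (L_cat m K :: ('k, ('k, 'v) L_object, nat set \<Rightarrow> 'v \<Rightarrow> 'v) lincat) \<and>
         wild_representation_type TYPE('v)
           (L_cat m K :: ('k, ('k, 'v) L_object, nat set \<Rightarrow> 'v \<Rightarrow> 'v) lincat)"
proof -
  obtain \<sigma> where \<sigma>: "\<sigma> \<subseteq> {1..m}" "int (card \<sigma>) \<le> int m - 2" "\<sigma> \<notin> K" using assms(4) by blast
  have "card ({1..m} - \<sigma>) = m - card \<sigma>" using \<sigma>(1) by (simp add: card_Diff_subset finite_subset)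
  then have "2 \<le> card ({1..m} - \<sigma>)" using \<sigma>(2) by linarith
  then obtain T where "T \<subseteq> {1..m} - \<sigma>" "card T = 2" by (meson obtain_subset_with_card_n)
  then obtain a b where ab: "a \<in> {1..m} - \<sigma>" "b \<in> {1..m} - \<sigma>" "a \<noteq> b" by (auto simp: card_2_iff)
  \<comment> \<open>Missing faces are closed under supersets.\<close>
  have "\<sigma> \<subseteq> corner_face m a b" using \<sigma>(1) ab by (auto simp: corner_face_def)
  then have base: "corner_face m a b \<notin> K" using \<sigma>(3) assms(3) by (auto simp: simplicial_complex_def)
  interpret corner_complex m a b K "TYPE('v)"
    by unfold_locales (use ab assms(3) base infinite_universe_of_inj[OF assms(1)] in auto)
  show ?thesis
    unfolding exact_retract_def using exact_spread exact_slice slice_spread wild_L_cat by blast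
qed

end
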